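(* Let $N=3$, $4<p<6$, $a>0$, suppose $V,f,Q$ satisfy (V1)–(V3) and (D1)–(D2), and $\int_\Omega Q\phi_1^pdx<0$. Then there exists $\delta_0>0$ such that for each $\lambda_1(f_\Omega)\le\lambda<\lambda_1(f_\Omega)+\delta_0$ there is $\mu^*>0$ such that for all $\mu>\mu^*$, $J_{\mu,\lambda}$ has a minimizer on $\mathbf N^+_{\mu,\lambda}$.
   Context: Conditions on $V,f,Q:\mathbb{R}^3\to\mathbb{R}$: (V1) $V$ nonnegative and continuous; (V2) there is $c>0$ with $\{V<c\}$ nonempty of finite measure; (V3) $\Omega=\mathrm{int}\{V=0\}$ is a nonempty bounded smooth domain with $\overline\Omega=\{V=0\}$; (D1) $f\in L^{3/2}(\mathbb{R}^3)$, $f^+\not\equiv0$ in $\Omega$; (D2) $Q\in L^\infty(\mathbb{R}^3)$, $Q^+\not\equiv0$ in $\Omega$. $X=\{u\in H^1(\mathbb{R}^3):\int Vu^2<\infty\}$, $\|u\|_{D^{1,2}}^2=\int|\nabla u|^2$, $\|u\|_\mu^2=\int(|\nabla u|^2+\mu Vu^2)$. $J_{\mu,\lambda}(u)=\frac a4\|u\|_{D^{1,2}}^4+\frac12\|u\|_\mu^2-\frac1p\int Q|u|^p-\frac\lambda2\int fu^2$; $h_u(t)=J_{\mu,\lambda}(tu)$; $\mathbf N_{\mu,\lambda}=\{u\in X\setminus\{0\}:h_u'(1)=0\}$, $\mathbf N^+_{\mu,\lambda}=\{u\in\mathbf N_{\mu,\lambda}:h_u''(1)>0\}$. $\lambda_1(f_\Omega)$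 is the positive principal eigenvalue of $-\Delta u=\lambda f_\Omega u$ in $\Omega$, $u=0$ on $\partial\Omega$ ($f_\Omega=f|_{\overline\Omega}$), $\phi_1$ the positive principal eigenfunction with $\int_\Omega f_\Omega\phi_1^2=1$. A minimizer on $\mathbf N^+_{\mu,\lambda}$ is $u_0\in\mathbf N^+_{\mu,\lambda}$ with $J_{\mu,\lambda}(u_0)=\inf_{\mathbf N^+_{\mu,\lambda}}J_{\mu,\lambda}$. *)

theory Defs
  imports "HOL-Analysis.Analysis"
begin

type_synonym R3 = "real^3"

definition pd :: "(R3 \<Rightarrow> real) \<Rightarrow> 3 \<Rightarrow> R3 \<Rightarrow> real" where
  "pd \<psi> i x = frechet_derivative \<psi> (at x) (axis i 1)"

definition grad :: "(R3 \<Rightarrow> real) \<Rightarrow> R3 \<Rightarrow> R3" where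
  "grad \<psi> x = (\<chi> i. pd \<psi> i x)"

fun Ck :: "nat \<Rightarrow> (R3 \<Rightarrow> real) \<Rightarrow> bool" where
  "Ck 0 \<psi> = continuous_on UNIV \<psi>"
| "Ck (Suc k) \<psi> = ((\<forall>x. \<psi> differentiable (at x)) \<and> (\<forall>i. Ck k (pd \<psi> i)))"

definition smooth :: "(R3 \<Rightarrow> real) \<Rightarrow> bool" where
  "smooth \<psi> \<longleftrightarrow> (\<forall>k. Ck k \<psi>)"

definition test_fun :: "R3 set \<Rightarrow> (R3 \<Rightarrow> real) \<Rightarrow> bool" where
  "test_fun U \<psi> \<longleftrightarrow> smooth \<psi> \<and> compact (closure {x. \<psi> x \<noteq> 0})
      \<and> closure {x. \<psi> x \<noteq> 0} \<subseteq> U"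

definition is_wgrad :: "(R3 \<Rightarrow> real) \<Rightarrow> (R3 \<Rightarrow> R3) \<Rightarrow> bool" where
  "is_wgrad u G \<longleftrightarrow> (\<forall>\<psi> i. test_fun UNIV \<psi> \<longrightarrow>
      (\<integral>x. u x * pd \<psi> i x \<partial>lborel) = - (\<integral>x. G x $ i * \<psi> x \<partial>lborel))"

definition L2_grad :: "(R3 \<Rightarrow> real) \<Rightarrow> (R3 \<Rightarrow> R3) \<Rightarrow> bool" where
  "L2_grad u G \<longleftrightarrow> G \<in> borel_measurable lborel
      \<and> integrable lborel (\<lambda>x. (norm (G x))\<^sup>2) \<and> is_wgrad u G"

definition H1 :: "(R3 \<Rightarrow> real) set" where
  "H1 = {u. u \<in> borel_measurable lborel \<and> integrable lborel (\<lambda>x. (u x)\<^sup>2) \<and> (\<exists>G. L2_grad u G)}"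

definition wgrad :: "(R3 \<Rightarrow> real) \<Rightarrow> R3 \<Rightarrow> R3" where
  "wgrad u = (SOME G. L2_grad u G)"

definition H10 :: "R3 set \<Rightarrow> (R3 \<Rightarrow> real) set" where
  "H10 \<Omega> = {u \<in> H1. \<exists>\<psi>s. (\<forall>n. test_fun \<Omega> (\<psi>s n)) \<and>
      (\<lambda>n. (\<integral>x. (\<psi>s n x - u x)\<^sup>2 \<partial>lborel)
          + (\<integral>x. (norm (grad (\<psi>s n) x - wgrad u x))\<^sup>2 \<partial>lborel)) \<longlonglongrightarrow> 0}"

definition smooth_bounded_domain :: "R3 set \<Rightarrow> bool" where
  "smooth_bounded_domain \<Omega> \<longleftrightarrow> open \<Omega> \<and> connected \<Omega> \<and> \<Omega> \<noteq> {} \<and> bounded \<Omega> \<and>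
     (\<exists>\<rho>. smooth \<rho> \<and> \<Omega> = {x. \<rho> x < 0} \<and> (\<forall>x. \<rho> x = 0 \<longrightarrow> grad \<rho> x \<noteq> 0))"

text \<open>lam is the positive principal eigenvalue of -Delta u = lam f_Omega u in Omega, u = 0 on
  the boundary (weak sense), with positive principal eigenfunction phi normalized by
  int_Omega f phi^2 = 1.\<close>
definition principal_eigenpair ::
  "R3 set \<Rightarrow> (R3 \<Rightarrow> real) \<Rightarrow> real \<Rightarrow> (R3 \<Rightarrow> real) \<Rightarrow> bool" where
  "principal_eigenpair \<Omega> f lam \<phi> \<longleftrightarrow> lam > 0 \<and> \<phi> \<in> H10 \<Omega> \<and>
     (AE x in lborel. x \<in> \<Omega> \<longrightarrow> \<phi> x > 0) \<and>
     (\<forall>\<psi>. test_fun \<Omega> \<psi> \<longrightarrow>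
        (\<integral>x. wgrad \<phi> x \<bullet> grad \<psi> x \<partial>lborel) = lam * (\<integral>x. f x * \<phi> x * \<psi> x \<partial>lborel)) \<and>
     (LINT x:\<Omega>|lborel. f x * (\<phi> x)\<^sup>2) = 1"

definition Xsp :: "(R3 \<Rightarrow> real) \<Rightarrow> (R3 \<Rightarrow> real) set" where
  "Xsp V = {u \<in> H1. integrable lborel (\<lambda>x. V x * (u x)\<^sup>2)}"

definition Jfun :: "real \<Rightarrow> real \<Rightarrow> (R3 \<Rightarrow> real) \<Rightarrow> (R3 \<Rightarrow> real) \<Rightarrow> (R3 \<Rightarrow> real)
    \<Rightarrow> real \<Rightarrow> real \<Rightarrow> (R3 \<Rightarrow> real) \<Rightarrow> real" where
  "Jfun a p V f Q \<mu> lam u =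
     a / 4 * (\<integral>x. (norm (wgrad u x))\<^sup>2 \<partial>lborel)\<^sup>2
     + 1/2 * (\<integral>x. (norm (wgrad u x))\<^sup>2 + \<mu> * V x * (u x)\<^sup>2 \<partial>lborel)
     - 1/p * (\<integral>x. Q x * \<bar>u x\<bar> powr p \<partial>lborel)
     - lam/2 * (\<integral>x. f x * (u x)\<^sup>2 \<partial>lborel)"

definition fib :: "real \<Rightarrow> real \<Rightarrow> (R3 \<Rightarrow> real) \<Rightarrow> (R3 \<Rightarrow> real) \<Rightarrow> (R3 \<Rightarrow> real)
    \<Rightarrow> real \<Rightarrow> real \<Rightarrow> (R3 \<Rightarrow> real) \<Rightarrow> real \<Rightarrow> real" where
  "fib a p V f Q \<mu> lam u t = Jfun a p V f Q \<mu> lam (\<lambda>x. t * u x)"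

text \<open>Nehari manifold and its positive part (u \<noteq> 0 in X means u not a.e. zero).\<close>
definition Nehari :: "real \<Rightarrow> real \<Rightarrow> (R3 \<Rightarrow> real) \<Rightarrow> (R3 \<Rightarrow> real) \<Rightarrow> (R3 \<Rightarrow> real)
    \<Rightarrow> real \<Rightarrow> real \<Rightarrow> (R3 \<Rightarrow> real) set" where
  "Nehari a p V f Q \<mu> lam = {u \<in> Xsp V. \<not> (AE x in lborel. u x = 0) \<and>
      deriv (fib a p V f Q \<mu> lam u) 1 = 0}"

definition Nehari_plus :: "real \<Rightarrow> real \<Rightarrow> (R3 \<Rightarrow> real) \<Rightarrow> (R3 \<Rightarrow> real) \<Rightarrow> (R3 \<Rightarrow> real)
    \<Rightarrow> real \<Rightarrow> real \<Rightarrow> (R3 \<Rightarrow> real) set" where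
  "Nehari_plus a p V f Q \<mu> lam = {u \<in> Nehari a p V f Q \<mu> lam.
      deriv (deriv (fib a p V f Q \<mu> lam u)) 1 > 0}"

end

theory Submission
  imports Defs "HOL-Complex_Analysis.Great_Picard"
begin

text \<open>Let \<open>E u\<close> be the quadratic form \<open>\<integral> |\<nabla>u|\<^sup>2 + \<mu> V u\<^sup>2 - \<lambda> f u\<^sup>2\<close> and \<open>B u = \<integral> Q |u|\<^sup>p\<close>. On
  \<open>N\<^sup>+\<close> both \<open>E\<close> and \<open>J\<close> are negative, and the quartic term bounds \<open>N\<^sup>+\<close> uniformly in \<open>\<mu>\<close>. For \<open>\<lambda>\<close> close
  to the eigenvalue and \<open>\<mu>\<close> large, \<open>E u \<le> 0\<close> forces \<open>B u < 0\<close>: normalised counterexamples with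
  \<open>\<mu> \<rightarrow> \<infinity>\<close> would converge to a function supported in the domain that attains the Rayleigh quotient, hence
  to a multiple of the eigenfunction, where \<open>B < 0\<close>. In a direction with \<open>E < 0\<close> and \<open>B < 0\<close> the
  fibering map has a global minimum, and it lies on \<open>N\<^sup>+\<close>. The limit \<open>u\<close> of a minimising sequence satisfies
  \<open>J u \<le> inf J < 0\<close> and \<open>E u \<le> 0\<close>, because for large \<open>\<mu>\<close> the mass lost at infinity costs more potential
  energy than it gains through \<open>B\<close>; then \<open>E u < 0\<close>, and the fibre of \<open>u\<close> contains a minimiser.\<close>

section \<open>Square integrable functions\<close>

text \<open>The hypothesis on the eigenpair says only that \<open>\<phi>1\<close> is a positive weak
  solution. That \<open>lam1\<close> bounds the Rayleigh quotient from below and is simple has to be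
  proved, and with \<open>f\<close> merely in L^(3/2) no continuity or Harnack inequality for
  \<open>\<phi>1\<close> can be invoked. Picone's identity gives both: its remainder is a square,
  which vanishes only for proportional gradients. The exponent 3/2 is critical, dual to u^2 in L^3,
  so convergence of the term with \<open>f\<close> rests on truncating \<open>f\<close> and not on
  boundedness alone. At \<open>lam = lam1\<close> the eigenfunction gives E = 0 exactly, and
  functions supported in the domain give E >= 0, so a direction with E < 0 has to cross the
  boundary. The condition p > 4 enters as follows. Eliminating B from the two conditions that define
  N^+ leaves (p - 4) a A^2 + (p - 2) E < 0, where A is the Dirichlet integral. Hence E < 0, and
  since E >= -K A with K independent of \<open>\<mu>\<close>, also A is bounded.\<close>

abbreviation mble where "mble \<equiv> borel_measurable lborel"

definition sq :: "(R3 \<Rightarrow> 'b::euclidean_space) \<Rightarrow> bool" where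
  "sq u \<longleftrightarrow> u \<in> mble \<and> integrable lborel (\<lambda>x. (norm (u x))\<^sup>2)"

definition nsq :: "(R3 \<Rightarrow> 'b::euclidean_space) \<Rightarrow> real" where
  "nsq u = (LBINT x. (norm (u x))\<^sup>2)"

abbreviation "nsq_on R u \<equiv> nsq (\<lambda>x. indicator (ball 0 R) x *\<^sub>R u x)"

lemma sq_meas: "sq u \<Longrightarrow> u \<in> mble"
  and sq_int: "sq u \<Longrightarrow> integrable lborel (\<lambda>x. (norm (u x))\<^sup>2)"
  by (auto simp: sq_def)

lemma nsq_nonneg [simp]: "nsq u \<ge> 0"
  by (simp add: nsq_def)

lemma sq_bound:
  fixes v :: "R3 \<Rightarrow> 'b::euclidean_space" and u :: "R3 \<Rightarrow> 'c::euclidean_space"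
  assumes "sq u" "v \<in> mble" "AE x in lborel. norm (v x) \<le> norm (u x)"
  shows "sq v" "nsq v \<le> nsq u"
proof -
  have "AE x in lborel. norm ((norm (v x))\<^sup>2) \<le> norm ((norm (u x))\<^sup>2)"
    using assms(3) by eventually_elim (simp add: power_mono)
  thus "sq v"
    using assms by (auto simp: sq_def intro: Bochner_Integration.integrable_bound)
  thus "nsq v \<le> nsq u"
    unfolding nsq_def using assms
    by (intro integral_mono_AE) (auto simp: sq_def power_mono)
qed

lemma sq_add:
  fixes u v :: "R3 \<Rightarrow> 'b::euclidean_space"
  assumes "sq u" "sq v"
  shows "sq (\<lambda>x. u x + v x)" "nsq (\<lambda>x. u x + v x) \<le> 2 * nsq u + 2 * nsq v"
proof -
  have [measurable]: "u \<in> mble" "v \<in> mble"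
    using assms by (auto simp: sq_def)
  have pt: "(norm (u x + v x))\<^sup>2 \<le> 2 * (norm (u x))\<^sup>2 + 2 * (norm (v x))\<^sup>2" for x
  proof -
    have "(norm (u x + v x))\<^sup>2 \<le> (norm (u x) + norm (v x))\<^sup>2"
      by (simp add: norm_triangle_ineq power_mono)
    also have "\<dots> \<le> 2 * (norm (u x))\<^sup>2 + 2 * (norm (v x))\<^sup>2"
      by (smt (verit) sum_squares_bound power2_sum)
    finally show ?thesis .
  qed
  have i: "integrable lborel (\<lambda>x. 2 * (norm (u x))\<^sup>2 + 2 * (norm (v x))\<^sup>2)"
    using assms by (auto simp: sq_def)
  have "integrable lborel (\<lambda>x. (norm (u x + v x))\<^sup>2)"
    by (rule Bochner_Integration.integrable_bound[OF i]) (use pt in auto)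
  thus "sq (\<lambda>x. u x + v x)" by (simp add: sq_def)
  have "nsq (\<lambda>x. u x + v x) \<le> (LBINT x. 2 * (norm (u x))\<^sup>2 + 2 * (norm (v x))\<^sup>2)"
    unfolding nsq_def using i \<open>integrable lborel (\<lambda>x. (norm (u x + v x))\<^sup>2)\<close> pt
    by (intro integral_mono)
  also have "\<dots> = 2 * nsq u + 2 * nsq v"
    using assms by (simp add: nsq_def sq_def)
  finally show "nsq (\<lambda>x. u x + v x) \<le> 2 * nsq u + 2 * nsq v" .
qed

lemma sq_scale: "sq u \<Longrightarrow> sq (\<lambda>x. c *\<^sub>R u x)" "nsq (\<lambda>x. c *\<^sub>R u x) = c\<^sup>2 * nsq u"
  by (auto simp: sq_def nsq_def power_mult_distrib)

lemma sq_cmult: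
  fixes u :: "R3 \<Rightarrow> real"
  shows "sq u \<Longrightarrow> sq (\<lambda>x. c * u x)" "nsq (\<lambda>x. c * u x) = c\<^sup>2 * nsq u"
  using sq_scale[where u=u and c=c] by auto

lemma sq_uminus: "sq u \<Longrightarrow> sq (\<lambda>x. - u x)" "nsq (\<lambda>x. - u x) = nsq u"
  by (auto simp: sq_def nsq_def)

lemma sq_zero [simp]: "sq (\<lambda>x. 0)" "nsq (\<lambda>x. 0) = 0"
  by (auto simp: sq_def nsq_def)

lemma sq_diff:
  fixes u v :: "R3 \<Rightarrow> 'b::euclidean_space"
  assumes "sq u" "sq v"
  shows "sq (\<lambda>x. u x - v x)" "nsq (\<lambda>x. u x - v x) \<le> 2 * nsq u + 2 * nsq v"
  using sq_add[OF assms(1) sq_uminus(1)[OF assms(2)]] sq_uminus(2)[of v] by auto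

lemma nsq_commute: "nsq (\<lambda>x. u x - v x) = nsq (\<lambda>x. v x - u x)"
  by (simp add: nsq_def norm_minus_commute)

text \<open>For squared norms the triangle inequality costs a factor 2 per step, which explains the
  small fractions of epsilon in later limit arguments.\<close>

lemma nsq_triangle:
  assumes "sq u" "sq v" "sq w"
  shows "nsq (\<lambda>x. u x - w x) \<le> 2 * nsq (\<lambda>x. u x - v x) + 2 * nsq (\<lambda>x. v x - w x)"
  using sq_add(2)[OF sq_diff(1)[OF assms(1,2)] sq_diff(1)[OF assms(2,3)]] by simp

lemma sq_prod_bound: "a * b \<le> a\<^sup>2 + b\<^sup>2" for a b :: real
  using sum_squares_bound[of a b] zero_le_power2[of a] zero_le_power2[of b] by linarith

lemma sq_norm_mult_int:
  fixes u :: "R3 \<Rightarrow> 'b::euclidean_space" and v :: "R3 \<Rightarrow> 'c::euclidean_space"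
  assumes "sq u" "sq v"
  shows "integrable lborel (\<lambda>x. norm (u x) * norm (v x))"
proof -
  have [measurable]: "u \<in> mble" "v \<in> mble"
    using assms by (auto simp: sq_def)
  have i: "integrable lborel (\<lambda>x. (norm (u x))\<^sup>2 + (norm (v x))\<^sup>2)"
    using assms by (auto simp: sq_def)
  show ?thesis
    by (rule Bochner_Integration.integrable_bound[OF i])
       (auto intro!: AE_I2 simp: sq_prod_bound)
qed

lemma sq_inner_int:
  assumes "sq u" "sq v"
  shows "integrable lborel (\<lambda>x. u x \<bullet> v x)"
proof -
  have [measurable]: "u \<in> mble" "v \<in> mble"
    using assms by (auto simp: sq_def)
  show ?thesis
    by (rule Bochner_Integration.integrable_bound[OF sq_norm_mult_int[OF assms]])
       (auto intro!: AE_I2 simp: Cauchy_Schwarz_ineq2)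
qed

lemma sq_mult_int: "sq u \<Longrightarrow> sq v \<Longrightarrow> integrable lborel (\<lambda>x. u x * v x)" for u v :: "R3 \<Rightarrow> real"
  using sq_inner_int[of u v] by simp

lemma nsq_diff_expand:
  assumes "sq u" "sq v"
  shows "nsq (\<lambda>x. u x - v x) = nsq u - 2 * (LBINT x. u x \<bullet> v x) + nsq v"
proof -
  have "(norm (u x - v x))\<^sup>2 = (norm (u x))\<^sup>2 - 2 * (u x \<bullet> v x) + (norm (v x))\<^sup>2" for x
    by (simp add: power2_norm_eq_inner algebra_simps inner_commute)
  thus ?thesis
    using assms sq_inner_int[OF assms] by (simp add: nsq_def sq_def)
qed

lemma nsq_add_expand:
  assumes "sq u" "sq v"
  shows "nsq (\<lambda>x. u x + v x) = nsq u + 2 * (LBINT x. u x \<bullet> v x) + nsq v"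
  using nsq_diff_expand[OF assms(1) sq_uminus(1)[OF assms(2)]] sq_uminus(2)[of v] by simp

text \<open>The polynomial \<open>t \<mapsto> nsq (u - t v)\<close> is nonnegative, and its minimum
  over \<open>t\<close> is the claim. In the degenerate case \<open>nsq v = 0\<close> it is linear,
  so its slope must vanish.\<close>

lemma L2_CS2:
  assumes "sq u" "sq v"
  shows "(LBINT x. u x \<bullet> v x)\<^sup>2 \<le> nsq u * nsq v"
proof -
  define b where "b = (LBINT x. u x \<bullet> v x)"
  have *: "0 \<le> nsq u - 2 * t * b + t\<^sup>2 * nsq v" for t
  proof -
    have "nsq (\<lambda>x. u x - t *\<^sub>R v x) = nsq u - 2 * t * b + t\<^sup>2 * nsq v"
      using nsq_diff_expand[OF assms(1) sq_scale(1)[OF assms(2), of t]]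
      by (simp add: sq_scale b_def)
    thus ?thesis by (metis nsq_nonneg)
  qed
  show ?thesis
  proof (cases "nsq v = 0")
    case True
    have "b = 0"
    proof (rule ccontr)
      assume "b \<noteq> 0"
      \<comment> \<open>At this \<open>t\<close> the linear polynomial has the value -1.\<close>
      thus False using *[of "(nsq u + 1) / (2 * b)"] True by simp
    qed
    thus ?thesis using True by (simp add: b_def)
  next
    case False
    hence "nsq v > 0" using nsq_nonneg[of v] by linarith
    thus ?thesis using *[of "b / nsq v"]
      by (simp add: b_def[symmetric] field_simps power2_eq_square)
  qed
qed

lemma L2_CS:
  assumes "sq u" "sq v"
  shows "\<bar>LBINT x. u x \<bullet> v x\<bar> \<le> sqrt (nsq u) * sqrt (nsq v)"
  using real_sqrt_le_mono[OF L2_CS2[OF assms]] by (simp add: real_sqrt_mult)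

lemma L2_CS_norm:
  fixes u :: "R3 \<Rightarrow> 'b::euclidean_space" and v :: "R3 \<Rightarrow> 'c::euclidean_space"
  assumes "sq u" "sq v"
  shows "(LBINT x. norm (u x) * norm (v x)) \<le> sqrt (nsq u) * sqrt (nsq v)"
proof -
  have "sq (\<lambda>x. norm (u x))" "sq (\<lambda>x. norm (v x))" using assms by (auto simp: sq_def)
  from L2_CS[OF this] show ?thesis by (simp add: nsq_def)
qed

text \<open>Integrability of the limit is part of the conclusion: this is how limits of bounded
  sequences enter L^2 and L^6. A bound for almost all \<open>n\<close> is enough, which fits bounds
  of the form "limit plus epsilon".\<close>

lemma fatou_real:
  fixes g :: "nat \<Rightarrow> 'a \<Rightarrow> real"
  assumes g: "\<And>n. integrable M (g n)" "\<And>n. AE x in M. 0 \<le> g n x"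
    and lim: "AE x in M. (\<lambda>n. g n x) \<longlonglongrightarrow> h x" and h[measurable]: "h \<in> borel_measurable M"
    and C: "\<forall>\<^sub>F n in sequentially. (\<integral>x. g n x \<partial>M) \<le> C"
  shows "integrable M h" "(\<integral>x. h x \<partial>M) \<le> C" "AE x in M. 0 \<le> h x"
proof -
  have [measurable]: "g n \<in> borel_measurable M" for n using g(1)[of n] by auto
  have pos: "AE x in M. \<forall>n. 0 \<le> g n x" using g(2) by (simp add: AE_all_countable)
  thus h0: "AE x in M. 0 \<le> h x" using lim
    by eventually_elim (auto intro: LIMSEQ_le_const)
  \<comment> \<open>\<open>ennreal\<close> sends negative reals to 0, so the final estimate can be
    read off in the reals only once \<open>C\<close> is known to be nonnegative.\<close>
  have C0: "C \<ge> 0"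
  proof -
    obtain n where "(\<integral>x. g n x \<partial>M) \<le> C" using eventually_happens[OF C] by auto
    moreover have "(\<integral>x. g n x \<partial>M) \<ge> 0" using g(2) by (rule integral_nonneg_AE)
    ultimately show ?thesis by linarith
  qed
  have "(\<integral>\<^sup>+x. ennreal (h x) \<partial>M) = (\<integral>\<^sup>+x. liminf (\<lambda>n. ennreal (g n x)) \<partial>M)"
  proof (rule nn_integral_cong_AE)
    show "AE x in M. ennreal (h x) = liminf (\<lambda>n. ennreal (g n x))"
      using lim
    proof eventually_elim
      case (elim x)
      hence "(\<lambda>n. ennreal (g n x)) \<longlonglongrightarrow> ennreal (h x)" by (rule tendsto_ennrealI)
      thus ?case by (simp add: lim_imp_Liminf)
    qed
  qed
  also have "\<dots> \<le> liminf (\<lambda>n. \<integral>\<^sup>+x. ennreal (g n x) \<partial>M)"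
    by (rule nn_integral_liminf) auto
  also have "\<dots> \<le> ennreal C"
  proof -
    have "\<forall>\<^sub>F n in sequentially. (\<integral>\<^sup>+x. ennreal (g n x) \<partial>M) \<le> ennreal C"
      using C by eventually_elim (use g in \<open>simp add: nn_integral_eq_integral ennreal_leI\<close>)
    thus ?thesis
      by (intro order_trans[OF Liminf_le_Limsup Limsup_bounded]) auto
  qed
  finally have le: "(\<integral>\<^sup>+x. ennreal (h x) \<partial>M) \<le> ennreal C" .
  show "integrable M h"
    by (rule integrableI_nonneg) (use le h0 in \<open>auto simp: le_less_trans\<close>)
  with le h0 C0 show "(\<integral>x. h x \<partial>M) \<le> C"
    by (simp add: nn_integral_eq_integral)
qed

lemma sq_fatou:
  fixes u :: "nat \<Rightarrow> R3 \<Rightarrow> 'b::euclidean_space"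
  assumes "\<And>n. sq (u n)" "AE x in lborel. (\<lambda>n. u n x) \<longlonglongrightarrow> v x" "v \<in> mble"
    and "\<forall>\<^sub>F n in sequentially. nsq (u n) \<le> C"
  shows "sq v" "nsq v \<le> C"
proof -
  have [measurable]: "v \<in> mble" by fact
  have "AE x in lborel. (\<lambda>n. (norm (u n x))\<^sup>2) \<longlonglongrightarrow> (norm (v x))\<^sup>2"
    using assms(2) by eventually_elim (intro tendsto_intros)
  note f = fatou_real[OF _ _ this, of C]
  show "sq v" "nsq v \<le> C" unfolding sq_def nsq_def
    using f assms by (auto simp: sq_def nsq_def)
qed

lemma L2_AE_subseq:
  fixes u :: "nat \<Rightarrow> R3 \<Rightarrow> 'b::euclidean_space"
  assumes "\<And>n. sq (\<lambda>x. u n x - v x)" "(\<lambda>n. nsq (\<lambda>x. u n x - v x)) \<longlonglongrightarrow> 0"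
  shows "\<exists>r::nat\<Rightarrow>nat. strict_mono r \<and> (AE x in lborel. (\<lambda>n. u (r n) x) \<longlonglongrightarrow> v x)"
proof -
  have "\<exists>r::nat\<Rightarrow>nat. strict_mono r \<and> (AE x in lborel. (\<lambda>n. (norm (u (r n) x - v x))\<^sup>2) \<longlonglongrightarrow> 0)"
    using assms by (intro tendsto_L1_AE_subseq) (auto simp: sq_def nsq_def)
  then obtain r :: "nat \<Rightarrow> nat" where r: "strict_mono r"
    "AE x in lborel. (\<lambda>n. (norm (u (r n) x - v x))\<^sup>2) \<longlonglongrightarrow> 0" by auto
  from r(2) have "AE x in lborel. (\<lambda>n. u (r n) x) \<longlonglongrightarrow> v x"
  proof eventually_elim
    case (elim x)
    from tendsto_real_sqrt[OF this] have "(\<lambda>n. norm (u (r n) x - v x)) \<longlonglongrightarrow> 0" by simp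
    thus ?case by (simp add: LIM_zero_cancel tendsto_norm_zero_iff)
  qed
  with r(1) show ?thesis by auto
qed

lemma sq_dominated:
  fixes u :: "nat \<Rightarrow> R3 \<Rightarrow> 'b::euclidean_space" and w :: "R3 \<Rightarrow> real"
  assumes "\<And>n. u n \<in> mble" "v \<in> mble"
    and "AE x in lborel. (\<lambda>n. u n x) \<longlonglongrightarrow> v x"
    and "sq w" "\<And>n. AE x in lborel. norm (u n x) \<le> w x"
  shows "\<And>n. sq (u n)" "sq v" "(\<lambda>n. nsq (\<lambda>x. u n x - v x)) \<longlonglongrightarrow> 0"
proof -
  have [measurable]: "u n \<in> mble" "v \<in> mble"
    "w \<in> mble" for n using assms by (auto simp: sq_def)
  have b: "AE x in lborel. \<forall>n. norm (u n x) \<le> w x" using assms(5) by (simp add: AE_all_countable)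
  have b2: "AE x in lborel. norm (v x) \<le> w x"
    using assms(3) b by eventually_elim (auto intro: LIMSEQ_le_const2 tendsto_norm)
  show 1: "sq (u n)" for n
    by (rule sq_bound[OF assms(4)]) (use assms(5)[of n] in \<open>auto elim!: eventually_mono\<close>)
  show 2: "sq v"
    by (rule sq_bound[OF assms(4)]) (use b2 in \<open>auto elim!: eventually_mono\<close>)
  have "(\<lambda>n. LBINT x. (norm (u n x - v x))\<^sup>2) \<longlonglongrightarrow> (\<integral>x. (0::real) \<partial>(lborel::R3 measure))"
  proof (rule Bochner_Integration.integral_dominated_convergence[where w="\<lambda>x. 4 * (w x)\<^sup>2"])
    show "integrable lborel (\<lambda>x. 4 * (w x)\<^sup>2)" using assms(4) by (simp add: sq_def)
    show "AE x in lborel. (\<lambda>n. (norm (u n x - v x))\<^sup>2) \<longlonglongrightarrow> 0"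
      using assms(3)
    proof eventually_elim
      case (elim x)
      have "(\<lambda>n. (norm (u n x - v x))\<^sup>2) \<longlonglongrightarrow> (norm (v x - v x))\<^sup>2"
        by (intro tendsto_intros elim)
      thus ?case by simp
    qed
    show "AE x in lborel. norm ((norm (u n x - v x))\<^sup>2) \<le> 4 * (w x)\<^sup>2" for n
      using b b2
    proof eventually_elim
      case (elim x)
      have "norm (u n x - v x) \<le> 2 * w x" using elim norm_triangle_ineq4[of "u n x" "v x"] 
        by (metis add_mono mult_2 order_trans)
      hence "(norm (u n x - v x))\<^sup>2 \<le> (2 * w x)\<^sup>2" by (intro power_mono) auto
      thus ?case by (simp add: power_mult_distrib)
    qed
  qed auto
  thus "(\<lambda>n. nsq (\<lambda>x. u n x - v x)) \<longlonglongrightarrow> 0" by (simp add: nsq_def)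
qed

lemma null_comparison:
  fixes a b :: "nat \<Rightarrow> real"
  assumes "b \<longlonglongrightarrow> 0" "\<And>n. \<bar>a n\<bar> \<le> b n"
  shows "a \<longlonglongrightarrow> 0"
  by (rule Lim_null_comparison[OF _ assms(1)]) (simp add: assms(2))

lemma null_seqI:
  fixes a :: "nat \<Rightarrow> real"
  assumes "\<And>n. 0 \<le> a n" "\<And>e. e > 0 \<Longrightarrow> \<exists>N. \<forall>i\<ge>N. a i \<le> e"
  shows "a \<longlonglongrightarrow> 0"
proof (rule LIMSEQ_I)
  fix e :: real assume "e > 0"
  then obtain N where "\<forall>i\<ge>N. a i \<le> e / 2" using assms(2)[of "e/2"] by auto
  hence "\<forall>i\<ge>N. norm (a i - 0) < e" using assms(1) \<open>e > 0\<close> by fastforce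
  thus "\<exists>N. \<forall>i\<ge>N. norm (a i - 0) < e" by blast
qed

section \<open>Continuity of the inner product, local convergence and completeness\<close>

lemma L2_inner_conv:
  fixes u v :: "nat \<Rightarrow> R3 \<Rightarrow> 'b::euclidean_space"
  assumes "\<And>n. sq (u n)" "sq u0" "(\<lambda>n. nsq (\<lambda>x. u n x - u0 x)) \<longlonglongrightarrow> 0"
    and "\<And>n. sq (v n)" "sq v0" "(\<lambda>n. nsq (\<lambda>x. v n x - v0 x)) \<longlonglongrightarrow> 0"
  shows "(\<lambda>n. LBINT x. u n x \<bullet> v n x) \<longlonglongrightarrow> (LBINT x. u0 x \<bullet> v0 x)"
proof -
  define a where "a n = (LBINT x. (u n x - u0 x) \<bullet> (v n x - v0 x))" for n
  define b where "b n = (LBINT x. (u n x - u0 x) \<bullet> v0 x)" for n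
  define c where "c n = (LBINT x. u0 x \<bullet> (v n x - v0 x))" for n
  have e: "(LBINT x. u n x \<bullet> v n x) = a n + b n + c n + (LBINT x. u0 x \<bullet> v0 x)" for n
  proof -
    have "u n x \<bullet> v n x = (u n x - u0 x) \<bullet> (v n x - v0 x) + (u n x - u0 x) \<bullet> v0 x
       + u0 x \<bullet> (v n x - v0 x) + u0 x \<bullet> v0 x" for x by (simp add: algebra_simps)
    thus ?thesis unfolding a_def b_def c_def
      using assms by (simp add: sq_inner_int sq_diff)
  qed
  have "(\<lambda>n. sqrt (nsq (\<lambda>x. u n x - u0 x)) * sqrt (nsq (\<lambda>x. v n x - v0 x))) \<longlonglongrightarrow> sqrt 0 * sqrt 0"
    by (intro tendsto_intros assms)
  hence 1: "a \<longlonglongrightarrow> 0"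
    by (intro null_comparison[of _ a]) (simp, unfold a_def, intro L2_CS sq_diff assms)
  have "(\<lambda>n. sqrt (nsq (\<lambda>x. u n x - u0 x)) * sqrt (nsq v0)) \<longlonglongrightarrow> sqrt 0 * sqrt (nsq v0)"
    by (intro tendsto_intros assms)
  hence 2: "b \<longlonglongrightarrow> 0"
    by (intro null_comparison[of _ b]) (simp, unfold b_def, intro L2_CS sq_diff assms)
  have "(\<lambda>n. sqrt (nsq u0) * sqrt (nsq (\<lambda>x. v n x - v0 x))) \<longlonglongrightarrow> sqrt (nsq u0) * sqrt 0"
    by (intro tendsto_intros assms)
  hence 3: "c \<longlonglongrightarrow> 0"
    by (intro null_comparison[of _ c]) (simp, unfold c_def, intro L2_CS sq_diff assms)
  show ?thesis unfolding e
    using tendsto_add[OF tendsto_add[OF tendsto_add[OF 1 2] 3] tendsto_const] by simp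
qed

lemma L2_nsq_conv:
  fixes u :: "nat \<Rightarrow> R3 \<Rightarrow> 'b::euclidean_space"
  assumes "\<And>n. sq (u n)" "sq u0" "(\<lambda>n. nsq (\<lambda>x. u n x - u0 x)) \<longlonglongrightarrow> 0"
  shows "(\<lambda>n. nsq (u n)) \<longlonglongrightarrow> nsq u0"
  using L2_inner_conv[OF assms assms] by (simp add: nsq_def power2_norm_eq_inner)

lemma nsq_eq_0_AE: "sq u \<Longrightarrow> nsq u = 0 \<Longrightarrow> AE x in lborel. u x = 0"
  unfolding nsq_def sq_def by (subst (asm) integral_nonneg_eq_0_iff_AE) auto

text \<open>Square root of a strictly positive integrable function, which exists because Lebesgue
  measure is sigma-finite.\<close>

lemma ex_pos_sq: "\<exists>g::R3 \<Rightarrow> real. sq g \<and> (\<forall>x. g x > 0)"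
proof -
  obtain h :: "R3 \<Rightarrow> ennreal" where h[measurable]: "h \<in> mble"
    and fin: "integral\<^sup>N lborel h \<noteq> \<infinity>" and pos: "\<And>x. 0 < h x \<and> h x < \<infinity>"
    using sigma_finite_measure.Ex_finite_integrable_function[OF sigma_finite_lborel] by auto
  define g where "g x = sqrt (enn2real (h x))" for x
  have "(\<integral>\<^sup>+x. ennreal (enn2real (h x)) \<partial>lborel) = integral\<^sup>N lborel h"
    by (rule nn_integral_cong) (use pos in \<open>simp add: less_top\<close>)
  hence "integrable lborel (\<lambda>x. enn2real (h x))"
    using fin by (intro integrableI_nonneg) (auto simp: less_top)
  hence "sq g" by (auto simp: sq_def g_def[abs_def])
  moreover have "g x > 0" for x using pos[of x] by (simp add: g_def enn2real_positive_iff)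
  ultimately show ?thesis by blast
qed

text \<open>Multiplying by a fixed positive square integrable weight turns local
  \<open>L\<^sup>2\<close>-convergence of a bounded sequence into \<open>L\<^sup>1\<close>-convergence, so the \<open>L\<^sup>1\<close> results of
  the library apply.\<close>
lemma L2loc_Cauchy_AE_subseq:
  fixes u :: "nat \<Rightarrow> R3 \<Rightarrow> 'b::euclidean_space"
  assumes u: "\<And>n. sq (u n)" and C: "\<And>n. nsq (u n) \<le> C"
    and cau: "\<And>R e. e > 0 \<Longrightarrow> \<exists>N. \<forall>i\<ge>N. \<forall>j\<ge>N. nsq_on R (\<lambda>x. (u i x - u j x)) < e"
  shows "\<exists>(r::nat\<Rightarrow>nat) v. strict_mono r \<and> (AE x in lborel. (\<lambda>i. u (r i) x) \<longlonglongrightarrow> v x) \<and> sq v \<and> nsq v \<le> C \<and>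
    (\<forall>R. (\<lambda>i. nsq_on R (\<lambda>x. (u (r i) x - v x))) \<longlonglongrightarrow> 0)"
proof -
  have [measurable]: "u n \<in> mble" for n using u by (simp add: sq_def)
  obtain g :: "R3 \<Rightarrow> real" where g: "sq g" "\<And>x. g x > 0" using ex_pos_sq by blast
  have [measurable]: "g \<in> mble" using g by (simp add: sq_def)
  have sqi: "sq (\<lambda>x. indicator A x *\<^sub>R w x)" if "A \<in> sets borel" "sq w" for A and w :: "R3 \<Rightarrow> 'b"
    using sq_bound(1)[OF that(2), of "\<lambda>x. indicator A x *\<^sub>R w x"] that
    by (auto simp: indicator_def sq_def)
  have sqi': "sq (\<lambda>x. indicator A x * w x)" if "A \<in> sets borel" "sq w" for A and w :: "R3 \<Rightarrow> real"
    using sq_bound(1)[OF that(2), of "\<lambda>x. indicator A x * w x"] that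
    by (auto simp: indicator_def sq_def)
  have C0: "C \<ge> 0" using C[of 0] nsq_nonneg[of "u 0"] by linarith
  \<comment> \<open>The weight has little mass outside large balls; this makes up for having the
    Cauchy property only on balls.\<close>
  have tail: "(\<lambda>n. nsq (\<lambda>x. indicator (- ball 0 (real n)) x * g x - 0)) \<longlonglongrightarrow> 0"
  proof (rule sq_dominated(3)[OF _ _ _ g(1)])
    show "AE x in lborel. (\<lambda>n. indicator (- ball 0 (real n)) x * g x) \<longlonglongrightarrow> 0"
    proof (rule AE_I2)
      fix x :: R3
      obtain N where "norm x < real N" using reals_Archimedean2 by blast
      hence "\<forall>n\<ge>N. indicator (- ball 0 (real n)) x * g x = 0" by (auto simp: indicator_def)
      thus "(\<lambda>n. indicator (- ball 0 (real n)) x * g x) \<longlonglongrightarrow> 0"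
        by (intro tendsto_eventually) (auto simp: eventually_sequentially)
    qed
    show "AE x in lborel. norm (indicator (- ball 0 (real n)) x * g x) \<le> g x" for n
      using g(2) by (auto simp: indicator_def less_imp_le)
  qed auto
  \<comment> \<open>Cauchy-Schwarz separately on a large ball, where the sequence is Cauchy in L^2,
    and on its complement, where the tail of \<open>g\<close> is small against the bound
    \<open>4 * C\<close> of a difference.\<close>
  have L1: "\<exists>N. \<forall>i\<ge>N. \<forall>j\<ge>N. (LBINT x. norm (g x *\<^sub>R u i x - g x *\<^sub>R u j x)) < e" if "e > 0" for e
  proof -
    have "\<forall>\<^sub>F n in sequentially. nsq (\<lambda>x. indicator (- ball 0 (real n)) x * g x) < (e / 2)\<^sup>2 / (4 * C + 1)"
      using order_tendstoD(2)[OF tail, of "(e / 2)\<^sup>2 / (4 * C + 1)"] C0 \<open>e > 0\<close> by simp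
    then obtain m where m: "nsq (\<lambda>x. indicator (- ball 0 (real m)) x * g x) < (e / 2)\<^sup>2 / (4 * C + 1)"
      by (auto simp: eventually_sequentially)
    obtain N where N: "\<forall>i\<ge>N. \<forall>j\<ge>N. nsq_on (real m) (\<lambda>x. (u i x - u j x)) < (e / 2)\<^sup>2 / (nsq g + 1)"
      using cau[of "(e / 2)\<^sup>2 / (nsq g + 1)" "real m"] \<open>e > 0\<close> nsq_nonneg[of g]
      by (auto simp: add_nonneg_pos)
    have "(LBINT x. norm (g x *\<^sub>R u i x - g x *\<^sub>R u j x)) < e" if "i \<ge> N" "j \<ge> N" for i j
    proof -
      let ?w = "\<lambda>x. u i x - u j x"
      have w: "sq ?w" using u by (simp add: sq_diff)
      have w4: "nsq ?w \<le> 4 * C" using sq_diff(2)[OF u u, of i j] C[of i] C[of j] by linarith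
      have pw: "norm (g x *\<^sub>R u i x - g x *\<^sub>R u j x)
          = norm (g x) * norm (indicator (ball 0 (real m)) x *\<^sub>R ?w x)
            + norm (indicator (- ball 0 (real m)) x * g x) * norm (?w x)" for x
        using g(2)[of x] by (auto simp: indicator_def simp flip: scaleR_diff_right)
      have "(LBINT x. norm (g x *\<^sub>R u i x - g x *\<^sub>R u j x))
          = (LBINT x. norm (g x) * norm (indicator (ball 0 (real m)) x *\<^sub>R ?w x))
            + (LBINT x. norm (indicator (- ball 0 (real m)) x * g x) * norm (?w x))"
        unfolding pw by (rule Bochner_Integration.integral_add; rule sq_norm_mult_int; intro g w sqi sqi'; simp)
      also have "\<dots> \<le> sqrt (nsq g) * sqrt (nsq_on (real m) (\<lambda>x. ?w x))
           + sqrt (nsq (\<lambda>x. indicator (- ball 0 (real m)) x * g x)) * sqrt (nsq ?w)"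
        by (intro add_mono L2_CS_norm g w sqi sqi') auto
      also have "\<dots> < e / 2 + e / 2"
      proof (rule add_less_le_mono)
        have "nsq g * nsq_on (real m) (\<lambda>x. ?w x)
            \<le> (nsq g + 1) * nsq_on (real m) (\<lambda>x. ?w x)"
          by (intro mult_right_mono) auto
        also have "\<dots> < (e / 2)\<^sup>2" using N that nsq_nonneg[of g]
          by (simp add: pos_less_divide_eq mult.commute add_nonneg_pos)
        finally have "sqrt (nsq g * nsq_on (real m) (\<lambda>x. ?w x)) < sqrt ((e/2)\<^sup>2)"
          by (rule real_sqrt_less_mono)
        thus "sqrt (nsq g) * sqrt (nsq_on (real m) (\<lambda>x. ?w x)) < e / 2"
          using \<open>e > 0\<close> by (simp add: real_sqrt_mult)
        have "nsq (\<lambda>x. indicator (- ball 0 (real m)) x * g x) * nsq ?w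
           \<le> nsq (\<lambda>x. indicator (- ball 0 (real m)) x * g x) * (4 * C + 1)"
          using w4 by (intro mult_left_mono) auto
        also have "\<dots> \<le> (e / 2)\<^sup>2" using m C0 by (simp add: pos_less_divide_eq)
        finally have "sqrt (nsq (\<lambda>x. indicator (- ball 0 (real m)) x * g x) * nsq ?w) \<le> sqrt ((e/2)\<^sup>2)"
          by (rule real_sqrt_le_mono)
        thus "sqrt (nsq (\<lambda>x. indicator (- ball 0 (real m)) x * g x)) * sqrt (nsq ?w) \<le> e / 2"
          using \<open>e > 0\<close> by (simp add: real_sqrt_mult)
      qed
      finally show ?thesis by simp
    qed
    thus ?thesis by blast
  qed
  have int: "integrable lborel (\<lambda>x. g x *\<^sub>R u n x)" for n
    by (rule Bochner_Integration.integrable_bound[OF sq_norm_mult_int[OF g(1) u[of n]]]) auto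
  obtain r where r: "strict_mono r" "AE x in lborel. Cauchy (\<lambda>i. g x *\<^sub>R u (r i) x)"
    using cauchy_L1_AE_cauchy_subseq[of lborel "\<lambda>n x. g x *\<^sub>R u n x", OF int L1] by blast
  define v where "v x = lim (\<lambda>i. u (r i) x)" for x
  have [measurable]: "v \<in> mble" unfolding v_def by measurable
  have v: "AE x in lborel. (\<lambda>i. u (r i) x) \<longlonglongrightarrow> v x"
    using r(2)
  proof eventually_elim
    case (elim x)
    hence "convergent (\<lambda>i. g x *\<^sub>R u (r i) x)" by (simp add: Cauchy_convergent_iff)
    then obtain l where "(\<lambda>i. g x *\<^sub>R u (r i) x) \<longlonglongrightarrow> l" by (auto simp: convergent_def)
    from tendsto_scaleR[OF tendsto_const[of "1 / g x"] this]
    have "(\<lambda>i. u (r i) x) \<longlonglongrightarrow> (1 / g x) *\<^sub>R l" using g(2)[of x] by simp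
    thus ?case unfolding v_def by (simp add: limI)
  qed
  have vsq: "sq v" "nsq v \<le> C"
    using sq_fatou[OF u v, of C] C by auto
  \<comment> \<open>Fatou in the second index turns the Cauchy estimate into an estimate of the
    distance to \<open>v\<close>.\<close>
  have "(\<lambda>i. nsq_on R (\<lambda>x. (u (r i) x - v x))) \<longlonglongrightarrow> 0" for R
  proof (rule null_seqI)
    fix e :: real assume "e > 0"
    obtain N where N: "\<forall>i\<ge>N. \<forall>j\<ge>N. nsq_on R (\<lambda>x. (u i x - u j x)) < e / 2"
      using cau[of "e/2" R] \<open>e > 0\<close> by auto
    have "nsq_on R (\<lambda>x. (u (r i) x - v x)) \<le> e / 2" if "i \<ge> N" for i
    proof (rule sq_fatou(2)[where u="\<lambda>j x. indicator (ball 0 R) x *\<^sub>R (u (r i) x - u (r j) x)"])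
      show "sq (\<lambda>x. indicator (ball 0 R) x *\<^sub>R (u (r i) x - u (r j) x))" for j
        by (intro sqi sq_diff u) auto
      show "AE x in lborel. (\<lambda>j. indicat_real (ball 0 R) x *\<^sub>R (u (r i) x - u (r j) x))
         \<longlonglongrightarrow> indicat_real (ball 0 R) x *\<^sub>R (u (r i) x - v x)"
        using v by eventually_elim (intro tendsto_intros)
      show "\<forall>\<^sub>F j in sequentially. nsq (\<lambda>x. indicat_real (ball 0 R) x *\<^sub>R (u (r i) x - u (r j) x)) \<le> e / 2"
        unfolding eventually_sequentially
      proof (intro exI[of _ N] allI impI)
        fix j assume "N \<le> j"
        hence "r j \<ge> N" "r i \<ge> N" using seq_suble[OF r(1)] that order_trans by blast+
        thus "nsq (\<lambda>x. indicat_real (ball 0 R) x *\<^sub>R (u (r i) x - u (r j) x)) \<le> e / 2"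
          using N by (meson less_imp_le)
      qed
      show "(\<lambda>x. indicat_real (ball 0 R) x *\<^sub>R (u (r i) x - v x)) \<in> mble"
        by (intro sq_meas sqi sq_diff u vsq) auto
    qed
    hence "\<forall>i\<ge>N. nsq_on R (\<lambda>x. (u (r i) x - v x)) \<le> e" using \<open>e > 0\<close> by fastforce
    thus "\<exists>N. \<forall>i\<ge>N. nsq_on R (\<lambda>x. (u (r i) x - v x)) \<le> e" by blast
  qed simp
  with r(1) v vsq show ?thesis by blast
qed

lemma L2_complete:
  fixes u :: "nat \<Rightarrow> R3 \<Rightarrow> 'b::euclidean_space"
  assumes u: "\<And>n. sq (u n)"
    and cau: "\<And>e. e > 0 \<Longrightarrow> \<exists>N. \<forall>i\<ge>N. \<forall>j\<ge>N. nsq (\<lambda>x. u i x - u j x) < e"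
  obtains v where "sq v" "(\<lambda>i. nsq (\<lambda>x. u i x - v x)) \<longlonglongrightarrow> 0"
proof -
  have [measurable]: "u n \<in> mble" for n using u by (simp add: sq_def)
  \<comment> \<open>The local theorem needs a bounded sequence; from \<open>N0\<close> on all terms
    are within distance 1 of \<open>u N0\<close>.\<close>
  obtain N0 where N0: "\<forall>i\<ge>N0. \<forall>j\<ge>N0. nsq (\<lambda>x. u i x - u j x) < 1" using cau[of 1] by auto
  define w where "w n = u (n + N0)" for n
  have w: "sq (w n)" for n by (simp add: w_def u)
  have wC: "nsq (w n) \<le> 2 + 2 * nsq (u N0)" for n
    using sq_add(2)[OF sq_diff(1)[OF u[of "n + N0"] u[of N0]] u[of N0]] N0[rule_format, of "n+N0" N0]
    by (simp add: w_def)
  have wcau: "\<exists>N. \<forall>i\<ge>N. \<forall>j\<ge>N. nsq_on R (\<lambda>x. (w i x - w j x)) < e" if "e > 0" for e R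
  proof -
    obtain N where N: "\<forall>i\<ge>N. \<forall>j\<ge>N. nsq (\<lambda>x. u i x - u j x) < e" using cau[OF \<open>e > 0\<close>] by auto
    have "nsq_on R (\<lambda>x. (w i x - w j x)) < e" if "i \<ge> N" "j \<ge> N" for i j
    proof -
      have "nsq_on R (\<lambda>x. (w i x - w j x)) \<le> nsq (\<lambda>x. w i x - w j x)"
        by (rule sq_bound(2)[OF sq_diff(1)[OF w w]]) (auto simp: indicator_def w_def)
      also have "\<dots> < e" using N that by (auto simp: w_def)
      finally show ?thesis .
    qed
    thus ?thesis by blast
  qed
  obtain r :: "nat \<Rightarrow> nat" and v where rv: "strict_mono r" "AE x in lborel. (\<lambda>i. w (r i) x) \<longlonglongrightarrow> v x" "sq v"
    using L2loc_Cauchy_AE_subseq[OF w wC wcau] by blast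
  have "(\<lambda>i. nsq (\<lambda>x. u i x - v x)) \<longlonglongrightarrow> 0"
  proof (rule null_seqI)
    fix e :: real assume "e > 0"
    obtain N where N: "\<forall>i\<ge>N. \<forall>j\<ge>N. nsq (\<lambda>x. u i x - u j x) < e / 2"
      using cau[of "e/2"] \<open>e > 0\<close> by auto
    have "nsq (\<lambda>x. u i x - v x) \<le> e / 2" if "i \<ge> N" for i
    proof (rule sq_fatou(2)[where u="\<lambda>j x. u i x - w (r j) x"])
      show "sq (\<lambda>x. u i x - w (r j) x)" for j by (intro sq_diff u w)
      show "AE x in lborel. (\<lambda>j. u i x - w (r j) x) \<longlonglongrightarrow> u i x - v x"
        using rv(2) by eventually_elim (intro tendsto_intros)
      show "(\<lambda>x. u i x - v x) \<in> mble" using sq_meas[OF rv(3)] by measurable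
      show "\<forall>\<^sub>F j in sequentially. nsq (\<lambda>x. u i x - w (r j) x) \<le> e / 2"
        unfolding eventually_sequentially
      proof (intro exI[of _ N] allI impI)
        fix j assume "N \<le> j"
        hence "r j + N0 \<ge> N" using seq_suble[OF rv(1), of j] by linarith
        thus "nsq (\<lambda>x. u i x - w (r j) x) \<le> e / 2"
          using N that unfolding w_def by (meson less_imp_le)
      qed
    qed
    hence "\<forall>i\<ge>N. nsq (\<lambda>x. u i x - v x) \<le> e" using \<open>e > 0\<close> by fastforce
    thus "\<exists>N. \<forall>i\<ge>N. nsq (\<lambda>x. u i x - v x) \<le> e" by blast
  qed simp
  with that rv(3) show thesis by blast
qed

section \<open>Smooth functions and integration by parts\<close>

lemma pd_eqI: "(\<psi> has_derivative D) (at x) \<Longrightarrow> pd \<psi> i x = D (axis i 1)"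
  unfolding pd_def using frechet_derivative_at by metis

lemma vec_axis_sum: "(\<Sum>i\<in>UNIV. (h $ i) *\<^sub>R axis i 1) = (h :: R3)"
  using basis_expansion[of h] by (simp add: scalar_mult_eq_scaleR)

lemma has_derivative_grad:
  assumes "\<psi> differentiable (at x)"
  shows "(\<psi> has_derivative (\<lambda>h. grad \<psi> x \<bullet> h)) (at x)"
proof -
  obtain D where D: "(\<psi> has_derivative D) (at x)" using assms by (auto simp: differentiable_def)
  have l: "linear D" using D has_derivative_linear by blast
  have "D h = grad \<psi> x \<bullet> h" for h
  proof -
    have "D h = D (\<Sum>i\<in>UNIV. (h $ i) *\<^sub>R axis i 1)" by (simp add: vec_axis_sum)
    also have "\<dots> = (\<Sum>i\<in>UNIV. (h $ i) * D (axis i 1))"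
      by (simp add: linear_sum[OF l] linear_cmul[OF l])
    also have "\<dots> = grad \<psi> x \<bullet> h"
      by (simp add: grad_def inner_vec_def pd_eqI[OF D] mult.commute)
    finally show ?thesis .
  qed
  hence "D = (\<lambda>h. grad \<psi> x \<bullet> h)" by auto
  with D show ?thesis by simp
qed

lemma pd_add: "f differentiable (at x) \<Longrightarrow> g differentiable (at x) \<Longrightarrow>
    pd (\<lambda>x. f x + g x) i x = pd f i x + pd g i x"
  by (rule pd_eqI[OF has_derivative_add[OF has_derivative_grad has_derivative_grad], THEN trans])
     (auto simp: grad_def inner_axis)

lemma pd_mult: "f differentiable (at x) \<Longrightarrow> g differentiable (at x) \<Longrightarrow>
    pd (\<lambda>x. f x * g x) i x = f x * pd g i x + pd f i x * g x"
  by (rule pd_eqI[OF has_derivative_mult[OF has_derivative_grad has_derivative_grad], THEN trans])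
     (auto simp: grad_def inner_axis)

lemma pd_const [simp]: "pd (\<lambda>x. c) i x = 0"
  by (rule pd_eqI[OF has_derivative_const, THEN trans]) simp

lemma pd_coord: "pd (\<lambda>x. x $ j) i x = (if i = j then 1 else 0)"
proof -
  have "((\<lambda>x::R3. x $ j) has_derivative (\<lambda>h. h $ j)) (at x)"
    by (rule bounded_linear_imp_has_derivative[OF bounded_linear_vec_nth])
  from pd_eqI[OF this] show ?thesis by (simp add: axis_def)
qed

lemma pd_shift:
  assumes "\<forall>x. \<psi> differentiable (at x)"
  shows "(\<lambda>x. \<psi> (x + z)) differentiable (at x)" "pd (\<lambda>x. \<psi> (x + z)) i x = pd \<psi> i (x + z)"
proof -
  have "((\<lambda>x. x + z) has_derivative (\<lambda>h. h)) (at x)" by (auto intro!: derivative_eq_intros)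
  from has_derivative_compose[OF this has_derivative_grad[OF assms[rule_format]]]
  have *: "((\<lambda>x. \<psi> (x + z)) has_derivative (\<lambda>h. grad \<psi> (x + z) \<bullet> h)) (at x)" .
  thus "(\<lambda>x. \<psi> (x + z)) differentiable (at x)" by (auto simp: differentiable_def)
  show "pd (\<lambda>x. \<psi> (x + z)) i x = pd \<psi> i (x + z)"
    by (simp add: pd_eqI[OF *] grad_def inner_axis)
qed

lemma pd_reflect:
  assumes "\<forall>x. \<psi> differentiable (at x)"
  shows "(\<lambda>x. \<psi> (z - x)) differentiable (at x)" "pd (\<lambda>x. \<psi> (z - x)) i x = - pd \<psi> i (z - x)"
proof -
  have "((\<lambda>x. z - x) has_derivative (\<lambda>h. - h)) (at x)" by (auto intro!: derivative_eq_intros)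
  from has_derivative_compose[OF this has_derivative_grad[OF assms[rule_format]]]
  have *: "((\<lambda>x. \<psi> (z - x)) has_derivative (\<lambda>h. grad \<psi> (z - x) \<bullet> - h)) (at x)" .
  thus "(\<lambda>x. \<psi> (z - x)) differentiable (at x)" by (auto simp: differentiable_def)
  show "pd (\<lambda>x. \<psi> (z - x)) i x = - pd \<psi> i (z - x)"
    by (simp add: pd_eqI[OF *] grad_def inner_axis)
qed

lemma Ck_continuous: "Ck k \<psi> \<Longrightarrow> continuous_on UNIV \<psi>"
proof (cases k)
  case (Suc j)
  assume "Ck k \<psi>"
  hence "\<forall>x. \<psi> differentiable (at x)" using Suc by simp
  thus ?thesis
    by (simp add: continuous_on_eq_continuous_at differentiable_imp_continuous_within)
qed simp

lemma Ck_SucD: "Ck (Suc k) \<psi> \<Longrightarrow> Ck k \<psi>"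
proof (induction k arbitrary: \<psi>)
  case 0 thus ?case using Ck_continuous by (metis Ck.simps(1))
qed auto

lemma Ck_const: "Ck k (\<lambda>x. c)"
proof (induction k arbitrary: c)
  case (Suc k)
  have "pd (\<lambda>x. c) i = (\<lambda>x. 0)" for i by auto
  thus ?case using Suc by simp
qed simp

lemma Ck_add: "Ck k f \<Longrightarrow> Ck k g \<Longrightarrow> Ck k (\<lambda>x. f x + g x)"
proof (induction k arbitrary: f g)
  case 0 thus ?case by (auto intro: continuous_intros)
next
  case (Suc k)
  hence d: "\<And>x. f differentiable (at x)" "\<And>x. g differentiable (at x)" by auto
  hence "pd (\<lambda>x. f x + g x) i = (\<lambda>x. pd f i x + pd g i x)" for i
    by (auto simp: pd_add)
  thus ?case using Suc d by auto
qed

lemma Ck_mult: "Ck k f \<Longrightarrow> Ck k g \<Longrightarrow> Ck k (\<lambda>x. f x * g x)"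
proof (induction k arbitrary: f g)
  case 0 thus ?case by (auto intro: continuous_intros)
next
  case (Suc k)
  hence d: "\<And>x. f differentiable (at x)" "\<And>x. g differentiable (at x)" by auto
  hence "pd (\<lambda>x. f x * g x) i = (\<lambda>x. f x * pd g i x + pd f i x * g x)" for i
    by (auto simp: pd_mult)
  moreover have "Ck k (\<lambda>x. f x * pd g i x + pd f i x * g x)" for i
    using Suc.prems Ck_SucD[OF Suc.prems(1)] Ck_SucD[OF Suc.prems(2)]
    by (intro Ck_add Suc.IH) auto
  ultimately show ?case using d by auto
qed

lemma Ck_coord: "Ck k (\<lambda>x. x $ j)"
proof (cases k)
  case 0 thus ?thesis by (auto intro!: continuous_intros)
next
  case (Suc l)
  have "pd (\<lambda>x. x $ j) i = (\<lambda>x. if i = j then 1 else 0)" for i by (auto simp: pd_coord)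
  moreover have "(\<lambda>x::R3. x $ j) differentiable (at x)" for x
    by (intro bounded_linear_imp_differentiable bounded_linear_vec_nth)
  ultimately show ?thesis using Suc Ck_const by simp
qed

lemma Ck_sum: "finite I \<Longrightarrow> (\<And>i. i \<in> I \<Longrightarrow> Ck k (f i)) \<Longrightarrow> Ck k (\<lambda>x. \<Sum>i\<in>I. f i x)"
  by (induction I rule: finite_induct) (auto intro: Ck_add Ck_const)

lemma Ck_cmult: "Ck k f \<Longrightarrow> Ck k (\<lambda>x. c * f x)"
  by (intro Ck_mult Ck_const)

lemma Ck_diff: "Ck k f \<Longrightarrow> Ck k g \<Longrightarrow> Ck k (\<lambda>x. f x - g x)"
  using Ck_add[of k f "\<lambda>x. (-1) * g x"] Ck_cmult[of k g "-1"] by simp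

lemma Ck_shift: "Ck k \<psi> \<Longrightarrow> Ck k (\<lambda>x. \<psi> (x + z))"
proof (induction k arbitrary: \<psi>)
  case 0 thus ?case
    by (auto intro!: continuous_on_compose2[of UNIV \<psi>] continuous_intros)
next
  case (Suc k)
  hence d: "\<forall>x. \<psi> differentiable (at x)" by auto
  hence "pd (\<lambda>x. \<psi> (x + z)) i = (\<lambda>x. pd \<psi> i (x + z))" for i
    by (auto simp: pd_shift)
  thus ?case using Suc d pd_shift(1)[OF d] by auto
qed

lemma Ck_reflect: "Ck k \<psi> \<Longrightarrow> Ck k (\<lambda>x. \<psi> (z - x))"
proof (induction k arbitrary: \<psi>)
  case 0 thus ?case
    by (auto intro!: continuous_on_compose2[of UNIV \<psi>] continuous_intros)
next
  case (Suc k)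
  hence d: "\<forall>x. \<psi> differentiable (at x)" by auto
  hence e: "pd (\<lambda>x. \<psi> (z - x)) i = (\<lambda>x. (-1) * pd \<psi> i (z - x))" for i
    by (auto simp: pd_reflect)
  have "Ck k (\<lambda>x. (-1) * pd \<psi> i (z - x))" for i
    using Suc by (intro Ck_cmult Suc.IH) auto
  thus ?case using Suc d pd_reflect(1)[OF d] by (auto simp only: Ck.simps e)
qed

text \<open>The family \<open>exp (-1/t) / t^m\<close>, extended by zero, is closed under differentiation, which
  makes the smoothness of the standard bump an induction over all \<open>m\<close> at once.\<close>
definition flat :: "nat \<Rightarrow> real \<Rightarrow> real" where
  "flat m t = (if t \<le> 0 then 0 else exp (- (1 / t)) / t ^ m)"

text \<open>From \<open>(1 + x / n) ^ n \<le> exp x\<close> at \<open>x = 1 / t\<close> and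
  \<open>n = m + 2\<close>: two powers of \<open>t\<close> survive the division by
  \<open>t ^ m\<close>, so the derivative at 0 exists and is 0.\<close>

lemma flat_bound: "\<bar>flat m t\<bar> \<le> real (m + 2) ^ (m + 2) * t\<^sup>2"
proof (cases "t \<le> 0")
  case False
  hence t: "t > 0" by simp
  let ?n = "m + 2"
  have "(1 / t / real ?n) ^ ?n \<le> (1 + 1 / t / real ?n) ^ ?n"
    using t by (intro power_mono) auto
  also have "\<dots> \<le> exp (1 / t)"
    using t by (intro exp_ge_one_plus_x_over_n_power_n) (auto intro: order_trans[of _ 0])
  finally have "(1 / (t * real ?n)) ^ ?n \<le> exp (1 / t)" by simp
  moreover have "(t * real ?n) ^ ?n > 0" using t by (intro zero_less_power) auto
  ultimately have "1 \<le> exp (1 / t) * (t * real ?n) ^ ?n"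
    by (simp only: power_one_over divide_le_eq simp_thms if_True)
  hence "exp (- (1 / t)) \<le> (t * real ?n) ^ ?n"
    by (simp only: exp_minus) (metis exp_gt_zero inverse_eq_divide mult.commute pos_divide_le_eq)
  hence "exp (- (1 / t)) \<le> real ?n ^ ?n * t ^ ?n"
    by (simp only: power_mult_distrib mult.commute)
  hence "exp (- (1 / t)) / t ^ m \<le> real ?n ^ ?n * t ^ ?n / t ^ m"
    using t by (intro divide_right_mono) auto
  also have "\<dots> = real ?n ^ ?n * t\<^sup>2" using t by (simp add: power_add power2_eq_square)
  finally show ?thesis using t by (simp add: flat_def)
qed (simp add: flat_def)

lemma flat_deriv: "(flat m has_real_derivative flat (m + 2) t - real m * flat (m + 1) t) (at t)"
proof -
  consider "t < 0" | "t = 0" | "t > 0" by linarith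
  thus ?thesis
  proof cases
    case 1
    have "((\<lambda>x. 0) has_real_derivative flat (m + 2) t - real m * flat (m + 1) t) (at t)"
      using 1 by (simp add: flat_def)
    thus ?thesis
      by (rule has_field_derivative_transform_within_open[of _ _ _ "{..<0}"])
         (use 1 in \<open>auto simp: flat_def\<close>)
  next
    case 3
    define y where "y = inverse t"
    have t0: "t \<noteq> 0" using 3 by simp
    have I: "(inverse has_real_derivative - (y ^ Suc (Suc 0))) (at t)"
      unfolding y_def by (rule DERIV_inverse[OF t0])
    have "((\<lambda>x. exp (- inverse x) * inverse x ^ m) has_real_derivative
        exp (- inverse t) * (- (- (y ^ Suc (Suc 0)))) * inverse t ^ m +
        (real m * (- (y ^ Suc (Suc 0)) * inverse t ^ (m - Suc 0))) * exp (- inverse t)) (at t)"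
      by (rule DERIV_mult[OF DERIV_fun_exp[OF DERIV_minus[OF I]] DERIV_power[OF I]])
    moreover have "exp (- inverse t) * (- (- (y ^ Suc (Suc 0)))) * inverse t ^ m +
        (real m * (- (y ^ Suc (Suc 0)) * inverse t ^ (m - Suc 0))) * exp (- inverse t)
       = flat (m + 2) t - real m * flat (m + 1) t"
    proof (cases m)
      case 0
      thus ?thesis using 3 by (simp add: flat_def y_def divide_inverse power2_eq_square)
    next
      case (Suc k)
      thus ?thesis using 3
        by (simp add: flat_def y_def divide_inverse power2_eq_square power_inverse algebra_simps)
    qed
    ultimately have "((\<lambda>x. exp (- (1 / x)) / x ^ m) has_real_derivative flat (m + 2) t - real m * flat (m + 1) t) (at t)"
      by (simp add: divide_inverse power_inverse)
    thus ?thesis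
      by (rule has_field_derivative_transform_within_open[of _ _ _ "{0<..}"])
         (use 3 in \<open>auto simp: flat_def\<close>)
  next
    case 2
    obtain K where K: "\<And>h. \<bar>flat m h\<bar> \<le> K * h\<^sup>2" using flat_bound by blast
    have "((\<lambda>h. flat m h / h) \<longlongrightarrow> 0) (at 0)"
    proof (rule Lim_null_comparison)
      show "\<forall>\<^sub>F h in at 0. norm (flat m h / h) \<le> K * \<bar>h\<bar>"
      proof (rule always_eventually, rule allI)
        fix h :: real
        have "\<bar>flat m h\<bar> \<le> (K * \<bar>h\<bar>) * \<bar>h\<bar>" using K[of h] by (simp add: power2_eq_square)
        thus "norm (flat m h / h) \<le> K * \<bar>h\<bar>"
          by (cases "h = 0") (simp_all add: pos_divide_le_eq)
      qed
      have "((\<lambda>h. K * \<bar>h\<bar>) \<longlongrightarrow> K * \<bar>0\<bar>) (at 0)"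
        by (intro tendsto_intros)
      thus "((\<lambda>h. K * \<bar>h\<bar>) \<longlongrightarrow> 0) (at 0)" by simp
    qed
    thus ?thesis unfolding 2 by (simp add: has_field_derivative_iff flat_def[of _ 0])
  qed
qed

lemma Ck_flat:
  assumes q: "\<And>k. Ck k q"
  shows "Ck k (\<lambda>x. flat m (q x))"
proof (induction k arbitrary: m)
  case 0
  have "isCont (flat m) t" for t by (rule DERIV_isCont[OF flat_deriv])
  hence "continuous_on UNIV (flat m)" by (simp add: continuous_on_eq_continuous_at)
  thus ?case
    using q[of 0] by (auto intro!: continuous_on_compose2[of UNIV "flat m" UNIV q])
next
  case (Suc k)
  have qd: "q differentiable (at x)" for x using q[of 1] by simp
  have D: "((\<lambda>x. flat m (q x)) has_derivative
      (\<lambda>h. (grad q x \<bullet> h) * (flat (m + 2) (q x) - real m * flat (m + 1) (q x)))) (at x)" for x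
    by (rule DERIV_compose_FDERIV[OF flat_deriv has_derivative_grad[OF qd]])
  have "pd (\<lambda>x. flat m (q x)) i
      = (\<lambda>x. pd q i x * (flat (m + 2) (q x) - real m * flat (m + 1) (q x)))" for i
    by (rule ext) (simp only: pd_eqI[OF D] grad_def inner_axis vec_lambda_beta, simp)
  moreover have "Ck k (\<lambda>x. pd q i x * (flat (m + 2) (q x) - real m * flat (m + 1) (q x)))" for i
    using q[of "Suc k"] by (intro Ck_mult Ck_diff Ck_cmult Suc.IH Ck_const) auto
  ultimately show ?case using D by (auto simp only: Ck.simps differentiable_def)
qed

definition bump :: "R3 \<Rightarrow> real \<Rightarrow> R3 \<Rightarrow> real" where
  "bump a r x = flat 0 (r\<^sup>2 - (norm (x - a))\<^sup>2)"

lemma smooth_bump: "smooth (bump a r)"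
proof -
  have "(norm (x - a))\<^sup>2 = (\<Sum>i\<in>UNIV. (x $ i - a $ i) * (x $ i - a $ i))" for x
    by (simp add: power2_norm_eq_inner inner_vec_def)
  hence "bump a r = (\<lambda>x. flat 0 (r\<^sup>2 - (\<Sum>i\<in>UNIV. (x $ i - a $ i) * (x $ i - a $ i))))"
    by (simp add: bump_def[abs_def])
  moreover have "Ck k (\<lambda>x. flat 0 (r\<^sup>2 - (\<Sum>i\<in>UNIV. (x $ i - a $ i) * (x $ i - a $ i))))" for k
    by (intro Ck_flat Ck_diff Ck_const Ck_sum Ck_mult Ck_coord) auto
  ultimately show ?thesis by (simp add: smooth_def)
qed

lemma bump_pos: "r > 0 \<Longrightarrow> x \<in> ball a r \<Longrightarrow> bump a r x > 0"
  using power_strict_mono[of "norm (x - a)" r 2]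
  by (auto simp: bump_def flat_def dist_norm norm_minus_commute)

lemma bump_nonneg: "0 \<le> bump a r x" "r > 0 \<Longrightarrow> x \<notin> ball a r \<Longrightarrow> bump a r x = 0"
  using power_mono[of r "norm (x - a)" 2]
  by (auto simp: bump_def flat_def dist_norm norm_minus_commute)

section \<open>Test functions and continuously differentiable functions of compact support\<close>

lemma test_funI:
  assumes "smooth \<psi>" "compact K" "K \<subseteq> U" "\<And>x. x \<notin> K \<Longrightarrow> \<psi> x = 0"
  shows "test_fun U \<psi>"
proof -
  have "{x. \<psi> x \<noteq> 0} \<subseteq> K" using assms(4) by auto
  hence "closure {x. \<psi> x \<noteq> 0} \<subseteq> K"
    using assms(2) by (simp add: closure_minimal compact_imp_closed)
  moreover from this have "compact (closure {x. \<psi> x \<noteq> 0})"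
    using assms(2) by (meson closed_closure compact_closure bounded_subset compact_imp_bounded
        bounded_closure compact_eq_bounded_closed)
  ultimately show ?thesis using assms by (auto simp: test_fun_def)
qed

lemma test_funE:
  assumes "test_fun U \<psi>"
  obtains K where "compact K" "K \<subseteq> U" "\<And>x. x \<notin> K \<Longrightarrow> \<psi> x = 0"
proof
  show "compact (closure {x. \<psi> x \<noteq> 0})" "closure {x. \<psi> x \<noteq> 0} \<subseteq> U"
    using assms by (auto simp: test_fun_def)
  show "\<psi> x = 0" if "x \<notin> closure {x. \<psi> x \<noteq> 0}" for x
    using that closure_subset[of "{x. \<psi> x \<noteq> 0}"] by blast
qed

lemma test_fun_mono: "test_fun U \<psi> \<Longrightarrow> U \<subseteq> W \<Longrightarrow> test_fun W \<psi>"
  by (auto simp: test_fun_def)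

lemma test_fun_smooth: "test_fun U \<psi> \<Longrightarrow> smooth \<psi>" by (simp add: test_fun_def)

lemma smooth_Ck: "smooth \<psi> \<Longrightarrow> Ck k \<psi>" by (simp add: smooth_def)

lemma smooth_mult: "smooth f \<Longrightarrow> smooth g \<Longrightarrow> smooth (\<lambda>x. f x * g x)"
  and smooth_add: "smooth f \<Longrightarrow> smooth g \<Longrightarrow> smooth (\<lambda>x. f x + g x)"
  and smooth_const: "smooth (\<lambda>x. c)"
  and smooth_reflect: "smooth f \<Longrightarrow> smooth (\<lambda>x. f (z - x))"
  by (auto simp: smooth_def intro: Ck_mult Ck_add Ck_diff Ck_const Ck_shift Ck_reflect)

lemma smooth_pd: "smooth \<psi> \<Longrightarrow> smooth (pd \<psi> i)"
  unfolding smooth_def by (metis Ck.simps(2))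

lemma pd_zero_off:
  assumes "closed K" "\<And>x. x \<notin> K \<Longrightarrow> \<psi> x = 0" "x \<notin> K"
  shows "pd \<psi> i x = 0"
proof -
  have "((\<lambda>x. 0) has_derivative (\<lambda>h. 0)) (at x)" by simp
  hence "(\<psi> has_derivative (\<lambda>h. 0)) (at x)"
    by (rule has_derivative_transform_within_open[of _ _ _ _ "- K"]) (use assms in auto)
  from pd_eqI[OF this] show ?thesis by simp
qed

lemma test_fun_pd: "test_fun U \<psi> \<Longrightarrow> test_fun U (pd \<psi> i)"
  by (metis test_funI test_funE test_fun_smooth smooth_pd pd_zero_off compact_imp_closed)

lemma test_fun_mult: "test_fun U \<psi> \<Longrightarrow> smooth f \<Longrightarrow> test_fun U (\<lambda>x. f x * \<psi> x)"
  by (metis (no_types, lifting) test_funE test_funI smooth_mult test_fun_smooth mult_zero_right)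

lemma test_fun_add: "test_fun U f \<Longrightarrow> test_fun U g \<Longrightarrow> test_fun U (\<lambda>x. f x + g x)"
proof -
  assume f: "test_fun U f" and g: "test_fun U g"
  obtain K where K: "compact K" "K \<subseteq> U" "\<And>x. x \<notin> K \<Longrightarrow> f x = 0" using test_funE[OF f] by metis
  obtain L where L: "compact L" "L \<subseteq> U" "\<And>x. x \<notin> L \<Longrightarrow> g x = 0" using test_funE[OF g] by metis
  show ?thesis
    by (rule test_funI[of _ "K \<union> L" U])
       (use K L f g in \<open>auto simp: compact_Un test_fun_smooth smooth_add\<close>)
qed

lemma test_fun_bump: "r > 0 \<Longrightarrow> test_fun UNIV (bump a r)"
  by (rule test_funI[of _ "cball a r"]) (auto simp: smooth_bump intro!: bump_nonneg)

text \<open>A class between test functions and Sobolev functions: composing test functions with a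
  function that is only C^1 leaves the smooth functions, but after multiplication by a cutoff the
  result stays here.\<close>

definition C1c :: "(R3 \<Rightarrow> real) \<Rightarrow> bool" where
  "C1c \<psi> \<longleftrightarrow> Ck 1 \<psi> \<and> (\<exists>R. \<forall>x. x \<notin> cball 0 R \<longrightarrow> \<psi> x = 0)"

lemma test_fun_C1c: assumes "test_fun U \<psi>" shows "C1c \<psi>"
proof -
  obtain K where K: "compact K" "\<And>x. x \<notin> K \<Longrightarrow> \<psi> x = 0" using test_funE[OF assms] by metis
  obtain R where "K \<subseteq> cball 0 R"
    using compact_imp_bounded[OF K(1)] by (auto simp: bounded_iff subset_iff)
  hence "\<forall>x. x \<notin> cball 0 R \<longrightarrow> \<psi> x = 0" using K(2) by blast
  thus ?thesis using smooth_Ck[OF test_fun_smooth[OF assms], of 1] unfolding C1c_def by blast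
qed

lemma Ck1_grad_cont: "Ck 1 \<psi> \<Longrightarrow> continuous_on UNIV (grad \<psi>)"
  unfolding grad_def by (auto intro!: continuous_on_vec_lambda)

lemma cont_meas: "continuous_on UNIV (f :: R3 \<Rightarrow> 'b::euclidean_space) \<Longrightarrow> f \<in> mble"
  by (simp add: borel_measurable_continuous_onI)

lemma cont_supp_bounded:
  fixes f :: "R3 \<Rightarrow> 'b::euclidean_space"
  assumes "continuous_on UNIV f" "\<And>x. x \<notin> cball 0 R \<Longrightarrow> f x = 0"
  shows "\<exists>C\<ge>0. \<forall>x. norm (f x) \<le> C * indicator (cball 0 R) x"
proof -
  have "compact (f ` cball 0 R)"
    using assms(1) by (intro compact_continuous_image) (auto intro: continuous_on_subset)
  hence "bounded (f ` cball 0 R)" by (rule compact_imp_bounded)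
  then obtain C where "\<forall>y\<in>f ` cball 0 R. norm y \<le> C" by (auto simp: bounded_iff)
  hence "\<forall>x. norm (f x) \<le> \<bar>C\<bar> * indicator (cball 0 R) x"
    using assms(2) by (force simp: indicator_def)
  thus ?thesis by (intro exI[of _ "\<bar>C\<bar>"]) auto
qed

lemma cball_int: "integrable lborel (\<lambda>x::R3. c * indicator (cball 0 R) x :: real)"
proof -
  have "emeasure lborel (cball 0 R :: R3 set) < \<infinity>" by (intro emeasure_bounded_finite) auto
  thus ?thesis by auto
qed

lemma bounded_supp_int:
  fixes f :: "R3 \<Rightarrow> 'b::euclidean_space"
  assumes "f \<in> mble" "\<forall>x. norm (f x) \<le> C * indicator (cball 0 R) x"
  shows "integrable lborel f" "sq f"
proof -
  show "integrable lborel f"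
    by (rule Bochner_Integration.integrable_bound[OF cball_int[of C R] assms(1)])
       (use assms(2) in \<open>auto intro!: AE_I2 order_trans[OF _ abs_ge_self]\<close>)
  have "(norm (f x))\<^sup>2 \<le> C\<^sup>2 * indicator (cball 0 R) x" for x
    using power_mono[OF assms(2)[rule_format, of x], of 2] by (auto simp: indicator_def power_mult_distrib)
  hence "integrable lborel (\<lambda>x. (norm (f x))\<^sup>2)"
    using assms(1) by (intro Bochner_Integration.integrable_bound[OF cball_int[of "C\<^sup>2" R]] AE_I2) auto
  thus "sq f" using assms by (simp add: sq_def)
qed

lemma C1c_D:
  assumes "C1c \<psi>"
  shows "integrable lborel \<psi>" "sq \<psi>" "sq (grad \<psi>)" "continuous_on UNIV \<psi>" "continuous_on UNIV (grad \<psi>)"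
    "\<exists>C\<ge>0. \<exists>R. (\<forall>x. \<bar>\<psi> x\<bar> \<le> C * indicator (cball 0 R) x) \<and> (\<forall>x. norm (grad \<psi> x) \<le> C * indicator (cball 0 R) x)"
proof -
  obtain R where R: "\<And>x. x \<notin> cball 0 R \<Longrightarrow> \<psi> x = 0" and c1: "Ck 1 \<psi>" using assms by (auto simp: C1c_def)
  have R': "\<And>x. x \<notin> cball 0 R \<Longrightarrow> grad \<psi> x = 0"
    unfolding grad_def using pd_zero_off[of "cball 0 R" \<psi>] R by (auto simp: vec_eq_iff)
  show c: "continuous_on UNIV \<psi>" "continuous_on UNIV (grad \<psi>)"
    using c1 Ck_continuous Ck1_grad_cont by blast+
  obtain C1 where C1: "C1 \<ge> 0" "\<forall>x. norm (\<psi> x) \<le> C1 * indicator (cball 0 R) x"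
    using cont_supp_bounded[OF c(1) R] by blast
  obtain C2 where C2: "C2 \<ge> 0" "\<forall>x. norm (grad \<psi> x) \<le> C2 * indicator (cball 0 R) x"
    using cont_supp_bounded[OF c(2) R'] by blast
  show "integrable lborel \<psi>" "sq \<psi>" "sq (grad \<psi>)"
    using bounded_supp_int[OF cont_meas[OF c(1)] C1(2)] bounded_supp_int[OF cont_meas[OF c(2)] C2(2)] by auto
  have le: "C1 * indicator (cball 0 R) x \<le> (C1 + C2) * (indicator (cball 0 R) x :: real)"
    "C2 * indicator (cball 0 R) x \<le> (C1 + C2) * (indicator (cball 0 R) x :: real)" for x :: R3
    using C1 C2 by (auto intro!: mult_right_mono)
  have "(\<forall>x. \<bar>\<psi> x\<bar> \<le> (C1 + C2) * indicator (cball 0 R) x) \<and> (\<forall>x. norm (grad \<psi> x) \<le> (C1 + C2) * indicator (cball 0 R) x)"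
    using order_trans[OF C1(2)[rule_format] le(1)] order_trans[OF C2(2)[rule_format] le(2)] by auto
  thus "\<exists>C\<ge>0. \<exists>R. (\<forall>x. \<bar>\<psi> x\<bar> \<le> C * indicator (cball 0 R) x) \<and> (\<forall>x. norm (grad \<psi> x) \<le> C * indicator (cball 0 R) x)"
    using C1 C2 by (intro exI[of _ "C1 + C2"]) auto
qed

lemma C1c_mult: "C1c \<psi> \<Longrightarrow> Ck 1 f \<Longrightarrow> C1c (\<lambda>x. f x * \<psi> x)"
  unfolding C1c_def by (metis Ck_mult mult_zero_right)

lemma grad_Lip:
  assumes d: "\<And>x. \<psi> differentiable (at x)" and L: "\<And>x. norm (grad \<psi> x) \<le> L"
  shows "\<bar>\<psi> (x + h) - \<psi> x\<bar> \<le> L * norm h"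
proof -
  have "norm (\<psi> (x + h) - \<psi> x) \<le> L * norm (x + h - x)"
  proof (rule differentiable_bound[of UNIV \<psi> "\<lambda>x h. grad \<psi> x \<bullet> h"])
    show "(\<psi> has_derivative (\<lambda>h. grad \<psi> x \<bullet> h)) (at x within UNIV)" for x
      using has_derivative_grad[OF d] by simp
    show "onorm (\<lambda>h. grad \<psi> x \<bullet> h) \<le> L" for x
    proof (rule onorm_le)
      fix h show "norm (grad \<psi> x \<bullet> h) \<le> L * norm h"
        using Cauchy_Schwarz_ineq2[of "grad \<psi> x" h] mult_right_mono[OF L, of "norm h" x] by simp
    qed
  qed auto
  thus ?thesis by simp
qed

section \<open>Invariance of Lebesgue measure and integration by parts\<close>

lemma distr_shift: "distr lborel borel (\<lambda>x. x + z) = (lborel :: R3 measure)"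
proof -
  have "(\<lambda>x. x + z) = (+) z" by (auto simp: add.commute)
  thus ?thesis using lborel_distr_plus[of z] by simp
qed

lemma integral_shift:
  fixes f :: "R3 \<Rightarrow> 'b::euclidean_space"
  assumes [measurable]: "f \<in> mble"
  shows "(LBINT x. f (x + z)) = (LBINT x. f x)"
    "integrable lborel (\<lambda>x. f (x + z)) \<longleftrightarrow> integrable lborel f"
proof -
  have [measurable]: "f \<in> borel_measurable borel" using assms by simp
  have "(LBINT x. f (x + z)) = (\<integral>x. f x \<partial>distr lborel borel (\<lambda>x. x + z))"
    by (subst integral_distr) auto
  thus "(LBINT x. f (x + z)) = (LBINT x. f x)" by (simp add: distr_shift)
  have "integrable lborel (\<lambda>x. f (x + z)) \<longleftrightarrow> integrable (distr lborel borel (\<lambda>x. x + z)) f"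
    by (subst integrable_distr_eq) auto
  thus "integrable lborel (\<lambda>x. f (x + z)) \<longleftrightarrow> integrable lborel f" by (simp add: distr_shift)
qed

lemma distr_reflect: "distr lborel borel (\<lambda>x. z - x) = (lborel :: R3 measure)"
proof -
  have "lborel = density (distr lborel borel (\<lambda>x::R3. z + (-1) *\<^sub>R x)) (\<lambda>_. ennreal (\<bar>-1\<bar> ^ DIM(R3)))"
    using lborel_affine[of "-1" z] by (simp add: ennreal_power)
  thus ?thesis by (simp add: density_1)
qed

lemma integral_reflect:
  fixes f :: "R3 \<Rightarrow> 'b::euclidean_space"
  assumes [measurable]: "f \<in> mble"
  shows "(LBINT x. f (z - x)) = (LBINT x. f x)"
    "integrable lborel (\<lambda>x. f (z - x)) \<longleftrightarrow> integrable lborel f"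
proof -
  have [measurable]: "f \<in> borel_measurable borel" using assms by simp
  have "(LBINT x. f (z - x)) = (\<integral>x. f x \<partial>distr lborel borel (\<lambda>x. z - x))"
    by (subst integral_distr) auto
  thus "(LBINT x. f (z - x)) = (LBINT x. f x)" by (simp add: distr_reflect)
  have "integrable lborel (\<lambda>x. f (z - x)) \<longleftrightarrow> integrable (distr lborel borel (\<lambda>x. z - x)) f"
    by (subst integrable_distr_eq) auto
  thus "integrable lborel (\<lambda>x. f (z - x)) \<longleftrightarrow> integrable lborel f" by (simp add: distr_reflect)
qed

text \<open>Difference quotients have integral zero by translation invariance, and they converge
  dominatedly to the partial derivative.\<close>

lemma integral_pd_zero:
  assumes "C1c \<psi>"
  shows "(LBINT x. pd \<psi> i x) = 0"
proof -
  obtain C R where C: "C \<ge> 0" "\<forall>x. \<bar>\<psi> x\<bar> \<le> C * indicator (cball 0 R) x"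
    "\<forall>x. norm (grad \<psi> x) \<le> C * indicator (cball 0 R) x" using C1c_D(6)[OF assms] by blast
  have d: "\<psi> differentiable (at x)" for x using assms by (simp add: C1c_def)
  have gC: "norm (grad \<psi> x) \<le> C" for x using C by (smt (verit, best) indicator_le_1 mult_left_le)
  let ?e = "axis i 1 :: R3"
  define g where "g n x = real (Suc n) * (\<psi> (x + (1 / real (Suc n)) *\<^sub>R ?e) - \<psi> x)" for n x
  have [measurable]: "\<psi> \<in> mble" using cont_meas C1c_D(4)[OF assms] by blast
  have [measurable]: "\<psi> \<in> borel_measurable borel" using cont_meas C1c_D(4)[OF assms] by simp
  have "continuous_on UNIV (pd \<psi> i)" using assms by (simp add: C1c_def)
  hence m: "pd \<psi> i \<in> mble" by (rule cont_meas)
  have "(\<lambda>n. LBINT x. g n x) \<longlonglongrightarrow> (LBINT x. pd \<psi> i x)"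
  proof (rule Bochner_Integration.integral_dominated_convergence
      [where w="\<lambda>x. C * indicator (cball 0 (R + 1)) x"])
    show "g n \<in> mble" for n unfolding g_def by measurable
    \<comment> \<open>The steps have length at most 1, so all quotients vanish outside the ball of
      radius \<open>R + 1\<close>.\<close>
    show "integrable lborel (\<lambda>x::R3. C * indicator (cball 0 (R + 1)) x :: real)"
      by (auto intro!: emeasure_lborel_cball_finite)
    show "AE x in lborel. (\<lambda>n. g n x) \<longlonglongrightarrow> pd \<psi> i x"
    proof (rule AE_I2)
      fix x
      have "((\<lambda>t. x + t *\<^sub>R ?e) has_derivative (\<lambda>t. t *\<^sub>R ?e)) (at 0)"
        by (auto intro!: derivative_eq_intros)
      from has_derivative_compose[OF this, of \<psi> "\<lambda>h. grad \<psi> x \<bullet> h"] has_derivative_grad[OF d[of x]]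
      have "((\<lambda>t. \<psi> (x + t *\<^sub>R ?e)) has_derivative (\<lambda>t. grad \<psi> x \<bullet> (t *\<^sub>R ?e))) (at 0)" by simp
      hence "((\<lambda>t. \<psi> (x + t *\<^sub>R ?e)) has_real_derivative pd \<psi> i x) (at 0)"
        by (simp add: has_field_derivative_def grad_def inner_axis mult_commute_abs)
      hence lim: "((\<lambda>h. (\<psi> (x + h *\<^sub>R ?e) - \<psi> x) / h) \<longlongrightarrow> pd \<psi> i x) (at 0)"
        by (simp add: has_field_derivative_iff)
      have "filterlim (\<lambda>n. 1 / real (Suc n)) (at 0) sequentially"
        using LIMSEQ_inverse_real_of_nat by (auto simp: filterlim_at inverse_eq_divide)
      from filterlim_compose[OF lim this]
      show "(\<lambda>n. g n x) \<longlonglongrightarrow> pd \<psi> i x"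
        unfolding g_def by (simp add: mult.commute)
    qed
    show "AE x in lborel. norm (g n x) \<le> C * indicator (cball 0 (R + 1)) x" for n
    proof (rule AE_I2)
      fix x
      let ?h = "(1 / real (Suc n)) *\<^sub>R ?e"
      have nh: "norm ?h \<le> 1" by (simp add: norm_axis_1)
      have "\<bar>\<psi> (x + ?h) - \<psi> x\<bar> \<le> C * norm ?h" by (rule grad_Lip[OF d gC])
      hence *: "\<bar>g n x\<bar> \<le> C"
        by (simp add: g_def abs_mult norm_axis_1 pos_le_divide_eq del: of_nat_Suc) (simp add: mult.commute del: of_nat_Suc)?
      show "norm (g n x) \<le> C * indicator (cball 0 (R + 1)) x"
      proof (cases "x \<in> cball 0 (R + 1)")
        case False
        hence "norm x > R + 1" by simp
        moreover have "norm x \<le> norm (x + ?h) + norm ?h"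
          using norm_triangle_ineq4[of "x + ?h" ?h] by (simp only: add_diff_cancel_right')
        ultimately have "norm (x + ?h) > R" "norm x > R" using nh by linarith+
        hence "\<psi> (x + ?h) = 0" "\<psi> x = 0" using C(2)[rule_format, of "x + ?h"] C(2)[rule_format, of x] by auto
        thus ?thesis using C(1) by (simp add: g_def)
      qed (use * in simp)
    qed
  qed (use m in auto)
  moreover have "(LBINT x. g n x) = 0" for n
  proof -
    have i: "integrable lborel \<psi>" by (rule C1c_D(1)[OF assms])
    hence "integrable lborel (\<lambda>x. \<psi> (x + (1 / real (Suc n)) *\<^sub>R ?e))"
      by (subst integral_shift(2)) auto
    thus ?thesis unfolding g_def using i
      by (simp add: integral_shift(1)[of \<psi>])
  qed
  ultimately show ?thesis by (simp add: LIMSEQ_const_iff)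
qed

text \<open>Only the product \<open>w * \<psi>\<close> has to have compact support; its derivative
  has integral zero.\<close>

lemma int_by_parts:
  assumes "C1c \<psi>" "Ck 1 w"
  shows "(LBINT x. w x * pd \<psi> i x) = - (LBINT x. pd w i x * \<psi> x)"
proof -
  have c: "C1c (\<lambda>x. w x * \<psi> x)" using assms by (rule C1c_mult)
  have p: "pd (\<lambda>x. w x * \<psi> x) i x = w x * pd \<psi> i x + pd w i x * \<psi> x" for x
    using assms by (intro pd_mult) (auto simp: C1c_def)
  obtain C R where C: "C \<ge> 0" "\<forall>x. \<bar>\<psi> x\<bar> \<le> C * indicator (cball 0 R) x"
    "\<forall>x. norm (grad \<psi> x) \<le> C * indicator (cball 0 R) x" using C1c_D(6)[OF assms(1)] by blast
  have z: "x \<notin> cball 0 R \<Longrightarrow> \<psi> x = 0 \<and> pd \<psi> i x = 0" for x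
  proof -
    assume x: "x \<notin> cball 0 R"
    hence "\<psi> x = 0" "grad \<psi> x = 0" using C(2,3)[rule_format, of x] by auto
    thus ?thesis by (metis grad_def vec_lambda_beta zero_index)
  qed
  have cw: "continuous_on UNIV w" "continuous_on UNIV (pd w i)" "continuous_on UNIV \<psi>" "continuous_on UNIV (pd \<psi> i)"
    using assms Ck_continuous[of 1 w] C1c_D(4)[OF assms(1)] Ck_continuous[of 0 "pd w i"] by (auto simp: C1c_def)
  have "integrable lborel (\<lambda>x. w x * pd \<psi> i x)" "integrable lborel (\<lambda>x. pd w i x * \<psi> x)"
    using cont_supp_bounded[of "\<lambda>x. w x * pd \<psi> i x" R] cont_supp_bounded[of "\<lambda>x. pd w i x * \<psi> x" R]
      cw z bounded_supp_int(1)[OF cont_meas, of "\<lambda>x. w x * pd \<psi> i x"]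
      bounded_supp_int(1)[OF cont_meas, of "\<lambda>x. pd w i x * \<psi> x"]
    by (auto simp: continuous_on_mult)
  thus ?thesis using integral_pd_zero[OF c, of i] unfolding p by simp
qed

text \<open>A normalised bump. The centre is arbitrary because near the boundary of a domain
  mollification uses kernels that shift mass inwards.\<close>

lemma kernel_exists:
  assumes "r > 0"
  shows "\<exists>k. test_fun UNIV k \<and> (\<forall>x. 0 \<le> k x) \<and> (LBINT x. k x) = 1 \<and> (\<forall>x. x \<notin> cball a r \<longrightarrow> k x = 0)"
proof -
  let ?I = "\<integral>x. bump a r x \<partial>lborel"
  have i: "integrable lborel (bump a r)" using C1c_D(1) test_fun_C1c test_fun_bump assms by blast
  have "?I \<noteq> 0"
  proof
    assume "?I = 0"
    hence "AE x in lborel. bump a r x = 0"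
      using integral_nonneg_eq_0_iff_AE[OF i] bump_nonneg(1) by auto
    hence "AE x in lborel. x \<notin> ball a r"
      by eventually_elim (use bump_pos[OF assms] in force)
    hence "ball a r \<in> null_sets lborel" by (subst AE_iff_null_sets) auto
    hence "negligible (ball a r)" 
      using negligible_iff_null_sets null_sets_completionI by blast
    thus False using assms open_not_negligible[of "ball a r"] by auto
  qed
  moreover have "?I \<ge> 0" using bump_nonneg(1) by (intro Bochner_Integration.integral_nonneg) auto
  ultimately have I: "?I > 0" by linarith
  have "test_fun UNIV (\<lambda>x. inverse ?I * bump a r x)"
    by (intro test_fun_mult test_fun_bump assms smooth_const)
  moreover have "bump a r x = 0" if "x \<notin> cball a r" for x using that bump_nonneg(2)[OF assms] by auto
  ultimately show ?thesis using I bump_nonneg(1)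
    by (intro exI[of _ "\<lambda>x. inverse ?I * bump a r x"]) auto
qed

section \<open>Convolution\<close>

declare Ck.simps [simp del]

lemma null_comparison_nonneg:
  fixes a b :: "nat \<Rightarrow> real"
  assumes "b \<longlonglongrightarrow> 0" "\<And>n. 0 \<le> a n" "\<And>n. a n \<le> b n"
  shows "a \<longlonglongrightarrow> 0"
  by (rule null_comparison[OF assms(1)]) (use assms in auto)

lemma sq_shift:
  fixes v :: "R3 \<Rightarrow> 'b::euclidean_space"
  assumes "sq v"
  shows "sq (\<lambda>x. v (x + z))" "nsq (\<lambda>x. v (x + z)) = nsq v"
proof -
  have m: "(\<lambda>x. (norm (v x))\<^sup>2) \<in> mble" using assms by (auto simp: sq_def)
  have [measurable]: "v \<in> borel_measurable borel" using assms by (simp add: sq_def)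
  have "(\<lambda>x. v (x + z)) \<in> mble" by measurable
  thus "sq (\<lambda>x. v (x + z))" "nsq (\<lambda>x. v (x + z)) = nsq v"
    using integral_shift[OF m, of z] assms by (auto simp: sq_def nsq_def)
qed

lemma sq_reflect:
  fixes v :: "R3 \<Rightarrow> 'b::euclidean_space"
  assumes "sq v"
  shows "sq (\<lambda>x. v (z - x))" "nsq (\<lambda>x. v (z - x)) = nsq v"
proof -
  have m: "(\<lambda>x. (norm (v x))\<^sup>2) \<in> mble" using assms by (auto simp: sq_def)
  have [measurable]: "v \<in> borel_measurable borel" using assms by (simp add: sq_def)
  have "(\<lambda>x. v (z - x)) \<in> mble" by measurable
  thus "sq (\<lambda>x. v (z - x))" "nsq (\<lambda>x. v (z - x)) = nsq v"
    using integral_reflect[OF m, of z] assms by (auto simp: sq_def nsq_def)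
qed

lemma sq_indicator:
  assumes "A \<in> sets borel" "sq v"
  shows "sq (\<lambda>x. indicator A x *\<^sub>R v x)" "nsq (\<lambda>x. indicator A x *\<^sub>R v x) \<le> nsq v"
proof -
  have [measurable]: "v \<in> mble" "A \<in> sets lborel" using assms by (auto simp: sq_def)
  have m: "(\<lambda>x. indicator A x *\<^sub>R v x) \<in> mble" by measurable
  show "sq (\<lambda>x. indicator A x *\<^sub>R v x)" "nsq (\<lambda>x. indicator A x *\<^sub>R v x) \<le> nsq v"
    by (rule sq_bound[OF assms(2) m]; auto simp: indicator_def)+
qed

lemma sq_indicator_const:
  fixes c :: "'b::euclidean_space"
  assumes "A \<in> sets borel" "emeasure lborel A < \<infinity>"
  shows "sq (\<lambda>x. indicator A x *\<^sub>R c)" "nsq (\<lambda>x. indicator A x *\<^sub>R c) = (norm c)\<^sup>2 * measure lborel A"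
proof -
  have e: "(norm (indicator A x *\<^sub>R c))\<^sup>2 = (norm c)\<^sup>2 * indicator A x" for x
    by (auto simp: indicator_def)
  have [measurable]: "A \<in> sets lborel" using assms by simp
  have "(\<lambda>x. indicator A x *\<^sub>R c) \<in> mble" by measurable
  thus "sq (\<lambda>x. indicator A x *\<^sub>R c)" "nsq (\<lambda>x. indicator A x *\<^sub>R c) = (norm c)\<^sup>2 * measure lborel A"
    unfolding sq_def nsq_def e using assms by auto
qed

text \<open>Continuity of translations in L^2, phrased with sequences because dominated convergence
  is about sequences.\<close>

definition transl_cont :: "(R3 \<Rightarrow> 'b::euclidean_space) \<Rightarrow> bool" where
  "transl_cont v \<longleftrightarrow> sq v \<and> (\<forall>z. z \<longlonglongrightarrow> 0 \<longrightarrow> (\<lambda>n. nsq (\<lambda>x. v (x + z n) - v x)) \<longlonglongrightarrow> 0)"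

text \<open>Translation is an isometry of L^2, so the error of the approximant enters twice and
  unchanged.\<close>

lemma transl_cont_limit:
  fixes v :: "R3 \<Rightarrow> 'b::euclidean_space"
  assumes v: "sq v" and ap: "\<And>e. e > 0 \<Longrightarrow> \<exists>w. transl_cont w \<and> nsq (\<lambda>x. v x - w x) < e"
  shows "transl_cont v"
  unfolding transl_cont_def
proof (intro conjI allI impI v)
  fix z :: "nat \<Rightarrow> R3" assume z: "z \<longlonglongrightarrow> 0"
  show "(\<lambda>n. nsq (\<lambda>x. v (x + z n) - v x)) \<longlonglongrightarrow> 0"
  proof (rule null_seqI)
    fix e :: real assume e: "e > 0"
    obtain w where w: "transl_cont w" "nsq (\<lambda>x. v x - w x) < e / 16" using ap[of "e/16"] e by auto
    have sw: "sq w" using w by (simp add: transl_cont_def)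
    have "(\<lambda>n. nsq (\<lambda>x. w (x + z n) - w x)) \<longlonglongrightarrow> 0" using w z by (auto simp: transl_cont_def)
    then obtain N where N: "\<forall>n\<ge>N. nsq (\<lambda>x. w (x + z n) - w x) < e / 16"
      using order_tendstoD(2)[of _ 0 sequentially "e/16"] e by (auto simp: eventually_sequentially)
    have "nsq (\<lambda>x. v (x + z n) - v x) \<le> e" if "n \<ge> N" for n
    proof -
      have 1: "nsq (\<lambda>x. v (x + z n) - w (x + z n)) = nsq (\<lambda>x. v x - w x)"
        using sq_shift(2)[OF sq_diff(1)[OF v sw], of "z n"] by simp
      have 2: "nsq (\<lambda>x. v (x + z n) - v x) \<le> 2 * nsq (\<lambda>x. v (x + z n) - w (x + z n)) + 2 * nsq (\<lambda>x. w (x + z n) - v x)"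
        by (intro nsq_triangle sq_shift v sw)
      have 3: "nsq (\<lambda>x. w (x + z n) - v x) \<le> 2 * nsq (\<lambda>x. w (x + z n) - w x) + 2 * nsq (\<lambda>x. w x - v x)"
        by (intro nsq_triangle sq_shift v sw)
      show ?thesis using 1 2 3 N[rule_format, OF that] w(2) e nsq_commute[of w v] by linarith
    qed
    thus "\<exists>N. \<forall>n\<ge>N. nsq (\<lambda>x. v (x + z n) - v x) \<le> e" by blast
  qed simp
qed

lemma transl_cont_add:
  fixes u v :: "R3 \<Rightarrow> 'b::euclidean_space"
  assumes "transl_cont u" "transl_cont v"
  shows "transl_cont (\<lambda>x. u x + v x)"
  unfolding transl_cont_def
proof (intro conjI allI impI)
  have s: "sq u" "sq v" using assms by (auto simp: transl_cont_def)
  thus "sq (\<lambda>x. u x + v x)" by (rule sq_add)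
  fix z :: "nat \<Rightarrow> R3" assume z: "z \<longlonglongrightarrow> 0"
  have "(\<lambda>n. 2 * nsq (\<lambda>x. u (x + z n) - u x) + 2 * nsq (\<lambda>x. v (x + z n) - v x)) \<longlonglongrightarrow> 2 * 0 + 2 * 0"
    using assms z by (intro tendsto_intros) (auto simp: transl_cont_def)
  hence "(\<lambda>n. 2 * nsq (\<lambda>x. u (x + z n) - u x) + 2 * nsq (\<lambda>x. v (x + z n) - v x)) \<longlonglongrightarrow> 0"
    by (simp only: mult_zero_right add_0)
  moreover have "nsq (\<lambda>x. u (x + z n) + v (x + z n) - (u x + v x))
     \<le> 2 * nsq (\<lambda>x. u (x + z n) - u x) + 2 * nsq (\<lambda>x. v (x + z n) - v x)" for n
  proof -
    have e: "(\<lambda>x. u (x + z n) + v (x + z n) - (u x + v x)) = (\<lambda>x. (u (x + z n) - u x) + (v (x + z n) - v x))"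
      by (rule ext) (rule add_diff_add)
    show ?thesis unfolding e by (rule sq_add(2); intro sq_diff sq_shift s)
  qed
  ultimately show "(\<lambda>n. nsq (\<lambda>x. u (x + z n) + v (x + z n) - (u x + v x))) \<longlonglongrightarrow> 0"
    by (rule null_comparison_nonneg[OF _ nsq_nonneg])
qed

text \<open>After expanding the square only the inner product of the translate with the function has
  to converge. Its integrand vanishes off \<open>U\<close>, and at a point of the open set
  \<open>U\<close> it is eventually constant in \<open>n\<close>, so the size of the boundary does
  not matter.\<close>

lemma transl_cont_open:
  fixes c :: "'b::euclidean_space"
  assumes U: "open U" "emeasure lborel U < \<infinity>"
  shows "transl_cont (\<lambda>x. indicator U x *\<^sub>R c)"
  unfolding transl_cont_def
proof (intro conjI allI impI)
  have Us: "U \<in> sets borel" using U by simp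
  show s: "sq (\<lambda>x. indicator U x *\<^sub>R c)" using sq_indicator_const[OF Us U(2)] by blast
  fix z :: "nat \<Rightarrow> R3" assume z: "z \<longlonglongrightarrow> 0"
  let ?v = "\<lambda>x. indicator U x *\<^sub>R c"
  have "(\<lambda>n. LBINT x. ?v (x + z n) \<bullet> ?v x) \<longlonglongrightarrow> (LBINT x. ?v x \<bullet> ?v x)"
  proof (rule Bochner_Integration.integral_dominated_convergence[where w="\<lambda>x. norm (?v x) * norm (?v x)"])
    show "(\<lambda>x. ?v x \<bullet> ?v x) \<in> mble" using sq_inner_int[OF s s] by auto
    show "(\<lambda>x. ?v (x + z n) \<bullet> ?v x) \<in> mble" for n
      using sq_inner_int[OF sq_shift(1)[OF s, of "z n"] s] by auto
    show "integrable lborel (\<lambda>x. norm (?v x) * norm (?v x))" by (rule sq_norm_mult_int[OF s s])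
    show "AE x in lborel. (\<lambda>n. ?v (x + z n) \<bullet> ?v x) \<longlonglongrightarrow> ?v x \<bullet> ?v x"
    proof (rule AE_I2)
      fix x
      show "(\<lambda>n. ?v (x + z n) \<bullet> ?v x) \<longlonglongrightarrow> ?v x \<bullet> ?v x"
      proof (cases "x \<in> U")
        case True
        have "(\<lambda>n. x + z n) \<longlonglongrightarrow> x + 0" by (intro tendsto_intros z)
        hence "\<forall>\<^sub>F n in sequentially. x + z n \<in> U"
          using topological_tendstoD[of _ x sequentially U] U True by simp
        hence "\<forall>\<^sub>F n in sequentially. ?v (x + z n) \<bullet> ?v x = ?v x \<bullet> ?v x"
          by eventually_elim (simp add: True)
        thus ?thesis by (rule tendsto_eventually)
      qed simp
    qed
    show "AE x in lborel. norm (?v (x + z n) \<bullet> ?v x) \<le> norm (?v x) * norm (?v x)" for n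
      by (rule AE_I2) (auto simp: indicator_def power2_norm_eq_inner simp flip: power2_eq_square)
  qed
  moreover have "nsq (\<lambda>x. ?v (x + z n) - ?v x) = 2 * nsq ?v - 2 * (LBINT x. ?v (x + z n) \<bullet> ?v x)" for n
    using nsq_diff_expand[OF sq_shift(1)[OF s, of "z n"] s] sq_shift(2)[OF s, of "z n"] by simp
  moreover have "(LBINT x. ?v x \<bullet> ?v x) = nsq ?v" by (simp only: nsq_def power2_norm_eq_inner)
  ultimately have "(\<lambda>n. nsq (\<lambda>x. ?v (x + z n) - ?v x)) \<longlonglongrightarrow> 2 * nsq ?v - 2 * nsq ?v"
    by (simp only:) (intro tendsto_intros)
  thus "(\<lambda>n. nsq (\<lambda>x. ?v (x + z n) - ?v x)) \<longlonglongrightarrow> 0" by simp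
qed

text \<open>Outer regularity replaces the set by an open one at a small cost in measure.\<close>

lemma transl_cont_indicator:
  fixes c :: "'b::euclidean_space"
  assumes A: "A \<in> sets borel" "emeasure lborel A < \<infinity>"
  shows "transl_cont (\<lambda>x. indicator A x *\<^sub>R c)"
proof (rule transl_cont_limit)
  show "sq (\<lambda>x. indicator A x *\<^sub>R c)" using sq_indicator_const[OF A] by blast
  fix e :: real assume e: "e > 0"
  \<comment> \<open>The summand 1 covers the case \<open>c = 0\<close>.\<close>
  define d where "d = e / ((norm c)\<^sup>2 + 1)"
  have p: "(norm c)\<^sup>2 + 1 > 0" by (simp add: add_nonneg_pos)
  hence d: "d > 0" using e by (simp add: d_def)
  obtain U where U: "open U" "A \<subseteq> U" "emeasure lborel (U - A) < d"
    using outer_regular_lborel[OF A(1) d] by blast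
  have f: "emeasure lborel (U - A) < \<infinity>" using U(3) by (simp add: less_top order_less_trans)
  have "emeasure lborel U \<le> emeasure lborel A + emeasure lborel (U - A)"
    using emeasure_subadditive[of A lborel "U - A"] A U by (simp add: Un_absorb1)
  hence fU: "emeasure lborel U < \<infinity>" using f A(2) 
    by (metis ennreal_add_eq_top infinity_ennreal_def less_top top.not_eq_extremum top_unique order_le_less_trans)
  have "(\<lambda>x. indicator A x *\<^sub>R c - indicator U x *\<^sub>R c) = (\<lambda>x. indicator (U - A) x *\<^sub>R (- c))"
    using U(2) by (auto simp: indicator_def fun_eq_iff)
  hence "nsq (\<lambda>x. indicator A x *\<^sub>R c - indicator U x *\<^sub>R c) = (norm c)\<^sup>2 * measure lborel (U - A)"
    using sq_indicator_const(2)[of "U - A" "- c"] U A f by simp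
  also have "\<dots> \<le> (norm c)\<^sup>2 * d"
  proof (intro mult_left_mono)
    show "measure lborel (U - A) \<le> d" using U(3) f d
      by (simp add: measure_def enn2real_leI less_imp_le)
  qed auto
  also have "\<dots> < e" using e p by (simp add: d_def field_simps)
  finally show "\<exists>w. transl_cont w \<and> nsq (\<lambda>x. indicator A x *\<^sub>R c - w x) < e"
    using transl_cont_open[OF U(1) fU] by blast
qed

lemma transl_cont_all:
  fixes v :: "R3 \<Rightarrow> 'b::euclidean_space"
  assumes v: "sq v"
  shows "transl_cont v"
proof (rule transl_cont_limit[OF v])
  fix e :: real assume e: "e > 0"
  obtain F where F: "\<And>i. simple_function lborel (F i)" "\<And>x. (\<lambda>i. F i x) \<longlonglongrightarrow> v x"
    "\<And>i x. dist (F i x) 0 \<le> 2 * dist (v x) 0"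
    using borel_measurable_implies_sequence_metric[OF sq_meas[OF v], of 0] by auto
  have Fm: "F i \<in> mble" for i using F(1) by (rule borel_measurable_simple_function)
  have n: "sq (\<lambda>x. 2 * norm (v x))" using sq_cmult(1)[of "\<lambda>x. norm (v x)" 2] v by (auto simp: sq_def)
  have conv: "(\<lambda>n. nsq (\<lambda>x. F n x - v x)) \<longlonglongrightarrow> 0" and sF: "\<And>n. sq (F n)"
    using sq_dominated[of F v, OF Fm sq_meas[OF v] _ n] F(2,3) by auto
  obtain n where n: "nsq (\<lambda>x. v x - F n x) < e"
    using order_tendstoD(2)[OF conv e] nsq_commute[of v] by (auto simp: eventually_sequentially)
  have fin: "finite (range (F n))" using F(1)[of n] by (simp add: simple_function_def)
  have fib: "F n -` {y} \<in> sets borel" for y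
  proof (cases "y \<in> range (F n)")
    case True thus ?thesis using F(1)[of n] by (auto simp: simple_function_def)
  next
    case False
    hence "F n -` {y} = {}" by auto
    thus ?thesis by simp
  qed
  have rep: "F n x = (\<Sum>y\<in>range (F n). indicator (F n -` {y}) x *\<^sub>R y)" for x
  proof -
    have "(\<Sum>y\<in>range (F n). indicator (F n -` {y}) x *\<^sub>R y) = (\<Sum>y\<in>range (F n). if y = F n x then y else 0)"
      by (rule sum.cong) (auto simp: indicator_def)
    thus ?thesis using fin by simp
  qed
  have zero: "transl_cont (\<lambda>x. 0 :: 'b)" by (simp add: transl_cont_def)
  \<comment> \<open>The level set of the value 0 may have infinite measure, but its term is zero;
    the other level sets have finite measure because \<open>F n\<close> is in L^2.\<close>
  have one: "transl_cont (\<lambda>x. indicator (F n -` {y}) x *\<^sub>R y)" for y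
  proof (cases "y = 0")
    case False
    have "emeasure lborel (F n -` {y}) < \<infinity>"
    proof -
      have "integrable lborel (\<lambda>x. (norm y)\<^sup>2 * indicator (F n -` {y}) x)"
      proof (rule Bochner_Integration.integrable_bound[OF sq_int[OF sF[of n]]])
        have [measurable]: "F n -` {y} \<in> sets lborel" using fib by simp
        show "(\<lambda>x. (norm y)\<^sup>2 * indicator (F n -` {y}) x) \<in> mble"
          by (intro borel_measurable_times borel_measurable_const borel_measurable_indicator) fact
      qed (auto simp: indicator_def)
      hence "integrable lborel (\<lambda>x. indicator (F n -` {y}) x :: real)" using False by simp
      thus ?thesis using fib by (simp add: integrable_indicator_iff)
    qed
    thus ?thesis using fib by (intro transl_cont_indicator) auto
  qed (use zero in simp)
  have "transl_cont (\<lambda>x. \<Sum>y\<in>S. indicator (F n -` {y}) x *\<^sub>R y)" if "finite S" for S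
    using that
  proof (induction S rule: finite_induct)
    case (insert y S)
    hence "(\<lambda>x. \<Sum>y\<in>insert y S. indicator (F n -` {y}) x *\<^sub>R y)
      = (\<lambda>x. indicator (F n -` {y}) x *\<^sub>R y + (\<Sum>y\<in>S. indicator (F n -` {y}) x *\<^sub>R y))"
      by (simp only: sum.insert[OF insert(1,2)])
    thus ?case using transl_cont_add[OF one insert.IH] by (simp only:)
  qed (use zero in simp)
  from this[OF fin] have "transl_cont (F n)" by (simp flip: rep)
  with n show "\<exists>w. transl_cont w \<and> nsq (\<lambda>x. v x - w x) < e" by blast
qed

lemma transl_continuity:
  fixes v :: "R3 \<Rightarrow> 'b::euclidean_space"
  assumes "sq v" "e > 0"
  shows "\<exists>d>0. \<forall>z. norm z < d \<longrightarrow> nsq (\<lambda>x. v (x + z) - v x) < e"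
proof (rule ccontr)
  assume "\<not> ?thesis"
  hence "\<exists>z. norm z < 1 / real (Suc n) \<and> nsq (\<lambda>x. v (x + z) - v x) \<ge> e" for n
    by (metis divide_pos_pos not_less of_nat_0_less_iff zero_less_Suc zero_less_one)
  then obtain z where z: "\<And>n. norm (z n) < 1 / real (Suc n)" "\<And>n. nsq (\<lambda>x. v (x + z n) - v x) \<ge> e"
    by metis
  have "z \<longlonglongrightarrow> 0"
    by (rule Lim_null_comparison[OF _ LIMSEQ_inverse_real_of_nat])
       (use z(1) in \<open>auto simp: inverse_eq_divide intro!: always_eventually less_imp_le\<close>)
  hence "(\<lambda>n. nsq (\<lambda>x. v (x + z n) - v x)) \<longlonglongrightarrow> 0"
    using transl_cont_all[OF assms(1)] by (auto simp: transl_cont_def)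
  from order_tendstoD(2)[OF this assms(2)] z(2) show False
    by (auto simp: eventually_sequentially not_less[symmetric])
qed

text \<open>Vector values allow a function, its gradient and the pair of both to be mollified by the
  same results.\<close>

definition conv :: "(R3 \<Rightarrow> real) \<Rightarrow> (R3 \<Rightarrow> 'b::euclidean_space) \<Rightarrow> R3 \<Rightarrow> 'b" where
  "conv k v x = (LBINT y. k (x - y) *\<^sub>R v y)"

lemma conv_int:
  assumes "sq k" "sq v"
  shows "integrable lborel (\<lambda>y. k (x - y) *\<^sub>R v y)"
proof (rule Bochner_Integration.integrable_bound[OF sq_norm_mult_int[OF sq_reflect(1)[OF assms(1), of x] assms(2)]])
  show "(\<lambda>y. k (x - y) *\<^sub>R v y) \<in> mble"
    using sq_meas[OF sq_reflect(1)[OF assms(1), of x]] sq_meas[OF assms(2)] by measurable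
qed auto

lemma conv_alt:
  assumes "sq k" "sq v"
  shows "conv k v x = (LBINT z. k z *\<^sub>R v (x - z))"
    "integrable lborel (\<lambda>z. k z *\<^sub>R v (x - z))"
  using integral_reflect[OF borel_measurable_integrable[OF conv_int[OF assms, of x]], of x] conv_int[OF assms, of x]
  by (auto simp: conv_def)

lemma conv_meas:
  assumes "sq k" "sq v"
  shows "conv k v \<in> mble"
proof -
  have [measurable]: "k \<in> borel_measurable borel" "v \<in> borel_measurable borel"
    using assms by (auto simp: sq_def)
  show ?thesis unfolding conv_def by measurable
qed

text \<open>The error is an average of translation errors: write \<open>k\<close> as
  \<open>sqrt k * sqrt k\<close>, apply Cauchy-Schwarz in \<open>z\<close> and exchange the
  integrals. Only translations by points where \<open>k\<close> is nonzero count, hence the form of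
  the hypothesis on \<open>S\<close>.\<close>

lemma conv_L2:
  fixes v :: "R3 \<Rightarrow> 'b::euclidean_space"
  assumes k: "sq k" "integrable lborel k" "\<And>x. k x \<ge> 0" "(LBINT x. k x) = 1"
    and v: "sq v" and S: "\<And>z. k z \<noteq> 0 \<Longrightarrow> nsq (\<lambda>x. v (x - z) - v x) \<le> S"
  shows "sq (conv k v)" "nsq (\<lambda>x. conv k v x - v x) \<le> S"
proof -
  have [measurable]: "k \<in> borel_measurable borel" "v \<in> borel_measurable borel"
    using k v by (auto simp: sq_def)
  have [measurable]: "conv k v \<in> borel_measurable borel" using conv_meas[OF k(1) v] by simp
  have S0: "S \<ge> 0"
  proof -
    obtain z where "k z \<noteq> 0" using k(4) by (metis Bochner_Integration.integral_zero zero_neq_one ext)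
    from S[OF this] show ?thesis using nsq_nonneg[of "\<lambda>x. v (x - z) - v x"] by linarith
  qed
  have pt: "(ennreal (norm (conv k v x - v x)))\<^sup>2 \<le> (\<integral>\<^sup>+z. ennreal (k z) * (ennreal (norm (v (x - z) - v x)))\<^sup>2 \<partial>lborel)" for x
  proof -
    have i1: "integrable lborel (\<lambda>z. k z *\<^sub>R v (x - z))" by (rule conv_alt[OF k(1) v])
    have i2: "integrable lborel (\<lambda>z. k z *\<^sub>R v x)" using k(2) by simp
    have e: "conv k v x - v x = (LBINT z. k z *\<^sub>R (v (x - z) - v x))"
      using i1 i2 k(4) conv_alt(1)[OF k(1) v, of x] k(2)
      by (simp add: scaleR_diff_right)
    have i3: "integrable lborel (\<lambda>z. k z *\<^sub>R (v (x - z) - v x))"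
      using Bochner_Integration.integrable_diff[OF i1 i2] by (simp add: scaleR_diff_right)
    have "ennreal (norm (conv k v x - v x)) \<le> (\<integral>\<^sup>+z. ennreal (norm (k z *\<^sub>R (v (x - z) - v x))) \<partial>lborel)"
      unfolding e by (rule integral_norm_bound_ennreal[OF i3])
    also have "\<dots> = (\<integral>\<^sup>+z. ennreal (sqrt (k z)) * ennreal (sqrt (k z) * norm (v (x - z) - v x)) \<partial>lborel)"
      using k(3) by (intro nn_integral_cong) (simp flip: ennreal_mult mult.assoc)
    finally have "(ennreal (norm (conv k v x - v x)))\<^sup>2
      \<le> (\<integral>\<^sup>+z. ennreal (sqrt (k z)) * ennreal (sqrt (k z) * norm (v (x - z) - v x)) \<partial>lborel)\<^sup>2"
      by (intro power_mono) auto
    also have "\<dots> \<le> (\<integral>\<^sup>+z. (ennreal (sqrt (k z)))\<^sup>2 \<partial>lborel) * (\<integral>\<^sup>+z. (ennreal (sqrt (k z) * norm (v (x - z) - v x)))\<^sup>2 \<partial>lborel)"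
      by (rule Cauchy_Schwarz_nn_integral) auto
    also have "(\<integral>\<^sup>+z. (ennreal (sqrt (k z)))\<^sup>2 \<partial>lborel) = (\<integral>\<^sup>+z. ennreal (k z) \<partial>lborel)"
      using k(3) by (intro nn_integral_cong) (simp add: ennreal_power)
    also have "\<dots> = 1" using k by (simp add: nn_integral_eq_integral)
    also have "(\<integral>\<^sup>+z. (ennreal (sqrt (k z) * norm (v (x - z) - v x)))\<^sup>2 \<partial>lborel)
        = (\<integral>\<^sup>+z. ennreal (k z) * (ennreal (norm (v (x - z) - v x)))\<^sup>2 \<partial>lborel)"
      using k(3) by (intro nn_integral_cong) (simp add: ennreal_power power_mult_distrib ennreal_mult)
    finally show ?thesis by simp
  qed
  have "(\<integral>\<^sup>+x. (ennreal (norm (conv k v x - v x)))\<^sup>2 \<partial>lborel)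
      \<le> (\<integral>\<^sup>+x. (\<integral>\<^sup>+z. ennreal (k z) * (ennreal (norm (v (x - z) - v x)))\<^sup>2 \<partial>lborel) \<partial>lborel)"
    by (intro nn_integral_mono pt)
  also have "\<dots> = (\<integral>\<^sup>+z. (\<integral>\<^sup>+x. ennreal (k z) * (ennreal (norm (v (x - z) - v x)))\<^sup>2 \<partial>lborel) \<partial>lborel)"
    by (rule lborel_pair.Fubini'[symmetric]) measurable
  also have "\<dots> \<le> (\<integral>\<^sup>+z. ennreal (k z) * ennreal S \<partial>lborel)"
  proof (rule nn_integral_mono)
    fix z
    have s: "sq (\<lambda>x. v (x - z) - v x)" using sq_diff(1)[OF sq_shift(1)[OF v, of "-z"] v] by simp
    have "(\<integral>\<^sup>+x. ennreal (k z) * (ennreal (norm (v (x - z) - v x)))\<^sup>2 \<partial>lborel)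
       = ennreal (k z) * (\<integral>\<^sup>+x. ennreal ((norm (v (x - z) - v x))\<^sup>2) \<partial>lborel)"
      by (subst nn_integral_cmult) (auto simp: ennreal_power)
    also have "(\<integral>\<^sup>+x. ennreal ((norm (v (x - z) - v x))\<^sup>2) \<partial>lborel) = ennreal (nsq (\<lambda>x. v (x - z) - v x))"
      unfolding nsq_def using sq_int[OF s] by (intro nn_integral_eq_integral) auto
    also have "ennreal (k z) * \<dots> \<le> ennreal (k z) * ennreal S"
      using S[of z] by (cases "k z = 0") (auto intro!: mult_left_mono ennreal_leI)
    finally show "(\<integral>\<^sup>+x. ennreal (k z) * (ennreal (norm (v (x - z) - v x)))\<^sup>2 \<partial>lborel) \<le> ennreal (k z) * ennreal S" .
  qed
  also have "\<dots> = ennreal S" using k by (simp add: nn_integral_multc nn_integral_eq_integral)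
  finally have fin: "(\<integral>\<^sup>+x. ennreal ((norm (conv k v x - v x))\<^sup>2) \<partial>lborel) \<le> ennreal S"
    by (simp add: ennreal_power)
  have "integrable lborel (\<lambda>x. (norm (conv k v x - v x))\<^sup>2)"
    using fin by (intro integrableI_nonneg) (auto intro: le_less_trans)
  hence d: "sq (\<lambda>x. conv k v x - v x)" by (simp add: sq_def)
  thus "sq (conv k v)" using sq_add(1)[OF d v] by simp
  show "nsq (\<lambda>x. conv k v x - v x) \<le> S"
    using fin sq_int[OF d] S0 by (simp add: nn_integral_eq_integral nsq_def)
qed

lemma C1c_uniform_cont:
  assumes k: "C1c k" and e: "e > 0"
  shows "\<exists>d>0. \<forall>x y. dist x y < d \<longrightarrow> norm (grad k x - grad k y) \<le> e"
proof -
  obtain C R where C: "\<forall>x. norm (grad k x) \<le> C * indicator (cball 0 R) x" using C1c_D(6)[OF k] by blast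
  have z: "grad k x = 0" if "x \<notin> cball 0 R" for x using C[rule_format, of x] that by simp
  have "uniformly_continuous_on (cball 0 (R + 2)) (grad k)"
    using C1c_D(5)[OF k] by (intro compact_uniformly_continuous) (auto intro: continuous_on_subset)
  then obtain d where d: "d > 0"
    "\<And>x y. x \<in> cball 0 (R + 2) \<Longrightarrow> y \<in> cball 0 (R + 2) \<Longrightarrow> dist y x < d \<Longrightarrow> dist (grad k y) (grad k x) < e"
    using e unfolding uniformly_continuous_on_def by metis
  have "norm (grad k x - grad k y) \<le> e" if xy: "dist x y < min d 1" for x y
  proof (cases "x \<in> cball 0 (R + 1)")
    case True
    hence "y \<in> cball 0 (R + 2)" "x \<in> cball 0 (R + 2)"
      using xy norm_triangle_ineq4[of x "x - y"] by (auto simp: dist_norm)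
    thus ?thesis using d(2)[of y x] xy by (simp add: dist_norm less_imp_le)
  next
    case False
    hence "x \<notin> cball 0 R" "y \<notin> cball 0 R"
      using xy norm_triangle_ineq[of y "x - y"] by (auto simp: dist_norm)
    thus ?thesis using z e by simp
  qed
  thus ?thesis using d(1) by (intro exI[of _ "min d 1"]) auto
qed

text \<open>Uniform continuity of the compactly supported gradient makes the first order expansion
  uniform in \<open>x\<close>; this is what differentiates a convolution.\<close>

lemma C1c_uniform_diff:
  assumes k: "C1c k" and e: "e > 0"
  shows "\<exists>d>0. \<forall>x h. norm h < d \<longrightarrow> \<bar>k (x + h) - k x - grad k x \<bullet> h\<bar> \<le> e * norm h"
proof -
  obtain d where d: "d > 0" "\<And>x y. dist x y < d \<Longrightarrow> norm (grad k x - grad k y) \<le> e"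
    using C1c_uniform_cont[OF k e] by blast
  have kd: "k differentiable (at x)" for x using k by (simp add: C1c_def Ck.simps)
  have "\<bar>k (x + h) - k x - grad k x \<bullet> h\<bar> \<le> e * norm h" if h: "norm h < d" for x h
  proof -
    have "norm ((k (x + h) - grad k x \<bullet> (x + h)) - (k x - grad k x \<bullet> x)) \<le> e * norm (x + h - x)"
    proof (rule differentiable_bound[of "ball x d" _ "\<lambda>y h. grad k y \<bullet> h - grad k x \<bullet> h"])
      show "((\<lambda>y. k y - grad k x \<bullet> y) has_derivative (\<lambda>h. grad k y \<bullet> h - grad k x \<bullet> h)) (at y within ball x d)" for y
        using has_derivative_grad[OF kd, THEN has_derivative_at_withinI]
        by (intro derivative_intros has_derivative_inner_right) auto
      show "onorm (\<lambda>h. grad k y \<bullet> h - grad k x \<bullet> h) \<le> e" if "y \<in> ball x d" for y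
      proof (rule onorm_le)
        fix h
        have "norm (grad k y \<bullet> h - grad k x \<bullet> h) \<le> norm (grad k y - grad k x) * norm h"
          using Cauchy_Schwarz_ineq2[of "grad k y - grad k x" h] by (simp add: inner_diff_left)
        also have "\<dots> \<le> e * norm h" using d(2)[of y x] that by (intro mult_right_mono) (auto simp: dist_commute)
        finally show "norm (grad k y \<bullet> h - grad k x \<bullet> h) \<le> e * norm h" .
      qed
    qed (use h d in \<open>auto simp: dist_norm\<close>)
    thus ?thesis by (simp add: inner_add_right algebra_simps)
  qed
  with d(1) show ?thesis by blast
qed

text \<open>The uniform expansion of \<open>k\<close> is integrated against \<open>v\<close>, which
  therefore has to be in L^1.\<close>

lemma conv_deriv:
  assumes k: "C1c k" and v: "integrable lborel (v :: R3 \<Rightarrow> real)"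
  shows "(conv k v has_derivative (\<lambda>h. (LBINT y. v y *\<^sub>R grad k (x - y)) \<bullet> h)) (at x)"
proof -
  obtain C R where C: "C \<ge> 0" "\<forall>x. \<bar>k x\<bar> \<le> C * indicator (cball 0 R) x"
    "\<forall>x. norm (grad k x) \<le> C * indicator (cball 0 R) x" using C1c_D(6)[OF k] by blast
  have bC: "\<bar>k x\<bar> \<le> C" "norm (grad k x) \<le> C" for x
    using C(1) C(2)[rule_format, of x] C(3)[rule_format, of x] by (cases "x \<in> cball 0 R"; simp)+
  have [measurable]: "k \<in> borel_measurable borel" "grad k \<in> borel_measurable borel" "v \<in> borel_measurable borel"
    using cont_meas C1c_D(4,5)[OF k] v by auto
  have i1: "integrable lborel (\<lambda>y. k (x - y) * v y)" for x
    by (rule Bochner_Integration.integrable_bound[of _ "\<lambda>y. C * v y"])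
       (use v bC C(1) in \<open>auto simp: abs_mult intro!: AE_I2 mult_right_mono\<close>)
  have i2: "integrable lborel (\<lambda>y. v y *\<^sub>R grad k (x - y))" for x
  proof (rule Bochner_Integration.integrable_bound[of _ "\<lambda>y. C * v y"])
    show "AE y in lborel. norm (v y *\<^sub>R grad k (x - y)) \<le> norm (C * v y)"
      using mult_left_mono[OF bC(2) abs_ge_zero] C(1) by (auto simp: abs_mult mult.commute)
  qed (use v in auto)
  show ?thesis unfolding has_derivative_at_alt
  proof (intro conjI allI impI)
    show "bounded_linear (\<lambda>h. (LBINT y. v y *\<^sub>R grad k (x - y)) \<bullet> h)" by (rule bounded_linear_inner_right)
    fix e :: real assume e: "e > 0"
    define I where "I = (LBINT y. \<bar>v y\<bar>)"
    have I: "I \<ge> 0" by (simp add: I_def)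
    obtain d where d: "d > 0" "\<And>x h. norm h < d \<Longrightarrow> \<bar>k (x + h) - k x - grad k x \<bullet> h\<bar> \<le> (e / (I + 1)) * norm h"
      using C1c_uniform_diff[OF k, of "e / (I + 1)"] e I by auto
    have "norm (conv k v y - conv k v x - (LBINT y. v y *\<^sub>R grad k (x - y)) \<bullet> (y - x)) \<le> e * norm (y - x)"
      if y: "norm (y - x) < d" for y
    proof -
      let ?h = "y - x"
      have eq: "conv k v y - conv k v x - (LBINT y. v y *\<^sub>R grad k (x - y)) \<bullet> ?h
          = (LBINT w. (k ((x - w) + ?h) - k (x - w) - grad k (x - w) \<bullet> ?h) * v w)"
      proof -
        have "(LBINT y. v y *\<^sub>R grad k (x - y)) \<bullet> ?h = (LBINT w. v w *\<^sub>R grad k (x - w) \<bullet> ?h)"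
          by (rule integral_inner_left[symmetric]) (use i2[of x] in auto)
        moreover have "integrable lborel (\<lambda>w. v w *\<^sub>R grad k (x - w) \<bullet> ?h)" using i2[of x] by (rule integrable_inner_left[rotated]) 
        moreover have "(k ((x - w) + ?h) - k (x - w) - grad k (x - w) \<bullet> ?h) * v w
            = k (y - w) * v w - k (x - w) * v w - v w *\<^sub>R grad k (x - w) \<bullet> ?h" for w
          by (simp add: algebra_simps)
        ultimately show ?thesis
          using i1[of x] i1[of y] by (simp add: conv_def)
      qed
      have m: "\<bar>k ((x - w) + ?h) - k (x - w) - grad k (x - w) \<bullet> ?h\<bar> \<le> (e / (I + 1)) * norm ?h" for w
        by (rule d(2)[OF y])
      have "norm (LBINT w. (k ((x - w) + ?h) - k (x - w) - grad k (x - w) \<bullet> ?h) * v w)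
          \<le> (LBINT w. (e / (I + 1)) * norm ?h * \<bar>v w\<bar>)"
      proof (rule order_trans[OF integral_norm_bound], rule integral_mono')
        show "integrable lborel (\<lambda>w. (e / (I + 1)) * norm ?h * \<bar>v w\<bar>)" using v by simp
        show "norm ((k ((x - w) + ?h) - k (x - w) - grad k (x - w) \<bullet> ?h) * v w)
            \<le> (e / (I + 1)) * norm ?h * \<bar>v w\<bar>" for w
          unfolding real_norm_def abs_mult by (rule mult_right_mono[OF m abs_ge_zero])
        show "0 \<le> (e / (I + 1)) * norm ?h * \<bar>v w\<bar>" for w using e I by simp
      qed
      also have "\<dots> = (e / (I + 1)) * norm ?h * I" by (simp add: I_def)
      also have "\<dots> \<le> e * norm ?h"
      proof -
        have "e / (I + 1) * I \<le> e" using e I by (simp add: field_simps)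
        thus ?thesis using mult_right_mono[of "e / (I + 1) * I" e "norm ?h"] by (simp add: mult_ac)
      qed
      finally show ?thesis unfolding eq .
    qed
    with d(1) show "\<exists>d>0. \<forall>y. norm (y - x) < d \<longrightarrow>
       norm (conv k v y - conv k v x - (LBINT y. v y *\<^sub>R grad k (x - y)) \<bullet> (y - x)) \<le> e * norm (y - x)" by blast
  qed
qed

lemma conv_pd:
  assumes k: "C1c k" and v: "integrable lborel (v :: R3 \<Rightarrow> real)"
  shows "pd (conv k v) i x = conv (pd k i) v x"
proof -
  obtain C R where C: "C \<ge> 0" "\<forall>x. norm (grad k x) \<le> C * indicator (cball 0 R) x" using C1c_D(6)[OF k] by blast
  have bC: "norm (grad k x) \<le> C" for x
    using C(1) C(2)[rule_format, of x] by (cases "x \<in> cball 0 R"; simp)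
  have [measurable]: "grad k \<in> borel_measurable borel" "v \<in> borel_measurable borel"
    using cont_meas C1c_D(5)[OF k] v by auto
  have i2: "integrable lborel (\<lambda>y. v y *\<^sub>R grad k (x - y))"
  proof (rule Bochner_Integration.integrable_bound[of _ "\<lambda>y. C * v y"])
    show "AE y in lborel. norm (v y *\<^sub>R grad k (x - y)) \<le> norm (C * v y)"
      using mult_left_mono[OF bC abs_ge_zero] C(1) by (auto simp: abs_mult mult.commute)
  qed (use v in auto)
  have "pd (conv k v) i x = (LBINT y. v y *\<^sub>R grad k (x - y)) \<bullet> axis i 1"
    by (rule pd_eqI[OF conv_deriv[OF k v]])
  also have "\<dots> = (LBINT y. v y *\<^sub>R grad k (x - y) \<bullet> axis i 1)" 
    by (rule integral_inner_left[symmetric]) (use i2 in auto)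
  also have "\<dots> = conv (pd k i) v x" by (simp add: conv_def inner_axis grad_def mult.commute)
  finally show ?thesis .
qed

text \<open>All derivatives fall on the kernel, so the induction runs over kernels while
  \<open>v\<close> stays fixed.\<close>

lemma conv_smooth:
  assumes k: "test_fun UNIV k" and v: "integrable lborel (v :: R3 \<Rightarrow> real)"
  shows "smooth (conv k v)"
proof -
  have "Ck m (conv k v)" for m using k
  proof (induction m arbitrary: k)
    case 0
    thus ?case using conv_deriv[OF test_fun_C1c v]
      by (auto simp: Ck.simps continuous_on_eq_continuous_at intro!: has_derivative_continuous)
  next
    case (Suc m)
    have "pd (conv k v) i = conv (pd k i) v" for i using conv_pd[OF test_fun_C1c v] Suc.prems by blast
    moreover have "conv k v differentiable (at x)" for x
      using conv_deriv[OF test_fun_C1c[OF Suc.prems] v] unfolding differentiable_def by blast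
    ultimately show ?case using Suc by (simp add: Ck.simps test_fun_pd)
  qed
  thus ?thesis by (simp add: smooth_def)
qed

lemma conv_supp:
  assumes v: "AE x in lborel. x \<notin> K \<longrightarrow> v x = 0" and k: "\<And>x. x \<notin> D \<Longrightarrow> k x = 0"
    and x: "x \<notin> {p + q |p q. p \<in> K \<and> q \<in> D}"
  shows "conv k v x = 0"
proof -
  have "AE y in lborel. k (x - y) *\<^sub>R v y = 0"
    using v
  proof eventually_elim
    case (elim y)
    show ?case
    proof (cases "y \<in> K")
      case True
      have "x - y \<notin> D"
      proof
        assume "x - y \<in> D"
        hence "\<exists>p q. x = p + q \<and> p \<in> K \<and> q \<in> D" using True by (intro exI[of _ y] exI[of _ "x - y"]) auto
        thus False using x by blast
      qed
      thus ?thesis using k by simp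
    qed (use elim in simp)
  qed
  thus ?thesis unfolding conv_def by (rule integral_eq_zero_AE)
qed

section \<open>Weak gradients and approximation by test functions\<close>

text \<open>The gradient is an explicit argument because \<open>wgrad\<close> is a choice that is
  determined only almost everywhere.\<close>

definition W12 :: "(R3 \<Rightarrow> real) \<Rightarrow> (R3 \<Rightarrow> R3) \<Rightarrow> bool" where
  "W12 u G \<longleftrightarrow> sq u \<and> sq G \<and> is_wgrad u G"

lemma W12D: "W12 u G \<Longrightarrow> sq u" "W12 u G \<Longrightarrow> sq G"
  "W12 u G \<Longrightarrow> test_fun UNIV \<psi> \<Longrightarrow> (LBINT x. u x * pd \<psi> i x) = - (LBINT x. G x $ i * \<psi> x)"
  by (auto simp: W12_def is_wgrad_def)

lemma test_sq: "test_fun U \<psi> \<Longrightarrow> sq \<psi>" "test_fun U \<psi> \<Longrightarrow> sq (pd \<psi> i)" "test_fun U \<psi> \<Longrightarrow> sq (grad \<psi>)"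
  using C1c_D(2)[OF test_fun_C1c] C1c_D(2)[OF test_fun_C1c[OF test_fun_pd]] C1c_D(3)[OF test_fun_C1c] by auto

lemma sq_component:
  fixes G :: "R3 \<Rightarrow> R3"
  assumes "sq G" shows "sq (\<lambda>x. G x $ i)" "nsq (\<lambda>x. G x $ i) \<le> nsq G"
proof -
  have "G \<in> borel_measurable borel" using assms by (simp add: sq_def)
  hence m: "(\<lambda>x. G x $ i) \<in> mble"
    using borel_measurable_continuous_on[OF continuous_on_component[OF continuous_on_id], of G borel i] by simp
  show "sq (\<lambda>x. G x $ i)" "nsq (\<lambda>x. G x $ i) \<le> nsq G"
    by (rule sq_bound[OF assms m]; simp add: component_le_norm_cart)+
qed

lemma W12_zero: "W12 (\<lambda>x. 0) (\<lambda>x. 0)"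
  by (simp add: W12_def is_wgrad_def)

lemma W12_add:
  assumes "W12 u G" "W12 v F"
  shows "W12 (\<lambda>x. u x + v x) (\<lambda>x. G x + F x)"
  unfolding W12_def is_wgrad_def
proof (intro conjI allI impI)
  note s = W12D(1,2)[OF assms(1)] W12D(1,2)[OF assms(2)]
  show "sq (\<lambda>x. u x + v x)" "sq (\<lambda>x. G x + F x)" using s by (auto intro: sq_add)
  fix \<psi> i assume t: "test_fun UNIV \<psi>"
  show "(LBINT x. (u x + v x) * pd \<psi> i x) = - (LBINT x. (G x + F x) $ i * \<psi> x)"
    using W12D(3)[OF assms(1) t, of i] W12D(3)[OF assms(2) t, of i]
      sq_mult_int[OF s(1) test_sq(2)[OF t, of i]] sq_mult_int[OF s(3) test_sq(2)[OF t, of i]]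
      sq_mult_int[OF sq_component(1)[OF s(2), of i] test_sq(1)[OF t]]
      sq_mult_int[OF sq_component(1)[OF s(4), of i] test_sq(1)[OF t]]
    by (simp add: distrib_right)
qed

lemma W12_scale:
  assumes "W12 u G"
  shows "W12 (\<lambda>x. c * u x) (\<lambda>x. c *\<^sub>R G x)"
  unfolding W12_def is_wgrad_def
proof (intro conjI allI impI)
  show "sq (\<lambda>x. c * u x)" "sq (\<lambda>x. c *\<^sub>R G x)"
    using W12D(1,2)[OF assms] by (auto intro: sq_scale sq_cmult)
  fix \<psi> i assume t: "test_fun UNIV \<psi>"
  show "(LBINT x. c * u x * pd \<psi> i x) = - (LBINT x. (c *\<^sub>R G x) $ i * \<psi> x)"
    using W12D(3)[OF assms(1) t, of i] by (simp add: mult.assoc)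
qed

lemma W12_diff:
  assumes "W12 u G" "W12 v F"
  shows "W12 (\<lambda>x. u x - v x) (\<lambda>x. G x - F x)"
  using W12_add[OF assms(1) W12_scale[OF assms(2), of "-1"]] by simp

lemma W12_C1c:
  assumes "C1c w" shows "W12 w (grad w)"
  unfolding W12_def is_wgrad_def
proof (intro conjI allI impI)
  show "sq w" "sq (grad w)" using C1c_D[OF assms] by auto
  fix \<psi> i assume t: "test_fun UNIV \<psi>"
  show "(LBINT x. w x * pd \<psi> i x) = - (LBINT x. grad w x $ i * \<psi> x)"
    using int_by_parts[OF test_fun_C1c[OF t], of w i] assms by (simp add: C1c_def grad_def)
qed

lemma W12_test: "test_fun U w \<Longrightarrow> W12 w (grad w)"
  by (rule W12_C1c[OF test_fun_C1c])

lemma W12_cong_AE: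
  assumes "W12 u G" "AE x in lborel. u x = v x" "AE x in lborel. G x = F x"
    "v \<in> mble" "F \<in> mble"
  shows "W12 v F"
  unfolding W12_def is_wgrad_def
proof (intro conjI allI impI)
  note s = W12D(1,2)[OF assms(1)]
  show v: "sq v" using assms by (intro sq_bound(1)[OF s(1)]) auto
  show F: "sq F" using assms by (intro sq_bound(1)[OF s(2)]) auto
  fix \<psi> i assume t: "test_fun UNIV \<psi>"
  have "(LBINT x. v x * pd \<psi> i x) = (LBINT x. u x * pd \<psi> i x)"
    using sq_mult_int[OF s(1) test_sq(2)[OF t, of i]] sq_mult_int[OF v test_sq(2)[OF t, of i]] assms(2)
    by (intro integral_cong_AE) auto
  also have "\<dots> = - (LBINT x. G x $ i * \<psi> x)" by (rule W12D(3)[OF assms(1) t])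
  also have "(LBINT x. G x $ i * \<psi> x) = (LBINT x. F x $ i * \<psi> x)"
    using sq_mult_int[OF sq_component(1)[OF s(2), of i] test_sq(1)[OF t]]
      sq_mult_int[OF sq_component(1)[OF F, of i] test_sq(1)[OF t]] assms(3)
    by (intro integral_cong_AE) auto
  finally show "(LBINT x. v x * pd \<psi> i x) = - (LBINT x. F x $ i * \<psi> x)" .
qed

lemma test_fun_ball:
  assumes "test_fun U \<psi>"
  obtains R where "\<And>x. x \<notin> ball 0 R \<Longrightarrow> \<psi> x = 0" "\<And>x i. x \<notin> ball 0 R \<Longrightarrow> pd \<psi> i x = 0"
    "\<And>x. x \<notin> ball 0 R \<Longrightarrow> grad \<psi> x = 0"
proof -
  obtain R where R: "\<And>x. x \<notin> cball 0 R \<Longrightarrow> \<psi> x = 0" using test_fun_C1c[OF assms] by (auto simp: C1c_def)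
  have 1: "\<psi> x = 0" if "x \<notin> ball 0 (R + 1)" for x using R that by simp
  have 2: "pd \<psi> i x = 0" if "x \<notin> ball 0 (R + 1)" for x i
    using pd_zero_off[of "cball 0 R" \<psi>] R that by simp
  show thesis by (rule that[of "R + 1"]) (auto simp: 1 2 grad_def vec_eq_iff)
qed

text \<open>Test functions have compact support, so for the functions themselves convergence on
  balls suffices, which is all that compactness provides on the whole space.\<close>

lemma W12_limit_loc:
  assumes W: "\<And>n. W12 (u n) (G n)" and s: "sq u0" "sq G0"
    and lim: "\<And>R. (\<lambda>n. nsq_on R (\<lambda>x. (u n x - u0 x))) \<longlonglongrightarrow> 0"
    "(\<lambda>n. nsq (\<lambda>x. G n x - G0 x)) \<longlonglongrightarrow> 0"
  shows "W12 u0 G0"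
  unfolding W12_def is_wgrad_def
proof (intro conjI allI impI s)
  fix \<psi> i assume t: "test_fun UNIV \<psi>"
  obtain R where R: "\<And>x. x \<notin> ball 0 R \<Longrightarrow> pd \<psi> i x = 0" using test_fun_ball[OF t] by metis
  have sR: "sq (\<lambda>x. indicator (ball 0 R) x *\<^sub>R v x)" if "sq v" for v :: "R3 \<Rightarrow> real"
    by (rule sq_indicator(1)[OF _ that]) simp
  have e: "(LBINT x. v x * pd \<psi> i x) = (LBINT x. (indicator (ball 0 R) x *\<^sub>R v x) \<bullet> pd \<psi> i x)" for v :: "R3 \<Rightarrow> real"
    by (intro Bochner_Integration.integral_cong) (use R in \<open>auto simp: indicator_def\<close>)
  have "(\<lambda>n. LBINT x. u n x * pd \<psi> i x) \<longlonglongrightarrow> (LBINT x. u0 x * pd \<psi> i x)"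
    unfolding e
  proof (rule L2_inner_conv)
    show "(\<lambda>n. nsq (\<lambda>x. indicator (ball 0 R) x *\<^sub>R u n x - indicator (ball 0 R) x *\<^sub>R u0 x)) \<longlonglongrightarrow> 0"
      using lim(1)[of R] by (simp only: scaleR_diff_right)
    show "sq (\<lambda>x. indicat_real (ball 0 R) x *\<^sub>R u n x)" for n by (rule sR[OF W12D(1)[OF W]])
    show "sq (\<lambda>x. indicat_real (ball 0 R) x *\<^sub>R u0 x)" by (rule sR[OF s(1)])
  qed (use test_sq[OF t] in auto)
  moreover have "(\<lambda>n. - (LBINT x. G n x $ i * \<psi> x)) \<longlonglongrightarrow> - (LBINT x. G0 x $ i * \<psi> x)"
  proof (rule tendsto_minus)
    have "(\<lambda>n. LBINT x. G n x $ i \<bullet> \<psi> x) \<longlonglongrightarrow> (LBINT x. G0 x $ i \<bullet> \<psi> x)"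
    proof (rule L2_inner_conv)
      show "(\<lambda>n. nsq (\<lambda>x. G n x $ i - G0 x $ i)) \<longlonglongrightarrow> 0"
        by (rule null_comparison_nonneg[OF lim(2) nsq_nonneg])
           (use sq_component(2)[OF sq_diff(1)[OF W12D(2)[OF W] s(2)]] in simp)
    qed (use W12D(2)[OF W] s test_sq[OF t] in \<open>auto intro: sq_component\<close>)
    thus "(\<lambda>n. LBINT x. G n x $ i * \<psi> x) \<longlonglongrightarrow> (LBINT x. G0 x $ i * \<psi> x)" by simp
  qed
  ultimately show "(LBINT x. u0 x * pd \<psi> i x) = - (LBINT x. G0 x $ i * \<psi> x)"
    by (simp only: W12D(3)[OF W t]) (rule LIMSEQ_unique)
qed

lemma W12_limit:
  assumes W: "\<And>n. W12 (u n) (G n)" and s: "sq u0" "sq G0"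
    and lim: "(\<lambda>n. nsq (\<lambda>x. u n x - u0 x)) \<longlonglongrightarrow> 0" "(\<lambda>n. nsq (\<lambda>x. G n x - G0 x)) \<longlonglongrightarrow> 0"
  shows "W12 u0 G0"
proof (rule W12_limit_loc[OF W s _ lim(2)])
  fix R
  show "(\<lambda>n. nsq_on R (\<lambda>x. (u n x - u0 x))) \<longlonglongrightarrow> 0"
    by (rule null_comparison_nonneg[OF lim(1) nsq_nonneg])
       (rule sq_indicator(2)[OF _ sq_diff(1)[OF W12D(1)[OF W] s(1)]], simp)
qed

lemma test_fun_reflect:
  assumes "test_fun UNIV k"
  shows "test_fun UNIV (\<lambda>y. k (x - y))"
proof -
  obtain K where K: "compact K" "\<And>x. x \<notin> K \<Longrightarrow> k x = 0" using test_funE[OF assms] by metis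
  show ?thesis
  proof (rule test_funI[of _ "(\<lambda>y. x - y) ` K"])
    show "smooth (\<lambda>y. k (x - y))" using assms by (intro smooth_reflect test_fun_smooth)
    show "compact ((\<lambda>y. x - y) ` K)" using K(1) by (intro compact_continuous_image continuous_intros)
    fix y assume "y \<notin> (\<lambda>y. x - y) ` K"
    hence "x - y \<notin> K" by (metis diff_diff_eq2 add_diff_cancel_left' image_eqI)
    thus "k (x - y) = 0" by (rule K(2))
  qed auto
qed

text \<open>The reflected kernel \<open>k (x - y)\<close> is a test function in \<open>y\<close>;
  the sign of its derivative cancels the sign of the weak formulation.\<close>

lemma conv_grad:
  assumes W: "W12 u G" and k: "test_fun UNIV k" and u: "integrable lborel u"
  shows "grad (conv k u) = conv k G"
proof (rule ext)
  fix x
  have "grad (conv k u) x $ i = conv k G x $ i" for i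
  proof -
    have kd: "\<forall>x. k differentiable (at x)" using smooth_Ck[OF test_fun_smooth[OF k], of 1] by (simp add: Ck.simps)
    have p: "pd (\<lambda>y. k (x - y)) i y = - pd k i (x - y)" for y by (rule pd_reflect(2)[OF kd])
    have "grad (conv k u) x $ i = conv (pd k i) u x"
      using conv_pd[OF test_fun_C1c[OF k] u] by (simp add: grad_def)
    also have "\<dots> = - (LBINT y. u y * pd (\<lambda>y. k (x - y)) i y)"
      unfolding p conv_def by (simp add: mult.commute)
    also have "\<dots> = (LBINT y. G y $ i * k (x - y))"
      by (simp add: W12D(3)[OF W test_fun_reflect[OF k]])
    also have "\<dots> = (LBINT y. (k (x - y) *\<^sub>R G y) $ i)" by (simp add: mult.commute)
    also have "\<dots> = conv k G x $ i"
      unfolding conv_def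
      by (rule integral_bounded_linear[OF bounded_linear_vec_nth])
         (rule conv_int[OF test_sq(1)[OF k] W12D(2)[OF W]])
    finally show ?thesis .
  qed
  thus "grad (conv k u) x = conv k G x" by (simp add: vec_eq_iff)
qed

text \<open>An approximate identity whose centres may move as long as they tend to 0. Each use
  provides kernels for one type of values only.\<close>

lemma conv_kernels:
  fixes a :: "nat \<Rightarrow> R3" and h :: "nat \<Rightarrow> real"
  assumes "\<And>n. h n > 0" "h \<longlonglongrightarrow> 0" "a \<longlonglongrightarrow> 0"
  obtains k where "\<And>n. test_fun UNIV (k n)" "\<And>n x. 0 \<le> k n x" "\<And>n. (LBINT x. k n x) = 1"
    "\<And>n x. x \<notin> cball (a n) (h n) \<Longrightarrow> k n x = 0"
    "\<And>v :: R3 \<Rightarrow> 'b::euclidean_space. sq v \<Longrightarrow> (\<forall>n. sq (conv (k n) v)) \<and> (\<lambda>n. nsq (\<lambda>x. conv (k n) v x - v x)) \<longlonglongrightarrow> 0"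
proof -
  have "\<forall>n. \<exists>k. test_fun UNIV k \<and> (\<forall>x. 0 \<le> k x) \<and> (LBINT x. k x) = 1 \<and> (\<forall>x. x \<notin> cball (a n) (h n) \<longrightarrow> k x = 0)"
    using kernel_exists[OF assms(1)] by blast
  then obtain k where k: "\<And>n. test_fun UNIV (k n)" "\<And>n x. 0 \<le> k n x" "\<And>n. (LBINT x. k n x) = 1"
    "\<And>n x. x \<notin> cball (a n) (h n) \<Longrightarrow> k n x = 0" by metis
  have "(\<forall>n. sq (conv (k n) v)) \<and> (\<lambda>n. nsq (\<lambda>x. conv (k n) v x - v x)) \<longlonglongrightarrow> 0" if v: "sq v" for v :: "R3 \<Rightarrow> 'b"
  proof
    note cl = conv_L2[OF test_sq(1)[OF k(1)] C1c_D(1)[OF test_fun_C1c[OF k(1)]] k(2) k(3) v]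
    show "\<forall>n. sq (conv (k n) v)"
    proof
      fix n
      show "sq (conv (k n) v)"
      proof (rule cl(1))
        fix z
        show "nsq (\<lambda>x. v (x - z) - v x) \<le> 4 * nsq v"
          using sq_diff(2)[OF sq_shift(1)[OF v, of "-z"] v] sq_shift(2)[OF v, of "-z"] by simp
      qed
    qed
    show "(\<lambda>n. nsq (\<lambda>x. conv (k n) v x - v x)) \<longlonglongrightarrow> 0"
    proof (rule null_seqI)
      fix e :: real assume e: "e > 0"
      obtain d where d: "d > 0" "\<And>z. norm z < d \<Longrightarrow> nsq (\<lambda>x. v (x + z) - v x) < e"
        using transl_continuity[OF v e] by blast
      have "(\<lambda>n. norm (a n) + h n) \<longlonglongrightarrow> 0 + 0"
        by (intro tendsto_add tendsto_norm_zero assms)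
      hence "\<forall>\<^sub>F n in sequentially. norm (a n) + h n < d"
        using order_tendstoD(2)[of _ 0 sequentially d] d by simp
      then obtain N where N: "\<forall>n\<ge>N. norm (a n) + h n < d" by (auto simp: eventually_sequentially)
      have "nsq (\<lambda>x. conv (k n) v x - v x) \<le> e" if n: "n \<ge> N" for n
      proof (rule cl(2))
        fix z assume "k n z \<noteq> 0"
        hence "z \<in> cball (a n) (h n)" using k(4) by blast
        hence "norm (- z) < d" using N[rule_format, OF n] norm_triangle_ineq2[of z "a n"]
          by (simp add: dist_norm norm_minus_commute)
        from d(2)[OF this] show "nsq (\<lambda>x. v (x - z) - v x) \<le> e" by simp
      qed
      thus "\<exists>N. \<forall>n\<ge>N. nsq (\<lambda>x. conv (k n) v x - v x) \<le> e" by blast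
    qed simp
  qed
  with k that show thesis by blast
qed

text \<open>Cauchy-Schwarz with the indicator of a ball. It is needed because convolutions are
  differentiated for integrable functions.\<close>

lemma compact_support_integrable:
  assumes v: "sq (v :: R3 \<Rightarrow> real)" and K: "bounded K" "AE x in lborel. x \<notin> K \<longrightarrow> v x = 0"
  shows "integrable lborel v"
proof -
  obtain R where R: "K \<subseteq> cball 0 R" using K(1) by (auto simp: bounded_iff subset_iff)
  have f: "emeasure lborel (cball 0 R :: R3 set) < \<infinity>" by (intro emeasure_bounded_finite) auto
  have s: "sq (\<lambda>x::R3. indicator (cball 0 R) x *\<^sub>R (1::real))" by (rule sq_indicator_const(1)) (use f in auto)
  show ?thesis
  proof (rule Bochner_Integration.integrable_bound[OF sq_norm_mult_int[OF s v]])
    show "AE x in lborel. norm (v x) \<le> norm (norm (indicat_real (cball 0 R) x *\<^sub>R (1::real)) * norm (v x))"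
      using K(2) by eventually_elim (use R in \<open>auto simp: indicator_def\<close>)
  qed (use v in \<open>simp add: sq_def\<close>)
qed

text \<open>Membership in H^1_0 of \<open>U\<close>, with the gradient kept as a separate
  datum.\<close>

definition tapprox :: "R3 set \<Rightarrow> (R3 \<Rightarrow> real) \<Rightarrow> (R3 \<Rightarrow> R3) \<Rightarrow> bool" where
  "tapprox U u G \<longleftrightarrow> (\<forall>e>0. \<exists>\<psi>. test_fun U \<psi> \<and> nsq (\<lambda>x. \<psi> x - u x) < e \<and> nsq (\<lambda>x. grad \<psi> x - G x) < e)"

lemma tapproxI_seq:
  assumes "\<And>n. test_fun U (\<psi> n)" "(\<lambda>n. nsq (\<lambda>x. \<psi> n x - u x)) \<longlonglongrightarrow> 0" "(\<lambda>n. nsq (\<lambda>x. grad (\<psi> n) x - G x)) \<longlonglongrightarrow> 0"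
  shows "tapprox U u G"
  unfolding tapprox_def
proof (intro allI impI)
  fix e :: real assume "e > 0"
  hence "\<forall>\<^sub>F n in sequentially. nsq (\<lambda>x. \<psi> n x - u x) < e \<and> nsq (\<lambda>x. grad (\<psi> n) x - G x) < e"
    using order_tendstoD(2)[OF assms(2)] order_tendstoD(2)[OF assms(3)] by (intro eventually_conj) auto
  then obtain n where "nsq (\<lambda>x. \<psi> n x - u x) < e \<and> nsq (\<lambda>x. grad (\<psi> n) x - G x) < e"
    by (auto simp: eventually_sequentially)
  thus "\<exists>\<psi>. test_fun U \<psi> \<and> nsq (\<lambda>x. \<psi> x - u x) < e \<and> nsq (\<lambda>x. grad \<psi> x - G x) < e"
    using assms(1) by blast
qed

lemma tapprox_seq:
  assumes "tapprox U u G"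
  obtains \<psi> where "\<And>n. test_fun U (\<psi> n)" "(\<lambda>n. nsq (\<lambda>x. \<psi> n x - u x)) \<longlonglongrightarrow> 0" "(\<lambda>n. nsq (\<lambda>x. grad (\<psi> n) x - G x)) \<longlonglongrightarrow> 0"
proof -
  have "\<forall>n. \<exists>\<psi>. test_fun U \<psi> \<and> nsq (\<lambda>x. \<psi> x - u x) < inverse (real (Suc n)) \<and> nsq (\<lambda>x. grad \<psi> x - G x) < inverse (real (Suc n))"
    using assms by (auto simp: tapprox_def)
  then obtain \<psi> where \<psi>: "\<And>n. test_fun U (\<psi> n)" "\<And>n. nsq (\<lambda>x. \<psi> n x - u x) < inverse (real (Suc n))"
    "\<And>n. nsq (\<lambda>x. grad (\<psi> n) x - G x) < inverse (real (Suc n))" by metis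
  show thesis
    by (rule that[OF \<psi>(1)]; rule null_comparison_nonneg[OF LIMSEQ_inverse_real_of_nat nsq_nonneg];
        rule less_imp_le, rule \<psi>)
qed

lemma tapprox_limit:
  assumes s: "sq u" "sq G"
    and ap: "\<And>e. e > 0 \<Longrightarrow> \<exists>v F. sq v \<and> sq F \<and> tapprox U v F \<and> nsq (\<lambda>x. v x - u x) < e \<and> nsq (\<lambda>x. F x - G x) < e"
  shows "tapprox U u G"
  unfolding tapprox_def
proof (intro allI impI)
  fix e :: real assume "e > 0"
  then obtain v F where v: "sq v" "sq F" "tapprox U v F" "nsq (\<lambda>x. v x - u x) < e / 4" "nsq (\<lambda>x. F x - G x) < e / 4"
    using ap[of "e/4"] by auto
  obtain \<psi> where p: "test_fun U \<psi>" "nsq (\<lambda>x. \<psi> x - v x) < e / 4" "nsq (\<lambda>x. grad \<psi> x - F x) < e / 4"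
    using v(3) \<open>e > 0\<close> unfolding tapprox_def by (meson divide_pos_pos zero_less_numeral)
  have "nsq (\<lambda>x. \<psi> x - u x) \<le> 2 * nsq (\<lambda>x. \<psi> x - v x) + 2 * nsq (\<lambda>x. v x - u x)"
    by (intro nsq_triangle test_sq[OF p(1)] v s)
  moreover have "nsq (\<lambda>x. grad \<psi> x - G x) \<le> 2 * nsq (\<lambda>x. grad \<psi> x - F x) + 2 * nsq (\<lambda>x. F x - G x)"
    by (intro nsq_triangle test_sq[OF p(1)] v s)
  ultimately show "\<exists>\<psi>. test_fun U \<psi> \<and> nsq (\<lambda>x. \<psi> x - u x) < e \<and> nsq (\<lambda>x. grad \<psi> x - G x) < e"
    using p v by (intro exI[of _ \<psi>]) auto
qed

lemma grad_add:
  "(\<And>x. f differentiable (at x)) \<Longrightarrow> (\<And>x. g differentiable (at x)) \<Longrightarrow> grad (\<lambda>x. f x + g x) x = grad f x + grad g x"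
  by (simp add: grad_def vec_eq_iff pd_add)

lemma grad_mult:
  "(\<And>x. f differentiable (at x)) \<Longrightarrow> (\<And>x. g differentiable (at x)) \<Longrightarrow> grad (\<lambda>x. f x * g x) x = f x *\<^sub>R grad g x + g x *\<^sub>R grad f x"
  by (simp add: grad_def vec_eq_iff pd_mult mult.commute)

lemma test_diff: "test_fun U \<psi> \<Longrightarrow> \<psi> differentiable (at x)"
  using smooth_Ck[OF test_fun_smooth, of U \<psi> 1] by (simp add: Ck.simps)

lemma tapprox_add:
  assumes "tapprox U u G" "tapprox U v F" "sq u" "sq G" "sq v" "sq F"
  shows "tapprox U (\<lambda>x. u x + v x) (\<lambda>x. G x + F x)"
  unfolding tapprox_def
proof (intro allI impI)
  fix e :: real assume e: "e > 0"
  obtain \<psi> where p: "test_fun U \<psi>" "nsq (\<lambda>x. \<psi> x - u x) < e / 4" "nsq (\<lambda>x. grad \<psi> x - G x) < e / 4"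
    using assms(1) e unfolding tapprox_def by (meson divide_pos_pos zero_less_numeral)
  obtain \<theta> where q: "test_fun U \<theta>" "nsq (\<lambda>x. \<theta> x - v x) < e / 4" "nsq (\<lambda>x. grad \<theta> x - F x) < e / 4"
    using assms(2) e unfolding tapprox_def by (meson divide_pos_pos zero_less_numeral)
  have g: "grad (\<lambda>x. \<psi> x + \<theta> x) x = grad \<psi> x + grad \<theta> x" for x
    using grad_add test_diff p q by blast
  have "nsq (\<lambda>x. (\<psi> x - u x) + (\<theta> x - v x)) \<le> 2 * nsq (\<lambda>x. \<psi> x - u x) + 2 * nsq (\<lambda>x. \<theta> x - v x)"
    by (intro sq_add(2) sq_diff test_sq[OF p(1)] test_sq[OF q(1)] assms)
  moreover have "nsq (\<lambda>x. (grad \<psi> x - G x) + (grad \<theta> x - F x)) \<le> 2 * nsq (\<lambda>x. grad \<psi> x - G x) + 2 * nsq (\<lambda>x. grad \<theta> x - F x)"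
    by (intro sq_add(2) sq_diff test_sq[OF p(1)] test_sq[OF q(1)] assms)
  ultimately show "\<exists>\<psi>. test_fun U \<psi> \<and> nsq (\<lambda>x. \<psi> x - (u x + v x)) < e \<and> nsq (\<lambda>x. grad \<psi> x - (G x + F x)) < e"
    using test_fun_add[OF p(1) q(1)] p q by (intro exI[of _ "\<lambda>x. \<psi> x + \<theta> x"]) (simp add: g add_diff_add)
qed

text \<open>The kernels may be off-centre: it is enough that \<open>K\<close>, moved by any point of
  the kernel balls, lies in \<open>U\<close>, even if \<open>K\<close> itself touches the boundary
  of \<open>U\<close>.\<close>

lemma mollify_tapprox:
  assumes W: "W12 v G" and K: "compact K" "AE x in lborel. x \<notin> K \<longrightarrow> v x = 0"
    and h: "\<And>n. h n > 0" "h \<longlonglongrightarrow> 0" "a \<longlonglongrightarrow> 0"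
    and U: "\<And>n p q. p \<in> K \<Longrightarrow> q \<in> cball (a n) (h n) \<Longrightarrow> p + q \<in> U"
  shows "tapprox U v G"
proof -
  have vi: "integrable lborel v" by (rule compact_support_integrable[OF W12D(1)[OF W] compact_imp_bounded[OF K(1)] K(2)])
  have "\<forall>n. \<exists>k. test_fun UNIV k \<and> (\<forall>x. 0 \<le> k x) \<and> (LBINT x. k x) = 1 \<and> (\<forall>x. x \<notin> cball (a n) (h n) \<longrightarrow> k x = 0)"
    using kernel_exists[OF h(1)] by blast
  \<comment> \<open>The pair is mollified as one function because a sequence of kernels is provided
    for a single type of values; the components are recovered by projection.\<close>
  define s where "s = (\<lambda>x. (v x, G x))"
  have sv: "sq v" and sG: "sq G" using W12D[OF W] by auto
  have [measurable]: "v \<in> mble" "G \<in> mble" using sv sG by (auto simp: sq_def)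
  have n2: "(norm (p, q))\<^sup>2 = (norm p)\<^sup>2 + (norm q)\<^sup>2" for p :: real and q :: R3 by (simp add: norm_Pair)
  have ss: "sq s" unfolding sq_def s_def n2 using sq_int[OF sv] sq_int[OF sG] by auto
  obtain k where k: "\<And>n. test_fun UNIV (k n)" "\<And>n x. 0 \<le> k n x" "\<And>n. (LBINT x. k n x) = 1"
    "\<And>n x. x \<notin> cball (a n) (h n) \<Longrightarrow> k n x = 0"
    and kc: "\<And>w :: R3 \<Rightarrow> real \<times> R3. sq w \<Longrightarrow> (\<forall>n. sq (conv (k n) w)) \<and> (\<lambda>n. nsq (\<lambda>x. conv (k n) w x - w x)) \<longlonglongrightarrow> 0"
    by (rule conv_kernels[OF h, where 'b="real \<times> R3"]) blast
  have kq: "sq (k n)" for n by (rule test_sq(1)[OF k(1)])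
  have pair: "conv (k n) s x = (conv (k n) v x, conv (k n) G x)" for n x
  proof -
    have "fst (conv (k n) s x) = conv (k n) v x" unfolding conv_def
      by (subst integral_bounded_linear[OF bounded_linear_fst conv_int[OF kq ss], symmetric]) (simp add: s_def)
    moreover have "snd (conv (k n) s x) = conv (k n) G x" unfolding conv_def
      by (subst integral_bounded_linear[OF bounded_linear_snd conv_int[OF kq ss], symmetric]) (simp add: s_def)
    ultimately show ?thesis by (simp add: prod_eq_iff)
  qed
  have sd: "sq (\<lambda>x. conv (k n) s x - s x)" for n using kc[OF ss] by (intro sq_diff ss) blast
  have lim: "(\<lambda>n. nsq (\<lambda>x. conv (k n) s x - s x)) \<longlonglongrightarrow> 0" using kc[OF ss] by blast
  have m: "(\<lambda>x. conv (k n) v x - v x) \<in> mble" "(\<lambda>x. conv (k n) G x - G x) \<in> mble" for n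
    using conv_meas[OF kq[of n] sv] conv_meas[OF kq[of n] sG] by auto
  have dp: "conv (k n) s x - s x = (conv (k n) v x - v x, conv (k n) G x - G x)" for n x
    by (simp only: pair) (simp add: s_def)
  have 1: "(\<lambda>n. nsq (\<lambda>x. conv (k n) v x - v x)) \<longlonglongrightarrow> 0"
  proof (rule null_comparison_nonneg[OF lim nsq_nonneg])
    show "nsq (\<lambda>x. conv (k n) v x - v x) \<le> nsq (\<lambda>x. conv (k n) s x - s x)" for n
      by (rule sq_bound(2)[OF sd m(1)]) (simp only: dp norm_fst_le AE_I2)
  qed
  have 2: "(\<lambda>n. nsq (\<lambda>x. conv (k n) G x - G x)) \<longlonglongrightarrow> 0"
  proof (rule null_comparison_nonneg[OF lim nsq_nonneg])
    show "nsq (\<lambda>x. conv (k n) G x - G x) \<le> nsq (\<lambda>x. conv (k n) s x - s x)" for n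
      by (rule sq_bound(2)[OF sd m(2)]) (simp only: dp norm_snd_le AE_I2)
  qed
  show ?thesis
  proof (rule tapproxI_seq[where \<psi>="\<lambda>n. conv (k n) v"])
    fix n
    show "test_fun U (conv (k n) v)"
    proof (rule test_funI)
      show "smooth (conv (k n) v)" by (rule conv_smooth[OF k(1) vi])
      show "compact {p + q |p q. p \<in> K \<and> q \<in> cball (a n) (h n)}" by (rule compact_sums[OF K(1) compact_cball])
      show "{p + q |p q. p \<in> K \<and> q \<in> cball (a n) (h n)} \<subseteq> U" using U by blast
      show "conv (k n) v x = 0" if "x \<notin> {p + q |p q. p \<in> K \<and> q \<in> cball (a n) (h n)}" for x
        by (rule conv_supp[OF K(2) k(4) that])
    qed
  next
    show "(\<lambda>n. nsq (\<lambda>x. conv (k n) v x - v x)) \<longlonglongrightarrow> 0" by (rule 1)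
    show "(\<lambda>n. nsq (\<lambda>x. grad (conv (k n) v) x - G x)) \<longlonglongrightarrow> 0" using 2 by (simp add: conv_grad[OF W k(1) vi])
  qed
qed

text \<open>The difference of two gradients is a weak gradient of 0; its mollifications are
  gradients of 0, and they converge to it.\<close>

lemma W12_unique:
  assumes "W12 u G" "W12 u F"
  shows "AE x in lborel. G x = F x"
proof -
  have W: "W12 (\<lambda>x. 0) (\<lambda>x. G x - F x)" using W12_diff[OF assms] by simp
  obtain k where k: "\<And>n. test_fun UNIV (k n)"
    and kc: "\<And>w :: R3 \<Rightarrow> R3. sq w \<Longrightarrow> (\<forall>n. sq (conv (k n) w)) \<and> (\<lambda>n. nsq (\<lambda>x. conv (k n) w x - w x)) \<longlonglongrightarrow> 0"
    by (rule conv_kernels[where 'b=R3 and h="\<lambda>n. inverse (real (Suc n))" and a="\<lambda>n. 0"])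
       (use LIMSEQ_inverse_real_of_nat in \<open>auto simp del: of_nat_Suc\<close>)
  have "conv (k n) (\<lambda>x. G x - F x) x = 0" for n x
  proof -
    have "conv (k n) (\<lambda>x. 0) = (\<lambda>x. 0::real)" by (simp add: conv_def[abs_def])
    moreover have "grad (conv (k n) (\<lambda>x. 0)) = conv (k n) (\<lambda>x. G x - F x)"
      by (rule conv_grad[OF W k]) simp
    ultimately have "grad (\<lambda>x. 0) = conv (k n) (\<lambda>x. G x - F x)" by (simp only:)
    moreover have "grad (\<lambda>x. 0) x = 0" by (simp add: grad_def vec_eq_iff)
    ultimately show ?thesis by metis
  qed
  hence "(\<lambda>n. nsq (\<lambda>x. 0 - (G x - F x))) \<longlonglongrightarrow> 0" using kc[OF W12D(2)[OF W]] by simp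
  hence "nsq (\<lambda>x. G x - F x) = 0" using nsq_commute[of "\<lambda>x. 0" "\<lambda>x. G x - F x"]
    by (simp add: LIMSEQ_const_iff)
  from nsq_eq_0_AE[OF W12D(2)[OF W] this] show ?thesis by simp
qed

lemma W12_mult:
  assumes W: "W12 u G" and c: "smooth \<eta>" "\<And>x. \<bar>\<eta> x\<bar> \<le> C" "\<And>x. norm (grad \<eta> x) \<le> C"
  shows "W12 (\<lambda>x. \<eta> x * u x) (\<lambda>x. \<eta> x *\<^sub>R G x + u x *\<^sub>R grad \<eta> x)"
  unfolding W12_def is_wgrad_def
proof (intro conjI allI impI)
  have C: "C \<ge> 0" using c(2)[of 0] by linarith
  note s = W12D(1,2)[OF W]
  have [measurable]: "u \<in> mble" "G \<in> mble" using s by (auto simp: sq_def)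
  have c1: "Ck 1 \<eta>" using c(1) by (rule smooth_Ck)
  have [measurable]: "\<eta> \<in> mble" "grad \<eta> \<in> mble"
    using cont_meas Ck_continuous[OF c1] Ck1_grad_cont[OF c1] by blast+
  show s1: "sq (\<lambda>x. \<eta> x * u x)"
    by (rule sq_bound(1)[OF sq_scale(1)[OF s(1), of C]]) (use c C in \<open>auto simp: abs_mult intro!: mult_right_mono\<close>)
  have s2: "sq (\<lambda>x. \<eta> x *\<^sub>R G x)"
    by (rule sq_bound(1)[OF sq_scale(1)[OF s(2), of C]]) (use c C in \<open>auto simp: abs_mult intro!: mult_right_mono\<close>)
  have s3: "sq (\<lambda>x. u x *\<^sub>R grad \<eta> x)"
  proof (rule sq_bound(1)[OF sq_scale(1)[OF s(1), of C]])
    show "AE x in lborel. norm (u x *\<^sub>R grad \<eta> x) \<le> norm (C *\<^sub>R u x)"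
      using mult_left_mono[OF c(3) abs_ge_zero] C by (auto simp: abs_mult mult.commute)
  qed measurable
  show "sq (\<lambda>x. \<eta> x *\<^sub>R G x + u x *\<^sub>R grad \<eta> x)" by (rule sq_add(1)[OF s2 s3])
  fix \<psi> i assume t: "test_fun UNIV \<psi>"
  have t2: "test_fun UNIV (\<lambda>x. \<eta> x * \<psi> x)" by (rule test_fun_mult[OF t c(1)])
  have p: "pd (\<lambda>x. \<eta> x * \<psi> x) i x = \<eta> x * pd \<psi> i x + pd \<eta> i x * \<psi> x" for x
    using c1 test_diff[OF t] by (intro pd_mult) (auto simp: Ck.simps)
  have i1: "integrable lborel (\<lambda>x. u x * (\<eta> x * pd \<psi> i x))"
    using sq_mult_int[OF s1 test_sq(2)[OF t]] by (simp add: mult_ac)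
  have i2: "integrable lborel (\<lambda>x. u x * (pd \<eta> i x * \<psi> x))"
    using sq_mult_int[OF sq_component(1)[OF s3, of i] test_sq(1)[OF t]] by (simp add: grad_def mult_ac)
  have i3: "integrable lborel (\<lambda>x. \<eta> x * G x $ i * \<psi> x)"
    using sq_mult_int[OF sq_component(1)[OF s2, of i] test_sq(1)[OF t]] by simp
  have "(LBINT x. u x * pd (\<lambda>x. \<eta> x * \<psi> x) i x) = - (LBINT x. G x $ i * (\<eta> x * \<psi> x))"
    by (rule W12D(3)[OF W t2])
  hence "(LBINT x. u x * (\<eta> x * pd \<psi> i x)) + (LBINT x. u x * (pd \<eta> i x * \<psi> x))
     = - (LBINT x. \<eta> x * G x $ i * \<psi> x)"
    unfolding p using i1 i2 by (simp add: distrib_left mult_ac)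
  moreover have "(LBINT x. (\<eta> x *\<^sub>R G x + u x *\<^sub>R grad \<eta> x) $ i * \<psi> x)
     = (LBINT x. \<eta> x * G x $ i * \<psi> x) + (LBINT x. u x * (pd \<eta> i x * \<psi> x))"
    using i2 i3 by (simp add: distrib_right grad_def mult.assoc)
  ultimately show "(LBINT x. \<eta> x * u x * pd \<psi> i x) = - (LBINT x. (\<eta> x *\<^sub>R G x + u x *\<^sub>R grad \<eta> x) $ i * \<psi> x)"
    by (simp add: mult_ac)
qed

lemma grad_const_on:
  assumes "open S" "x \<in> S" "\<And>y. y \<in> S \<Longrightarrow> \<psi> y = c"
  shows "grad \<psi> x = 0"
proof -
  have "((\<lambda>x. c) has_derivative (\<lambda>h. 0)) (at x)" by simp
  hence "(\<psi> has_derivative (\<lambda>h. 0)) (at x)"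
    by (rule has_derivative_transform_within_open[OF _ assms(1,2)]) (use assms in auto)
  from pd_eqI[OF this] show ?thesis by (simp add: grad_def vec_eq_iff)
qed

text \<open>The indicator of the ball of radius \<open>r + s\<close> is mollified at scale
  \<open>s\<close>. The gradient is bounded by L^1 norms of derivatives of one fixed kernel, so the
  bound does not depend on centre and radius.\<close>

lemma cutoffs:
  assumes s: "s > 0"
  shows "\<exists>C. \<forall>a r. \<exists>\<eta>. test_fun UNIV \<eta> \<and> (\<forall>x. 0 \<le> \<eta> x \<and> \<eta> x \<le> 1) \<and> (\<forall>x\<in>cball a r. \<eta> x = 1)
     \<and> (\<forall>x. x \<notin> cball a (r + 2 * s) \<longrightarrow> \<eta> x = 0) \<and> (\<forall>x. norm (grad \<eta> x) \<le> C)"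
proof -
  obtain k where k: "test_fun UNIV k" "\<And>x. 0 \<le> k x" "(LBINT x. k x) = 1" "\<And>x. x \<notin> cball 0 s \<Longrightarrow> k x = 0"
    using kernel_exists[OF s, of 0] by blast
  have ki: "integrable lborel k" by (rule C1c_D(1)[OF test_fun_C1c[OF k(1)]])
  have kpi: "integrable lborel (pd k i)" for i by (rule C1c_D(1)[OF test_fun_C1c[OF test_fun_pd[OF k(1)]]])
  define C where "C = (\<Sum>i\<in>UNIV. \<integral>x. \<bar>pd k i x\<bar> \<partial>lborel)"
  have "\<exists>\<eta>. test_fun UNIV \<eta> \<and> (\<forall>x. 0 \<le> \<eta> x \<and> \<eta> x \<le> 1) \<and> (\<forall>x\<in>cball a r. \<eta> x = 1)
     \<and> (\<forall>x. x \<notin> cball a (r + 2 * s) \<longrightarrow> \<eta> x = 0) \<and> (\<forall>x. norm (grad \<eta> x) \<le> C)" for a :: R3 and r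
  proof -
    let ?B = "cball a (r + s)"
    let ?v = "\<lambda>x. indicator ?B x *\<^sub>R (1::real)"
    have f: "emeasure lborel ?B < \<infinity>" by (intro emeasure_bounded_finite) auto
    have sv: "sq ?v" by (rule sq_indicator_const(1)) (use f in auto)
    have vi: "integrable lborel ?v" using f by simp
    have alt: "conv l ?v x = (LBINT z. l z * indicator ?B (x - z))"
      "integrable lborel (\<lambda>z. l z * indicator ?B (x - z))" if "sq l" for l x
      using conv_alt[OF that sv, of x] by auto
    have 1: "0 \<le> conv k ?v x \<and> conv k ?v x \<le> 1" for x
    proof
      show "0 \<le> conv k ?v x" unfolding alt(1)[OF test_sq(1)[OF k(1)]] using k(2) by (intro Bochner_Integration.integral_nonneg) auto
      have "conv k ?v x \<le> (LBINT z. k z)" unfolding alt(1)[OF test_sq(1)[OF k(1)]]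
        by (intro integral_mono alt(2)[OF test_sq(1)[OF k(1)]] ki) (use k(2) in \<open>auto simp: indicator_def\<close>)
      thus "conv k ?v x \<le> 1" using k(3) by simp
    qed
    have 2: "conv k ?v x = 1" if "x \<in> cball a r" for x
    proof -
      have kz: "k z * indicator ?B (x - z) = k z" for z
      proof (cases "z \<in> cball 0 s")
        case True
        hence "dist a (x - z) \<le> r + s"
          using that norm_triangle_ineq[of "a - x" z] by (auto simp: dist_norm algebra_simps)
        thus ?thesis by simp
      qed (use k(4) in simp)
      show ?thesis unfolding alt(1)[OF test_sq(1)[OF k(1)]] kz by (rule k(3))
    qed
    have 3: "conv k ?v x = 0" if "x \<notin> cball a (r + 2 * s)" for x
    proof (rule conv_supp[of ?B _ "cball 0 s"])
      show "x \<notin> {p + q |p q. p \<in> ?B \<and> q \<in> cball 0 s}"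
      proof
        assume "x \<in> {p + q |p q. p \<in> ?B \<and> q \<in> cball 0 s}"
        then obtain p q where "x = p + q" "dist a p \<le> r + s" "norm q \<le> s" by auto
        hence "dist a x \<le> r + 2 * s" using norm_triangle_ineq4[of "a - p" q] by (simp add: dist_norm diff_diff_eq)
        thus False using that by simp
      qed
    qed (use k(4) in auto)
    have 4: "norm (grad (conv k ?v) x) \<le> C" for x
    proof -
      have "\<bar>grad (conv k ?v) x $ i\<bar> \<le> (LBINT x. \<bar>pd k i x\<bar>)" for i
      proof -
        have "grad (conv k ?v) x $ i = conv (pd k i) ?v x"
          using conv_pd[OF test_fun_C1c[OF k(1)] vi] by (simp add: grad_def)
        also have "\<dots> = (LBINT z. pd k i z * indicator ?B (x - z))" by (rule alt(1)[OF test_sq(2)[OF k(1)]])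
        finally have "\<bar>grad (conv k ?v) x $ i\<bar> = \<bar>LBINT z. pd k i z * indicator ?B (x - z)\<bar>" by simp
        also have "\<dots> \<le> (LBINT z. \<bar>pd k i z * indicator ?B (x - z)\<bar>)" by (rule integral_abs_bound)
        also have "\<dots> \<le> (LBINT z. \<bar>pd k i z\<bar>)"
          by (intro integral_mono integrable_abs alt(2)[OF test_sq(2)[OF k(1)]] kpi) (auto simp: indicator_def)
        finally show ?thesis .
      qed
      hence "(\<Sum>i\<in>UNIV. \<bar>grad (conv k ?v) x $ i\<bar>) \<le> C" unfolding C_def by (rule sum_mono)
      thus ?thesis using norm_le_l1_cart[of "grad (conv k ?v) x"] by linarith
    qed
    have 5: "test_fun UNIV (conv k ?v)"
      by (rule test_funI[of _ "cball a (r + 2 * s)"]) (use conv_smooth[OF k(1) vi] 3 in auto)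
    show ?thesis using 1 2 3 4 5 by (intro exI[of _ "conv k ?v"]) auto
  qed
  thus ?thesis by blast
qed

text \<open>Cut off at radius \<open>n\<close>, then mollify. The cutoffs share one gradient bound
  \<open>C\<close>, so the term with \<open>grad (\<eta> n)\<close> is dominated by
  \<open>C * norm (u x)\<close>, and at each point it is eventually zero.\<close>

lemma W12_density:
  assumes W: "W12 u G"
  shows "tapprox UNIV u G"
proof (rule tapprox_limit)
  note s = W12D(1,2)[OF W]
  have mu: "u \<in> mble" "G \<in> mble" using s by (auto simp: sq_def)
  note [measurable] = mu
  obtain C where "\<forall>a r. \<exists>\<eta>. test_fun UNIV \<eta> \<and> (\<forall>x. 0 \<le> \<eta> x \<and> \<eta> x \<le> 1) \<and> (\<forall>x\<in>cball a r. \<eta> x = 1)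
     \<and> (\<forall>x. x \<notin> cball a (r + 2 * 1) \<longrightarrow> \<eta> x = 0) \<and> (\<forall>x. norm (grad \<eta> x) \<le> C)"
    using cutoffs[of 1] by auto
  hence "\<forall>n. \<exists>\<eta>. test_fun UNIV \<eta> \<and> (\<forall>x. 0 \<le> \<eta> x \<and> \<eta> x \<le> 1) \<and> (\<forall>x\<in>cball 0 (real n). \<eta> x = 1)
     \<and> (\<forall>x. x \<notin> cball 0 (real n + 2) \<longrightarrow> \<eta> x = 0) \<and> (\<forall>x. norm (grad \<eta> x) \<le> C)"
    by (intro allI) (drule spec[of _ "0::R3"], drule_tac x="real n" in spec, simp)
  then obtain \<eta> where \<eta>: "\<And>n. test_fun UNIV (\<eta> n)" "\<And>n x. 0 \<le> \<eta> n x \<and> \<eta> n x \<le> 1"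
    "\<And>n x. x \<in> cball 0 (real n) \<Longrightarrow> \<eta> n x = 1" "\<And>n x. x \<notin> cball 0 (real n + 2) \<Longrightarrow> \<eta> n x = 0"
    "\<And>n x. norm (grad (\<eta> n) x) \<le> C" by metis
  have [measurable]: "\<eta> n \<in> mble" "grad (\<eta> n) \<in> mble" for n
    using cont_meas C1c_D(4,5)[OF test_fun_C1c[OF \<eta>(1)[of n]]] by blast+
  have C: "C \<ge> 0" using \<eta>(5)[of 0 0] norm_ge_zero order_trans by blast
  have W': "W12 (\<lambda>x. \<eta> n x * u x) (\<lambda>x. \<eta> n x *\<^sub>R G x + u x *\<^sub>R grad (\<eta> n) x)" for n
  proof (rule W12_mult[OF W, where C="max 1 C"])
    show "smooth (\<eta> n)" using \<eta>(1) by (rule test_fun_smooth)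
    show "\<bar>\<eta> n x\<bar> \<le> max 1 C" for x using \<eta>(2)[of n x] by auto
    show "norm (grad (\<eta> n) x) \<le> max 1 C" for x using \<eta>(5)[of n x] by auto
  qed
  have T: "tapprox UNIV (\<lambda>x. \<eta> n x * u x) (\<lambda>x. \<eta> n x *\<^sub>R G x + u x *\<^sub>R grad (\<eta> n) x)" for n
    by (rule mollify_tapprox[OF W', where K="cball 0 (real n + 2)" and h="\<lambda>n. inverse (real (Suc n))" and a="\<lambda>n. 0"])
       (use LIMSEQ_inverse_real_of_nat \<eta>(4)[of _ n] in \<open>auto simp del: of_nat_Suc\<close>)
  have ev: "\<forall>\<^sub>F n in sequentially. x \<in> ball 0 (real n)" for x :: R3
  proof -
    obtain N where "norm x < real N" using reals_Archimedean2 by blast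
    thus ?thesis unfolding eventually_sequentially by (intro exI[of _ N]) auto
  qed
  have ev1: "\<forall>\<^sub>F n in sequentially. \<eta> n x = 1 \<and> grad (\<eta> n) x = 0" for x
    using ev[of x]
  proof eventually_elim
    case (elim n)
    thus ?case using \<eta>(3)[of x n] grad_const_on[of "ball 0 (real n)" x "\<eta> n" 1] \<eta>(3) by auto
  qed
  have w: "sq (\<lambda>x. norm (u x))" "sq (\<lambda>x. norm (G x) + C * norm (u x))"
  proof -
    show a: "sq (\<lambda>x. norm (u x))" using s by (auto simp: sq_def)
    have b: "sq (\<lambda>x. norm (G x))" using s by (auto simp: sq_def)
    show "sq (\<lambda>x. norm (G x) + C * norm (u x))" using sq_add(1)[OF b sq_cmult(1)[OF a, of C]] .
  qed
  have L1: "(\<lambda>n. nsq (\<lambda>x. \<eta> n x * u x - u x)) \<longlonglongrightarrow> 0"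
  proof (rule sq_dominated(3)[OF _ mu(1) _ w(1)])
    show "AE x in lborel. (\<lambda>n. \<eta> n x * u x) \<longlonglongrightarrow> u x"
    proof (rule AE_I2, rule tendsto_eventually)
      fix x show "\<forall>\<^sub>F n in sequentially. \<eta> n x * u x = u x" using ev1[of x] by eventually_elim auto
    qed
    show "AE x in lborel. norm (\<eta> n x * u x) \<le> norm (u x)" for n
    proof (rule AE_I2)
      fix x show "norm (\<eta> n x * u x) \<le> norm (u x)"
        using \<eta>(2)[of n x] mult_right_mono[of "\<eta> n x" 1 "\<bar>u x\<bar>"] by (simp add: abs_mult)
    qed
  qed measurable
  have L2: "(\<lambda>n. nsq (\<lambda>x. (\<eta> n x *\<^sub>R G x + u x *\<^sub>R grad (\<eta> n) x) - G x)) \<longlonglongrightarrow> 0"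
  proof (rule sq_dominated(3)[OF _ mu(2) _ w(2)])
    show "AE x in lborel. (\<lambda>n. \<eta> n x *\<^sub>R G x + u x *\<^sub>R grad (\<eta> n) x) \<longlonglongrightarrow> G x"
    proof (rule AE_I2, rule tendsto_eventually)
      fix x show "\<forall>\<^sub>F n in sequentially. \<eta> n x *\<^sub>R G x + u x *\<^sub>R grad (\<eta> n) x = G x"
        using ev1[of x] by eventually_elim auto
    qed
    show "AE x in lborel. norm (\<eta> n x *\<^sub>R G x + u x *\<^sub>R grad (\<eta> n) x) \<le> norm (G x) + C * norm (u x)" for n
    proof (rule AE_I2)
      fix x
      have "norm (\<eta> n x *\<^sub>R G x) \<le> norm (G x)"
        using \<eta>(2)[of n x] mult_right_mono[of "\<eta> n x" 1 "norm (G x)"] by simp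
      moreover have "norm (u x *\<^sub>R grad (\<eta> n) x) \<le> C * norm (u x)"
        using mult_left_mono[OF \<eta>(5)[of n x], of "\<bar>u x\<bar>"] by (simp add: mult.commute)
      ultimately show "norm (\<eta> n x *\<^sub>R G x + u x *\<^sub>R grad (\<eta> n) x) \<le> norm (G x) + C * norm (u x)"
        by (rule norm_triangle_le[OF add_mono])
    qed
  qed measurable
  fix e :: real assume e: "e > 0"
  have "\<forall>\<^sub>F n in sequentially. nsq (\<lambda>x. \<eta> n x * u x - u x) < e \<and> nsq (\<lambda>x. (\<eta> n x *\<^sub>R G x + u x *\<^sub>R grad (\<eta> n) x) - G x) < e"
    using order_tendstoD(2)[OF L1 e] order_tendstoD(2)[OF L2 e] by (rule eventually_conj)
  then obtain n where "nsq (\<lambda>x. \<eta> n x * u x - u x) < e" "nsq (\<lambda>x. (\<eta> n x *\<^sub>R G x + u x *\<^sub>R grad (\<eta> n) x) - G x) < e"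
    by (auto simp: eventually_sequentially)
  thus "\<exists>v F. sq v \<and> sq F \<and> tapprox UNIV v F \<and> nsq (\<lambda>x. v x - u x) < e \<and> nsq (\<lambda>x. F x - G x) < e"
    using T[of n] W12D(1,2)[OF W'[of n]] by blast
qed (use W12D[OF W] in auto)

lemma tapprox_seq_AE:
  assumes "tapprox U u G" "sq u" "sq G"
  shows "\<exists>\<psi>. (\<forall>n. test_fun U (\<psi> n)) \<and> (\<lambda>n. nsq (\<lambda>x. \<psi> n x - u x)) \<longlonglongrightarrow> 0 \<and> (\<lambda>n. nsq (\<lambda>x. grad (\<psi> n) x - G x)) \<longlonglongrightarrow> 0
    \<and> (AE x in lborel. (\<lambda>n. \<psi> n x) \<longlonglongrightarrow> u x) \<and> (AE x in lborel. (\<lambda>n. grad (\<psi> n) x) \<longlonglongrightarrow> G x)"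
proof -
  obtain \<psi> where p: "\<And>n. test_fun U (\<psi> n)" "(\<lambda>n. nsq (\<lambda>x. \<psi> n x - u x)) \<longlonglongrightarrow> 0" "(\<lambda>n. nsq (\<lambda>x. grad (\<psi> n) x - G x)) \<longlonglongrightarrow> 0"
    using tapprox_seq[OF assms(1)] by blast
  obtain r :: "nat \<Rightarrow> nat" where r: "strict_mono r" "AE x in lborel. (\<lambda>n. \<psi> (r n) x) \<longlonglongrightarrow> u x"
    using L2_AE_subseq[OF sq_diff(1)[OF test_sq(1)[OF p(1)] assms(2)] p(2)] by blast
  have p3: "(\<lambda>n. nsq (\<lambda>x. grad (\<psi> (r n)) x - G x)) \<longlonglongrightarrow> 0"
    using LIMSEQ_subseq_LIMSEQ[OF p(3) r(1)] by (simp add: o_def)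
  obtain r' :: "nat \<Rightarrow> nat" where r': "strict_mono r'" "AE x in lborel. (\<lambda>n. grad (\<psi> (r (r' n))) x) \<longlonglongrightarrow> G x"
    using L2_AE_subseq[of "\<lambda>n. grad (\<psi> (r n))", OF sq_diff(1)[OF test_sq(3)[OF p(1)] assms(3)] p3] by blast
  show ?thesis
  proof (intro exI[of _ "\<lambda>n. \<psi> (r (r' n))"] conjI allI)
    show "test_fun U (\<psi> (r (r' n)))" for n by (rule p(1))
    have rr: "strict_mono (r \<circ> r')" using r r' by (simp add: strict_mono_o)
    show "(\<lambda>n. nsq (\<lambda>x. \<psi> (r (r' n)) x - u x)) \<longlonglongrightarrow> 0" "(\<lambda>n. nsq (\<lambda>x. grad (\<psi> (r (r' n))) x - G x)) \<longlonglongrightarrow> 0"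
      using LIMSEQ_subseq_LIMSEQ[OF p(2) rr] LIMSEQ_subseq_LIMSEQ[OF p(3) rr] by (simp_all add: o_def)
    show "AE x in lborel. (\<lambda>n. \<psi> (r (r' n)) x) \<longlonglongrightarrow> u x"
      using r(2)
    proof eventually_elim
      case (elim x) from LIMSEQ_subseq_LIMSEQ[OF this r'(1)] show ?case by (simp add: o_def)
    qed
    show "AE x in lborel. (\<lambda>n. grad (\<psi> (r (r' n))) x) \<longlonglongrightarrow> G x" by (rule r'(2))
  qed
qed

section \<open>The Sobolev inequality\<close>

text \<open>A square root on the extended nonnegative reals spares all integrability conditions in
  the inequality of Loomis and Whitney.\<close>

definition esqrt :: "ennreal \<Rightarrow> ennreal" where
  "esqrt t = (if t = top then top else ennreal (sqrt (enn2real t)))"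

lemma esqrt_meas [measurable]: "esqrt \<in> borel_measurable borel"
  unfolding esqrt_def by measurable

lemma esqrt_top [simp]: "esqrt top = top"
  by (simp add: esqrt_def)

lemma esqrt_ennreal: "r \<ge> 0 \<Longrightarrow> esqrt (ennreal r) = ennreal (sqrt r)"
  by (simp add: esqrt_def)

lemma esqrt_sq: "(esqrt t)\<^sup>2 = t"
  by (cases t) (auto simp: esqrt_ennreal ennreal_power)

lemma esqrt_power2: "esqrt (t\<^sup>2) = t"
  by (cases t) (auto simp: ennreal_power esqrt_ennreal power2_eq_square simp flip: ennreal_mult)

lemma esqrt_mono: "s \<le> t \<Longrightarrow> esqrt s \<le> esqrt t"
  by (cases s; cases t) (auto simp: esqrt_ennreal top_unique)

lemma esqrt_mult: "esqrt (s * t) = esqrt s * esqrt t"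
proof -
  have "esqrt (s * t) = esqrt ((esqrt s * esqrt t)\<^sup>2)" by (simp add: power_mult_distrib esqrt_sq)
  thus ?thesis by (simp only: esqrt_power2)
qed

lemma esqrt_Cauchy_Schwarz:
  assumes [measurable]: "f \<in> borel_measurable M" "g \<in> borel_measurable M"
  shows "(\<integral>\<^sup>+x. esqrt (f x) * esqrt (g x) \<partial>M) \<le> esqrt (\<integral>\<^sup>+x. f x \<partial>M) * esqrt (\<integral>\<^sup>+x. g x \<partial>M)"
proof -
  have "(\<integral>\<^sup>+x. esqrt (f x) * esqrt (g x) \<partial>M)\<^sup>2 \<le> (\<integral>\<^sup>+x. (esqrt (f x))\<^sup>2 \<partial>M) * (\<integral>\<^sup>+x. (esqrt (g x))\<^sup>2 \<partial>M)"
    by (rule Cauchy_Schwarz_nn_integral) measurable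
  from esqrt_mono[OF this] show ?thesis by (simp add: esqrt_power2 esqrt_sq esqrt_mult)
qed

text \<open>Integrate in \<open>z\<close>, then in \<open>y\<close>, then in \<open>x\<close>: each
  time exactly two of the remaining factors depend on the variable, so Cauchy-Schwarz applies once
  per variable.\<close>

lemma Loomis_Whitney:
  fixes a b c :: "real \<Rightarrow> real \<Rightarrow> ennreal"
  assumes [measurable]: "case_prod a \<in> borel_measurable borel" "case_prod b \<in> borel_measurable borel"
    "case_prod c \<in> borel_measurable borel"
  shows "(\<integral>\<^sup>+x. \<integral>\<^sup>+y. \<integral>\<^sup>+z. esqrt (a y z) * esqrt (b x z) * esqrt (c x y) \<partial>lborel \<partial>lborel \<partial>lborel)
    \<le> esqrt (\<integral>\<^sup>+y. \<integral>\<^sup>+z. a y z \<partial>lborel \<partial>lborel) * esqrt (\<integral>\<^sup>+x. \<integral>\<^sup>+z. b x z \<partial>lborel \<partial>lborel)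
      * esqrt (\<integral>\<^sup>+x. \<integral>\<^sup>+y. c x y \<partial>lborel \<partial>lborel)"
proof -
  have [measurable]: "case_prod a \<in> borel_measurable (borel \<Otimes>\<^sub>M borel)" "case_prod b \<in> borel_measurable (borel \<Otimes>\<^sub>M borel)"
    "case_prod c \<in> borel_measurable (borel \<Otimes>\<^sub>M borel)"
    using assms by (simp_all add: borel_prod)
  define A where "A y = (\<integral>\<^sup>+z. a y z \<partial>lborel)" for y
  define B where "B x = (\<integral>\<^sup>+z. b x z \<partial>lborel)" for x
  define C where "C x = (\<integral>\<^sup>+y. c x y \<partial>lborel)" for x
  have [measurable]: "A \<in> borel_measurable borel" "B \<in> borel_measurable borel" "C \<in> borel_measurable borel"
    unfolding A_def B_def C_def by measurable
  have 1: "(\<integral>\<^sup>+z. esqrt (a y z) * esqrt (b x z) * esqrt (c x y) \<partial>lborel) \<le> esqrt (A y) * esqrt (B x) * esqrt (c x y)" for x y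
  proof -
    have "(\<integral>\<^sup>+z. esqrt (a y z) * esqrt (b x z) * esqrt (c x y) \<partial>lborel) = (\<integral>\<^sup>+z. esqrt (a y z) * esqrt (b x z) \<partial>lborel) * esqrt (c x y)"
      by (rule nn_integral_multc) measurable
    also have "\<dots> \<le> esqrt (A y) * esqrt (B x) * esqrt (c x y)"
      unfolding A_def B_def by (intro mult_right_mono esqrt_Cauchy_Schwarz) auto
    finally show ?thesis .
  qed
  have 2: "(\<integral>\<^sup>+y. esqrt (A y) * esqrt (B x) * esqrt (c x y) \<partial>lborel) \<le> esqrt (integral\<^sup>N lborel A) * (esqrt (B x) * esqrt (C x))" for x
  proof -
    have "(\<integral>\<^sup>+y. esqrt (A y) * esqrt (B x) * esqrt (c x y) \<partial>lborel) = (\<integral>\<^sup>+y. esqrt (A y) * esqrt (c x y) * esqrt (B x) \<partial>lborel)"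
      by (simp add: mult_ac)
    also have "\<dots> = (\<integral>\<^sup>+y. esqrt (A y) * esqrt (c x y) \<partial>lborel) * esqrt (B x)"
      by (rule nn_integral_multc) measurable
    also have "\<dots> \<le> esqrt (integral\<^sup>N lborel A) * esqrt (C x) * esqrt (B x)"
      unfolding C_def by (intro mult_right_mono esqrt_Cauchy_Schwarz) auto
    finally show ?thesis by (simp add: mult_ac)
  qed
  have "(\<integral>\<^sup>+x. \<integral>\<^sup>+y. \<integral>\<^sup>+z. esqrt (a y z) * esqrt (b x z) * esqrt (c x y) \<partial>lborel \<partial>lborel \<partial>lborel)
     \<le> (\<integral>\<^sup>+x. esqrt (integral\<^sup>N lborel A) * (esqrt (B x) * esqrt (C x)) \<partial>lborel)"
    by (intro nn_integral_mono order_trans[OF nn_integral_mono[OF 1] 2])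
  also have "\<dots> = esqrt (integral\<^sup>N lborel A) * (\<integral>\<^sup>+x. esqrt (B x) * esqrt (C x) \<partial>lborel)"
    by (rule nn_integral_cmult) measurable
  also have "\<dots> \<le> esqrt (integral\<^sup>N lborel A) * (esqrt (integral\<^sup>N lborel B) * esqrt (integral\<^sup>N lborel C))"
    by (intro mult_left_mono esqrt_Cauchy_Schwarz) auto
  finally show ?thesis by (simp add: A_def[abs_def] B_def[abs_def] C_def[abs_def] mult.assoc)
qed

definition vec3 :: "real \<times> real \<times> real \<Rightarrow> R3" where
  "vec3 p = (case p of (x, y, z) \<Rightarrow> x *\<^sub>R axis 1 1 + y *\<^sub>R axis 2 1 + z *\<^sub>R axis 3 1)"

lemma vec3_nth [simp]: "vec3 (x, y, z) $ 1 = x" "vec3 (x, y, z) $ 2 = y" "vec3 (x, y, z) $ 3 = z"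
  by (auto simp: vec3_def axis_def)

lemma vec3_cont: "continuous_on UNIV vec3"
  unfolding vec3_def case_prod_unfold by (intro continuous_intros)

lemma vec3_meas [measurable]: "vec3 \<in> borel_measurable borel"
  by (rule borel_measurable_continuous_onI[OF vec3_cont])

text \<open>The two measures agree on boxes. The coordinates become an iterated product, for which
  Tonelli's theorem is available.\<close>

lemma lborel_vec3: "distr lborel borel vec3 = (lborel :: R3 measure)"
proof (rule lborel_eqI[symmetric])
  fix l u :: R3 assume le: "\<And>b. b \<in> Basis \<Longrightarrow> l \<bullet> b \<le> u \<bullet> b"
  have lei: "l $ i \<le> u $ i" for i using le[of "axis i 1"] by (simp add: inner_axis)
  have v: "vec3 -` box l u = box (l $ 1) (u $ 1) \<times> box (l $ 2) (u $ 2) \<times> box (l $ 3) (u $ 3)"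
    by (auto simp: mem_box_cart forall_3 box_real)
  have "emeasure (distr lborel borel vec3) (box l u) = emeasure lborel (vec3 -` box l u)"
    by (subst emeasure_distr) auto
  also have "\<dots> = emeasure (lborel \<Otimes>\<^sub>M (lborel \<Otimes>\<^sub>M lborel)) (box (l $ 1) (u $ 1) \<times> box (l $ 2) (u $ 2) \<times> box (l $ 3) (u $ 3))"
    by (simp add: v lborel_prod)
  also have "\<dots> = emeasure lborel (box (l $ 1) (u $ 1)) * emeasure (lborel \<Otimes>\<^sub>M lborel) (box (l $ 2) (u $ 2) \<times> box (l $ 3) (u $ 3))"
  proof (rule sigma_finite_measure.emeasure_pair_measure_Times)
    show "sigma_finite_measure (lborel \<Otimes>\<^sub>M lborel :: (real \<times> real) measure)"
      by (simp only: lborel_prod sigma_finite_lborel)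
    show "box (l $ 2) (u $ 2) \<times> box (l $ 3) (u $ 3) \<in> sets (lborel \<Otimes>\<^sub>M lborel)" by (intro pair_measureI) auto
  qed simp
  also have "emeasure (lborel \<Otimes>\<^sub>M lborel) (box (l $ 2) (u $ 2) \<times> box (l $ 3) (u $ 3)) = emeasure lborel (box (l $ 2) (u $ 2)) * emeasure lborel (box (l $ 3) (u $ 3))"
    by (rule lborel.emeasure_pair_measure_Times) auto
  also have "emeasure lborel (box (l $ 1) (u $ 1)) * \<dots> = ennreal ((u $ 1 - l $ 1) * ((u $ 2 - l $ 2) * (u $ 3 - l $ 3)))"
    using lei by (simp add: box_real ennreal_mult)
  also have "(u $ 1 - l $ 1) * ((u $ 2 - l $ 2) * (u $ 3 - l $ 3)) = (\<Prod>b\<in>Basis. (u - l) \<bullet> b)"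
  proof -
    have B: "(Basis :: R3 set) = (\<lambda>i. axis i 1) ` UNIV" by (auto simp: Basis_vec_def)
    have "inj (\<lambda>i::3. axis i (1::real))" by (auto simp: inj_on_def axis_eq_axis)
    hence "(\<Prod>b\<in>Basis. (u - l) \<bullet> b) = (\<Prod>i\<in>UNIV. (u - l) \<bullet> axis i 1)"
      unfolding B by (subst prod.reindex) auto
    also have "\<dots> = (\<Prod>i\<in>{1, 2, 3}. (u - l) $ i)" by (simp only: inner_axis UNIV_3 inner_real_def mult_1_right)
    finally show ?thesis by simp
  qed
  finally show "emeasure (distr lborel borel vec3) (box l u) = ennreal (\<Prod>b\<in>Basis. (u - l) \<bullet> b)" .
qed simp

lemma nn_integral_vec3:
  assumes [measurable]: "f \<in> borel_measurable borel"
  shows "(\<integral>\<^sup>+w. f w \<partial>lborel) = (\<integral>\<^sup>+x. \<integral>\<^sup>+y. \<integral>\<^sup>+z. f (vec3 (x, y, z)) \<partial>lborel \<partial>lborel \<partial>lborel)"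
proof -
  have m: "(\<lambda>p. f (vec3 p)) \<in> borel_measurable borel" by measurable
  have m1: "(\<lambda>p. f (vec3 p)) \<in> borel_measurable (lborel \<Otimes>\<^sub>M lborel)" using m by (simp add: lborel_prod)
  have m2: "(\<lambda>q. f (vec3 (x, q))) \<in> borel_measurable (lborel \<Otimes>\<^sub>M lborel)" for x
  proof -
    have "(\<lambda>q. f (vec3 (x, q))) \<in> borel_measurable borel" by measurable
    thus ?thesis by (simp add: lborel_prod)
  qed
  have "(\<integral>\<^sup>+w. f w \<partial>lborel) = (\<integral>\<^sup>+w. f w \<partial>distr lborel borel vec3)" by (simp add: lborel_vec3)
  also have "\<dots> = (\<integral>\<^sup>+p. f (vec3 p) \<partial>lborel)" by (rule nn_integral_distr) auto
  also have "\<dots> = (\<integral>\<^sup>+p. f (vec3 p) \<partial>(lborel \<Otimes>\<^sub>M lborel))" by (simp add: lborel_prod)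
  also have "\<dots> = (\<integral>\<^sup>+x. \<integral>\<^sup>+q. f (vec3 (x, q)) \<partial>lborel \<partial>lborel)"
    by (rule sigma_finite_measure.nn_integral_fst[OF sigma_finite_lborel m1, symmetric])
  also have "\<dots> = (\<integral>\<^sup>+x. (\<integral>\<^sup>+q. f (vec3 (x, q)) \<partial>(lborel \<Otimes>\<^sub>M lborel)) \<partial>lborel)" by (simp add: lborel_prod)
  also have "\<dots> = (\<integral>\<^sup>+x. \<integral>\<^sup>+y. \<integral>\<^sup>+z. f (vec3 (x, y, z)) \<partial>lborel \<partial>lborel \<partial>lborel)"
    by (rule nn_integral_cong) (rule lborel.nn_integral_fst[OF m2, symmetric])
  finally show ?thesis .
qed

lemma line_bound:
  assumes v: "C1c v"
  shows "ennreal \<bar>v (w + t *\<^sub>R axis i 1)\<bar> \<le> (\<integral>\<^sup>+s. ennreal \<bar>pd v i (w + s *\<^sub>R axis i 1)\<bar> \<partial>lborel)"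
proof -
  let ?e = "axis i 1 :: R3"
  obtain R where R: "\<And>x. x \<notin> cball 0 R \<Longrightarrow> v x = 0" using v by (auto simp: C1c_def)
  \<comment> \<open>A parameter to the left of \<open>t\<close> at which the line has left the
    support of \<open>v\<close>.\<close>
  define m where "m = min t (- (\<bar>R\<bar> + norm w + 1))"
  have "\<bar>m\<bar> > R + norm w" by (auto simp: m_def)
  hence "norm (w + m *\<^sub>R ?e) > R" using norm_triangle_ineq2[of "m *\<^sub>R ?e" "- w"] by (simp add: norm_axis_1 add.commute)
  hence z: "v (w + m *\<^sub>R ?e) = 0" using R by simp
  have mt: "m \<le> t" by (simp add: m_def)
  have d: "v differentiable (at x)" for x using v by (simp add: C1c_def Ck.simps)
  have D: "((\<lambda>s. v (w + s *\<^sub>R ?e)) has_vector_derivative pd v i (w + s *\<^sub>R ?e)) (at s within {m..t})" for s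
  proof -
    have "((\<lambda>s. w + s *\<^sub>R ?e) has_derivative (\<lambda>h. h *\<^sub>R ?e)) (at s)" by (auto intro!: derivative_eq_intros)
    from has_derivative_compose[OF this has_derivative_grad[OF d]]
    have "((\<lambda>s. v (w + s *\<^sub>R ?e)) has_derivative (\<lambda>h. h *\<^sub>R pd v i (w + s *\<^sub>R ?e))) (at s)"
      by (simp add: grad_def inner_axis)
    thus ?thesis by (simp add: has_vector_derivative_def has_derivative_at_withinI)
  qed
  have c: "continuous_on UNIV (pd v i)" using v by (simp add: C1c_def Ck.simps)
  have c2: "continuous_on {m..t} (\<lambda>s. pd v i (w + s *\<^sub>R ?e))"
    by (rule continuous_on_compose2[OF c]) (auto intro!: continuous_intros)
  have "has_bochner_integral lborel (\<lambda>s. indicator {m..t} s *\<^sub>R pd v i (w + s *\<^sub>R ?e)) (v (w + t *\<^sub>R ?e) - v (w + m *\<^sub>R ?e))"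
    by (rule has_bochner_integral_FTC_Icc[OF mt D c2])
  hence i: "integrable lborel (\<lambda>s. indicator {m..t} s *\<^sub>R pd v i (w + s *\<^sub>R ?e))"
    and e: "(LBINT s. indicator {m..t} s *\<^sub>R pd v i (w + s *\<^sub>R ?e)) = v (w + t *\<^sub>R ?e)"
    using z by (auto simp: has_bochner_integral_iff)
  have "ennreal (norm (v (w + t *\<^sub>R ?e))) \<le> (\<integral>\<^sup>+s. ennreal (norm (indicator {m..t} s *\<^sub>R pd v i (w + s *\<^sub>R ?e))) \<partial>lborel)"
    using integral_norm_bound_ennreal[OF i] unfolding e .
  also have "\<dots> \<le> (\<integral>\<^sup>+s. ennreal \<bar>pd v i (w + s *\<^sub>R ?e)\<bar> \<partial>lborel)"
    by (intro nn_integral_mono ennreal_leI) (auto simp: indicator_def)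
  finally show ?thesis by simp
qed

text \<open>The line integral of a partial derivative in one coordinate bounds \<open>v\<close> and
  does not depend on that coordinate, so the product of the three has the shape that Loomis and
  Whitney require. This is the Sobolev inequality for gradients in L^1, with exponent 3/2.\<close>

lemma Gagliardo:
  assumes v: "C1c v" "\<And>x. v x \<ge> 0"
  shows "(\<integral>\<^sup>+w. esqrt (ennreal (v w ^ 3)) \<partial>lborel) \<le> (esqrt (\<integral>\<^sup>+w. ennreal (norm (grad v w)) \<partial>lborel)) ^ 3"
proof -
  have cp: "continuous_on UNIV (pd v i)" for i using v by (simp add: C1c_def Ck.simps)
  have mv: "v \<in> borel_measurable borel" using cont_meas[OF C1c_D(4)[OF v(1)]] by simp
  note [measurable] = mv
  have mg [measurable]: "grad v \<in> borel_measurable borel" using cont_meas[OF C1c_D(5)[OF v(1)]] by simp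
  define g where "g i x y z = ennreal \<bar>pd v i (vec3 (x, y, z))\<bar>" for i :: 3 and x y z
  have gm: "(\<lambda>(x, y, z). g i x y z) \<in> borel_measurable borel" for i
  proof -
    have "(\<lambda>p. pd v i (vec3 p)) \<in> borel_measurable borel"
      by (intro borel_measurable_continuous_onI continuous_on_compose2[OF cp vec3_cont]) auto
    thus ?thesis unfolding g_def case_prod_unfold prod.collapse by measurable
  qed
  have gm3: "(\<lambda>(x, y, z). g i x y z) \<in> borel_measurable (borel \<Otimes>\<^sub>M borel \<Otimes>\<^sub>M borel)" for i
    using gm by (simp add: borel_prod)
  have [measurable (raw)]: "(\<lambda>p. g i (X p) (Y p) (Z p)) \<in> borel_measurable M"
    if [measurable]: "X \<in> borel_measurable M" "Y \<in> borel_measurable M" "Z \<in> borel_measurable M"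
    for i X Y Z and M :: "'m measure"
  proof -
    have "(\<lambda>p. (X p, Y p, Z p)) \<in> M \<rightarrow>\<^sub>M borel \<Otimes>\<^sub>M borel \<Otimes>\<^sub>M borel" by measurable
    from measurable_compose[OF this gm3[of i]] show ?thesis by simp
  qed
  note gm4 = this
  define a where "a y z = (\<integral>\<^sup>+s. g 1 s y z \<partial>lborel)" for y z
  define b where "b x z = (\<integral>\<^sup>+s. g 2 x s z \<partial>lborel)" for x z
  define c where "c x y = (\<integral>\<^sup>+s. g 3 x y s \<partial>lborel)" for x y
  have am: "case_prod a \<in> borel_measurable borel" "case_prod b \<in> borel_measurable borel" "case_prod c \<in> borel_measurable borel"
  proof -
    have "(\<lambda>(p, s). g 1 s (fst p) (snd p)) \<in> borel_measurable ((borel \<Otimes>\<^sub>M borel) \<Otimes>\<^sub>M lborel)"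
      unfolding case_prod_unfold by (rule gm4) measurable
    from lborel.borel_measurable_nn_integral[OF this]
    show "case_prod a \<in> borel_measurable borel" by (simp add: a_def[abs_def] case_prod_unfold borel_prod)
    have "(\<lambda>(p, s). g 2 (fst p) s (snd p)) \<in> borel_measurable ((borel \<Otimes>\<^sub>M borel) \<Otimes>\<^sub>M lborel)"
      unfolding case_prod_unfold by (rule gm4) measurable
    from lborel.borel_measurable_nn_integral[OF this]
    show "case_prod b \<in> borel_measurable borel" by (simp add: b_def[abs_def] case_prod_unfold borel_prod)
    have "(\<lambda>(p, s). g 3 (fst p) (snd p) s) \<in> borel_measurable ((borel \<Otimes>\<^sub>M borel) \<Otimes>\<^sub>M lborel)"
      unfolding case_prod_unfold by (rule gm4) measurable
    from lborel.borel_measurable_nn_integral[OF this]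
    show "case_prod c \<in> borel_measurable borel" by (simp add: c_def[abs_def] case_prod_unfold borel_prod)
  qed
  have va: "ennreal (v (vec3 (x, y, z))) \<le> a y z" for x y z
  proof -
    have e: "vec3 (s, y, z) = vec3 (0, y, z) + s *\<^sub>R axis 1 1" for s by (simp add: vec3_def)
    have g: "g 1 s y z = ennreal \<bar>pd v 1 (vec3 (0, y, z) + s *\<^sub>R axis 1 1)\<bar>" for s by (simp only: g_def e[of s])
    show ?thesis using line_bound[OF v(1), of "vec3 (0, y, z)" x 1] by (simp only: a_def g e[of x] abs_of_nonneg[OF v(2)])
  qed
  have vb: "ennreal (v (vec3 (x, y, z))) \<le> b x z" for x y z
  proof -
    have e: "vec3 (x, s, z) = vec3 (x, 0, z) + s *\<^sub>R axis 2 1" for s by (simp add: vec3_def)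
    have g: "g 2 x s z = ennreal \<bar>pd v 2 (vec3 (x, 0, z) + s *\<^sub>R axis 2 1)\<bar>" for s by (simp only: g_def e[of s])
    show ?thesis using line_bound[OF v(1), of "vec3 (x, 0, z)" y 2] by (simp only: b_def g e[of y] abs_of_nonneg[OF v(2)])
  qed
  have vc: "ennreal (v (vec3 (x, y, z))) \<le> c x y" for x y z
  proof -
    have e: "vec3 (x, y, s) = vec3 (x, y, 0) + s *\<^sub>R axis 3 1" for s by (simp add: vec3_def)
    have g: "g 3 x y s = ennreal \<bar>pd v 3 (vec3 (x, y, 0) + s *\<^sub>R axis 3 1)\<bar>" for s by (simp only: g_def e[of s])
    show ?thesis using line_bound[OF v(1), of "vec3 (x, y, 0)" z 3] by (simp only: c_def g e[of z] abs_of_nonneg[OF v(2)])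
  qed
  let ?D = "\<integral>\<^sup>+w. ennreal (norm (grad v w)) \<partial>lborel"
  have gD: "(\<integral>\<^sup>+x. \<integral>\<^sup>+y. \<integral>\<^sup>+z. g i x y z \<partial>lborel \<partial>lborel \<partial>lborel) \<le> ?D" for i
  proof -
    have m: "(\<lambda>w. ennreal \<bar>pd v i w\<bar>) \<in> borel_measurable borel"
      using borel_measurable_continuous_onI[OF cp] by measurable
    have "(\<integral>\<^sup>+x. \<integral>\<^sup>+y. \<integral>\<^sup>+z. g i x y z \<partial>lborel \<partial>lborel \<partial>lborel) = (\<integral>\<^sup>+w. ennreal \<bar>pd v i w\<bar> \<partial>lborel)"
      unfolding g_def by (rule nn_integral_vec3[OF m, symmetric])
    also have "\<dots> \<le> ?D"
    proof (intro nn_integral_mono ennreal_leI)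
      fix w show "\<bar>pd v i w\<bar> \<le> norm (grad v w)" using component_le_norm_cart[of "grad v w" i] by (simp add: grad_def)
    qed
    finally show ?thesis .
  qed
  have cD: "(\<integral>\<^sup>+x. \<integral>\<^sup>+y. c x y \<partial>lborel \<partial>lborel) \<le> ?D" unfolding c_def by (rule gD)
  have bD: "(\<integral>\<^sup>+x. \<integral>\<^sup>+z. b x z \<partial>lborel \<partial>lborel) \<le> ?D"
  proof -
    have "(\<integral>\<^sup>+z. b x z \<partial>lborel) = (\<integral>\<^sup>+y. \<integral>\<^sup>+z. g 2 x y z \<partial>lborel \<partial>lborel)" for x
      unfolding b_def by (rule lborel_pair.Fubini') measurable
    thus ?thesis using gD[of 2] by simp
  qed
  have aD: "(\<integral>\<^sup>+y. \<integral>\<^sup>+z. a y z \<partial>lborel \<partial>lborel) \<le> ?D"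
  proof -
    have "(\<integral>\<^sup>+y. \<integral>\<^sup>+z. a y z \<partial>lborel \<partial>lborel) = (\<integral>\<^sup>+y. \<integral>\<^sup>+x. \<integral>\<^sup>+z. g 1 x y z \<partial>lborel \<partial>lborel \<partial>lborel)"
      unfolding a_def by (intro nn_integral_cong lborel_pair.Fubini') measurable
    also have "\<dots> = (\<integral>\<^sup>+x. \<integral>\<^sup>+y. \<integral>\<^sup>+z. g 1 x y z \<partial>lborel \<partial>lborel \<partial>lborel)"
      by (rule lborel_pair.Fubini') measurable
    finally show ?thesis using gD[of 1] by simp
  qed
  have "(\<integral>\<^sup>+w. esqrt (ennreal (v w ^ 3)) \<partial>lborel)
     = (\<integral>\<^sup>+x. \<integral>\<^sup>+y. \<integral>\<^sup>+z. esqrt (ennreal (v (vec3 (x, y, z)) ^ 3)) \<partial>lborel \<partial>lborel \<partial>lborel)"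
    by (rule nn_integral_vec3) measurable
  also have "\<dots> \<le> (\<integral>\<^sup>+x. \<integral>\<^sup>+y. \<integral>\<^sup>+z. esqrt (a y z) * esqrt (b x z) * esqrt (c x y) \<partial>lborel \<partial>lborel \<partial>lborel)"
  proof (intro nn_integral_mono)
    fix x y z
    let ?v = "ennreal (v (vec3 (x, y, z)))"
    have "ennreal (v (vec3 (x, y, z)) ^ 3) = ?v * ?v * ?v"
      using v(2) by (simp add: power3_eq_cube ennreal_mult)
    also have "\<dots> \<le> a y z * b x z * c x y" by (intro mult_mono va vb vc) auto
    finally show "esqrt (ennreal (v (vec3 (x, y, z)) ^ 3)) \<le> esqrt (a y z) * esqrt (b x z) * esqrt (c x y)"
      using esqrt_mono by (simp flip: esqrt_mult)
  qed
  also have "\<dots> \<le> esqrt (\<integral>\<^sup>+y. \<integral>\<^sup>+z. a y z \<partial>lborel \<partial>lborel) * esqrt (\<integral>\<^sup>+x. \<integral>\<^sup>+z. b x z \<partial>lborel \<partial>lborel)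
      * esqrt (\<integral>\<^sup>+x. \<integral>\<^sup>+y. c x y \<partial>lborel \<partial>lborel)"
    by (rule Loomis_Whitney[OF am])
  also have "\<dots> \<le> esqrt ?D * esqrt ?D * esqrt ?D"
    by (intro mult_mono esqrt_mono aD bD cD) auto
  finally show ?thesis by (simp add: power3_eq_cube)
qed

text \<open>Apply the L^1 inequality to \<open>\<psi> ^ 4\<close>, whose gradient is
  \<open>4 * \<psi> ^ 3\<close> times that of \<open>\<psi>\<close>. Let P be the integral of
  \<open>\<psi> ^ 6\<close>, A the Dirichlet integral and D the L^1 norm of the new gradient. Then P
  <= D^(3/2) and D <= 4 sqrt(P A), so P^4 <= 16^3 P^3 A^3, and 4096 is 16^3.\<close>

lemma Sobolev_test:
  assumes t: "test_fun UNIV \<psi>"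
  shows "integrable lborel (\<lambda>x. \<psi> x ^ 6)" "(LBINT x. \<psi> x ^ 6) \<le> 4096 * (nsq (grad \<psi>)) ^ 3"
proof -
  have sm: "smooth \<psi>" using t by (rule test_fun_smooth)
  have t2: "test_fun UNIV (\<lambda>x. \<psi> x * \<psi> x)" by (rule test_fun_mult[OF t sm])
  have t3: "test_fun UNIV (\<lambda>x. \<psi> x * (\<psi> x * \<psi> x))" by (rule test_fun_mult[OF t2 sm])
  have t4: "test_fun UNIV (\<lambda>x. \<psi> x * (\<psi> x * (\<psi> x * \<psi> x)))" by (rule test_fun_mult[OF t3 sm])
  have s3: "sq (\<lambda>x. \<psi> x * (\<psi> x * \<psi> x))" by (rule test_sq(1)[OF t3])
  have p6: "(norm (\<psi> x * (\<psi> x * \<psi> x)))\<^sup>2 = \<psi> x ^ 6" for x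
    by (simp add: power2_abs power_mult_distrib flip: power_add power_Suc)
  show i6: "integrable lborel (\<lambda>x. \<psi> x ^ 6)" using sq_int[OF s3] unfolding p6 .
  define P where "P = (LBINT x. \<psi> x ^ 6)"
  define A where "A = nsq (grad \<psi>)"
  have P3: "nsq (\<lambda>x. \<psi> x * (\<psi> x * \<psi> x)) = P" unfolding nsq_def p6 P_def ..
  have P0: "P \<ge> 0" and A0: "A \<ge> 0" using nsq_nonneg[of "\<lambda>x. \<psi> x * (\<psi> x * \<psi> x)"] unfolding P3 by (auto simp: A_def)
  define v where "v = (\<lambda>x. \<psi> x * (\<psi> x * (\<psi> x * \<psi> x)))"
  have d: "\<psi> differentiable (at x)" "(\<lambda>x. \<psi> x * \<psi> x) differentiable (at x)" "(\<lambda>x. \<psi> x * (\<psi> x * \<psi> x)) differentiable (at x)" for x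
    using test_diff[OF t] test_diff[OF t2] test_diff[OF t3] by auto
  have gv: "grad v x = (4 * (\<psi> x * (\<psi> x * \<psi> x))) *\<^sub>R grad \<psi> x" for x
    unfolding v_def using d by (simp add: grad_mult algebra_simps flip: scaleR_add_left)
  have vC: "C1c v" unfolding v_def by (rule test_fun_C1c[OF t4])
  have v0: "v x \<ge> 0" for x 
  proof -
    have "v x = (\<psi> x * \<psi> x)\<^sup>2" by (simp add: v_def power2_eq_square mult.assoc)
    thus ?thesis by simp
  qed
  define D where "D = (LBINT x. norm (4 * (\<psi> x * (\<psi> x * \<psi> x))) * norm (grad \<psi> x))"
  have s34: "sq (\<lambda>x. 4 * (\<psi> x * (\<psi> x * \<psi> x)))" "nsq (\<lambda>x. 4 * (\<psi> x * (\<psi> x * \<psi> x))) = 16 * P"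
    using sq_cmult[where u="\<lambda>x. \<psi> x * (\<psi> x * \<psi> x)" and c=4] s3 P3 by auto
  have D0: "D \<ge> 0" unfolding D_def by (intro Bochner_Integration.integral_nonneg) simp
  have DA: "D \<le> 4 * sqrt P * sqrt A"
    using L2_CS_norm[OF s34(1) test_sq(3)[OF t]] s34(2) P0 unfolding D_def A_def by (simp add: real_sqrt_mult)
  have nD: "(\<integral>\<^sup>+w. ennreal (norm (grad v w)) \<partial>lborel) = ennreal D"
    unfolding gv norm_scaleR D_def real_norm_def[symmetric]
    by (rule nn_integral_eq_integral[OF sq_norm_mult_int[OF s34(1) test_sq(3)[OF t]]]) simp
  have "esqrt (ennreal (v w ^ 3)) = ennreal (\<psi> w ^ 6)" for w
  proof -
    have "v w ^ 3 = (\<psi> w ^ 6)\<^sup>2" by (simp add: v_def power_numeral_reduce)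
    hence "ennreal (v w ^ 3) = (ennreal (\<psi> w ^ 6))\<^sup>2" by (simp add: ennreal_power zero_le_even_power)
    thus ?thesis by (simp only: esqrt_power2)
  qed
  hence nP: "(\<integral>\<^sup>+w. esqrt (ennreal (v w ^ 3)) \<partial>lborel) = ennreal P"
    unfolding P_def using i6 by (simp add: nn_integral_eq_integral zero_le_even_power)
  have "ennreal P \<le> ennreal (sqrt D ^ 3)"
    using Gagliardo[OF vC v0] D0 unfolding nD nP by (simp add: esqrt_ennreal ennreal_power)
  hence "P \<le> sqrt D ^ 3" using D0 by (simp add: ennreal_le_iff)
  hence "P\<^sup>2 \<le> (sqrt D ^ 3)\<^sup>2" using P0 by (intro power_mono)
  also have "(sqrt D ^ 3)\<^sup>2 = ((sqrt D)\<^sup>2) ^ 3" by (simp only: power_mult[symmetric] mult.commute)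
  also have "\<dots> = D ^ 3" using D0 by simp
  also have "D ^ 3 \<le> (4 * sqrt P * sqrt A) ^ 3" using DA D0 by (intro power_mono)
  finally have "(P\<^sup>2)\<^sup>2 \<le> ((4 * sqrt P * sqrt A) ^ 3)\<^sup>2" by (intro power_mono) auto
  also have "\<dots> = ((4 * sqrt P * sqrt A)\<^sup>2) ^ 3" by (simp only: power_mult[symmetric] mult.commute)
  also have "(4 * sqrt P * sqrt A)\<^sup>2 = 16 * P * A" using P0 A0 by (simp add: power_mult_distrib)
  finally have le: "P * P ^ 3 \<le> (4096 * A ^ 3) * P ^ 3"
    by (simp add: power_mult_distrib power_numeral_reduce mult_ac)
  show "(LBINT x. \<psi> x ^ 6) \<le> 4096 * (nsq (grad \<psi>)) ^ 3"
  proof (cases "P = 0")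
    case True thus ?thesis using A0 unfolding P_def A_def by simp
  next
    case False
    hence "P ^ 3 > 0" using P0 by simp
    thus ?thesis using le unfolding P_def[symmetric] A_def[symmetric] by (simp only: mult_le_cancel_right_pos)
  qed
qed

text \<open>Fatou along an almost everywhere convergent approximation; the room \<open>e\<close>
  turns convergence of the right sides into an eventual bound.\<close>

theorem Sobolev:
  assumes W: "W12 u G"
  shows "integrable lborel (\<lambda>x. u x ^ 6)" "(LBINT x. u x ^ 6) \<le> 4096 * (nsq G) ^ 3"
proof -
  obtain \<psi> where p0: "\<forall>n. test_fun UNIV (\<psi> n)" and p1: "(\<lambda>n. nsq (\<lambda>x. \<psi> n x - u x)) \<longlonglongrightarrow> 0"
    "(\<lambda>n. nsq (\<lambda>x. grad (\<psi> n) x - G x)) \<longlonglongrightarrow> 0"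
    "AE x in lborel. (\<lambda>n. \<psi> n x) \<longlonglongrightarrow> u x" "AE x in lborel. (\<lambda>n. grad (\<psi> n) x) \<longlonglongrightarrow> G x"
    using tapprox_seq_AE[OF W12_density[OF W] W12D(1,2)[OF W]] by (elim exE conjE) (rule that)
  note p = p0[rule_format] p1
  have [measurable]: "u \<in> mble" using W12D(1)[OF W] by (rule sq_meas)
  have lim: "(\<lambda>n. 4096 * (nsq (grad (\<psi> n))) ^ 3) \<longlonglongrightarrow> 4096 * (nsq G) ^ 3"
    by (intro tendsto_intros L2_nsq_conv[OF test_sq(3)[OF p(1)] W12D(2)[OF W] p(3)])
  have *: "integrable lborel (\<lambda>x. u x ^ 6) \<and> (LBINT x. u x ^ 6) \<le> 4096 * (nsq G) ^ 3 + e" if "e > 0" for e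
  proof -
    have "\<forall>\<^sub>F n in sequentially. 4096 * (nsq (grad (\<psi> n))) ^ 3 < 4096 * (nsq G) ^ 3 + e"
      using order_tendstoD(2)[OF lim] that by simp
    hence ev: "\<forall>\<^sub>F n in sequentially. (LBINT x. \<psi> n x ^ 6) \<le> 4096 * (nsq G) ^ 3 + e"
      by eventually_elim (use Sobolev_test(2)[OF p(1)] in \<open>meson order_le_less_trans less_imp_le\<close>)
    have l: "AE x in lborel. (\<lambda>n. \<psi> n x ^ 6) \<longlonglongrightarrow> u x ^ 6"
      using p(4) by eventually_elim (intro tendsto_intros)
    have m: "(\<lambda>x. u x ^ 6) \<in> mble" by measurable
    have z: "AE x in lborel. 0 \<le> \<psi> n x ^ 6" for n by (rule AE_I2) (simp add: zero_le_even_power)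
    show ?thesis using fatou_real(1,2)[OF Sobolev_test(1)[OF p(1)] z l m ev] by blast
  qed
  show "integrable lborel (\<lambda>x. u x ^ 6)" using *[of 1] by simp
  show "(LBINT x. u x ^ 6) \<le> 4096 * (nsq G) ^ 3" by (rule field_le_epsilon) (use * in blast)
qed

section \<open>Compactness\<close>

text \<open>The increment is the integral of the gradient over the segment. Cauchy-Schwarz in the
  parameter and translation invariance in \<open>x\<close> give the bound.\<close>

lemma transl_test:
  assumes t: "test_fun UNIV \<psi>"
  shows "nsq (\<lambda>x. \<psi> (x + z) - \<psi> x) \<le> (norm z)\<^sup>2 * nsq (grad \<psi>)"
proof -
  note C = test_fun_C1c[OF t]
  have d: "\<psi> differentiable (at x)" for x by (rule test_diff[OF t])
  have cg: "continuous_on UNIV (grad \<psi>)" by (rule C1c_D(5)[OF C])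
  have [measurable]: "\<psi> \<in> borel_measurable borel" "grad \<psi> \<in> borel_measurable borel"
    using cont_meas[OF C1c_D(4)[OF C]] cont_meas[OF cg] by auto
  have sg: "sq (grad \<psi>)" by (rule test_sq(3)[OF t])
  have sd: "sq (\<lambda>x. \<psi> (x + z) - \<psi> x)" by (intro sq_diff sq_shift test_sq(1)[OF t])
  let ?I = "indicator {0..1::real} :: real \<Rightarrow> real"
  define h where "h x t = ?I t * norm (grad \<psi> (x + t *\<^sub>R z))" for x t
  have hm [measurable]: "(\<lambda>(x, t). ennreal (h x t)) \<in> borel_measurable (lborel \<Otimes>\<^sub>M lborel)"
    unfolding h_def by measurable
  have h0: "h x t \<ge> 0" for x t by (simp add: h_def)
  have pt: "ennreal ((norm (\<psi> (x + z) - \<psi> x))\<^sup>2) \<le> ennreal ((norm z)\<^sup>2) * (\<integral>\<^sup>+t. (ennreal (h x t))\<^sup>2 \<partial>lborel)" for x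
  proof -
    have hmx [measurable]: "(\<lambda>t. ennreal (h x t)) \<in> mble" unfolding h_def by measurable
    have D: "((\<lambda>s. \<psi> (x + s *\<^sub>R z)) has_vector_derivative grad \<psi> (x + s *\<^sub>R z) \<bullet> z) (at s within {0..1})" for s
    proof -
      have "((\<lambda>s. x + s *\<^sub>R z) has_derivative (\<lambda>h. h *\<^sub>R z)) (at s)" by (auto intro!: derivative_eq_intros)
      from has_derivative_compose[OF this has_derivative_grad[OF d]]
      show ?thesis by (simp add: has_vector_derivative_def has_derivative_at_withinI)
    qed
    have c: "continuous_on {0..1} (\<lambda>s. grad \<psi> (x + s *\<^sub>R z) \<bullet> z)"
      by (intro continuous_on_inner continuous_on_compose2[OF cg]) (auto intro!: continuous_intros)
    have "has_bochner_integral lborel (\<lambda>s. ?I s *\<^sub>R (grad \<psi> (x + s *\<^sub>R z) \<bullet> z)) (\<psi> (x + 1 *\<^sub>R z) - \<psi> (x + 0 *\<^sub>R z))"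
      by (rule has_bochner_integral_FTC_Icc[OF _ D c]) simp
    hence i: "integrable lborel (\<lambda>s. ?I s *\<^sub>R (grad \<psi> (x + s *\<^sub>R z) \<bullet> z))"
      and e: "(LBINT s. ?I s *\<^sub>R (grad \<psi> (x + s *\<^sub>R z) \<bullet> z)) = \<psi> (x + z) - \<psi> x"
      by (auto simp: has_bochner_integral_iff)
    have "ennreal (norm (\<psi> (x + z) - \<psi> x)) \<le> (\<integral>\<^sup>+s. ennreal (norm (?I s *\<^sub>R (grad \<psi> (x + s *\<^sub>R z) \<bullet> z))) \<partial>lborel)"
      using integral_norm_bound_ennreal[OF i] unfolding e .
    also have "\<dots> \<le> (\<integral>\<^sup>+s. ennreal (norm z) * (ennreal (?I s) * ennreal (h x s)) \<partial>lborel)"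
    proof (rule nn_integral_mono)
      fix s
      have "norm (?I s *\<^sub>R (grad \<psi> (x + s *\<^sub>R z) \<bullet> z)) \<le> norm z * (?I s * h x s)"
        using Cauchy_Schwarz_ineq2[of "grad \<psi> (x + s *\<^sub>R z)" z] by (simp add: h_def indicator_def mult.commute)
      thus "ennreal (norm (?I s *\<^sub>R (grad \<psi> (x + s *\<^sub>R z) \<bullet> z))) \<le> ennreal (norm z) * (ennreal (?I s) * ennreal (h x s))"
        using h0 by (simp add: ennreal_leI flip: ennreal_mult)
    qed
    also have "\<dots> = ennreal (norm z) * (\<integral>\<^sup>+s. ennreal (?I s) * ennreal (h x s) \<partial>lborel)"
      by (rule nn_integral_cmult) measurable
    finally have "(ennreal (norm (\<psi> (x + z) - \<psi> x)))\<^sup>2 \<le> (ennreal (norm z) * (\<integral>\<^sup>+s. ennreal (?I s) * ennreal (h x s) \<partial>lborel))\<^sup>2"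
      by (intro power_mono) auto
    also have "\<dots> = (ennreal (norm z))\<^sup>2 * (\<integral>\<^sup>+s. ennreal (?I s) * ennreal (h x s) \<partial>lborel)\<^sup>2"
      by (simp add: power_mult_distrib)
    also have "\<dots> \<le> (ennreal (norm z))\<^sup>2 * ((\<integral>\<^sup>+s. (ennreal (?I s))\<^sup>2 \<partial>lborel) * (\<integral>\<^sup>+s. (ennreal (h x s))\<^sup>2 \<partial>lborel))"
      by (intro mult_left_mono Cauchy_Schwarz_nn_integral) auto
    also have "(\<integral>\<^sup>+s. (ennreal (?I s))\<^sup>2 \<partial>lborel) = (\<integral>\<^sup>+s. indicator {0..1::real} s \<partial>lborel)"
      by (intro nn_integral_cong) (auto simp: indicator_def)
    also have "\<dots> = 1" by (simp add: nn_integral_indicator)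
    finally show ?thesis by (simp add: ennreal_power)
  qed
  have "ennreal (nsq (\<lambda>x. \<psi> (x + z) - \<psi> x)) = (\<integral>\<^sup>+x. ennreal ((norm (\<psi> (x + z) - \<psi> x))\<^sup>2) \<partial>lborel)"
    unfolding nsq_def using sq_int[OF sd] by (intro nn_integral_eq_integral[symmetric]) auto
  also have "\<dots> \<le> (\<integral>\<^sup>+x. ennreal ((norm z)\<^sup>2) * (\<integral>\<^sup>+t. (ennreal (h x t))\<^sup>2 \<partial>lborel) \<partial>lborel)"
    by (intro nn_integral_mono pt)
  also have "\<dots> = ennreal ((norm z)\<^sup>2) * (\<integral>\<^sup>+x. (\<integral>\<^sup>+t. (ennreal (h x t))\<^sup>2 \<partial>lborel) \<partial>lborel)"
    by (rule nn_integral_cmult) measurable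
  also have "(\<integral>\<^sup>+x. (\<integral>\<^sup>+t. (ennreal (h x t))\<^sup>2 \<partial>lborel) \<partial>lborel) = (\<integral>\<^sup>+t. (\<integral>\<^sup>+x. (ennreal (h x t))\<^sup>2 \<partial>lborel) \<partial>lborel)"
    by (rule lborel_pair.Fubini'[symmetric]) measurable
  also have "\<dots> = (\<integral>\<^sup>+t. indicator {0..1::real} t * ennreal (nsq (grad \<psi>)) \<partial>lborel)"
  proof (rule nn_integral_cong)
    fix t
    show "(\<integral>\<^sup>+x. (ennreal (h x t))\<^sup>2 \<partial>lborel) = indicator {0..1} t * ennreal (nsq (grad \<psi>))"
    proof (cases "t \<in> {0..1}")
      case True
      have "(\<integral>\<^sup>+x. (ennreal (h x t))\<^sup>2 \<partial>lborel) = (\<integral>\<^sup>+x. ennreal ((norm (grad \<psi> (x + t *\<^sub>R z)))\<^sup>2) \<partial>lborel)"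
        using True by (intro nn_integral_cong) (simp add: h_def ennreal_power)
      also have "\<dots> = ennreal (nsq (\<lambda>x. grad \<psi> (x + t *\<^sub>R z)))"
        unfolding nsq_def using sq_int[OF sq_shift(1)[OF sg]] by (intro nn_integral_eq_integral) auto
      finally show ?thesis using True sq_shift(2)[OF sg] by simp
    next
      case False
      hence "h x t = 0" for x by (simp add: h_def)
      moreover have "indicator {0..1} t = (0::ennreal)" using False by (simp add: indicator_def)
      ultimately show ?thesis by simp
    qed
  qed
  also have "\<dots> = ennreal (nsq (grad \<psi>))" by (subst nn_integral_multc) (auto simp: nn_integral_indicator)
  finally have "ennreal (nsq (\<lambda>x. \<psi> (x + z) - \<psi> x)) \<le> ennreal ((norm z)\<^sup>2 * nsq (grad \<psi>))"
    by (simp add: ennreal_mult)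
  thus ?thesis by (simp add: ennreal_le_iff)
qed

lemma W12_approx:
  assumes "W12 u G"
  obtains \<psi> where "\<forall>n. test_fun UNIV (\<psi> n)" "(\<lambda>n. nsq (\<lambda>x. \<psi> n x - u x)) \<longlonglongrightarrow> 0"
    "(\<lambda>n. nsq (\<lambda>x. grad (\<psi> n) x - G x)) \<longlonglongrightarrow> 0"
    "AE x in lborel. (\<lambda>n. \<psi> n x) \<longlonglongrightarrow> u x" "AE x in lborel. (\<lambda>n. grad (\<psi> n) x) \<longlonglongrightarrow> G x"
  using tapprox_seq_AE[OF W12_density[OF assms] W12D(1,2)[OF assms]] by (elim exE conjE) (rule that)

lemma transl_W12:
  assumes W: "W12 u G"
  shows "nsq (\<lambda>x. u (x + z) - u x) \<le> (norm z)\<^sup>2 * nsq G"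
proof -
  obtain \<psi> where p: "\<forall>n. test_fun UNIV (\<psi> n)" "(\<lambda>n. nsq (\<lambda>x. \<psi> n x - u x)) \<longlonglongrightarrow> 0"
    "(\<lambda>n. nsq (\<lambda>x. grad (\<psi> n) x - G x)) \<longlonglongrightarrow> 0"
    by (rule W12_approx[OF W])
  have pt: "test_fun UNIV (\<psi> n)" for n using p(1) by blast
  note su = W12D(1)[OF W] and sG = W12D(2)[OF W]
  have d: "sq (\<lambda>x. \<psi> n x - u x)" for n by (intro sq_diff test_sq(1)[OF pt] su)
  have sd: "sq (\<lambda>x. \<psi> n (x + z) - u (x + z))" for n by (intro sq_diff sq_shift test_sq(1)[OF pt] su)
  have "(\<lambda>n. nsq (\<lambda>x. (\<psi> n (x + z) - \<psi> n x) - (u (x + z) - u x))) \<longlonglongrightarrow> 0"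
  proof (rule null_comparison_nonneg[OF _ nsq_nonneg])
    have "(\<lambda>n. 2 * nsq (\<lambda>x. \<psi> n x - u x) + 2 * nsq (\<lambda>x. \<psi> n x - u x)) \<longlonglongrightarrow> 2 * 0 + 2 * 0"
      by (intro tendsto_intros p)
    thus "(\<lambda>n. 2 * nsq (\<lambda>x. \<psi> n x - u x) + 2 * nsq (\<lambda>x. \<psi> n x - u x)) \<longlonglongrightarrow> 0" by simp
    fix n
    have "(\<lambda>x. (\<psi> n (x + z) - \<psi> n x) - (u (x + z) - u x)) = (\<lambda>x. (\<psi> n (x + z) - u (x + z)) - (\<psi> n x - u x))"
      by (rule ext) simp
    thus "nsq (\<lambda>x. (\<psi> n (x + z) - \<psi> n x) - (u (x + z) - u x)) \<le> 2 * nsq (\<lambda>x. \<psi> n x - u x) + 2 * nsq (\<lambda>x. \<psi> n x - u x)"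
      using sq_diff(2)[OF sd[of n] d[of n]] sq_shift(2)[OF d[of n], of z] by simp
  qed
  hence 1: "(\<lambda>n. nsq (\<lambda>x. \<psi> n (x + z) - \<psi> n x)) \<longlonglongrightarrow> nsq (\<lambda>x. u (x + z) - u x)"
    by (intro L2_nsq_conv sq_diff sq_shift test_sq(1)[OF pt] su)
  have 2: "(\<lambda>n. (norm z)\<^sup>2 * nsq (grad (\<psi> n))) \<longlonglongrightarrow> (norm z)\<^sup>2 * nsq G"
    by (intro tendsto_intros L2_nsq_conv[OF test_sq(3)[OF pt] sG p(3)])
  show ?thesis by (rule LIMSEQ_le[OF 1 2]) (use transl_test[OF pt] in blast)
qed

lemma ball_sq_indicator_cont: "sq (\<lambda>x::R3. indicator (ball 0 R) x *\<^sub>R (c::real))"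
proof -
  have "emeasure lborel (ball 0 R :: R3 set) < \<infinity>" by (intro emeasure_bounded_finite) auto
  thus ?thesis by (intro sq_indicator_const(1)) auto
qed

text \<open>Compactness by mollification. At a fixed scale the convolutions are bounded and
  equicontinuous, so a diagonal subsequence converges everywhere and hence in L^2 on every ball; the
  translation estimate makes the mollification error small uniformly in \<open>n\<close>.\<close>

theorem Rellich:
  fixes u :: "nat \<Rightarrow> R3 \<Rightarrow> real"
  assumes W: "\<And>n. W12 (u n) (G n)" and C: "\<And>n. nsq (u n) \<le> C" "\<And>n. nsq (G n) \<le> C"
  shows "\<exists>(r::nat\<Rightarrow>nat) v. strict_mono r \<and> (AE x in lborel. (\<lambda>i. u (r i) x) \<longlonglongrightarrow> v x) \<and> sq v \<and> nsq v \<le> C \<and>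
    (\<forall>R. (\<lambda>i. nsq_on R (\<lambda>x. (u (r i) x - v x))) \<longlonglongrightarrow> 0)"
proof -
  have C0: "C \<ge> 0" using C(1)[of 0] nsq_nonneg[of "u 0"] by linarith
  have su: "sq (u n)" for n by (rule W12D(1)[OF W])
  let ?h = "\<lambda>j. inverse (real (Suc j))"
  have "\<forall>j. \<exists>k. test_fun UNIV k \<and> (\<forall>x. 0 \<le> k x) \<and> (LBINT x. k x) = 1 \<and> (\<forall>x. x \<notin> cball (0::R3) (?h j) \<longrightarrow> k x = 0)"
    by (intro allI kernel_exists) simp
  then obtain k where k: "\<And>j. test_fun UNIV (k j)" "\<And>j x. 0 \<le> k j x" "\<And>j. (LBINT x. k j x) = 1"
    "\<And>j x. x \<notin> cball 0 (?h j) \<Longrightarrow> k j x = 0" by metis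
  have sk: "sq (k j)" for j by (rule test_sq(1)[OF k(1)])
  note cl = conv_L2[OF sk C1c_D(1)[OF test_fun_C1c[OF k(1)]] k(2) k(3) su]
  have close: "nsq (\<lambda>x. u n x - conv (k j) (u n) x) \<le> (?h j)\<^sup>2 * C" and sc: "sq (conv (k j) (u n))" for n j
  proof -
    have S: "nsq (\<lambda>x. u n (x - z) - u n x) \<le> (?h j)\<^sup>2 * C" if "k j z \<noteq> 0" for z
    proof -
      have "norm z \<le> ?h j" using k(4)[of z j] that by auto
      hence "(norm z)\<^sup>2 \<le> (?h j)\<^sup>2" by (intro power_mono) auto
      moreover have "nsq (\<lambda>x. u n (x - z) - u n x) \<le> (norm z)\<^sup>2 * nsq (G n)" using transl_W12[OF W[of n], of "-z"] by simp
      ultimately show ?thesis using C(2)[of n] by (meson mult_mono nsq_nonneg order_trans zero_le_power2)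
    qed
    show "sq (conv (k j) (u n))" by (rule cl(1)[OF S])
    show "nsq (\<lambda>x. u n x - conv (k j) (u n) x) \<le> (?h j)\<^sup>2 * C"
      using cl(2)[OF S] by (subst nsq_commute)
  qed
  define b where "b j = sqrt (nsq (k j)) * sqrt C" for j
  have b0: "b j \<ge> 0" for j using C0 by (simp add: b_def)
  have convb: "\<bar>conv (k j) (u n) x\<bar> \<le> b j" for j n x
  proof -
    have "\<bar>conv (k j) (u n) x\<bar> \<le> sqrt (nsq (\<lambda>y. k j (x - y))) * sqrt (nsq (u n))"
      using L2_CS[OF sq_reflect(1)[OF sk] su] by (simp add: conv_def)
    also have "\<dots> \<le> b j" unfolding b_def sq_reflect(2)[OF sk] using C(1)[of n] by (intro mult_left_mono) auto
    finally show ?thesis .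
  qed
  have equi: "\<bar>conv (k j) (u n) x - conv (k j) (u n) y\<bar> \<le> norm (x - y) * (sqrt (nsq (grad (k j))) * sqrt C)" for j n x y
  proof -
    have s: "sq (\<lambda>w. k j (x - w) - k j (y - w))" by (intro sq_diff sq_reflect sk)
    have e: "conv (k j) (u n) x - conv (k j) (u n) y = (LBINT w. (k j (x - w) - k j (y - w)) \<bullet> u n w)"
      using conv_int[OF sk su, of j x n] conv_int[OF sk su, of j y n] by (simp add: conv_def left_diff_distrib)
    have "nsq (\<lambda>w. k j (x - w) - k j (y - w)) = nsq (\<lambda>w. k j (w + (x - y)) - k j w)"
      using sq_reflect(2)[OF sq_diff(1)[OF sq_shift(1)[OF sk[of j], of "x - y"] sk[of j]], of y] by simp
    also have "\<dots> \<le> (norm (x - y))\<^sup>2 * nsq (grad (k j))" by (rule transl_test[OF k(1)])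
    finally have n: "sqrt (nsq (\<lambda>w. k j (x - w) - k j (y - w))) \<le> norm (x - y) * sqrt (nsq (grad (k j)))"
      using real_sqrt_le_mono by (fastforce simp: real_sqrt_mult)
    have "\<bar>conv (k j) (u n) x - conv (k j) (u n) y\<bar> \<le> sqrt (nsq (\<lambda>w. k j (x - w) - k j (y - w))) * sqrt (nsq (u n))"
      unfolding e by (rule L2_CS[OF s su])
    also have "\<dots> \<le> (norm (x - y) * sqrt (nsq (grad (k j)))) * sqrt C"
      using n C(1)[of n] by (intro mult_mono) auto
    finally show ?thesis by (simp add: mult.assoc)
  qed
  \<comment> \<open>One diagonal argument handles all scales \<open>j\<close> and all points of a
    dense set; equicontinuity then extends convergence to every point.\<close>
  obtain D :: "R3 set" where D: "countable D" "\<And>X. open X \<Longrightarrow> X \<noteq> {} \<Longrightarrow> \<exists>d\<in>D. d \<in> X"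
    using countable_dense_exists by metis
  \<comment> \<open>Division by \<open>b + 1\<close> brings all scales under the common bound 1 of
    the diagonal argument.\<close>
  define f where "f n p = conv (k (fst p)) (u n) (snd p) / (b (fst p) + 1)" for n p
  have cS: "countable ((UNIV :: nat set) \<times> D)" using D by auto
  have fb: "norm (f n p) \<le> 1" if "p \<in> UNIV \<times> D" for n p
    using convb[of "fst p" n "snd p"] b0[of "fst p"] by (simp add: f_def abs_div_pos[symmetric] pos_divide_le_eq)
  obtain r :: "nat \<Rightarrow> nat" where r: "strict_mono r" "\<And>p. p \<in> UNIV \<times> D \<Longrightarrow> \<exists>l. (\<lambda>n. f (r n) p) \<longlonglongrightarrow> l"
    using function_convergent_subsequence[of "UNIV \<times> D" f 1, OF cS fb] by metis
  define w where "w n = u (r n)" for n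
  have cauD: "Cauchy (\<lambda>n. conv (k j) (w n) q)" if "q \<in> D" for j q
  proof -
    have "\<exists>l. (\<lambda>n. f (r n) (j, q)) \<longlonglongrightarrow> l" using r(2)[of "(j, q)"] that by simp
    then obtain l where "(\<lambda>n. f (r n) (j, q)) \<longlonglongrightarrow> l" by blast
    from tendsto_mult[OF this tendsto_const[of "b j + 1"]]
    have "(\<lambda>n. conv (k j) (w n) q) \<longlonglongrightarrow> l * (b j + 1)" using b0[of j] by (simp add: f_def w_def add_nonneg_eq_0_iff)
    thus ?thesis by (rule LIMSEQ_imp_Cauchy)
  qed
  have conv_pt: "\<exists>l. (\<lambda>n. conv (k j) (w n) x) \<longlonglongrightarrow> l" for j x
  proof -
    have "Cauchy (\<lambda>n. conv (k j) (w n) x)"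
    proof (rule metric_CauchyI)
      fix e :: real assume e: "e > 0"
      define L where "L = sqrt (nsq (grad (k j))) * sqrt C"
      have L: "L \<ge> 0" using C0 by (simp add: L_def)
      obtain q where q: "q \<in> D" "q \<in> ball x (e / (3 * (L + 1)))"
      proof -
        have "e / (3 * (L + 1)) > 0" using e L by simp
        thus thesis using D(2)[of "ball x (e / (3 * (L + 1)))"] that by (metis ball_eq_empty not_le open_ball)
      qed
      have xq: "\<bar>conv (k j) (w n) x - conv (k j) (w n) q\<bar> \<le> e / 3" for n
      proof -
        have "\<bar>conv (k j) (w n) x - conv (k j) (w n) q\<bar> \<le> norm (x - q) * L" unfolding w_def L_def by (rule equi)
        also have "\<dots> \<le> e / (3 * (L + 1)) * (L + 1)" using q(2) L e by (intro mult_mono) (auto simp: dist_norm)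
        also have "\<dots> = e / 3"
        proof -
          have "e / (3 * M) * M = e / 3" if "M > 0" for M using that by simp
          thus ?thesis using L by (simp only: add_nonneg_pos zero_less_one)
        qed
        finally show ?thesis .
      qed
      obtain N where N: "\<forall>m\<ge>N. \<forall>n\<ge>N. dist (conv (k j) (w m) q) (conv (k j) (w n) q) < e / 3"
        using metric_CauchyD[OF cauD[OF q(1), of j], of "e/3"] e by auto
      have "dist (conv (k j) (w m) x) (conv (k j) (w n) x) < e" if "m \<ge> N" "n \<ge> N" for m n
        using N[rule_format, OF that] xq[of m] xq[of n] unfolding dist_real_def by linarith
      thus "\<exists>N. \<forall>m\<ge>N. \<forall>n\<ge>N. dist (conv (k j) (w m) x) (conv (k j) (w n) x) < e" by blast
    qed
    thus ?thesis by (simp add: Cauchy_convergent_iff convergent_def)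
  qed
  then obtain U where U: "\<And>j x. (\<lambda>n. conv (k j) (w n) x) \<longlonglongrightarrow> U j x" by metis
  have cm [measurable]: "conv (k j) (w n) \<in> mble" for j n unfolding w_def by (rule conv_meas[OF sk su])
  have Um [measurable]: "U j \<in> mble" for j
    by (rule borel_measurable_LIMSEQ_metric[OF cm U])
  have loc: "(\<lambda>n. nsq (\<lambda>x. indicator (ball 0 R) x *\<^sub>R conv (k j) (w n) x - indicator (ball 0 R) x *\<^sub>R U j x)) \<longlonglongrightarrow> 0"
    and sU: "sq (\<lambda>x. indicator (ball 0 R) x *\<^sub>R U j x)" for R j
  proof -
    have 1: "(\<lambda>x. indicator (ball 0 R) x *\<^sub>R conv (k j) (w n) x) \<in> mble" for n
      by (intro borel_measurable_scaleR borel_measurable_indicator cm) auto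
    have 2: "(\<lambda>x. indicator (ball 0 R) x *\<^sub>R U j x) \<in> mble"
      by (intro borel_measurable_scaleR borel_measurable_indicator Um) auto
    have 3: "AE x in lborel. (\<lambda>n. indicator (ball 0 R) x *\<^sub>R conv (k j) (w n) x) \<longlonglongrightarrow> indicator (ball 0 R) x *\<^sub>R U j x"
      by (intro AE_I2 tendsto_intros U)
    have 4: "sq (\<lambda>x::R3. indicator (ball 0 R) x *\<^sub>R b j)" by (rule ball_sq_indicator_cont)
    have 5: "AE x in lborel. norm (indicator (ball 0 R) x *\<^sub>R conv (k j) (w n) x) \<le> indicator (ball 0 R) x *\<^sub>R b j" for n
      using convb by (intro AE_I2) (auto simp: indicator_def w_def)
    show "(\<lambda>n. nsq (\<lambda>x. indicator (ball 0 R) x *\<^sub>R conv (k j) (w n) x - indicator (ball 0 R) x *\<^sub>R U j x)) \<longlonglongrightarrow> 0"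
      "sq (\<lambda>x. indicator (ball 0 R) x *\<^sub>R U j x)"
      by (rule sq_dominated(3)[OF 1 2 3 4 5], rule sq_dominated(2)[OF 1 2 3 4 5])
  qed
  have cau: "\<exists>N. \<forall>i\<ge>N. \<forall>m\<ge>N. nsq_on R (\<lambda>x. (w i x - w m x)) < e" if e: "e > 0" for e R
  proof -
    have "(\<lambda>j. (?h j)\<^sup>2 * C) \<longlonglongrightarrow> 0\<^sup>2 * C" by (intro tendsto_intros LIMSEQ_inverse_real_of_nat)
    hence "\<forall>\<^sub>F j in sequentially. (?h j)\<^sup>2 * C < e / 32"
      using order_tendstoD(2)[of _ 0 sequentially "e/32"] e by simp
    then obtain j where j: "(?h j)\<^sup>2 * C < e / 32" by (auto simp: eventually_sequentially)
    have "\<forall>\<^sub>F n in sequentially. nsq (\<lambda>x. indicator (ball 0 R) x *\<^sub>R conv (k j) (w n) x - indicator (ball 0 R) x *\<^sub>R U j x) < e / 32"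
      by (rule order_tendstoD(2)[OF loc]) (use e in simp)
    then obtain N where N: "\<And>n. n \<ge> N \<Longrightarrow> nsq (\<lambda>x. indicator (ball 0 R) x *\<^sub>R conv (k j) (w n) x - indicator (ball 0 R) x *\<^sub>R U j x) < e / 32"
      by (auto simp: eventually_sequentially)
    let ?i = "\<lambda>v x. indicator (ball 0 R) x *\<^sub>R (v x :: real)"
    have sw: "sq (?i (w n))" "sq (?i (conv (k j) (w n)))" for n j
      unfolding w_def by (rule sq_indicator(1)[OF _ su], simp, rule sq_indicator(1)[OF _ sc], simp)
    \<comment> \<open>Mollification and convergence errors of \<open>e / 32\<close> each give
      \<open>e / 8\<close> after a triangle inequality with factor 2, and two such errors give
      \<open>e / 2\<close> below.\<close>
    have half: "nsq (\<lambda>x. ?i (w n) x - ?i (U j) x) < e / 8" if "n \<ge> N" for n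
    proof -
      have "nsq (\<lambda>x. ?i (w n) x - ?i (conv (k j) (w n)) x) \<le> nsq (\<lambda>x. w n x - conv (k j) (w n) x)"
        using sq_indicator(2)[OF _ sq_diff(1)[OF su sc], of "ball 0 R" "r n" j "r n"] by (simp add: w_def right_diff_distrib)
      also have "\<dots> \<le> (?h j)\<^sup>2 * C" unfolding w_def by (rule close)
      finally show ?thesis using nsq_triangle[OF sw(1)[of n] sw(2)[of j n] sU[of R j]] N[OF that] j by argo
    qed
    have "nsq_on R (\<lambda>x. (w i x - w m x)) < e" if "i \<ge> N" "m \<ge> N" for i m
    proof -
      have "nsq (\<lambda>x. ?i (w i) x - ?i (w m) x) \<le> 2 * nsq (\<lambda>x. ?i (w i) x - ?i (U j) x) + 2 * nsq (\<lambda>x. ?i (U j) x - ?i (w m) x)"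
        by (rule nsq_triangle[OF sw(1) sU sw(1)])
      also have "nsq (\<lambda>x. ?i (U j) x - ?i (w m) x) = nsq (\<lambda>x. ?i (w m) x - ?i (U j) x)" by (rule nsq_commute)
      finally have "nsq (\<lambda>x. ?i (w i) x - ?i (w m) x) < e" using half[OF that(1)] half[OF that(2)] e by linarith
      thus ?thesis by (simp only: scaleR_diff_right)
    qed
    thus ?thesis by blast
  qed
  have sw: "sq (w n)" "nsq (w n) \<le> C" for n using su C(1) by (auto simp: w_def)
  obtain r' :: "nat \<Rightarrow> nat" and v where v: "strict_mono r'" "AE x in lborel. (\<lambda>i. w (r' i) x) \<longlonglongrightarrow> v x" "sq v" "nsq v \<le> C"
    "\<forall>R. (\<lambda>i. nsq_on R (\<lambda>x. (w (r' i) x - v x))) \<longlonglongrightarrow> 0"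
    using L2loc_Cauchy_AE_subseq[OF sw cau] by blast
  have "strict_mono (r \<circ> r')" using r(1) v(1) by (rule strict_mono_o)
  thus ?thesis using v(2-5) unfolding w_def by (intro exI[of _ "r \<circ> r'"] exI[of _ v]) simp
qed

text \<open>Minimising the Dirichlet integral over the convex sets of functions that are ever closer to
  \<open>u\<close> in \<open>L\<^sup>2\<close> on ever larger balls gives, by the parallelogram law, gradients that converge
  strongly; this replaces weak compactness of the gradients.\<close>
theorem weak_gradient_limit:
  fixes u :: "nat \<Rightarrow> R3 \<Rightarrow> real"
  assumes W: "\<And>n. W12 (u n) (G n)" and C: "\<And>n. nsq (G n) \<le> C" and v: "sq v"
    and lim: "\<And>R. (\<lambda>i. nsq_on R (\<lambda>x. (u i x - v x))) \<longlonglongrightarrow> 0"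
  shows "\<exists>F. W12 v F"
proof -
  \<comment> \<open>The admissible pairs at level \<open>n\<close> form a convex set that shrinks
    with \<open>n\<close>, so the infimum \<open>d n\<close> of the Dirichlet integral increases. It
    is bounded by \<open>C\<close> because some member of the sequence is admissible.\<close>
  define P where "P n w F \<longleftrightarrow> W12 w F \<and> nsq_on (real n) (\<lambda>x. (w x - v x)) \<le> inverse (real (Suc n))" for n w F
  define S where "S n = {nsq F |w F. P n w F}" for n
  define d where "d n = Inf (S n)" for n
  have bdd: "bdd_below (S n)" for n by (rule bdd_belowI[of _ 0]) (auto simp: S_def)
  have ind_mono: "nsq_on a (\<lambda>x. (w x - v x)) \<le> nsq_on b (\<lambda>x. (w x - v x))"
    if "a \<le> b" "sq w" for a b :: real and w
  proof (rule sq_bound(2))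
    show "sq (\<lambda>x. indicator (ball 0 b) x *\<^sub>R (w x - v x))" by (intro sq_indicator sq_diff that v) simp
    have "sq (\<lambda>x. indicator (ball 0 a) x *\<^sub>R (w x - v x))" by (intro sq_indicator sq_diff that v) simp
    thus "(\<lambda>x. indicator (ball 0 a) x *\<^sub>R (w x - v x)) \<in> mble" by (rule sq_meas)
  qed (use that in \<open>auto simp: indicator_def\<close>)
  have Pmono: "P n w F" if "P m w F" "n \<le> m" for n m w F
  proof -
    have "nsq_on (real n) (\<lambda>x. (w x - v x)) \<le> nsq_on (real m) (\<lambda>x. (w x - v x))"
      using that W12D(1) by (intro ind_mono) (auto simp: P_def)
    also have "\<dots> \<le> inverse (real (Suc m))" using that by (simp add: P_def)
    also have "\<dots> \<le> inverse (real (Suc n))" using that by (intro le_imp_inverse_le) auto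
    finally show ?thesis using that by (simp add: P_def)
  qed
  have ex: "\<exists>k. P n (u k) (G k)" for n
  proof -
    have "\<forall>\<^sub>F k in sequentially. nsq_on (real n) (\<lambda>x. (u k x - v x)) < inverse (real (Suc n))"
      by (rule order_tendstoD(2)[OF lim]) simp
    then obtain k where "nsq_on (real n) (\<lambda>x. (u k x - v x)) < inverse (real (Suc n))"
      by (auto simp: eventually_sequentially)
    thus ?thesis using W by (auto simp: P_def intro: less_imp_le)
  qed
  have ne: "S n \<noteq> {}" for n using ex[of n] by (auto simp: S_def)
  have dC: "d n \<le> C" for n
  proof -
    obtain k where "P n (u k) (G k)" using ex by blast
    hence "d n \<le> nsq (G k)" unfolding d_def by (intro cInf_lower bdd) (auto simp: S_def)
    thus ?thesis using C[of k] by linarith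
  qed
  have dmono: "d n \<le> d m" if "n \<le> m" for n m
    unfolding d_def by (intro cInf_superset_mono ne bdd) (use Pmono[OF _ that] in \<open>auto simp: S_def\<close>)
  have "\<forall>n. \<exists>w F. P n w F \<and> nsq F < d n + inverse (real (Suc n))"
  proof
    fix n
    have "Inf (S n) < d n + inverse (real (Suc n))" by (simp add: d_def)
    then obtain y where "y \<in> S n" "y < d n + inverse (real (Suc n))" using cInf_lessD[OF ne] by blast
    thus "\<exists>w F. P n w F \<and> nsq F < d n + inverse (real (Suc n))" by (auto simp: S_def)
  qed
  then obtain w F where wF: "\<And>n. P n (w n) (F n)" "\<And>n. nsq (F n) < d n + inverse (real (Suc n))" by metis
  have WF: "W12 (w n) (F n)" for n using wF(1) by (simp add: P_def)
  note sF = W12D(2)[OF WF]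
  have diff: "nsq (\<lambda>x. F n x - F m x) \<le> 2 * (d m - d n) + 4 * inverse (real (Suc n))" if nm: "n \<le> m" for n m
  proof -
    \<comment> \<open>The midpoint is admissible at the lower level \<open>n\<close>, so its
      Dirichlet integral is at least \<open>d n\<close>; the parallelogram law then bounds the
      distance of the gradients.\<close>
    let ?w = "\<lambda>x. (1/2) * (w n x + w m x)" and ?F = "\<lambda>x. (1/2) *\<^sub>R (F n x + F m x)"
    have "P n ?w ?F"
      unfolding P_def
    proof
      show "W12 ?w ?F" by (intro W12_scale W12_add WF)
      let ?a = "\<lambda>x. indicator (ball 0 (real n)) x *\<^sub>R (w n x - v x)" and ?b = "\<lambda>x. indicator (ball 0 (real n)) x *\<^sub>R (w m x - v x)"
      have sa: "sq ?a" "sq ?b" by (intro sq_indicator sq_diff W12D(1)[OF WF] v; simp)+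
      have e: "(\<lambda>x. indicator (ball 0 (real n)) x *\<^sub>R (?w x - v x)) = (\<lambda>x. (1/2) * (?a x + ?b x))"
        by (rule ext) (simp add: algebra_simps)
      have "nsq (\<lambda>x. (1/2) * (?a x + ?b x)) = (1/4) * nsq (\<lambda>x. ?a x + ?b x)" by (simp only: sq_cmult(2)) (simp add: power2_eq_square)
      also have "\<dots> \<le> (1/4) * (2 * nsq ?a + 2 * nsq ?b)" using sq_add(2)[OF sa] by simp
      also have "\<dots> \<le> inverse (real (Suc n))" 
      proof -
        have "nsq ?a \<le> inverse (real (Suc n))" "nsq ?b \<le> inverse (real (Suc n))"
          using wF(1)[of n] Pmono[OF wF(1)[of m] nm] by (auto simp: P_def)
        moreover have "(1/4) * (2 * a + 2 * b) \<le> c" if "a \<le> c" "b \<le> c" for a b c :: real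
          using that by simp
        ultimately show ?thesis by blast
      qed
      finally show "nsq_on (real n) (\<lambda>x. (?w x - v x)) \<le> inverse (real (Suc n))" unfolding e .
    qed
    hence "d n \<le> nsq ?F" unfolding d_def by (intro cInf_lower bdd) (auto simp: S_def)
    also have "nsq ?F = (1/4) * nsq (\<lambda>x. F n x + F m x)" by (simp only: sq_scale(2)) (simp add: power2_eq_square)
    finally have 1: "4 * d n \<le> nsq (\<lambda>x. F n x + F m x)" by simp
    have 2: "nsq (\<lambda>x. F n x - F m x) = 2 * nsq (F n) + 2 * nsq (F m) - nsq (\<lambda>x. F n x + F m x)"
      using nsq_diff_expand[OF sF[of n] sF[of m]] nsq_add_expand[OF sF[of n] sF[of m]] by linarith
    have 3: "inverse (real (Suc m)) \<le> inverse (real (Suc n))" using nm by (intro le_imp_inverse_le) auto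
    have gen: "X \<le> 2 * (dm - dn) + 4 * p" if "4 * dn \<le> S" "X = 2 * a + 2 * b - S" "q \<le> p" "a < dn + p" "b < dm + q"
      for X S a b p q dm dn :: real using that by argo
    show ?thesis by (rule gen[OF 1 2 3 wF(2)[of n] wF(2)[of m]])
  qed
  have conv: "convergent d"
  proof -
    have "incseq d" using dmono by (simp add: incseq_def)
    then obtain L where "d \<longlonglongrightarrow> L" using incseq_convergent[of d C] dC by blast
    thus ?thesis by (rule convergentI)
  qed
  have cau: "\<exists>N. \<forall>i\<ge>N. \<forall>j\<ge>N. nsq (\<lambda>x. F i x - F j x) < e" if e: "e > 0" for e
  proof -
    have "Cauchy d" using conv by (simp add: Cauchy_convergent_iff)
    then obtain N1 where N1: "\<forall>i\<ge>N1. \<forall>j\<ge>N1. dist (d i) (d j) < e / 8" using metric_CauchyD[of d "e/8"] e by auto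
    have "\<forall>\<^sub>F n in sequentially. inverse (real (Suc n)) < e / 16"
      using order_tendstoD(2)[OF LIMSEQ_inverse_real_of_nat, of "e/16"] e by simp
    then obtain N2 where N2: "\<forall>n\<ge>N2. inverse (real (Suc n)) < e / 16" by (auto simp: eventually_sequentially)
    have main: "nsq (\<lambda>x. F i x - F j x) < e" if "i \<ge> max N1 N2" "i \<le> j" for i j
    proof -
      have "dist (d i) (d j) < e / 8" using N1 that by auto
      hence "d j - d i < e / 8" unfolding dist_real_def by linarith
      thus ?thesis using diff[OF that(2)] N2[rule_format, of i] that(1) e by auto
    qed
    have "nsq (\<lambda>x. F i x - F j x) < e" if "i \<ge> max N1 N2" "j \<ge> max N1 N2" for i j
    proof (cases "i \<le> j")
      case True thus ?thesis using main that by blast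
    next
      case False thus ?thesis using main[of j i] that nsq_commute[of "F i" "F j"] by simp
    qed
    thus ?thesis by blast
  qed
  obtain F0 where F0: "sq F0" "(\<lambda>i. nsq (\<lambda>x. F i x - F0 x)) \<longlonglongrightarrow> 0"
    using L2_complete[OF sF cau] by blast
  have "W12 v F0"
  proof (rule W12_limit_loc[OF WF v F0(1) _ F0(2)])
    fix R
    show "(\<lambda>n. nsq_on R (\<lambda>x. (w n x - v x))) \<longlonglongrightarrow> 0"
    proof (rule tendsto_sandwich[OF _ _ tendsto_const LIMSEQ_inverse_real_of_nat])
      show "\<forall>\<^sub>F n in sequentially. 0 \<le> nsq_on R (\<lambda>x. (w n x - v x))" by simp
      obtain N where N: "R \<le> real N" using real_arch_simple by blast
      show "\<forall>\<^sub>F n in sequentially. nsq_on R (\<lambda>x. (w n x - v x)) \<le> inverse (real (Suc n))"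
        unfolding eventually_sequentially
      proof (intro exI[of _ N] allI impI)
        fix n assume "N \<le> n"
        hence "nsq_on R (\<lambda>x. (w n x - v x)) \<le> nsq_on (real n) (\<lambda>x. (w n x - v x))"
          using N by (intro ind_mono W12D(1)[OF WF]) auto
        also have "\<dots> \<le> inverse (real (Suc n))" using wF(1)[of n] by (simp add: P_def)
        finally show "nsq_on R (\<lambda>x. (w n x - v x)) \<le> inverse (real (Suc n))" .
      qed
    qed
  qed
  thus ?thesis by blast
qed

text \<open>Weak convergence tested only against gradients: \<open>H\<close> is approximated by
  gradients of test functions, for which one integration by parts moves the derivative off
  \<open>G n - F\<close>, and local L^2 convergence suffices.\<close>

lemma weak_convergence_gradient:
  fixes u :: "nat \<Rightarrow> R3 \<Rightarrow> real"
  assumes W: "\<And>n. W12 (u n) (G n)" and C: "\<And>n. nsq (G n) \<le> C" and Wv: "W12 v F"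
    and lim: "\<And>R. (\<lambda>i. nsq_on R (\<lambda>x. (u i x - v x))) \<longlonglongrightarrow> 0"
    and Wz: "W12 z H"
  shows "(\<lambda>n. LBINT x. G n x \<bullet> H x) \<longlonglongrightarrow> (LBINT x. F x \<bullet> H x)"
proof -
  note sG = W12D(2)[OF W] and sF = W12D(2)[OF Wv] and sH = W12D(2)[OF Wz]
  have WD: "W12 (\<lambda>x. u n x - v x) (\<lambda>x. G n x - F x)" for n by (rule W12_diff[OF W Wv])
  have testcase: "(\<lambda>n. LBINT x. (G n x - F x) \<bullet> grad \<psi> x) \<longlonglongrightarrow> 0" if t: "test_fun UNIV \<psi>" for \<psi>
  proof -
    have e: "(LBINT x. (G n x - F x) \<bullet> grad \<psi> x) = - (\<Sum>i\<in>UNIV. \<integral>x. (u n x - v x) * pd (pd \<psi> i) i x \<partial>lborel)" for n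
    proof -
      have "(LBINT x. (G n x - F x) \<bullet> grad \<psi> x) = (LBINT x. (\<Sum>i\<in>UNIV. (G n x - F x) $ i * pd \<psi> i x))"
        by (simp add: inner_vec_def grad_def)
      also have "\<dots> = (\<Sum>i\<in>UNIV. \<integral>x. (G n x - F x) $ i * pd \<psi> i x \<partial>lborel)"
        by (rule Bochner_Integration.integral_sum) (rule sq_mult_int[OF sq_component(1)[OF W12D(2)[OF WD]] test_sq(2)[OF t]])
      also have "\<dots> = (\<Sum>i\<in>UNIV. - (LBINT x. (u n x - v x) * pd (pd \<psi> i) i x))"
        using W12D(3)[OF WD test_fun_pd[OF t]] by (intro sum.cong) (auto simp: algebra_simps)
      finally show ?thesis by (simp add: sum_negf)
    qed
    have "(\<lambda>n. LBINT x. (u n x - v x) * pd (pd \<psi> i) i x) \<longlonglongrightarrow> 0" for i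
    proof -
      have tp: "test_fun UNIV (pd \<psi> i)" by (rule test_fun_pd[OF t])
      obtain R where R: "\<And>x. x \<notin> ball 0 R \<Longrightarrow> pd (pd \<psi> i) i x = 0" using test_fun_ball[OF tp] by metis
      let ?a = "\<lambda>n x. indicator (ball 0 R) x *\<^sub>R (u n x - v x)"
      have sa: "sq (?a n)" for n by (intro sq_indicator W12D(1)[OF WD]) simp
      have "(\<lambda>n. sqrt (nsq (?a n)) * sqrt (nsq (pd (pd \<psi> i) i))) \<longlonglongrightarrow> sqrt 0 * sqrt (nsq (pd (pd \<psi> i) i))"
        by (intro tendsto_intros lim)
      hence l: "(\<lambda>n. sqrt (nsq (?a n)) * sqrt (nsq (pd (pd \<psi> i) i))) \<longlonglongrightarrow> 0" by simp
      show ?thesis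
      proof (rule null_comparison[OF l])
        fix n
        have "(LBINT x. (u n x - v x) * pd (pd \<psi> i) i x) = (LBINT x. ?a n x \<bullet> pd (pd \<psi> i) i x)"
          by (intro Bochner_Integration.integral_cong) (use R in \<open>auto simp: indicator_def\<close>)
        thus "\<bar>LBINT x. (u n x - v x) * pd (pd \<psi> i) i x\<bar> \<le> sqrt (nsq (?a n)) * sqrt (nsq (pd (pd \<psi> i) i))"
          using L2_CS[OF sa[of n] test_sq(2)[OF tp, of i]] by simp
      qed
    qed
    hence "(\<lambda>n. - (\<Sum>i\<in>UNIV. \<integral>x. (u n x - v x) * pd (pd \<psi> i) i x \<partial>lborel)) \<longlonglongrightarrow> - (\<Sum>i\<in>(UNIV::3 set). 0)"
      by (intro tendsto_minus tendsto_sum)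
    thus ?thesis by (simp add: e)
  qed
  define B where "B = sqrt (2 * C + 2 * nsq F)"
  have B0: "B \<ge> 0" using C[of 0] nsq_nonneg[of "G 0"] nsq_nonneg[of F] unfolding B_def by (intro real_sqrt_ge_zero) linarith
  have GB: "sqrt (nsq (\<lambda>x. G n x - F x)) \<le> B" for n
    unfolding B_def using sq_diff(2)[OF sG[of n] sF] C[of n] by (intro real_sqrt_le_mono) linarith
  have "(\<lambda>n. LBINT x. (G n x - F x) \<bullet> H x) \<longlonglongrightarrow> 0"
  proof (rule LIMSEQ_I)
    fix e :: real assume e: "e > 0"
    obtain \<psi> where p: "test_fun UNIV \<psi>" "nsq (\<lambda>x. grad \<psi> x - H x) < (e / (2 * (B + 1)))\<^sup>2"
    proof -
      have "(e / (2 * (B + 1)))\<^sup>2 > 0" using e B0 by simp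
      thus thesis using W12_density[OF Wz] that unfolding tapprox_def by blast
    qed
    have sp: "sqrt (nsq (\<lambda>x. grad \<psi> x - H x)) \<le> e / (2 * (B + 1))"
      using real_sqrt_le_mono[OF less_imp_le[OF p(2)]] e B0 by simp
    have spd: "sq (\<lambda>x. grad \<psi> x - H x)" by (intro sq_diff test_sq(3)[OF p(1)] sH)
    have "\<forall>\<^sub>F n in sequentially. \<bar>LBINT x. (G n x - F x) \<bullet> grad \<psi> x\<bar> < e / 2"
      using order_tendstoD(2)[OF tendsto_rabs_zero[OF testcase[OF p(1)]], of "e/2"] e by simp
    then obtain N where N: "\<And>n. n \<ge> N \<Longrightarrow> \<bar>LBINT x. (G n x - F x) \<bullet> grad \<psi> x\<bar> < e / 2"
      by (auto simp: eventually_sequentially)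
    have "norm ((LBINT x. (G n x - F x) \<bullet> H x) - 0) < e" if "n \<ge> N" for n
    proof -
      have sd: "sq (\<lambda>x. G n x - F x)" by (intro sq_diff sG sF)
      have "(LBINT x. (G n x - F x) \<bullet> H x) = (LBINT x. (G n x - F x) \<bullet> grad \<psi> x) - (LBINT x. (G n x - F x) \<bullet> (grad \<psi> x - H x))"
        using sq_inner_int[OF sd test_sq(3)[OF p(1)]] sq_inner_int[OF sd sH] by (simp add: inner_diff_right)
      moreover have "\<bar>LBINT x. (G n x - F x) \<bullet> (grad \<psi> x - H x)\<bar> \<le> B * (e / (2 * (B + 1)))"
        by (rule order_trans[OF L2_CS[OF sd spd]]) (intro mult_mono GB sp; use B0 in simp)
      moreover have "B * (e / (2 * (B + 1))) \<le> e / 2" using e B0 by (simp add: field_simps)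
      ultimately show ?thesis using N[OF that] unfolding real_norm_def diff_zero by linarith
    qed
    thus "\<exists>N. \<forall>n\<ge>N. norm ((LBINT x. (G n x - F x) \<bullet> H x) - 0) < e" by blast
  qed
  moreover have "(LBINT x. (G n x - F x) \<bullet> H x) = (LBINT x. G n x \<bullet> H x) - (LBINT x. F x \<bullet> H x)" for n
    using sq_inner_int[OF sG[of n] sH] sq_inner_int[OF sF sH] by (simp add: inner_diff_left)
  ultimately show ?thesis by (simp add: LIM_zero_cancel)
qed

section \<open>Critical weights and the chain rule\<close>

text \<open>If \<open>a \<le> b\<^sup>2\<close> the second term dominates, otherwise the
  first.\<close>

lemma young_32: "0 \<le> a \<Longrightarrow> 0 \<le> b \<Longrightarrow> a * b \<le> a powr (3/2) + b ^ 3" for a b :: real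
proof -
  assume a: "0 \<le> a" and b: "0 \<le> b"
  show ?thesis
  proof (cases "a \<le> b\<^sup>2")
    case True
    hence "a * b \<le> b\<^sup>2 * b" using b by (intro mult_right_mono)
    also have "\<dots> = b ^ 3" by (simp add: power3_eq_cube power2_eq_square)
    finally show ?thesis by (smt (verit) powr_ge_zero)
  next
    case False
    hence pos: "a > 0" using zero_le_power2[of b] by linarith
    have "b \<le> sqrt a" using False b by (simp add: real_le_rsqrt)
    hence "a * b \<le> a * sqrt a" using a by (intro mult_left_mono)
    also have "\<dots> = a powr (3/2)"
    proof -
      have "a powr (3/2) = a powr (1 + 1/2)" by simp
      also have "\<dots> = a powr 1 * a powr (1/2)" by (rule powr_add)
      also have "\<dots> = a * sqrt a" using pos by (simp add: powr_half_sqrt)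
      finally show ?thesis by simp
    qed
    finally show ?thesis using b by (smt (verit) zero_le_power)
  qed
qed

text \<open>An inhomogeneous substitute for Hoelder's inequality with exponents 3/2 for
  \<open>g\<close> and 3 for \<open>(v x)\<^sup>2\<close>; rescaling restores homogeneity where it
  is needed.\<close>

lemma weighted_int:
  fixes g v :: "R3 \<Rightarrow> real"
  assumes g: "g \<in> mble" "integrable lborel (\<lambda>x. \<bar>g x\<bar> powr (3/2))"
    and v: "v \<in> mble" "integrable lborel (\<lambda>x. v x ^ 6)"
  shows "integrable lborel (\<lambda>x. \<bar>g x\<bar> * (v x)\<^sup>2)" "integrable lborel (\<lambda>x. g x * (v x)\<^sup>2)"
    "(LBINT x. \<bar>g x\<bar> * (v x)\<^sup>2) \<le> (LBINT x. \<bar>g x\<bar> powr (3/2)) + (LBINT x. v x ^ 6)"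
proof -
  note [measurable] = g(1) v(1)
  have pt: "\<bar>g x\<bar> * (v x)\<^sup>2 \<le> \<bar>g x\<bar> powr (3/2) + v x ^ 6" for x
    using young_32[of "\<bar>g x\<bar>" "(v x)\<^sup>2"] by (simp flip: power_mult)
  have i: "integrable lborel (\<lambda>x. \<bar>g x\<bar> powr (3/2) + v x ^ 6)" using g v by simp
  show 1: "integrable lborel (\<lambda>x. \<bar>g x\<bar> * (v x)\<^sup>2)"
    by (rule Bochner_Integration.integrable_bound[OF i]) (use pt in \<open>auto intro!: AE_I2 order_trans[OF _ abs_ge_self]\<close>)
  show "integrable lborel (\<lambda>x. g x * (v x)\<^sup>2)"
    by (rule Bochner_Integration.integrable_bound[OF 1]) (auto simp: abs_mult)
  have "(LBINT x. \<bar>g x\<bar> * (v x)\<^sup>2) \<le> (LBINT x. \<bar>g x\<bar> powr (3/2) + v x ^ 6)"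
    by (rule integral_mono[OF 1 i pt])
  thus "(LBINT x. \<bar>g x\<bar> * (v x)\<^sup>2) \<le> (LBINT x. \<bar>g x\<bar> powr (3/2)) + (LBINT x. v x ^ 6)"
    using g v by simp
qed

text \<open>The weight is critical, so the bound in L^6 alone gives no smallness. On a bounded set
  where \<open>g\<close> is bounded, local L^2 convergence does. Off it, Young's inequality with a
  parameter \<open>c\<close> trades the tail of \<open>g\<close> against a small multiple of the L^6
  bound.\<close>

lemma weighted_convergence:
  fixes g :: "R3 \<Rightarrow> real" and v :: "nat \<Rightarrow> R3 \<Rightarrow> real"
  assumes g: "g \<in> mble" "integrable lborel (\<lambda>x. \<bar>g x\<bar> powr (3/2))"
    and v: "\<And>n. sq (v n)" "\<And>n. integrable lborel (\<lambda>x. v n x ^ 6)" "\<And>n. (LBINT x. v n x ^ 6) \<le> K"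
    and lim: "\<And>R. (\<lambda>n. nsq_on R (\<lambda>x. v n x)) \<longlonglongrightarrow> 0"
  shows "(\<lambda>n. LBINT x. \<bar>g x\<bar> * (v n x)\<^sup>2) \<longlonglongrightarrow> 0"
proof (rule null_seqI)
  have vm [measurable]: "v n \<in> mble" for n using v(1) by (rule sq_meas)
  note [measurable] = g(1)
  have K0: "K \<ge> 0"
  proof -
    have "0 \<le> (LBINT x. v 0 x ^ 6)" by (intro Bochner_Integration.integral_nonneg) (simp add: zero_le_even_power)
    thus ?thesis using v(3)[of 0] by linarith
  qed
  show "0 \<le> (LBINT x. \<bar>g x\<bar> * (v n x)\<^sup>2)" for n by (intro Bochner_Integration.integral_nonneg) simp
  fix e :: real assume e: "e > 0"
  obtain c where c: "c > 0" "c ^ 3 * K \<le> e / 3"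
  proof -
    define c where "c = min 1 (e / (3 * (K + 1)))"
    have c0: "c > 0" using e K0 by (simp add: c_def)
    have "c ^ 3 \<le> c ^ 1" using c0 by (intro power_decreasing) (auto simp: c_def)
    hence "c ^ 3 * K \<le> c * (K + 1)" using K0 c0 by (intro mult_mono) auto
    also have "\<dots> \<le> e / (3 * (K + 1)) * (K + 1)" using K0 by (intro mult_right_mono) (auto simp: c_def)
    also have "\<dots> = e / 3"
    proof -
      have "e / (3 * M) * M = e / 3" if "M > 0" for M using that by simp
      thus ?thesis using K0 by (simp only: add_nonneg_pos zero_less_one)
    qed
    finally show thesis using that c0 by blast
  qed
  define S where "S n = {x. norm x < real n \<and> \<bar>g x\<bar> \<le> real n}" for n
  have Sm [measurable]: "S n \<in> sets lborel" for n unfolding S_def by measurable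
  \<comment> \<open>The tail of \<open>g\<close> pays for the factor \<open>1 / c\<close> that is
    moved onto it in Young's inequality.\<close>
  define d where "d = (1 / c) powr (3/2)"
  have d: "d > 0" using c by (simp add: d_def)
  have tail: "(\<lambda>n. d * (LBINT x. indicator (- S n) x * \<bar>g x\<bar> powr (3/2))) \<longlonglongrightarrow> d * (\<integral>x. 0 \<partial>(lborel::R3 measure))"
  proof (rule tendsto_mult_left, rule Bochner_Integration.integral_dominated_convergence[where w="\<lambda>x. \<bar>g x\<bar> powr (3/2)"])
    show "AE x in lborel. (\<lambda>n. indicator (- S n) x * \<bar>g x\<bar> powr (3/2)) \<longlonglongrightarrow> 0"
    proof (rule AE_I2, rule tendsto_eventually)
      fix x
      obtain N where "max (norm x) \<bar>g x\<bar> < real N" using reals_Archimedean2 by blast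
      hence "x \<in> S n" if "n \<ge> N" for n using that unfolding S_def by auto
      thus "\<forall>\<^sub>F n in sequentially. indicator (- S n) x * \<bar>g x\<bar> powr (3/2) = 0"
        unfolding eventually_sequentially by (intro exI[of _ N]) auto
    qed
  qed (use g in \<open>auto simp: indicator_def\<close>)
  hence "\<forall>\<^sub>F n in sequentially. d * (LBINT x. indicator (- S n) x * \<bar>g x\<bar> powr (3/2)) < e / 3"
    using order_tendstoD(2)[of _ 0 sequentially "e/3"] e by simp
  then obtain m where m: "d * (LBINT x. indicator (- S m) x * \<bar>g x\<bar> powr (3/2)) < e / 3"
    by (auto simp: eventually_sequentially)
  have "(\<lambda>n. real m * nsq_on (real m) (\<lambda>x. v n x)) \<longlonglongrightarrow> real m * 0"
    by (intro tendsto_intros lim)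
  hence "\<forall>\<^sub>F n in sequentially. real m * nsq_on (real m) (\<lambda>x. v n x) < e / 3"
    using order_tendstoD(2)[of _ 0 sequentially "e/3"] e by simp
  then obtain N where N: "\<And>n. n \<ge> N \<Longrightarrow> real m * nsq_on (real m) (\<lambda>x. v n x) < e / 3"
    by (auto simp: eventually_sequentially)
  have "(LBINT x. \<bar>g x\<bar> * (v n x)\<^sup>2) \<le> e" if "n \<ge> N" for n
  proof -
    let ?a = "\<lambda>x. real m * (norm (indicator (ball 0 (real m)) x *\<^sub>R v n x))\<^sup>2"
    let ?b = "\<lambda>x. d * (indicator (- S m) x * \<bar>g x\<bar> powr (3/2))"
    let ?c = "\<lambda>x. c ^ 3 * v n x ^ 6"
    have si: "sq (\<lambda>x. indicator (ball 0 (real m)) x *\<^sub>R v n x)" by (intro sq_indicator v) simp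
    have ia: "integrable lborel ?a" using sq_int[OF si] by simp
    have ib: "integrable lborel ?b"
      by (intro integrable_mult_right Bochner_Integration.integrable_bound[OF g(2)]) (auto simp: indicator_def)
    have ic: "integrable lborel ?c" using v(2) by simp
    have pt: "\<bar>g x\<bar> * (v n x)\<^sup>2 \<le> ?a x + (?b x + ?c x)" for x
    proof (cases "x \<in> S m")
      case True
      hence "\<bar>g x\<bar> * (v n x)\<^sup>2 \<le> real m * (v n x)\<^sup>2" by (intro mult_right_mono) (auto simp: S_def)
      also have "\<dots> = ?a x" using True by (simp add: S_def)
      finally show ?thesis using d c(1) by (simp add: add_increasing2 zero_le_even_power)
    next
      case False
      have "\<bar>g x\<bar> * (v n x)\<^sup>2 = (\<bar>g x\<bar> * (1 / c)) * (c * (v n x)\<^sup>2)" using c(1) by simp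
      also have "\<dots> \<le> (\<bar>g x\<bar> * (1 / c)) powr (3/2) + (c * (v n x)\<^sup>2) ^ 3"
        by (rule young_32) (use c(1) in auto)
      also have "(\<bar>g x\<bar> * (1 / c)) powr (3/2) = ?b x" using False c(1) by (subst powr_mult) (auto simp: d_def mult.commute)
      also have "(c * (v n x)\<^sup>2) ^ 3 = ?c x" by (simp add: power_mult_distrib flip: power_mult)
      finally show ?thesis by (simp add: add_increasing)
    qed
    have "(LBINT x. \<bar>g x\<bar> * (v n x)\<^sup>2) \<le> (LBINT x. ?a x + (?b x + ?c x))"
      using ia ib ic weighted_int(1)[OF g vm v(2)] pt by (intro integral_mono) auto
    also have "\<dots> = (LBINT x. ?a x) + ((LBINT x. ?b x) + (LBINT x. ?c x))"
      using ia ib ic by simp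
    also have "(LBINT x. ?a x) = real m * nsq_on (real m) (\<lambda>x. v n x)" by (simp add: nsq_def)
    also have "(LBINT x. ?b x) = d * (LBINT x. indicator (- S m) x * \<bar>g x\<bar> powr (3/2))" by simp
    also have "(LBINT x. ?c x) = c ^ 3 * (LBINT x. v n x ^ 6)" by simp
    also have "c ^ 3 * (LBINT x. v n x ^ 6) \<le> c ^ 3 * K" using v(3) c(1) by (intro mult_left_mono) auto
    finally show ?thesis using N[OF that] m c(2) by linarith
  qed
  thus "\<exists>N. \<forall>n\<ge>N. (LBINT x. \<bar>g x\<bar> * (v n x)\<^sup>2) \<le> e" by blast
qed

text \<open>The Sobolev inequality makes the integral of the sixth power vanish; on the whole space
  no nonzero constant is left over.\<close>

lemma zero_grad_zero:
  assumes W: "W12 u G" and z: "nsq G = 0"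
  shows "AE x in lborel. u x = 0"
proof -
  have "(LBINT x. u x ^ 6) \<le> 0" using Sobolev(2)[OF W] z by simp
  moreover have "(LBINT x. u x ^ 6) \<ge> 0" by (intro Bochner_Integration.integral_nonneg) (simp add: zero_le_even_power)
  ultimately have "(LBINT x. u x ^ 6) = 0" by linarith
  hence "AE x in lborel. u x ^ 6 = 0"
    using integral_nonneg_eq_0_iff_AE[OF Sobolev(1)[OF W]] by (simp add: zero_le_even_power)
  thus ?thesis by simp
qed

text \<open>Normalise the Dirichlet integral to 1 in the inhomogeneous estimate; the sixth power
  then contributes at most 4096.\<close>

lemma weighted_bound:
  assumes g: "g \<in> mble" "integrable lborel (\<lambda>x. \<bar>g x\<bar> powr (3/2))"
    and W: "W12 u G"
  shows "(LBINT x. \<bar>g x\<bar> * (u x)\<^sup>2) \<le> ((LBINT x. \<bar>g x\<bar> powr (3/2)) + 4096) * nsq G"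
proof (cases "nsq G = 0")
  case True
  hence "AE x in lborel. \<bar>g x\<bar> * (u x)\<^sup>2 = 0" using zero_grad_zero[OF W] by (auto elim: eventually_mono)
  hence "(LBINT x. \<bar>g x\<bar> * (u x)\<^sup>2) = 0" by (rule integral_eq_zero_AE)
  thus ?thesis using True by simp
next
  case False
  define A where "A = nsq G"
  have A: "A > 0" using False nsq_nonneg[of G] unfolding A_def by linarith
  let ?c = "1 / sqrt A"
  have Wc: "W12 (\<lambda>x. ?c * u x) (\<lambda>x. ?c *\<^sub>R G x)" by (rule W12_scale[OF W])
  have c2: "?c\<^sup>2 = 1 / A" using A by (simp add: power_divide)
  have n1: "nsq (\<lambda>x. ?c *\<^sub>R G x) = 1" using A by (simp only: sq_scale(2) c2 flip: A_def) simp
  have "(LBINT x. \<bar>g x\<bar> * (?c * u x)\<^sup>2) \<le> (LBINT x. \<bar>g x\<bar> powr (3/2)) + (LBINT x. (?c * u x) ^ 6)"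
    by (rule weighted_int(3)[OF g sq_meas[OF W12D(1)[OF Wc]] Sobolev(1)[OF Wc]])
  also have "\<dots> \<le> (LBINT x. \<bar>g x\<bar> powr (3/2)) + 4096" using Sobolev(2)[OF Wc] n1 by simp
  also have "(LBINT x. \<bar>g x\<bar> * (?c * u x)\<^sup>2) = (1 / A) * (LBINT x. \<bar>g x\<bar> * (u x)\<^sup>2)"
  proof -
    have "\<bar>g x\<bar> * (?c * u x)\<^sup>2 = (1 / A) * (\<bar>g x\<bar> * (u x)\<^sup>2)" for x by (simp only: power_mult_distrib c2) simp
    thus ?thesis by (simp only: Bochner_Integration.integral_mult_right_zero)
  qed
  finally show ?thesis using A by (simp add: A_def[symmetric] pos_divide_le_eq)
qed

section \<open>Bounded factors and the chain rule\<close>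

lemma sq_mult_bounded:
  fixes w :: "R3 \<Rightarrow> 'b::euclidean_space"
  assumes a: "a \<in> mble" "AE x in lborel. \<bar>a x\<bar> \<le> C" and w: "sq w"
  shows "sq (\<lambda>x. a x *\<^sub>R w x)" "nsq (\<lambda>x. a x *\<^sub>R w x) \<le> C\<^sup>2 * nsq w"
proof -
  have m: "(\<lambda>x. a x *\<^sub>R w x) \<in> mble" using a(1) sq_meas[OF w] by measurable
  have b: "AE x in lborel. norm (a x *\<^sub>R w x) \<le> norm (C *\<^sub>R w x)"
    using a(2) by eventually_elim (auto intro!: mult_right_mono)
  show "sq (\<lambda>x. a x *\<^sub>R w x)" by (rule sq_bound(1)[OF sq_scale(1)[OF w] m b])
  show "nsq (\<lambda>x. a x *\<^sub>R w x) \<le> C\<^sup>2 * nsq w" using sq_bound(2)[OF sq_scale(1)[OF w] m b] by (simp only: sq_scale(2))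
qed

text \<open>Two variables, since the chain rule is needed for the polar angle of a pair of Sobolev
  functions; \<open>F1\<close> and \<open>F2\<close> are the partial derivatives.\<close>

definition C1F :: "(real \<Rightarrow> real \<Rightarrow> real) \<Rightarrow> (real \<Rightarrow> real \<Rightarrow> real) \<Rightarrow> (real \<Rightarrow> real \<Rightarrow> real) \<Rightarrow> real \<Rightarrow> bool" where
  "C1F F F1 F2 L \<longleftrightarrow>
     (\<forall>p. ((\<lambda>p. F (fst p) (snd p)) has_derivative (\<lambda>h. F1 (fst p) (snd p) * fst h + F2 (fst p) (snd p) * snd h)) (at p)) \<and>
     continuous_on UNIV (\<lambda>p. F1 (fst p) (snd p)) \<and> continuous_on UNIV (\<lambda>p. F2 (fst p) (snd p)) \<and>
     (\<forall>s t. \<bar>F1 s t\<bar> \<le> L \<and> \<bar>F2 s t\<bar> \<le> L)"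

lemma C1F_Lip:
  assumes "C1F F F1 F2 L"
  shows "\<bar>F s t - F s' t'\<bar> \<le> 2 * L * (\<bar>s - s'\<bar> + \<bar>t - t'\<bar>)"
proof -
  have L0: "L \<ge> 0" using assms unfolding C1F_def by (meson abs_ge_zero order_trans)
  have "norm (F (fst (s, t)) (snd (s, t)) - F (fst (s', t')) (snd (s', t'))) \<le> 2 * L * norm ((s, t) - (s', t'))"
  proof (rule differentiable_bound[of UNIV "\<lambda>p. F (fst p) (snd p)" "\<lambda>p h. F1 (fst p) (snd p) * fst h + F2 (fst p) (snd p) * snd h"])
    show "((\<lambda>p. F (fst p) (snd p)) has_derivative (\<lambda>h. F1 (fst p) (snd p) * fst h + F2 (fst p) (snd p) * snd h)) (at p within UNIV)" for p
      using assms unfolding C1F_def by blast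
    show "onorm (\<lambda>h. F1 (fst p) (snd p) * fst h + F2 (fst p) (snd p) * snd h) \<le> 2 * L" for p
    proof (rule onorm_le)
      fix h :: "real \<times> real"
      have "\<bar>F1 (fst p) (snd p)\<bar> * \<bar>fst h\<bar> \<le> L * norm h" "\<bar>F2 (fst p) (snd p)\<bar> * \<bar>snd h\<bar> \<le> L * norm h"
        using assms L0 norm_fst_le[of "fst h" "snd h"] norm_snd_le[of "snd h" "fst h"] by (auto simp: C1F_def intro!: mult_mono)
      thus "norm (F1 (fst p) (snd p) * fst h + F2 (fst p) (snd p) * snd h) \<le> 2 * L * norm h"
        using norm_triangle_ineq[of "F1 (fst p) (snd p) * fst h" "F2 (fst p) (snd p) * snd h"]
        by (simp only: real_norm_def abs_mult)
    qed
  qed auto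
  also have "norm ((s, t) - (s', t')) \<le> \<bar>s - s'\<bar> + \<bar>t - t'\<bar>"
    using norm_Pair_le[of "s - s'" "t - t'"] by simp
  finally show ?thesis using L0 by (simp add: mult_left_mono)
qed

lemma C1F_meas:
  assumes F: "C1F F F1 F2 L" and [measurable]: "u \<in> borel_measurable M" "v \<in> borel_measurable M"
  shows "(\<lambda>x. F (u x) (v x)) \<in> borel_measurable M" "(\<lambda>x. F1 (u x) (v x)) \<in> borel_measurable M"
    "(\<lambda>x. F2 (u x) (v x)) \<in> borel_measurable M"
proof -
  have c: "continuous_on UNIV (\<lambda>p. F (fst p) (snd p))"
    using F unfolding C1F_def by (intro continuous_at_imp_continuous_on ballI) (blast intro: has_derivative_continuous)
  have m: "(\<lambda>x. (u x, v x)) \<in> borel_measurable M" by (rule borel_measurable_Pair) fact+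
  show "(\<lambda>x. F (u x) (v x)) \<in> borel_measurable M" using measurable_compose[OF m borel_measurable_continuous_onI[OF c]] by simp
  show "(\<lambda>x. F1 (u x) (v x)) \<in> borel_measurable M" "(\<lambda>x. F2 (u x) (v x)) \<in> borel_measurable M"
    using F measurable_compose[OF m borel_measurable_continuous_onI] unfolding C1F_def by fastforce+
qed

lemma chain_test:
  assumes F: "C1F F F1 F2 L" and t: "test_fun UNIV \<eta>" "test_fun UNIV \<psi>" "test_fun UNIV \<theta>"
  shows "W12 (\<lambda>x. \<eta> x * F (\<psi> x) (\<theta> x))
    (\<lambda>x. F (\<psi> x) (\<theta> x) *\<^sub>R grad \<eta> x + \<eta> x *\<^sub>R (F1 (\<psi> x) (\<theta> x) *\<^sub>R grad \<psi> x + F2 (\<psi> x) (\<theta> x) *\<^sub>R grad \<theta> x))"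
proof -
  let ?w = "\<lambda>x. F (\<psi> x) (\<theta> x)"
  have D: "(?w has_derivative (\<lambda>h. (F1 (\<psi> x) (\<theta> x) *\<^sub>R grad \<psi> x + F2 (\<psi> x) (\<theta> x) *\<^sub>R grad \<theta> x) \<bullet> h)) (at x)" for x
  proof -
    have 1: "((\<lambda>x. (\<psi> x, \<theta> x)) has_derivative (\<lambda>h. (grad \<psi> x \<bullet> h, grad \<theta> x \<bullet> h))) (at x)"
      by (intro has_derivative_Pair has_derivative_grad test_diff[OF t(2)] test_diff[OF t(3)])
    have 2: "((\<lambda>p. F (fst p) (snd p)) has_derivative (\<lambda>h. F1 (\<psi> x) (\<theta> x) * fst h + F2 (\<psi> x) (\<theta> x) * snd h)) (at (\<psi> x, \<theta> x))"
      using F[unfolded C1F_def] by fastforce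
    from has_derivative_compose[OF 1 2] show ?thesis by (simp add: inner_add_left)
  qed
  have c: "continuous_on UNIV \<psi>" "continuous_on UNIV \<theta>" "continuous_on UNIV (pd \<psi> i)" "continuous_on UNIV (pd \<theta> i)" for i
    using C1c_D(4)[OF test_fun_C1c] t test_fun_pd by blast+
  have cF: "continuous_on UNIV (\<lambda>x. F1 (\<psi> x) (\<theta> x))" "continuous_on UNIV (\<lambda>x. F2 (\<psi> x) (\<theta> x))"
  proof -
    have cp: "continuous_on UNIV (\<lambda>x. (\<psi> x, \<theta> x))" by (intro continuous_intros c)
    have "continuous_on UNIV (\<lambda>p. F1 (fst p) (snd p))" "continuous_on UNIV (\<lambda>p. F2 (fst p) (snd p))" using F by (auto simp: C1F_def)
    from continuous_on_compose2[OF this(1) cp] continuous_on_compose2[OF this(2) cp]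
    show "continuous_on UNIV (\<lambda>x. F1 (\<psi> x) (\<theta> x))" "continuous_on UNIV (\<lambda>x. F2 (\<psi> x) (\<theta> x))" by auto
  qed
  have p: "pd ?w i x = F1 (\<psi> x) (\<theta> x) * pd \<psi> i x + F2 (\<psi> x) (\<theta> x) * pd \<theta> i x" for i x
    using pd_eqI[OF D, of i x] by (simp add: inner_axis grad_def inner_add_left)
  have wd: "?w differentiable (at x)" for x using D unfolding differentiable_def by blast
  have "pd ?w i = (\<lambda>x. F1 (\<psi> x) (\<theta> x) * pd \<psi> i x + F2 (\<psi> x) (\<theta> x) * pd \<theta> i x)" for i by (rule ext) (rule p)
  hence cw: "Ck 1 ?w" using wd unfolding One_nat_def Ck.simps by (simp only:) (intro conjI allI continuous_intros cF c; simp)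
  have "C1c (\<lambda>x. ?w x * \<eta> x)" by (rule C1c_mult[OF test_fun_C1c[OF t(1)] cw])
  hence C: "C1c (\<lambda>x. \<eta> x * ?w x)" by (simp only: mult.commute)
  have "grad (\<lambda>x. \<eta> x * ?w x) = (\<lambda>x. F (\<psi> x) (\<theta> x) *\<^sub>R grad \<eta> x + \<eta> x *\<^sub>R (F1 (\<psi> x) (\<theta> x) *\<^sub>R grad \<psi> x + F2 (\<psi> x) (\<theta> x) *\<^sub>R grad \<theta> x))"
    by (rule ext) (simp add: vec_eq_iff grad_def pd_mult[OF test_diff[OF t(1)] wd] p algebra_simps)
  with W12_C1c[OF C] show ?thesis by (simp only:)
qed

lemma bounded_test:
  assumes "test_fun U \<eta>"
  obtains C where "C \<ge> 0" "\<And>x. \<bar>\<eta> x\<bar> \<le> C" "\<And>x. norm (grad \<eta> x) \<le> C"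
proof -
  obtain C R where C: "C \<ge> 0" "\<forall>x. \<bar>\<eta> x\<bar> \<le> C * indicator (cball 0 R) x"
    "\<forall>x. norm (grad \<eta> x) \<le> C * indicator (cball 0 R) x" using C1c_D(6)[OF test_fun_C1c[OF assms]] by blast
  have le: "C * indicator (cball 0 R) x \<le> C" for x :: R3 using C(1) by (auto simp: indicator_def)
  show thesis by (rule that[OF C(1)]) (use C(2,3) le in \<open>blast intro: order_trans\<close>)+
qed

text \<open>\<open>F\<close> need not vanish at the origin, so it is the factor
  \<open>\<eta>\<close> that makes the product square integrable. The approximation by test
  functions converges almost everywhere as well, since \<open>F1\<close> and \<open>F2\<close> are
  only continuous and bounded.\<close>

theorem chain_rule:
  assumes F: "C1F F F1 F2 L" and t: "test_fun UNIV \<eta>" and Wu: "W12 u G" and Wv: "W12 v H"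
  shows "W12 (\<lambda>x. \<eta> x * F (u x) (v x))
    (\<lambda>x. F (u x) (v x) *\<^sub>R grad \<eta> x + \<eta> x *\<^sub>R (F1 (u x) (v x) *\<^sub>R G x + F2 (u x) (v x) *\<^sub>R H x))"
proof -
  obtain \<psi> where p: "\<forall>n. test_fun UNIV (\<psi> n)" "(\<lambda>n. nsq (\<lambda>x. \<psi> n x - u x)) \<longlonglongrightarrow> 0"
    "(\<lambda>n. nsq (\<lambda>x. grad (\<psi> n) x - G x)) \<longlonglongrightarrow> 0"
    "AE x in lborel. (\<lambda>n. \<psi> n x) \<longlonglongrightarrow> u x" by (rule W12_approx[OF Wu])
  obtain \<theta> where q: "\<forall>n. test_fun UNIV (\<theta> n)" "(\<lambda>n. nsq (\<lambda>x. \<theta> n x - v x)) \<longlonglongrightarrow> 0"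
    "(\<lambda>n. nsq (\<lambda>x. grad (\<theta> n) x - H x)) \<longlonglongrightarrow> 0"
    "AE x in lborel. (\<lambda>n. \<theta> n x) \<longlonglongrightarrow> v x" by (rule W12_approx[OF Wv])
  have pt: "test_fun UNIV (\<psi> n)" and qt: "test_fun UNIV (\<theta> n)" for n using p(1) q(1) by auto
  obtain C where C: "C \<ge> 0" "\<And>x. \<bar>\<eta> x\<bar> \<le> C" "\<And>x. norm (grad \<eta> x) \<le> C" using bounded_test[OF t] by blast
  note s = W12D(1,2)[OF Wu] W12D(1,2)[OF Wv]
  have mu: "u \<in> mble" "v \<in> mble" "G \<in> mble" "H \<in> mble"
    using s by (auto simp: sq_def)
  have mt: "\<psi> n \<in> mble" "\<theta> n \<in> mble" for n
    using test_sq(1)[OF pt] test_sq(1)[OF qt] by (auto simp: sq_def)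
  have me: "\<eta> \<in> mble" "grad \<eta> \<in> mble"
    using test_sq[OF t] by (auto simp: sq_def)
  have Lb: "\<bar>F1 s t\<bar> \<le> L \<and> \<bar>F2 s t\<bar> \<le> L" for s t using F unfolding C1F_def by blast
  have L: "L \<ge> 0" "\<And>s t. \<bar>F1 s t\<bar> \<le> L" "\<And>s t. \<bar>F2 s t\<bar> \<le> L"
    using order_trans[OF abs_ge_zero conjunct1[OF Lb[of 0 0]]] Lb by auto
  note mF = C1F_meas[OF F mu(1,2)]
  note mFn = C1F_meas[OF F mt]
  let ?d = "\<lambda>n x. F (\<psi> n x) (\<theta> n x) - F (u x) (v x)"
  have sd: "sq (?d n)" and dn: "nsq (?d n) \<le> 4 * L\<^sup>2 * (2 * nsq (\<lambda>x. \<psi> n x - u x) + 2 * nsq (\<lambda>x. \<theta> n x - v x))" for n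
  proof -
    let ?e = "\<lambda>x. \<bar>\<psi> n x - u x\<bar> + \<bar>\<theta> n x - v x\<bar>"
    have d1: "sq (\<lambda>x. \<psi> n x - u x)" "sq (\<lambda>x. \<theta> n x - v x)" by (intro sq_diff s test_sq(1)[OF pt] test_sq(1)[OF qt])+
    hence a1: "sq (\<lambda>x. \<bar>\<psi> n x - u x\<bar>)" "sq (\<lambda>x. \<bar>\<theta> n x - v x\<bar>)" by (auto simp: sq_def)
    have a2: "nsq (\<lambda>x. \<bar>\<psi> n x - u x\<bar>) = nsq (\<lambda>x. \<psi> n x - u x)" "nsq (\<lambda>x. \<bar>\<theta> n x - v x\<bar>) = nsq (\<lambda>x. \<theta> n x - v x)"
      by (auto simp: nsq_def)
    have e: "sq (\<lambda>x. (2 * L) * ?e x)" "nsq (\<lambda>x. (2 * L) * ?e x) = 4 * L\<^sup>2 * nsq ?e"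
      using sq_cmult(1)[OF sq_add(1)[OF a1], of "2 * L"] by (auto simp only: sq_cmult(2)) (simp add: power_mult_distrib)
    have b: "AE x in lborel. norm (?d n x) \<le> norm ((2 * L) * ?e x)"
      using C1F_Lip[OF F] L(1) by (auto intro!: AE_I2 simp: abs_mult)
    have m: "?d n \<in> mble" using mF(1) mFn(1)[of n n] by measurable
    show "sq (?d n)" by (rule sq_bound(1)[OF e(1) m b])
    have "nsq (?d n) \<le> 4 * L\<^sup>2 * nsq ?e" using sq_bound(2)[OF e(1) m b] unfolding e(2) .
    also have "\<dots> \<le> 4 * L\<^sup>2 * (2 * nsq (\<lambda>x. \<psi> n x - u x) + 2 * nsq (\<lambda>x. \<theta> n x - v x))"
      using sq_add(2)[OF a1] unfolding a2 by (intro mult_left_mono) auto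
    finally show "nsq (?d n) \<le> 4 * L\<^sup>2 * (2 * nsq (\<lambda>x. \<psi> n x - u x) + 2 * nsq (\<lambda>x. \<theta> n x - v x))" .
  qed
  have "(\<lambda>n. 4 * L\<^sup>2 * (2 * nsq (\<lambda>x. \<psi> n x - u x) + 2 * nsq (\<lambda>x. \<theta> n x - v x))) \<longlonglongrightarrow> 4 * L\<^sup>2 * (2 * 0 + 2 * 0)"
    by (intro tendsto_intros p q)
  hence dlim: "(\<lambda>n. nsq (?d n)) \<longlonglongrightarrow> 0"
    by (intro null_comparison_nonneg[OF _ nsq_nonneg dn]) simp
  have lim_mult: "(\<lambda>n. nsq (\<lambda>x. a x *\<^sub>R w n x)) \<longlonglongrightarrow> 0"
    if "a \<in> mble" "\<And>x. \<bar>a x\<bar> \<le> B" "\<And>n. sq (w n)" "(\<lambda>n. nsq (w n)) \<longlonglongrightarrow> 0"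
    for a B and w :: "nat \<Rightarrow> R3 \<Rightarrow> 'c::euclidean_space"
  proof (rule null_comparison_nonneg[OF _ nsq_nonneg])
    show "(\<lambda>n. B\<^sup>2 * nsq (w n)) \<longlonglongrightarrow> 0" using tendsto_mult_left[OF that(4), of "B\<^sup>2"] by simp
    show "nsq (\<lambda>x. a x *\<^sub>R w n x) \<le> B\<^sup>2 * nsq (w n)" for n by (rule sq_mult_bounded(2)[OF that(1) _ that(3)]) (use that(2) in auto)
  qed
  have A0: "(\<lambda>n. nsq (\<lambda>x. \<eta> x * F (\<psi> n x) (\<theta> n x) - \<eta> x * F (u x) (v x))) \<longlonglongrightarrow> 0"
    using lim_mult[OF me(1) C(2) sd dlim] by (simp add: right_diff_distrib)
  have sF0: "sq (\<lambda>x. \<eta> x * F (\<psi> n x) (\<theta> n x))" for n using W12D(1)[OF chain_test[OF F t pt qt]] .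
  have sF: "sq (\<lambda>x. \<eta> x * F (u x) (v x))"
    using sq_diff(1)[OF sF0[of 0] sq_mult_bounded(1)[OF me(1) _ sd[of 0], of C]] C(2) by (simp add: right_diff_distrib)
  let ?a = "\<lambda>E n x. \<eta> x * E (\<psi> n x) (\<theta> n x)" and ?b = "\<lambda>E x. \<eta> x * E (u x) (v x)"
  \<comment> \<open>A bounded, almost everywhere convergent factor times an L^2 convergent one:
    first replace the L^2 factor by its limit \<open>Z\<close>, then use dominated convergence with
    \<open>Z\<close> fixed.\<close>
  have key: "(\<lambda>n. nsq (\<lambda>x. (?a E n x) *\<^sub>R Y n x - (?b E x) *\<^sub>R Z x)) \<longlonglongrightarrow> 0"
    and keys: "sq (\<lambda>x. (?b E x) *\<^sub>R Z x)" "\<And>n. sq (\<lambda>x. (?a E n x) *\<^sub>R Y n x)"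
    if E: "continuous_on UNIV (\<lambda>p. E (fst p) (snd p))" "\<And>s t. \<bar>E s t\<bar> \<le> L"
      and mE: "(\<lambda>x. E (u x) (v x)) \<in> mble" "\<And>n. (\<lambda>x. E (\<psi> n x) (\<theta> n x)) \<in> mble"
      and Y: "\<And>n. sq (Y n)" "sq Z" "(\<lambda>n. nsq (\<lambda>x. Y n x - Z x)) \<longlonglongrightarrow> 0"
    for E and Y :: "nat \<Rightarrow> R3 \<Rightarrow> R3" and Z
  proof -
    have b: "\<bar>\<eta> x * E s t\<bar> \<le> C * L" for x s t using C E(2) by (simp add: abs_mult mult_mono)
    have m1: "(\<lambda>x. ?a E n x) \<in> mble" for n using me(1) mE(2)[of n] by measurable
    have m2: "(\<lambda>x. ?b E x) \<in> mble" using me(1) mE(1) by measurable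
    show k1: "sq (\<lambda>x. (?b E x) *\<^sub>R Z x)" by (rule sq_mult_bounded(1)[OF m2 _ Y(2)]) (use b in auto)
    show k2: "sq (\<lambda>x. (?a E n x) *\<^sub>R Y n x)" for n by (rule sq_mult_bounded(1)[OF m1 _ Y(1)]) (use b in auto)
    have k3: "sq (\<lambda>x. (?a E n x) *\<^sub>R Z x)" for n by (rule sq_mult_bounded(1)[OF m1 _ Y(2)]) (use b in auto)
    have l1: "(\<lambda>n. nsq (\<lambda>x. (?a E n x) *\<^sub>R Y n x - (?a E n x) *\<^sub>R Z x)) \<longlonglongrightarrow> 0"
    proof (rule null_comparison_nonneg[OF _ nsq_nonneg])
      show "(\<lambda>n. (C * L)\<^sup>2 * nsq (\<lambda>x. Y n x - Z x)) \<longlonglongrightarrow> 0" using tendsto_mult_left[OF Y(3), of "(C * L)\<^sup>2"] by simp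
      fix n
      have "nsq (\<lambda>x. (?a E n x) *\<^sub>R (Y n x - Z x)) \<le> (C * L)\<^sup>2 * nsq (\<lambda>x. Y n x - Z x)"
        by (rule sq_mult_bounded(2)[OF m1 _ sq_diff(1)[OF Y(1) Y(2)]]) (use b in auto)
      thus "nsq (\<lambda>x. (?a E n x) *\<^sub>R Y n x - (?a E n x) *\<^sub>R Z x) \<le> (C * L)\<^sup>2 * nsq (\<lambda>x. Y n x - Z x)"
        by (simp only: scaleR_diff_right)
    qed
    have l2: "(\<lambda>n. nsq (\<lambda>x. (?a E n x) *\<^sub>R Z x - (?b E x) *\<^sub>R Z x)) \<longlonglongrightarrow> 0"
    proof (rule sq_dominated(3)[OF sq_meas[OF k3] sq_meas[OF k1]])
      show "AE x in lborel. (\<lambda>n. (?a E n x) *\<^sub>R Z x) \<longlonglongrightarrow> (?b E x) *\<^sub>R Z x"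
        using p(4) q(4)
      proof eventually_elim
        case (elim x)
        have "isCont (\<lambda>p. E (fst p) (snd p)) (u x, v x)" using E(1) by (simp add: continuous_on_eq_continuous_at)
        from isCont_tendsto_compose[OF this tendsto_Pair[OF elim]]
        have "(\<lambda>n. E (\<psi> n x) (\<theta> n x)) \<longlonglongrightarrow> E (u x) (v x)" by simp
        thus ?case by (intro tendsto_intros)
      qed
      show "sq (\<lambda>x. (C * L) * norm (Z x))" using Y(2) sq_cmult(1)[of "\<lambda>x. norm (Z x)" "C * L"] by (auto simp: sq_def)
      show "AE x in lborel. norm ((?a E n x) *\<^sub>R Z x) \<le> (C * L) * norm (Z x)" for n
      proof (rule AE_I2)
        fix x show "norm ((?a E n x) *\<^sub>R Z x) \<le> (C * L) * norm (Z x)"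
          unfolding norm_scaleR by (rule mult_right_mono[OF b norm_ge_zero])
      qed
    qed
    show "(\<lambda>n. nsq (\<lambda>x. (?a E n x) *\<^sub>R Y n x - (?b E x) *\<^sub>R Z x)) \<longlonglongrightarrow> 0"
    proof (rule null_comparison_nonneg[OF _ nsq_nonneg])
      show "(\<lambda>n. 2 * nsq (\<lambda>x. (?a E n x) *\<^sub>R Y n x - (?a E n x) *\<^sub>R Z x)
          + 2 * nsq (\<lambda>x. (?a E n x) *\<^sub>R Z x - (?b E x) *\<^sub>R Z x)) \<longlonglongrightarrow> 0"
        using tendsto_add[OF tendsto_mult_left[OF l1, of 2] tendsto_mult_left[OF l2, of 2]] by simp
      show "nsq (\<lambda>x. (?a E n x) *\<^sub>R Y n x - (?b E x) *\<^sub>R Z x)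
         \<le> 2 * nsq (\<lambda>x. (?a E n x) *\<^sub>R Y n x - (?a E n x) *\<^sub>R Z x)
          + 2 * nsq (\<lambda>x. (?a E n x) *\<^sub>R Z x - (?b E x) *\<^sub>R Z x)" for n
        by (rule nsq_triangle[OF k2 k3 k1])
    qed
  qed
  have cF: "continuous_on UNIV (\<lambda>p. F1 (fst p) (snd p))" "continuous_on UNIV (\<lambda>p. F2 (fst p) (snd p))"
    using F by (auto simp: C1F_def)
  note K1 = key[OF cF(1) L(2) mF(2) mFn(2) test_sq(3)[OF pt] s(2) p(3)]
  note K1s = keys[OF cF(1) L(2) mF(2) mFn(2) test_sq(3)[OF pt] s(2) p(3)]
  note K2 = key[OF cF(2) L(3) mF(3) mFn(3) test_sq(3)[OF qt] s(4) q(3)]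
  note K2s = keys[OF cF(2) L(3) mF(3) mFn(3) test_sq(3)[OF qt] s(4) q(3)]
  let ?Tn = "\<lambda>n x. F (\<psi> n x) (\<theta> n x) *\<^sub>R grad \<eta> x" and ?T = "\<lambda>x. F (u x) (v x) *\<^sub>R grad \<eta> x"
  have T: "(\<lambda>n. nsq (\<lambda>x. ?Tn n x - ?T x)) \<longlonglongrightarrow> 0" and sTd: "sq (\<lambda>x. ?Tn n x - ?T x)" for n
  proof -
    have m: "(\<lambda>x. ?Tn n x - ?T x) \<in> mble" for n using mF(1) mFn(1)[of n n] me(2) by measurable
    have b: "AE x in lborel. norm (?Tn n x - ?T x) \<le> norm (C * ?d n x)" for n
    proof (rule AE_I2)
      fix x
      have "norm (?Tn n x - ?T x) = \<bar>?d n x\<bar> * norm (grad \<eta> x)" by (simp flip: scaleR_diff_left)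
      also have "\<dots> \<le> \<bar>?d n x\<bar> * C" using C(3) by (intro mult_left_mono) auto
      finally show "norm (?Tn n x - ?T x) \<le> norm (C * ?d n x)" using C(1) by (simp add: abs_mult mult.commute)
    qed
    show "sq (\<lambda>x. ?Tn n x - ?T x)" for n by (rule sq_bound(1)[OF sq_cmult(1)[OF sd] m b])
    show "(\<lambda>n. nsq (\<lambda>x. ?Tn n x - ?T x)) \<longlonglongrightarrow> 0"
    proof (rule null_comparison_nonneg[OF _ nsq_nonneg])
      show "(\<lambda>n. C\<^sup>2 * nsq (?d n)) \<longlonglongrightarrow> 0" using tendsto_mult_left[OF dlim, of "C\<^sup>2"] by simp
      show "nsq (\<lambda>x. ?Tn n x - ?T x) \<le> C\<^sup>2 * nsq (?d n)" for n
        using sq_bound(2)[OF sq_cmult(1)[OF sd] m b] by (simp only: sq_cmult(2))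
    qed
  qed
  let ?A1n = "\<lambda>n x. (\<eta> x * F1 (\<psi> n x) (\<theta> n x)) *\<^sub>R grad (\<psi> n) x" and ?A1 = "\<lambda>x. (\<eta> x * F1 (u x) (v x)) *\<^sub>R G x"
  let ?A2n = "\<lambda>n x. (\<eta> x * F2 (\<psi> n x) (\<theta> n x)) *\<^sub>R grad (\<theta> n) x" and ?A2 = "\<lambda>x. (\<eta> x * F2 (u x) (v x)) *\<^sub>R H x"
  have Wn: "W12 (\<lambda>x. \<eta> x * F (\<psi> n x) (\<theta> n x)) (\<lambda>x. ?Tn n x + (?A1n n x + ?A2n n x))" for n
    using chain_test[OF F t pt qt, of n n] by (simp add: scaleR_add_right)
  have sTn: "sq (?Tn n)" for n
    using sq_diff(1)[OF W12D(2)[OF Wn[of n]] sq_add(1)[OF K1s(2)[of n] K2s(2)[of n]]] by simp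
  have sT: "sq ?T" using sq_diff(1)[OF sTn[of 0] sTd[of 0]] by simp
  have "W12 (\<lambda>x. \<eta> x * F (u x) (v x)) (\<lambda>x. ?T x + (?A1 x + ?A2 x))"
  proof (rule W12_limit[OF Wn sF _ A0])
    show "sq (\<lambda>x. ?T x + (?A1 x + ?A2 x))" by (intro sq_add sT K1s(1) K2s(1))
    show "(\<lambda>n. nsq (\<lambda>x. (?Tn n x + (?A1n n x + ?A2n n x)) - (?T x + (?A1 x + ?A2 x)))) \<longlonglongrightarrow> 0"
    proof (rule null_comparison_nonneg[OF _ nsq_nonneg])
      show "(\<lambda>n. 2 * nsq (\<lambda>x. ?Tn n x - ?T x) + 2 * (2 * nsq (\<lambda>x. ?A1n n x - ?A1 x) + 2 * nsq (\<lambda>x. ?A2n n x - ?A2 x))) \<longlonglongrightarrow> 0"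
        using tendsto_add[OF tendsto_mult_left[OF T, of 2] tendsto_mult_left[OF tendsto_add[OF tendsto_mult_left[OF K1, of 2] tendsto_mult_left[OF K2, of 2]], of 2]]
        by simp
      fix n
      have d1: "sq (\<lambda>x. ?A1n n x - ?A1 x)" by (intro sq_diff K1s)
      have d2: "sq (\<lambda>x. ?A2n n x - ?A2 x)" by (intro sq_diff K2s)
      have e: "(\<lambda>x. (?Tn n x + (?A1n n x + ?A2n n x)) - (?T x + (?A1 x + ?A2 x))) = (\<lambda>x. (?Tn n x - ?T x) + ((?A1n n x - ?A1 x) + (?A2n n x - ?A2 x)))"
        by (rule ext) (simp only: add_diff_add)
      show "nsq (\<lambda>x. (?Tn n x + (?A1n n x + ?A2n n x)) - (?T x + (?A1 x + ?A2 x)))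
        \<le> 2 * nsq (\<lambda>x. ?Tn n x - ?T x) + 2 * (2 * nsq (\<lambda>x. ?A1n n x - ?A1 x) + 2 * nsq (\<lambda>x. ?A2n n x - ?A2 x))"
        unfolding e using sq_add(2)[OF sTd[of n] sq_add(1)[OF d1 d2]] sq_add(2)[OF d1 d2] by argo
    qed
  qed
  thus ?thesis by (simp add: scaleR_add_right)
qed

section \<open>Picone's identity\<close>

text \<open>A compact support keeps a positive distance from the complement of \<open>U\<close>, so
  centred kernels of small radius stay inside.\<close>

lemma tapprox_compact:
  assumes W: "W12 v G" and K: "compact K" "K \<subseteq> U" "open U" "AE x in lborel. x \<notin> K \<longrightarrow> v x = 0"
  shows "tapprox U v G"
proof -
  obtain d where d: "d > 0" "(\<Union>x\<in>K. cball x d) \<subseteq> U"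
    using compact_subset_open_imp_cball_epsilon_subset[OF K(1,3,2)] by blast
  show ?thesis
  proof (rule mollify_tapprox[OF W K(1,4), where h="\<lambda>n. d * inverse (real (Suc n))" and a="\<lambda>n. 0"])
    show "(\<lambda>n. d * inverse (real (Suc n))) \<longlonglongrightarrow> 0"
      using tendsto_mult_left[OF LIMSEQ_inverse_real_of_nat, of d] by simp
    fix n and p q :: R3 assume p: "p \<in> K" and q: "q \<in> cball 0 (d * inverse (real (Suc n)))"
    have "d * inverse (real (Suc n)) \<le> d * 1" using d by (intro mult_left_mono) (auto simp: inverse_le_1_iff)
    hence "p + q \<in> cball p d" using q by (simp add: dist_norm)
    thus "p + q \<in> U" using d(2) p by blast
  qed (use d in auto)
qed

text \<open>Putting a square root of the weight on each factor turns the term with \<open>f\<close>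
  into an L^2 pairing, for which Cauchy-Schwarz and the convergence results are available.\<close>

lemma sqrt_weight:
  fixes f :: "R3 \<Rightarrow> real"
  assumes f: "f \<in> mble" "integrable lborel (\<lambda>x. \<bar>f x\<bar> powr (3/2))" and W: "W12 u G"
  shows "sq (\<lambda>x. sqrt \<bar>f x\<bar> * u x)" "nsq (\<lambda>x. sqrt \<bar>f x\<bar> * u x) = (LBINT x. \<bar>f x\<bar> * (u x)\<^sup>2)"
    "nsq (\<lambda>x. sqrt \<bar>f x\<bar> * u x) \<le> ((LBINT x. \<bar>f x\<bar> powr (3/2)) + 4096) * nsq G"
proof -
  have e: "(norm (sqrt \<bar>f x\<bar> * u x))\<^sup>2 = \<bar>f x\<bar> * (u x)\<^sup>2" for x
    by (simp add: power_mult_distrib)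
  have [measurable]: "u \<in> mble" "f \<in> mble" using f W12D(1)[OF W] by (auto simp: sq_def)
  have "(\<lambda>x. sqrt \<bar>f x\<bar> * u x) \<in> mble" by measurable
  thus "sq (\<lambda>x. sqrt \<bar>f x\<bar> * u x)"
    unfolding sq_def e using weighted_int(1)[OF f _ Sobolev(1)[OF W]] by simp
  show 1: "nsq (\<lambda>x. sqrt \<bar>f x\<bar> * u x) = (LBINT x. \<bar>f x\<bar> * (u x)\<^sup>2)" unfolding nsq_def e ..
  show "nsq (\<lambda>x. sqrt \<bar>f x\<bar> * u x) \<le> ((LBINT x. \<bar>f x\<bar> powr (3/2)) + 4096) * nsq G"
    unfolding 1 by (rule weighted_bound[OF f W])
qed

lemma weight_bilinear:
  fixes f :: "R3 \<Rightarrow> real"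
  assumes f: "f \<in> mble" "integrable lborel (\<lambda>x. \<bar>f x\<bar> powr (3/2))" and W: "W12 u G" "W12 v H"
  shows "integrable lborel (\<lambda>x. f x * u x * v x)"
    "\<bar>LBINT x. f x * u x * v x\<bar> \<le> sqrt (nsq (\<lambda>x. sqrt \<bar>f x\<bar> * u x)) * sqrt (nsq (\<lambda>x. sqrt \<bar>f x\<bar> * v x))"
proof -
  have [measurable]: "u \<in> mble" "v \<in> mble" "f \<in> mble"
    using f W12D(1)[OF W(1)] W12D(1)[OF W(2)] by (auto simp: sq_def)
  have e: "\<bar>f x * u x * v x\<bar> = norm (sqrt \<bar>f x\<bar> * u x) * norm (sqrt \<bar>f x\<bar> * v x)" for x
  proof -
    have "\<bar>f x\<bar> = sqrt \<bar>f x\<bar> * sqrt \<bar>f x\<bar>" by simp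
    thus ?thesis by (simp add: abs_mult mult_ac)
  qed
  note i = sq_norm_mult_int[OF sqrt_weight(1)[OF f W(1)] sqrt_weight(1)[OF f W(2)]]
  show i2: "integrable lborel (\<lambda>x. f x * u x * v x)"
    by (rule Bochner_Integration.integrable_bound[OF i]) (use e in auto)
  have "\<bar>LBINT x. f x * u x * v x\<bar> \<le> (LBINT x. \<bar>f x * u x * v x\<bar>)" by (rule integral_abs_bound)
  also have "\<dots> \<le> sqrt (nsq (\<lambda>x. sqrt \<bar>f x\<bar> * u x)) * sqrt (nsq (\<lambda>x. sqrt \<bar>f x\<bar> * v x))"
    unfolding e by (rule L2_CS_norm[OF sqrt_weight(1)[OF f W(1)] sqrt_weight(1)[OF f W(2)]])
  finally show "\<bar>LBINT x. f x * u x * v x\<bar> \<le> sqrt (nsq (\<lambda>x. sqrt \<bar>f x\<bar> * u x)) * sqrt (nsq (\<lambda>x. sqrt \<bar>f x\<bar> * v x))" .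
qed

lemma weight_approx:
  fixes f :: "R3 \<Rightarrow> real"
  assumes f: "f \<in> mble" "integrable lborel (\<lambda>x. \<bar>f x\<bar> powr (3/2))"
    and W: "\<And>n. W12 (\<psi> n) (D n)" "W12 u G" and lim: "(\<lambda>n. nsq (\<lambda>x. D n x - G x)) \<longlonglongrightarrow> 0"
  shows "(\<lambda>n. nsq (\<lambda>x. sqrt \<bar>f x\<bar> * \<psi> n x - sqrt \<bar>f x\<bar> * u x)) \<longlonglongrightarrow> 0"
proof (rule null_comparison_nonneg[OF _ nsq_nonneg])
  let ?K = "(LBINT x. \<bar>f x\<bar> powr (3/2)) + 4096"
  show "(\<lambda>n. ?K * nsq (\<lambda>x. D n x - G x)) \<longlonglongrightarrow> 0" using tendsto_mult_left[OF lim, of ?K] by simp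
  show "nsq (\<lambda>x. sqrt \<bar>f x\<bar> * \<psi> n x - sqrt \<bar>f x\<bar> * u x) \<le> ?K * nsq (\<lambda>x. D n x - G x)" for n
    using sqrt_weight(3)[OF f W12_diff[OF W(1)[of n] W(2)]] by (simp only: right_diff_distrib)
qed

text \<open>\<open>U\<close> is any open set and \<open>\<phi>\<close> only nonnegative, so that the
  whole space can take the place of \<open>U\<close> when the eigenfunction is extended by
  zero.\<close>

locale weak_eigenfunction =
  fixes f :: "R3 \<Rightarrow> real" and U :: "R3 set" and \<phi> :: "R3 \<Rightarrow> real" and H :: "R3 \<Rightarrow> R3" and l :: real
  assumes f: "f \<in> mble" "integrable lborel (\<lambda>x. \<bar>f x\<bar> powr (3/2))"
    and U: "open U" and W: "W12 \<phi> H" and pos: "AE x in lborel. \<phi> x \<ge> 0"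
    and eq: "\<And>\<psi>. test_fun U \<psi> \<Longrightarrow> (LBINT x. H x \<bullet> grad \<psi> x) = l * (LBINT x. f x * \<phi> x * \<psi> x)"
begin

lemma sH: "sq H" and s\<phi>: "sq \<phi>" and m\<phi> [measurable]: "\<phi> \<in> mble"
  and mH [measurable]: "H \<in> mble" and mf [measurable]: "f \<in> mble"
  using W12D[OF W] f by (auto simp: sq_def)

text \<open>The weighted bound makes the term with \<open>f\<close> continuous in the Dirichlet
  norm, so the equation passes from test functions to their limits.\<close>

lemma eq_extend:
  assumes T: "tapprox U v G" and Wv: "W12 v G"
  shows "(LBINT x. H x \<bullet> G x) = l * (LBINT x. f x * \<phi> x * v x)"
proof -
  obtain \<psi> where p: "\<And>n. test_fun U (\<psi> n)" "(\<lambda>n. nsq (\<lambda>x. grad (\<psi> n) x - G x)) \<longlonglongrightarrow> 0"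
    using tapprox_seq[OF T] by blast
  have 1: "(\<lambda>n. LBINT x. H x \<bullet> grad (\<psi> n) x) \<longlonglongrightarrow> (LBINT x. H x \<bullet> G x)"
    by (rule L2_inner_conv[OF sH sH _ test_sq(3)[OF p(1)] W12D(2)[OF Wv] p(2)]) simp
  let ?a = "sqrt (nsq (\<lambda>x. sqrt \<bar>f x\<bar> * \<phi> x))"
  have "(\<lambda>n. ?a * sqrt (nsq (\<lambda>x. sqrt \<bar>f x\<bar> * \<psi> n x - sqrt \<bar>f x\<bar> * v x))) \<longlonglongrightarrow> ?a * sqrt 0"
    by (intro tendsto_intros weight_approx[OF f W12_test[OF p(1)] Wv p(2)])
  hence z: "(\<lambda>n. ?a * sqrt (nsq (\<lambda>x. sqrt \<bar>f x\<bar> * \<psi> n x - sqrt \<bar>f x\<bar> * v x))) \<longlonglongrightarrow> 0" by simp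
  have "(\<lambda>n. (LBINT x. f x * \<phi> x * \<psi> n x) - (LBINT x. f x * \<phi> x * v x)) \<longlonglongrightarrow> 0"
  proof (rule null_comparison[OF z])
    fix n
    have "(LBINT x. f x * \<phi> x * \<psi> n x) - (LBINT x. f x * \<phi> x * v x) = (LBINT x. f x * \<phi> x * (\<psi> n x - v x))"
      using weight_bilinear(1)[OF f W W12_test[OF p(1)]] weight_bilinear(1)[OF f W Wv] by (simp add: right_diff_distrib)
    thus "\<bar>(LBINT x. f x * \<phi> x * \<psi> n x) - (LBINT x. f x * \<phi> x * v x)\<bar>
        \<le> ?a * sqrt (nsq (\<lambda>x. sqrt \<bar>f x\<bar> * \<psi> n x - sqrt \<bar>f x\<bar> * v x))"
      using weight_bilinear(2)[OF f W W12_diff[OF W12_test[OF p(1)[of n]] Wv]] by (simp only: right_diff_distrib)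
  qed
  hence "(\<lambda>n. LBINT x. f x * \<phi> x * \<psi> n x) \<longlonglongrightarrow> (LBINT x. f x * \<phi> x * v x)" by (rule LIM_zero_cancel)
  hence 2: "(\<lambda>n. l * (LBINT x. f x * \<phi> x * \<psi> n x)) \<longlonglongrightarrow> l * (LBINT x. f x * \<phi> x * v x)"
    by (intro tendsto_intros)
  show ?thesis using 1 2 unfolding eq[OF p(1)] by (rule LIMSEQ_unique)
qed

text \<open>The function \<open>1 / (s + e)\<close> for nonnegative \<open>s\<close>, continued by
  its tangent at 0, so that it is C^1 with bounded derivative on the whole line as the chain rule
  requires.\<close>

definition recip :: "real \<Rightarrow> real \<Rightarrow> real" where
  "recip e s = 1 / (max s 0 + e) - min s 0 / e\<^sup>2"

lemma recip_nonneg: "s \<ge> 0 \<Longrightarrow> recip e s = 1 / (s + e)"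
  by (simp add: recip_def)

lemma recip_deriv:
  assumes e: "e > 0"
  shows "(recip e has_real_derivative (- 1 / (max s 0 + e)\<^sup>2)) (at s)"
proof -
  consider "s < 0" | "s = 0" | "s > 0" by linarith
  thus ?thesis
  proof cases
    case 1
    have "((\<lambda>s. 1 / e - s / e\<^sup>2) has_real_derivative (- 1 / e\<^sup>2)) (at s)"
      using e by (auto intro!: derivative_eq_intros simp: power4_eq_xxxx power2_eq_square)
    hence "(recip e has_real_derivative (- 1 / e\<^sup>2)) (at s)"
      by (rule has_field_derivative_transform_within_open[of _ _ _ "{..<0}"]) (use 1 in \<open>auto simp: recip_def\<close>)
    thus ?thesis using 1 by simp
  next
    case 3
    have "((\<lambda>s. 1 / (s + e)) has_real_derivative (- 1 / (s + e)\<^sup>2)) (at s)"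
      using e 3 by (auto intro!: derivative_eq_intros simp: power2_eq_square)
    hence "(recip e has_real_derivative (- 1 / (s + e)\<^sup>2)) (at s)"
      by (rule has_field_derivative_transform_within_open[of _ _ _ "{0<..}"]) (use 3 in \<open>auto simp: recip_def\<close>)
    thus ?thesis using 3 by simp
  next
    case 2
    \<comment> \<open>Caratheodory's form of the derivative: one slope function, continuous at 0,
      serves both sides.\<close>
    let ?q = "\<lambda>z. - 1 / (e * (max z 0 + e))"
    have q1: "recip e z - recip e 0 = ?q z * (z - 0)" for z
    proof (cases "z \<ge> 0")
      case True
      hence "z + e > 0" using e by simp
      thus ?thesis using True e by (simp add: recip_def field_simps)
    next
      case False
      thus ?thesis using e by (simp add: recip_def power2_eq_square)
    qed
    have q2: "isCont ?q 0" using e by (intro continuous_intros) auto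
    have q3: "?q 0 = - 1 / e\<^sup>2" by (simp add: power2_eq_square)
    have "(recip e has_real_derivative (- 1 / e\<^sup>2)) (at 0)"
      unfolding CARAT_DERIV by (intro exI[of _ ?q] conjI allI q1 q2 q3)
    thus ?thesis unfolding 2 by simp
  qed
qed

lemma recip_C1F:
  assumes e: "e > 0"
  shows "C1F (\<lambda>s t. recip e s) (\<lambda>s t. - 1 / (max s 0 + e)\<^sup>2) (\<lambda>s t. 0) (1 / e\<^sup>2)"
  unfolding C1F_def
proof (intro conjI allI)
  fix p :: "real \<times> real"
  have "((\<lambda>p. recip e (fst p)) has_derivative (\<lambda>h. fst h * (- 1 / (max (fst p) 0 + e)\<^sup>2))) (at p)"
    by (rule DERIV_compose_FDERIV[OF recip_deriv[OF e] has_derivative_fst[OF has_derivative_ident]])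
  thus "((\<lambda>p. recip e (fst p)) has_derivative (\<lambda>h. - 1 / (max (fst p) 0 + e)\<^sup>2 * fst h + 0 * snd h)) (at p)"
    by (simp add: mult.commute)
  show "continuous_on UNIV (\<lambda>p::real \<times> real. - 1 / (max (fst p) 0 + e)\<^sup>2)"
    using e by (intro continuous_intros) (auto simp: add_nonneg_eq_0_iff)
  fix s :: real
  have "e\<^sup>2 \<le> (max s 0 + e)\<^sup>2" using e by (intro power_mono) auto
  thus "\<bar>- 1 / (max s 0 + e)\<^sup>2\<bar> \<le> 1 / e\<^sup>2" using e by (simp add: frac_le)
qed (use e in auto)

lemma bounded_factor:
  assumes "test_fun UNIV \<eta>" "e > 0"
  shows "sq (\<lambda>x. (\<eta> x / (\<phi> x + e)) *\<^sub>R H x)"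
proof -
  obtain C where C: "C \<ge> 0" "\<And>x. \<bar>\<eta> x\<bar> \<le> C" "\<And>x. norm (grad \<eta> x) \<le> C"
    using bounded_test[OF assms(1)] by blast
  have [measurable]: "\<eta> \<in> mble" using test_sq(1)[OF assms(1)] by (rule sq_meas)
  show ?thesis
  proof (rule sq_mult_bounded(1)[OF _ _ sH])
    show "(\<lambda>x. \<eta> x / (\<phi> x + e)) \<in> mble" by measurable
    show "AE x in lborel. \<bar>\<eta> x / (\<phi> x + e)\<bar> \<le> C / e"
      using pos
    proof eventually_elim
      case (elim x)
      hence "\<bar>\<eta> x\<bar> / \<bar>\<phi> x + e\<bar> \<le> C / e" using C assms(2) by (intro frac_le) auto
      thus ?case by simp
    qed
  qed
qed

text \<open>Test the equation with \<open>\<eta>\<^sup>2 / (\<phi> + e)\<close> and complete the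
  square. The shift \<open>e\<close> keeps the quotient bounded where \<open>\<phi>\<close> is
  small.\<close>

lemma Picone_eps:
  assumes t: "test_fun U \<eta>" and e: "e > 0"
  shows "nsq (\<lambda>x. grad \<eta> x - (\<eta> x / (\<phi> x + e)) *\<^sub>R H x) = nsq (grad \<eta>) - l * (LBINT x. f x * \<phi> x * ((\<eta> x)\<^sup>2 / (\<phi> x + e)))"
proof -
  have tu: "test_fun UNIV \<eta>" using test_fun_mono[OF t] by simp
  have t2: "test_fun U (\<lambda>x. \<eta> x * \<eta> x)" by (rule test_fun_mult[OF t test_fun_smooth[OF t]])
  have t2u: "test_fun UNIV (\<lambda>x. \<eta> x * \<eta> x)" using test_fun_mono[OF t2] by simp
  let ?v = "\<lambda>x. (\<eta> x * \<eta> x) * recip e (\<phi> x)"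
  let ?G = "\<lambda>x. recip e (\<phi> x) *\<^sub>R grad (\<lambda>x. \<eta> x * \<eta> x) x + (\<eta> x * \<eta> x) *\<^sub>R ((- 1 / (max (\<phi> x) 0 + e)\<^sup>2) *\<^sub>R H x + 0 *\<^sub>R H x)"
  have Wv: "W12 ?v ?G" by (rule chain_rule[OF recip_C1F[OF e] t2u W W])
  obtain K where K: "compact K" "K \<subseteq> U" "\<And>x. x \<notin> K \<Longrightarrow> \<eta> x = 0" using test_funE[OF t] by metis
  have T: "tapprox U ?v ?G" by (rule tapprox_compact[OF Wv K(1,2) U]) (use K(3) in auto)
  have main: "(LBINT x. H x \<bullet> ?G x) = l * (LBINT x. f x * \<phi> x * ?v x)" by (rule eq_extend[OF T Wv])
  have ge: "grad (\<lambda>x. \<eta> x * \<eta> x) x = (2 * \<eta> x) *\<^sub>R grad \<eta> x" for x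
    using grad_mult[OF test_diff[OF t] test_diff[OF t]] by (simp flip: scaleR_add_left)
  let ?d = "\<lambda>x. grad \<eta> x - (\<eta> x / (\<phi> x + e)) *\<^sub>R H x"
  have sg: "sq (grad \<eta>)" by (rule test_sq(3)[OF t])
  have sd: "sq ?d" by (intro sq_diff sg bounded_factor[OF tu e])
  have "AE x in lborel. H x \<bullet> ?G x = (norm (grad \<eta> x))\<^sup>2 - (norm (?d x))\<^sup>2"
    using pos
  proof eventually_elim
    case (elim x)
    define c where "c = \<eta> x / (\<phi> x + e)"
    have G: "?G x = (2 * c) *\<^sub>R grad \<eta> x - c\<^sup>2 *\<^sub>R H x"
    proof -
      have "(\<eta> x * \<eta> x) * (- 1 / (\<phi> x + e)\<^sup>2) = - c\<^sup>2" by (simp add: c_def power_divide power2_eq_square)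
      moreover have "1 / (\<phi> x + e) * (2 * \<eta> x) = 2 * c" by (simp add: c_def)
      ultimately show ?thesis using elim by (simp add: recip_nonneg ge max_absorb1 c_def power2_eq_square)
    qed
    have "(norm (grad \<eta> x - c *\<^sub>R H x))\<^sup>2 = (norm (grad \<eta> x))\<^sup>2 - 2 * c * (grad \<eta> x \<bullet> H x) + c\<^sup>2 * (H x \<bullet> H x)"
      unfolding power2_norm_eq_inner
      by (simp add: inner_diff_left inner_diff_right inner_commute power2_eq_square algebra_simps)
    moreover have "H x \<bullet> ?G x = 2 * c * (grad \<eta> x \<bullet> H x) - c\<^sup>2 * (H x \<bullet> H x)"
      unfolding G by (simp add: inner_diff_right inner_commute)
    ultimately show ?case unfolding c_def by linarith
  qed
  hence "(LBINT x. H x \<bullet> ?G x) = (LBINT x. (norm (grad \<eta> x))\<^sup>2 - (norm (?d x))\<^sup>2)"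
    using sq_inner_int[OF sH W12D(2)[OF Wv]] sq_int[OF sg] sq_int[OF sd] by (intro integral_cong_AE) auto
  also have "\<dots> = nsq (grad \<eta>) - nsq ?d" unfolding nsq_def using sq_int[OF sg] sq_int[OF sd] by simp
  finally have 1: "(LBINT x. H x \<bullet> ?G x) = nsq (grad \<eta>) - nsq ?d" .
  have "(LBINT x. f x * \<phi> x * ?v x) = (LBINT x. f x * \<phi> x * ((\<eta> x)\<^sup>2 / (\<phi> x + e)))"
  proof (rule integral_cong_AE)
    show "AE x in lborel. f x * \<phi> x * ?v x = f x * \<phi> x * ((\<eta> x)\<^sup>2 / (\<phi> x + e))"
      using pos by eventually_elim (simp add: recip_nonneg power2_eq_square)
    show "(\<lambda>x. f x * \<phi> x * ?v x) \<in> mble" using weight_bilinear(1)[OF f W Wv] by auto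
    have [measurable]: "\<eta> \<in> mble" using test_sq(1)[OF t] by (rule sq_meas)
    show "(\<lambda>x. f x * \<phi> x * ((\<eta> x)\<^sup>2 / (\<phi> x + e))) \<in> mble" by measurable
  qed
  with main have "nsq (grad \<eta>) - nsq ?d = l * (LBINT x. f x * \<phi> x * ((\<eta> x)\<^sup>2 / (\<phi> x + e)))"
    unfolding 1 by simp
  thus ?thesis by linarith
qed

abbreviation "P \<equiv> {x. \<phi> x > 0}"

lemma mP [measurable]: "P \<in> sets lborel" "P \<in> sets borel"
proof -
  show 1: "P \<in> sets lborel" by measurable
  thus "P \<in> sets borel" by simp
qed

text \<open>Let \<open>e\<close> tend to 0: the term with \<open>f\<close> converges by domination,
  the square by Fatou. Where \<open>\<phi>\<close> vanishes the quotient carries no information,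
  hence the indicator of \<open>P\<close>.\<close>

lemma Picone_test:
  assumes t: "test_fun U \<eta>"
  shows "sq (\<lambda>x. indicator P x *\<^sub>R (grad \<eta> x - (\<eta> x / \<phi> x) *\<^sub>R H x))"
    "nsq (\<lambda>x. indicator P x *\<^sub>R (grad \<eta> x - (\<eta> x / \<phi> x) *\<^sub>R H x)) \<le> nsq (grad \<eta>) - l * (LBINT x. f x * (\<eta> x)\<^sup>2 * indicator P x)"
proof -
  have tu: "test_fun UNIV \<eta>" using test_fun_mono[OF t] by simp
  have m\<eta> [measurable]: "\<eta> \<in> mble" using test_sq(1)[OF t] by (rule sq_meas)
  have mg [measurable]: "grad \<eta> \<in> mble" using test_sq(3)[OF t] by (rule sq_meas)
  let ?e = "\<lambda>n. inverse (real (Suc n))"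
  let ?I = "\<integral>x. f x * (\<eta> x)\<^sup>2 * indicator P x \<partial>lborel"
  let ?d = "\<lambda>n x. grad \<eta> x - (\<eta> x / (\<phi> x + ?e n)) *\<^sub>R H x"
  have elim0: "(\<lambda>n. y + ?e n) \<longlonglongrightarrow> y" for y using tendsto_add[OF tendsto_const LIMSEQ_inverse_real_of_nat, of y] by simp
  have sd: "sq (?d n)" for n by (intro sq_diff test_sq(3)[OF t] bounded_factor[OF tu]) simp
  have I: "(\<lambda>n. LBINT x. f x * \<phi> x * ((\<eta> x)\<^sup>2 / (\<phi> x + ?e n))) \<longlonglongrightarrow> ?I"
  proof (rule Bochner_Integration.integral_dominated_convergence[where w="\<lambda>x. \<bar>f x\<bar> * (\<eta> x)\<^sup>2"])
    show "integrable lborel (\<lambda>x. \<bar>f x\<bar> * (\<eta> x)\<^sup>2)" by (rule weighted_int(1)[OF f m\<eta> Sobolev(1)[OF W12_test[OF t]]])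
    show "AE x in lborel. (\<lambda>n. f x * \<phi> x * ((\<eta> x)\<^sup>2 / (\<phi> x + ?e n))) \<longlonglongrightarrow> f x * (\<eta> x)\<^sup>2 * indicator P x"
      using pos
    proof eventually_elim
      case (elim x)
      show ?case
      proof (cases "\<phi> x > 0")
        case True
        have "(\<lambda>n. f x * \<phi> x * ((\<eta> x)\<^sup>2 / (\<phi> x + ?e n))) \<longlonglongrightarrow> f x * \<phi> x * ((\<eta> x)\<^sup>2 / \<phi> x)"
          by (intro tendsto_intros elim0) (use True in auto)
        thus ?thesis using True by simp
      next
        case False
        thus ?thesis using elim by simp
      qed
    qed
    show "AE x in lborel. norm (f x * \<phi> x * ((\<eta> x)\<^sup>2 / (\<phi> x + ?e n))) \<le> \<bar>f x\<bar> * (\<eta> x)\<^sup>2" for n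
      using pos
    proof eventually_elim
      case (elim x)
      have ep: "\<phi> x + ?e n > 0" using elim by (simp add: add_nonneg_pos)
      have "norm (f x * \<phi> x * ((\<eta> x)\<^sup>2 / (\<phi> x + ?e n))) = \<bar>f x\<bar> * (\<eta> x)\<^sup>2 * (\<phi> x / (\<phi> x + ?e n))"
        using elim ep by (simp add: abs_mult)
      also have "\<dots> \<le> \<bar>f x\<bar> * (\<eta> x)\<^sup>2 * 1"
        using ep elim by (intro mult_left_mono) (auto simp: pos_divide_le_eq)
      finally show ?case by simp
    qed
    show "(\<lambda>x. f x * (\<eta> x)\<^sup>2 * indicator P x) \<in> mble" by measurable
    show "(\<lambda>x. f x * \<phi> x * ((\<eta> x)\<^sup>2 / (\<phi> x + ?e n))) \<in> mble" for n by measurable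
  qed
  have N: "(\<lambda>n. nsq (?d n)) \<longlonglongrightarrow> nsq (grad \<eta>) - l * ?I"
  proof -
    have "nsq (?d n) = nsq (grad \<eta>) - l * (LBINT x. f x * \<phi> x * ((\<eta> x)\<^sup>2 / (\<phi> x + ?e n)))" for n
      by (rule Picone_eps[OF t]) simp
    thus ?thesis by (simp only:) (intro tendsto_intros I)
  qed
  let ?v = "\<lambda>x. indicator P x *\<^sub>R (grad \<eta> x - (\<eta> x / \<phi> x) *\<^sub>R H x)"
  have mv: "?v \<in> mble"
    by (intro borel_measurable_scaleR borel_measurable_indicator borel_measurable_diff borel_measurable_divide mP mH m\<phi> m\<eta> mg)
  have A: "AE x in lborel. (\<lambda>n. indicator P x *\<^sub>R ?d n x) \<longlonglongrightarrow> ?v x"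
  proof (rule AE_I2)
    fix x show "(\<lambda>n. indicator P x *\<^sub>R ?d n x) \<longlonglongrightarrow> ?v x"
    proof (cases "x \<in> P")
      case True
      show ?thesis by (intro tendsto_intros elim0) (use True in auto)
    qed simp
  qed
  have si: "sq (\<lambda>x. indicator P x *\<^sub>R ?d n x)" for n by (rule sq_indicator(1)[OF mP(2) sd])
  have le: "nsq (\<lambda>x. indicator P x *\<^sub>R ?d n x) \<le> nsq (?d n)" for n by (rule sq_indicator(2)[OF mP(2) sd])
  have *: "sq ?v \<and> nsq ?v \<le> nsq (grad \<eta>) - l * ?I + e" if "e > 0" for e
  proof -
    have "\<forall>\<^sub>F n in sequentially. nsq (?d n) < nsq (grad \<eta>) - l * ?I + e"
      by (rule order_tendstoD(2)[OF N]) (use that in simp)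
    hence ev: "\<forall>\<^sub>F n in sequentially. nsq (\<lambda>x. indicator P x *\<^sub>R ?d n x) \<le> nsq (grad \<eta>) - l * ?I + e"
      by eventually_elim (rule order_trans[OF le less_imp_le])
    show ?thesis using sq_fatou[OF si A mv ev] by blast
  qed
  show "sq ?v" using *[of 1] by simp
  show "nsq ?v \<le> nsq (grad \<eta>) - l * ?I" by (rule field_le_epsilon) (use * in blast)
qed

text \<open>Local square integrability of the logarithmic gradient of \<open>\<phi>\<close>; it is
  the majorant in the argument on the polar angle.\<close>

lemma log_grad:
  assumes t: "test_fun U \<eta>"
  shows "sq (\<lambda>x. indicator P x *\<^sub>R ((\<eta> x / \<phi> x) *\<^sub>R H x))"
proof -
  have "sq (\<lambda>x. indicator P x *\<^sub>R grad \<eta> x - indicator P x *\<^sub>R (grad \<eta> x - (\<eta> x / \<phi> x) *\<^sub>R H x))"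
    by (intro sq_diff Picone_test[OF t] sq_indicator mP test_sq(3)[OF t])
  thus ?thesis by (simp only: scaleR_diff_right[symmetric] diff_diff_eq2 add_diff_cancel_left')
qed

text \<open>Fatou again, now along approximating test functions. The right side converges because
  the term with \<open>f\<close> is an L^2 pairing after the weight is split.\<close>

lemma Picone:
  assumes T: "tapprox U u G" and Wu: "W12 u G"
  shows "sq (\<lambda>x. indicator P x *\<^sub>R (G x - (u x / \<phi> x) *\<^sub>R H x))"
    "nsq (\<lambda>x. indicator P x *\<^sub>R (G x - (u x / \<phi> x) *\<^sub>R H x)) \<le> nsq G - l * (LBINT x. f x * (u x)\<^sup>2 * indicator P x)"
proof -
  obtain \<psi> where p0: "\<forall>n. test_fun U (\<psi> n)" and p1: "(\<lambda>n. nsq (\<lambda>x. \<psi> n x - u x)) \<longlonglongrightarrow> 0"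
    "(\<lambda>n. nsq (\<lambda>x. grad (\<psi> n) x - G x)) \<longlonglongrightarrow> 0"
    "AE x in lborel. (\<lambda>n. \<psi> n x) \<longlonglongrightarrow> u x" "AE x in lborel. (\<lambda>n. grad (\<psi> n) x) \<longlonglongrightarrow> G x"
    using tapprox_seq_AE[OF T W12D(1,2)[OF Wu]] by (elim exE conjE) (rule that)
  note p = p0[rule_format]
  have mu: "u \<in> mble" and mG: "G \<in> mble" using W12D(1,2)[OF Wu] by (auto simp: sq_def)
  \<comment> \<open>The restriction of \<open>f x * (w x)\<^sup>2\<close> to \<open>P\<close> is the
    pairing of \<open>sqrt \<bar>f x\<bar> * w x\<close> with this bounded factor times
    itself.\<close>
  let ?s = "\<lambda>x. sgn (f x) * indicator P x"
  have ms: "?s \<in> mble" by measurable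
  have bs: "AE x in lborel. \<bar>?s x\<bar> \<le> 1" by (auto simp: indicator_def sgn_if)
  have fe: "f x * (w x)\<^sup>2 * indicator P x = (sqrt \<bar>f x\<bar> * w x) \<bullet> (?s x *\<^sub>R (sqrt \<bar>f x\<bar> * w x))" for w :: "R3 \<Rightarrow> real" and x
  proof -
    have "(sqrt \<bar>f x\<bar> * w x) * (sgn (f x) * (sqrt \<bar>f x\<bar> * w x)) = (sqrt \<bar>f x\<bar>)\<^sup>2 * sgn (f x) * (w x)\<^sup>2"
      by (simp only: power2_eq_square mult_ac)
    also have "\<dots> = f x * (w x)\<^sup>2" by (simp add: abs_mult_sgn)
    finally show ?thesis by (simp add: mult_ac)
  qed
  note wa = weight_approx[OF f W12_test[OF p] Wu p1(2)]
  have sw: "sq (\<lambda>x. sqrt \<bar>f x\<bar> * \<psi> n x)" for n by (rule sqrt_weight(1)[OF f W12_test[OF p]])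
  have sw0: "sq (\<lambda>x. sqrt \<bar>f x\<bar> * u x)" by (rule sqrt_weight(1)[OF f Wu])
  have F: "(\<lambda>n. LBINT x. f x * (\<psi> n x)\<^sup>2 * indicator P x) \<longlonglongrightarrow> (LBINT x. f x * (u x)\<^sup>2 * indicator P x)"
    unfolding fe
  proof (rule L2_inner_conv[OF sw sw0 wa sq_mult_bounded(1)[OF ms bs sw] sq_mult_bounded(1)[OF ms bs sw0]])
    show "(\<lambda>n. nsq (\<lambda>x. ?s x *\<^sub>R (sqrt \<bar>f x\<bar> * \<psi> n x) - ?s x *\<^sub>R (sqrt \<bar>f x\<bar> * u x))) \<longlonglongrightarrow> 0"
    proof (rule null_comparison_nonneg[OF wa nsq_nonneg])
      show "nsq (\<lambda>x. ?s x *\<^sub>R (sqrt \<bar>f x\<bar> * \<psi> n x) - ?s x *\<^sub>R (sqrt \<bar>f x\<bar> * u x)) \<le> nsq (\<lambda>x. sqrt \<bar>f x\<bar> * \<psi> n x - sqrt \<bar>f x\<bar> * u x)" for n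
        using sq_mult_bounded(2)[OF ms bs sq_diff(1)[OF sw[of n] sw0]] by (simp add: right_diff_distrib)
    qed
  qed
  let ?B = "nsq G - l * (LBINT x. f x * (u x)\<^sup>2 * indicator P x)"
  have N: "(\<lambda>n. nsq (grad (\<psi> n)) - l * (LBINT x. f x * (\<psi> n x)\<^sup>2 * indicator P x)) \<longlonglongrightarrow> ?B"
    by (intro tendsto_intros F L2_nsq_conv[OF test_sq(3)[OF p] W12D(2)[OF Wu] p1(2)])
  let ?v = "\<lambda>x. indicator P x *\<^sub>R (G x - (u x / \<phi> x) *\<^sub>R H x)"
  have mv: "?v \<in> mble"
    by (intro borel_measurable_scaleR borel_measurable_indicator borel_measurable_diff borel_measurable_divide mP mH m\<phi> mu mG)
  have A: "AE x in lborel. (\<lambda>n. indicator P x *\<^sub>R (grad (\<psi> n) x - (\<psi> n x / \<phi> x) *\<^sub>R H x)) \<longlonglongrightarrow> ?v x"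
    using p1(3,4)
  proof eventually_elim
    case (elim x)
    show ?case by (cases "x \<in> P") (auto intro!: tendsto_intros elim)
  qed
  have *: "sq ?v \<and> nsq ?v \<le> ?B + e" if "e > 0" for e
  proof -
    have "\<forall>\<^sub>F n in sequentially. nsq (grad (\<psi> n)) - l * (LBINT x. f x * (\<psi> n x)\<^sup>2 * indicator P x) < ?B + e"
      by (rule order_tendstoD(2)[OF N]) (use that in simp)
    hence ev: "\<forall>\<^sub>F n in sequentially. nsq (\<lambda>x. indicator P x *\<^sub>R (grad (\<psi> n) x - (\<psi> n x / \<phi> x) *\<^sub>R H x)) \<le> ?B + e"
      by eventually_elim (rule order_trans[OF Picone_test(2)[OF p] less_imp_le])
    show ?thesis using sq_fatou[OF Picone_test(1)[OF p] A mv ev] by blast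
  qed
  show "sq ?v" using *[of 1] by simp
  show "nsq ?v \<le> ?B" by (rule field_le_epsilon) (use * in blast)
qed

text \<open>For \<open>e = 0\<close> this is the cosine of the polar angle of \<open>(s, t)\<close>;
  a positive \<open>e\<close> removes the singularity at the origin.\<close>

definition angle :: "real \<Rightarrow> real \<Rightarrow> real \<Rightarrow> real" where
  "angle e s t = s / sqrt (s\<^sup>2 + t\<^sup>2 + e)"

lemma angle_C1F:
  assumes e: "e > 0"
  shows "C1F (angle e) (\<lambda>s t. 1 / sqrt (s\<^sup>2 + t\<^sup>2 + e) - s * s / sqrt (s\<^sup>2 + t\<^sup>2 + e) ^ 3)
     (\<lambda>s t. - s * t / sqrt (s\<^sup>2 + t\<^sup>2 + e) ^ 3) (1 / sqrt e)"
proof -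
  have q0: "s\<^sup>2 + t\<^sup>2 + e > 0" for s t using e by (simp add: add_nonneg_pos)
  have qn: "sqrt (s\<^sup>2 + t\<^sup>2 + e) \<noteq> 0" for s t using q0[of s t] by simp
  show ?thesis unfolding C1F_def
  proof (intro conjI allI)
    fix p :: "real \<times> real"
    let ?q = "\<lambda>p. sqrt ((fst p)\<^sup>2 + (snd p)\<^sup>2 + e)"
    define Q where "Q = ?q p"
    have Qp: "Q > 0" and Q2: "Q\<^sup>2 = (fst p)\<^sup>2 + (snd p)\<^sup>2 + e" using q0[of "fst p" "snd p"] by (auto simp: Q_def)
    have dq: "(?q has_derivative (\<lambda>h. (fst p * fst h + snd p * snd h) / Q)) (at p)"
    proof -
      have "((\<lambda>p::real \<times> real. (fst p)\<^sup>2 + (snd p)\<^sup>2 + e) has_derivative (\<lambda>h. 2 * (fst p * fst h + snd p * snd h))) (at p)"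
        by (auto intro!: derivative_eq_intros simp: algebra_simps)
      from DERIV_compose_FDERIV[OF DERIV_real_sqrt[OF q0[of "fst p" "snd p"]] this]
      have D: "(?q has_derivative (\<lambda>h. 2 * (fst p * fst h + snd p * snd h) * (inverse (?q p) / 2))) (at p)" .
      have e: "2 * a * (inverse Q / 2) = a / Q" for a :: real by (simp add: inverse_eq_divide)
      show ?thesis using D unfolding Q_def[symmetric] e .
    qed
    have "((\<lambda>p. fst p / ?q p) has_derivative (\<lambda>h. - fst p * (inverse Q * ((fst p * fst h + snd p * snd h) / Q) * inverse Q) + fst h / Q)) (at p)"
      using has_derivative_divide[OF has_derivative_fst[OF has_derivative_ident] dq] Qp unfolding Q_def by simp
    moreover have "- fst p * (inverse Q * ((fst p * fst h + snd p * snd h) / Q) * inverse Q) + fst h / Q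
      = (1 / Q - fst p * fst p / Q ^ 3) * fst h + - fst p * snd p / Q ^ 3 * snd h" for h :: "real \<times> real"
    proof -
      have "- a * (i * ((a * c + b * d) * i) * i) + c * i = (i - a * a * i ^ 3) * c + - a * b * i ^ 3 * d" for a b c d i :: real
        by (simp add: power3_eq_cube algebra_simps)
      thus ?thesis by (simp only: divide_inverse power_inverse mult_1_left)
    qed
    ultimately have "((\<lambda>p. fst p / ?q p) has_derivative
       (\<lambda>h. (1 / Q - fst p * fst p / Q ^ 3) * fst h + - fst p * snd p / Q ^ 3 * snd h)) (at p)"
      by (simp only:)
    thus "((\<lambda>p. angle e (fst p) (snd p)) has_derivative
       (\<lambda>h. (1 / ?q p - fst p * fst p / ?q p ^ 3) * fst h + - fst p * snd p / ?q p ^ 3 * snd h)) (at p)"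
      unfolding angle_def Q_def .
  next
    show "continuous_on UNIV (\<lambda>p. 1 / sqrt ((fst p)\<^sup>2 + (snd p)\<^sup>2 + e) - fst p * fst p / sqrt ((fst p)\<^sup>2 + (snd p)\<^sup>2 + e) ^ 3)"
      "continuous_on UNIV (\<lambda>p. - fst p * snd p / sqrt ((fst p)\<^sup>2 + (snd p)\<^sup>2 + e) ^ 3)"
      using qn by (intro continuous_intros; simp)+
  next
    fix s t :: real
    define Q where "Q = sqrt (s\<^sup>2 + t\<^sup>2 + e)"
    have Qp: "Q > 0" and Q2: "Q\<^sup>2 = s\<^sup>2 + t\<^sup>2 + e" using q0[of s t] by (auto simp: Q_def)
    have se: "sqrt e \<le> Q" unfolding Q_def by (intro real_sqrt_le_mono) simp
    have sQ: "\<bar>s\<bar> \<le> Q" "\<bar>t\<bar> \<le> Q" unfolding Q_def using e by (intro real_le_rsqrt; simp)+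
    have iQ: "1 / Q \<le> 1 / sqrt e" using se e by (intro frac_le) auto
    have Q3: "x / Q ^ 3 = (x / Q\<^sup>2) * (1 / Q)" for x by (simp add: power2_eq_square power3_eq_cube)
    have "1 / Q - s * s / Q ^ 3 = (1 - s\<^sup>2 / Q\<^sup>2) * (1 / Q)" by (simp only: Q3 left_diff_distrib mult_1_left power2_eq_square)
    moreover have "0 \<le> s\<^sup>2 / Q\<^sup>2" "s\<^sup>2 / Q\<^sup>2 \<le> 1" unfolding Q2 using q0[of s t] e by (auto simp: divide_le_eq_1)
    ultimately have "\<bar>1 / Q - s * s / Q ^ 3\<bar> \<le> 1 * (1 / Q)"
      using Qp by (simp only: abs_mult) (intro mult_mono, auto)
    thus "\<bar>1 / sqrt (s\<^sup>2 + t\<^sup>2 + e) - s * s / sqrt (s\<^sup>2 + t\<^sup>2 + e) ^ 3\<bar> \<le> 1 / sqrt e"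
      using iQ unfolding Q_def by linarith
    have "\<bar>s\<bar> * \<bar>t\<bar> \<le> Q * Q" using sQ Qp by (intro mult_mono) auto
    hence "\<bar>s\<bar> * \<bar>t\<bar> / Q\<^sup>2 \<le> 1" using Qp by (simp add: power2_eq_square divide_le_eq_1)
    hence "\<bar>s\<bar> * \<bar>t\<bar> / Q\<^sup>2 * (1 / Q) \<le> 1 * (1 / Q)" using Qp by (intro mult_right_mono) auto
    hence "\<bar>- s * t / Q ^ 3\<bar> \<le> 1 / Q" unfolding Q3 using Qp by (simp add: abs_mult)
    thus "\<bar>- s * t / sqrt (s\<^sup>2 + t\<^sup>2 + e) ^ 3\<bar> \<le> 1 / sqrt e" using iQ unfolding Q_def by linarith
  qed
qed

text \<open>Proportional gradients make the polar angle of \<open>(u, \<phi>)\<close> locally constant; the angle is bounded,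
  whereas \<open>u / \<phi>\<close> need not be locally integrable.\<close>
lemma angle_gradient:
  assumes Wu: "W12 u G" and t: "test_fun U \<eta>"
    and prp: "AE x in lborel. x \<in> U \<longrightarrow> (\<phi> x > 0 \<and> G x = (u x / \<phi> x) *\<^sub>R H x) \<or> (u x = 0 \<and> \<phi> x = 0 \<and> G x = 0 \<and> H x = 0)"
  shows "W12 (\<lambda>x. \<eta> x * (u x / sqrt ((u x)\<^sup>2 + (\<phi> x)\<^sup>2))) (\<lambda>x. (u x / sqrt ((u x)\<^sup>2 + (\<phi> x)\<^sup>2)) *\<^sub>R grad \<eta> x)"
proof -
  have tu: "test_fun UNIV \<eta>" using test_fun_mono[OF t] by simp
  have m\<eta> [measurable]: "\<eta> \<in> mble" using test_sq(1)[OF t] by (rule sq_meas)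
  have mg [measurable]: "grad \<eta> \<in> mble" using test_sq(3)[OF t] by (rule sq_meas)
  have mu [measurable]: "u \<in> mble" using W12D(1)[OF Wu] by (rule sq_meas)
  let ?Z = "\<lambda>x. u x / sqrt ((u x)\<^sup>2 + (\<phi> x)\<^sup>2)"
  have mZ: "?Z \<in> mble" by measurable
  obtain K where K: "K \<subseteq> U" "\<And>x. x \<notin> K \<Longrightarrow> \<eta> x = 0" using test_funE[OF t] by metis
  let ?e = "\<lambda>n. inverse (real (Suc n))"
  have ep: "?e n > 0" for n by simp
  let ?q = "\<lambda>n x. sqrt ((u x)\<^sup>2 + (\<phi> x)\<^sup>2 + ?e n)"
  let ?F = "\<lambda>n x. angle (?e n) (u x) (\<phi> x)"
  have mF: "?F n \<in> mble" for n unfolding angle_def by measurable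
  let ?F1 = "\<lambda>n x. 1 / ?q n x - u x * u x / ?q n x ^ 3"
  let ?F2 = "\<lambda>n x. - u x * \<phi> x / ?q n x ^ 3"
  let ?T = "\<lambda>n x. ?F n x *\<^sub>R grad \<eta> x"
  let ?R = "\<lambda>n x. \<eta> x *\<^sub>R (?F1 n x *\<^sub>R G x + ?F2 n x *\<^sub>R H x)"
  have Wn: "W12 (\<lambda>x. \<eta> x * ?F n x) (\<lambda>x. ?T n x + ?R n x)" for n
    by (rule chain_rule[OF angle_C1F[OF ep] tu Wu W])
  have q0: "?q n x > 0" for n x using ep[of n] by (simp add: add_nonneg_pos)
  have uq: "\<bar>u x\<bar> \<le> ?q n x" for n x
    using ep[of n] by (intro real_le_rsqrt) (simp add: power2_abs)
  have F1: "\<bar>?F n x\<bar> \<le> 1" for n x using uq[of x n] q0[of x n] by (simp add: angle_def abs_div_pos[symmetric] pos_divide_le_eq)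
  have elim0: "(\<lambda>n. y + ?e n) \<longlonglongrightarrow> y" for y using tendsto_add[OF tendsto_const LIMSEQ_inverse_real_of_nat, of y] by simp
  have qlim: "(\<lambda>n. ?q n x) \<longlonglongrightarrow> sqrt ((u x)\<^sup>2 + (\<phi> x)\<^sup>2)" for x by (intro tendsto_intros elim0)
  have Flim: "(\<lambda>n. ?F n x) \<longlonglongrightarrow> ?Z x" for x
  proof (cases "(u x)\<^sup>2 + (\<phi> x)\<^sup>2 = 0")
    case True
    hence "u x = 0" by (simp add: sum_power2_eq_zero_iff)
    thus ?thesis by (simp add: angle_def)
  next
    case False
    show ?thesis unfolding angle_def by (intro tendsto_divide tendsto_const qlim) (use False in simp)
  qed
  have L0: "(\<lambda>n. nsq (\<lambda>x. \<eta> x * ?F n x - \<eta> x * ?Z x)) \<longlonglongrightarrow> 0" and s0: "sq (\<lambda>x. \<eta> x * ?Z x)"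
  proof -
    have a1: "(\<lambda>x. \<eta> x * ?F n x) \<in> mble" for n using m\<eta> mF[of n] by measurable
    have a2: "(\<lambda>x. \<eta> x * ?Z x) \<in> mble" using m\<eta> mZ by measurable
    have a3: "AE x in lborel. (\<lambda>n. \<eta> x * ?F n x) \<longlonglongrightarrow> \<eta> x * ?Z x" by (intro AE_I2 tendsto_intros Flim)
    have a4: "sq (\<lambda>x. \<bar>\<eta> x\<bar>)" using test_sq(1)[OF t] by (auto simp: sq_def)
    have a5: "AE x in lborel. norm (\<eta> x * ?F n x) \<le> \<bar>\<eta> x\<bar>" for n
    proof (rule AE_I2)
      fix x show "norm (\<eta> x * ?F n x) \<le> \<bar>\<eta> x\<bar>" using mult_left_mono[OF F1[of n x], of "\<bar>\<eta> x\<bar>"] by (simp add: abs_mult)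
    qed
    show "(\<lambda>n. nsq (\<lambda>x. \<eta> x * ?F n x - \<eta> x * ?Z x)) \<longlonglongrightarrow> 0" "sq (\<lambda>x. \<eta> x * ?Z x)"
      by (rule sq_dominated(3)[OF a1 a2 a3 a4 a5], rule sq_dominated(2)[OF a1 a2 a3 a4 a5])
  qed
  have L1: "(\<lambda>n. nsq (\<lambda>x. ?T n x - ?Z x *\<^sub>R grad \<eta> x)) \<longlonglongrightarrow> 0" and s1: "sq (\<lambda>x. ?Z x *\<^sub>R grad \<eta> x)" and s1n: "\<And>n. sq (?T n)"
  proof -
    have a1: "?T n \<in> mble" for n using mg mF[of n] by measurable
    have a2: "(\<lambda>x. ?Z x *\<^sub>R grad \<eta> x) \<in> mble" using mg mZ by measurable
    have a3: "AE x in lborel. (\<lambda>n. ?T n x) \<longlonglongrightarrow> ?Z x *\<^sub>R grad \<eta> x" by (intro AE_I2 tendsto_intros Flim)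
    have a4: "sq (\<lambda>x. norm (grad \<eta> x))" using test_sq(3)[OF t] by (auto simp: sq_def)
    have a5: "AE x in lborel. norm (?T n x) \<le> norm (grad \<eta> x)" for n
    proof (rule AE_I2)
      fix x show "norm (?T n x) \<le> norm (grad \<eta> x)" using mult_right_mono[OF F1[of n x], of "norm (grad \<eta> x)"] by simp
    qed
    show "(\<lambda>n. nsq (\<lambda>x. ?T n x - ?Z x *\<^sub>R grad \<eta> x)) \<longlonglongrightarrow> 0" "sq (\<lambda>x. ?Z x *\<^sub>R grad \<eta> x)" "\<And>n. sq (?T n)"
      by (rule sq_dominated(3)[OF a1 a2 a3 a4 a5], rule sq_dominated(2)[OF a1 a2 a3 a4 a5], rule sq_dominated(1)[OF a1 a2 a3 a4 a5])
  qed
  have sR: "sq (?R n)" for n using sq_diff(1)[OF W12D(2)[OF Wn[of n]] s1n[of n]] by simp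
  \<comment> \<open>For proportional gradients the derivative of the unregularised cosine cancels.
    What is left carries the factor \<open>?e n\<close>, is dominated by the logarithmic gradient
    and tends to 0.\<close>
  have Rform: "AE x in lborel. \<forall>n. ?R n x = (u x / ?q n x * (?e n / (?q n x)\<^sup>2)) *\<^sub>R (indicator P x *\<^sub>R ((\<eta> x / \<phi> x) *\<^sub>R H x))"
    using prp
  proof eventually_elim
    case (elim x)
    show ?case
    proof (intro allI)
      fix n
      show "?R n x = (u x / ?q n x * (?e n / (?q n x)\<^sup>2)) *\<^sub>R (indicator P x *\<^sub>R ((\<eta> x / \<phi> x) *\<^sub>R H x))"
      proof (cases "x \<in> U")
        case False
        hence "\<eta> x = 0" using K by blast
        thus ?thesis by simp
      next
        case True
        with elim consider (a) "\<phi> x > 0" "G x = (u x / \<phi> x) *\<^sub>R H x" | (b) "G x = 0" "H x = 0" by blast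
        thus ?thesis
        proof cases
          case a
          define q where "q = ?q n x"
          have qp: "q > 0" unfolding q_def by (rule q0)
          have q2: "q\<^sup>2 = (u x)\<^sup>2 + (\<phi> x)\<^sup>2 + ?e n" unfolding q_def using ep[of n] by simp
          have "(1 / q - u x * u x / q ^ 3) * (u x / \<phi> x) + - u x * \<phi> x / q ^ 3
             = u x * (q\<^sup>2 - (u x)\<^sup>2 - (\<phi> x)\<^sup>2) / (\<phi> x * q ^ 3)"
            using a(1) qp by (simp add: field_simps power2_eq_square power3_eq_cube)
          also have "\<dots> = u x * ?e n / (\<phi> x * q ^ 3)" unfolding q2 by simp
          also have "\<dots> = u x / q * (?e n / q\<^sup>2) * (1 / \<phi> x)" by (simp add: power2_eq_square power3_eq_cube)
          finally have c: "(1 / q - u x * u x / q ^ 3) * (u x / \<phi> x) + - u x * \<phi> x / q ^ 3 = u x / q * (?e n / q\<^sup>2) * (1 / \<phi> x)" .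
          have "?R n x = (\<eta> x * ((1 / q - u x * u x / q ^ 3) * (u x / \<phi> x) + - u x * \<phi> x / q ^ 3)) *\<^sub>R H x"
            unfolding a(2) q_def by (simp only: scaleR_scaleR scaleR_add_left[symmetric])
          also have "\<dots> = (u x / q * (?e n / q\<^sup>2)) *\<^sub>R ((\<eta> x / \<phi> x) *\<^sub>R H x)" unfolding c by (simp add: mult_ac)
          finally show ?thesis using a(1) unfolding q_def by simp
        qed simp
      qed
    qed
  qed
  have L2: "(\<lambda>n. nsq (\<lambda>x. ?R n x - 0)) \<longlonglongrightarrow> 0"
  proof (rule sq_dominated(3)[OF sq_meas[OF sR]])
    let ?w = "\<lambda>x. norm (indicator P x *\<^sub>R ((\<eta> x / \<phi> x) *\<^sub>R H x))"
    show "sq ?w" using log_grad[OF t] by (auto simp: sq_def)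
    show "AE x in lborel. norm (?R n x) \<le> ?w x" for n
      using Rform
    proof eventually_elim
      case (elim x)
      have q2: "(?q n x)\<^sup>2 = (u x)\<^sup>2 + (\<phi> x)\<^sup>2 + ?e n" using ep[of n] by simp
      have "\<bar>u x / ?q n x\<bar> \<le> 1" using uq[of x n] q0[of x n] by (simp add: abs_div_pos[symmetric] pos_divide_le_eq)
      moreover have "0 \<le> ?e n / (?q n x)\<^sup>2" "?e n / (?q n x)\<^sup>2 \<le> 1" using q0[of x n] unfolding q2 by (auto simp: divide_le_eq_1 add_nonneg_pos)
      ultimately have "\<bar>u x / ?q n x * (?e n / (?q n x)\<^sup>2)\<bar> \<le> 1 * 1" unfolding abs_mult by (intro mult_mono) auto
      hence "\<bar>u x / ?q n x * (?e n / (?q n x)\<^sup>2)\<bar> * ?w x \<le> 1 * ?w x" by (intro mult_right_mono) auto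
      thus ?case unfolding elim[rule_format] norm_scaleR[of "u x / ?q n x * (?e n / (?q n x)\<^sup>2)"] by simp
    qed
    show "AE x in lborel. (\<lambda>n. ?R n x) \<longlonglongrightarrow> 0"
      using Rform
    proof eventually_elim
      case (elim x)
      show ?case
      proof (cases "x \<in> P")
        case True
        hence nz: "sqrt ((u x)\<^sup>2 + (\<phi> x)\<^sup>2) \<noteq> 0" by (simp add: sum_power2_eq_zero_iff)
        have "(\<lambda>n. (u x / ?q n x * (?e n / (?q n x)\<^sup>2)) *\<^sub>R (indicator P x *\<^sub>R ((\<eta> x / \<phi> x) *\<^sub>R H x)))
          \<longlonglongrightarrow> (u x / sqrt ((u x)\<^sup>2 + (\<phi> x)\<^sup>2) * (0 / (sqrt ((u x)\<^sup>2 + (\<phi> x)\<^sup>2))\<^sup>2)) *\<^sub>R (indicator P x *\<^sub>R ((\<eta> x / \<phi> x) *\<^sub>R H x))"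
          by (intro tendsto_intros qlim LIMSEQ_inverse_real_of_nat) (use nz in auto)
        thus ?thesis unfolding elim[rule_format] by simp
      next
        case False
        thus ?thesis unfolding elim[rule_format] by simp
      qed
    qed
  qed auto
  show ?thesis
  proof (rule W12_limit[OF Wn s0 s1 L0])
    show "(\<lambda>n. nsq (\<lambda>x. ?T n x + ?R n x - ?Z x *\<^sub>R grad \<eta> x)) \<longlonglongrightarrow> 0"
    proof (rule null_comparison_nonneg[OF _ nsq_nonneg])
      show "(\<lambda>n. 2 * nsq (\<lambda>x. ?T n x - ?Z x *\<^sub>R grad \<eta> x) + 2 * nsq (\<lambda>x. ?R n x - 0)) \<longlonglongrightarrow> 0"
        using tendsto_add[OF tendsto_mult_left[OF L1, of 2] tendsto_mult_left[OF L2, of 2]] by simp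
      fix n
      have e: "(\<lambda>x. ?T n x + ?R n x - ?Z x *\<^sub>R grad \<eta> x) = (\<lambda>x. (?T n x - ?Z x *\<^sub>R grad \<eta> x) + ?R n x)"
        by (rule ext) (simp only: add_diff_eq diff_add_eq)
      show "nsq (\<lambda>x. ?T n x + ?R n x - ?Z x *\<^sub>R grad \<eta> x) \<le> 2 * nsq (\<lambda>x. ?T n x - ?Z x *\<^sub>R grad \<eta> x) + 2 * nsq (\<lambda>x. ?R n x - 0)"
        unfolding e using sq_add(2)[OF sq_diff(1)[OF s1n[of n] s1] sR[of n]] by simp
    qed
  qed
qed

end

section \<open>Simplicity of the principal eigenvalue and the boundary of the domain\<close>

lemma open_not_AE:
  fixes S :: "R3 set"
  assumes "open S" "S \<noteq> {}" shows "\<not> (AE x in lborel. x \<notin> S)"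
proof
  assume "AE x in lborel. x \<notin> S"
  hence "S \<in> null_sets lborel" using assms(1) by (subst AE_iff_null_sets) auto
  hence "negligible S" using negligible_iff_null_sets null_sets_completionI by blast
  thus False using assms open_not_negligible by blast
qed

text \<open>The cutoff equals 1 near \<open>x0\<close>, so there the weak gradient of the product
  vanishes, the mollifications are constant, and so is their limit.\<close>

lemma locally_constant:
  assumes O: "open U" "x0 \<in> U"
    and Z: "\<And>\<eta>. test_fun U \<eta> \<Longrightarrow> W12 (\<lambda>x. \<eta> x * Z x) (\<lambda>x. Z x *\<^sub>R grad \<eta> x)"
  shows "\<exists>r>0. \<exists>c. AE x in lborel. x \<in> ball x0 r \<longrightarrow> Z x = c"
proof -
  obtain R where R: "R > 0" "cball x0 R \<subseteq> U" using O open_contains_cball by metis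
  define r where "r = R / 4"
  have r: "r > 0" "cball x0 (2 * r + 2 * r) \<subseteq> U" using R by (auto simp: r_def)
  obtain \<eta> where \<eta>: "test_fun UNIV \<eta>" "\<And>x. x \<in> cball x0 (2 * r) \<Longrightarrow> \<eta> x = 1" "\<And>x. x \<notin> cball x0 (2 * r + 2 * r) \<Longrightarrow> \<eta> x = 0"
    using cutoffs[OF r(1)] by metis
  have t: "test_fun U \<eta>" by (rule test_funI[OF test_fun_smooth[OF \<eta>(1)] compact_cball r(2) \<eta>(3)])
  let ?V = "\<lambda>x. \<eta> x * Z x" and ?D = "\<lambda>x. Z x *\<^sub>R grad \<eta> x"
  have W: "W12 ?V ?D" by (rule Z[OF t])
  have D0: "?D y = 0" if "y \<in> ball x0 (2 * r)" for y
    using grad_const_on[of "ball x0 (2 * r)" y \<eta> 1] that \<eta>(2) by auto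
  have Vi: "integrable lborel ?V"
    by (rule compact_support_integrable[OF W12D(1)[OF W] bounded_cball]) (use \<eta>(3) in auto)
  obtain k where k: "\<And>n. test_fun UNIV (k n)"
    "\<And>n x. x \<notin> cball 0 (r * inverse (real (Suc n))) \<Longrightarrow> k n x = 0"
    and kc: "\<And>w :: R3 \<Rightarrow> real. sq w \<Longrightarrow> (\<forall>n. sq (conv (k n) w)) \<and> (\<lambda>n. nsq (\<lambda>x. conv (k n) w x - w x)) \<longlonglongrightarrow> 0"
  proof (rule conv_kernels[where 'b=real and h="\<lambda>n. r * inverse (real (Suc n))" and a="\<lambda>n. 0"])
    show "(\<lambda>n. r * inverse (real (Suc n))) \<longlonglongrightarrow> 0" using tendsto_mult_left[OF LIMSEQ_inverse_real_of_nat, of r] by simp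
  qed (use r(1) that in auto)
  have cz: "conv (k n) ?V x = conv (k n) ?V x0" if x: "x \<in> ball x0 r" for n x
  proof -
    have hr: "r * inverse (real (Suc n)) \<le> r" using r(1) by (simp add: inverse_eq_divide field_simps)
    have g0: "grad (conv (k n) ?V) y = 0" if y: "y \<in> ball x0 r" for y
    proof -
      have "k n (y - w) *\<^sub>R ?D w = 0" for w
      proof (cases "w \<in> ball x0 (2 * r)")
        case False
        hence "norm (y - w) > r" using y norm_triangle_ineq[of "x0 - y" "y - w"] by (simp add: dist_norm)
        hence "k n (y - w) = 0" using hr by (intro k(2)) simp
        thus ?thesis by simp
      qed (simp only: D0 scaleR_zero_right)
      hence "conv (k n) ?D y = 0" unfolding conv_def by (simp only: Bochner_Integration.integral_zero)
      thus ?thesis using conv_grad[OF W k(1) Vi] by simp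
    qed
    have d: "conv (k n) ?V differentiable (at y)" for y
      using smooth_Ck[OF conv_smooth[OF k(1) Vi], of 1] by (simp add: Ck.simps)
    have "norm (conv (k n) ?V x - conv (k n) ?V x0) \<le> 0 * norm (x - x0)"
    proof (rule differentiable_bound[of "ball x0 r" _ "\<lambda>y h. grad (conv (k n) ?V) y \<bullet> h"])
      show "(conv (k n) ?V has_derivative (\<lambda>h. grad (conv (k n) ?V) y \<bullet> h)) (at y within ball x0 r)" for y
        by (rule has_derivative_at_withinI[OF has_derivative_grad[OF d]])
      show "onorm (\<lambda>h. grad (conv (k n) ?V) y \<bullet> h) \<le> 0" if "y \<in> ball x0 r" for y
        unfolding g0[OF that] by (simp add: onorm_zero)
    qed (use x r(1) in auto)
    thus ?thesis by simp
  qed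
  obtain s :: "nat \<Rightarrow> nat" where s: "AE x in lborel. (\<lambda>n. conv (k (s n)) ?V x) \<longlonglongrightarrow> ?V x"
    using L2_AE_subseq[of "\<lambda>n. conv (k n) ?V" ?V] sq_diff(1)[OF _ W12D(1)[OF W]] kc[OF W12D(1)[OF W]] by blast
  have "AE x in lborel. x \<in> ball x0 r \<longrightarrow> Z x = lim (\<lambda>n. conv (k (s n)) ?V x0)"
    using s
  proof eventually_elim
    case (elim x)
    show ?case
    proof
      assume x: "x \<in> ball x0 r"
      hence "\<eta> x = 1" using r(1) by (intro \<eta>(2)) auto
      hence "(\<lambda>n. conv (k (s n)) ?V x0) \<longlonglongrightarrow> Z x" using elim cz[OF x] by simp
      thus "Z x = lim (\<lambda>n. conv (k (s n)) ?V x0)" by (simp add: limI)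
    qed
  qed
  thus ?thesis using r(1) by blast
qed

text \<open>Connectedness is applied to the points near which \<open>Z\<close> is almost everywhere
  \<open>c\<close> and those near which it is another constant. They cannot overlap because open
  balls have positive measure.\<close>

lemma connected_constant:
  assumes O: "open U" "connected U"
    and Z: "\<And>\<eta>. test_fun U \<eta> \<Longrightarrow> W12 (\<lambda>x. \<eta> x * Z x) (\<lambda>x. Z x *\<^sub>R grad \<eta> x)"
  shows "\<exists>c. AE x in lborel. x \<in> U \<longrightarrow> Z x = c"
proof (cases "U = {}")
  case False
  then obtain x1 where x1: "x1 \<in> U" by blast
  note lc = locally_constant[OF O(1) _ Z]
  obtain r1 c where c: "r1 > 0" "AE x in lborel. x \<in> ball x1 r1 \<longrightarrow> Z x = c" using lc[OF x1] by blast
  define good where "good x \<longleftrightarrow> (\<exists>r>0. AE y in lborel. y \<in> ball x r \<longrightarrow> Z y = c)" for x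
  define bad where "bad x \<longleftrightarrow> (\<exists>r>0. \<exists>c'. c' \<noteq> c \<and> (AE y in lborel. y \<in> ball x r \<longrightarrow> Z y = c'))" for x
  have sub: "ball y (r - dist x y) \<subseteq> ball x r" for x y :: R3 and r
    using dist_triangle[of x _ y] by (auto simp: dist_commute) (smt (verit) dist_commute dist_triangle)
  have nearby: "\<exists>r'>0. AE z in lborel. z \<in> ball y r' \<longrightarrow> Z z = c'" if "AE z in lborel. z \<in> ball x r \<longrightarrow> Z z = c'" "y \<in> ball x r" for x y r c'
  proof (intro exI[of _ "r - dist x y"] conjI)
    show "AE z in lborel. z \<in> ball y (r - dist x y) \<longrightarrow> Z z = c'"
      using that(1) by eventually_elim (use sub in blast)
  qed (use that(2) in auto)
  have og: "open {x. good x}" unfolding open_contains_ball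
  proof safe
    fix x assume "good x"
    then obtain r where r: "r > 0" "AE y in lborel. y \<in> ball x r \<longrightarrow> Z y = c" by (auto simp: good_def)
    thus "\<exists>e>0. ball x e \<subseteq> {x. good x}" using nearby[OF r(2)] unfolding good_def by blast
  qed
  have ob: "open {x. bad x}" unfolding open_contains_ball
  proof safe
    fix x assume "bad x"
    then obtain r c' where r: "r > 0" "c' \<noteq> c" "AE y in lborel. y \<in> ball x r \<longrightarrow> Z y = c'" by (auto simp: bad_def)
    thus "\<exists>e>0. ball x e \<subseteq> {x. bad x}" using nearby[OF r(3)] unfolding bad_def by blast
  qed
  have disj: "{x. good x} \<inter> {x. bad x} \<inter> U = {}"
  proof -
    have False if g: "good x" and b: "bad x" for x
    proof -
      obtain r where r: "r > 0" "AE y in lborel. y \<in> ball x r \<longrightarrow> Z y = c" using g by (auto simp: good_def)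
      obtain r' c' where r': "r' > 0" "c' \<noteq> c" "AE y in lborel. y \<in> ball x r' \<longrightarrow> Z y = c'" using b by (auto simp: bad_def)
      have "AE y in lborel. y \<notin> ball x (min r r')"
        using r(2) r'(3) by eventually_elim (use r'(2) in auto)
      moreover have "ball x (min r r') \<noteq> {}" using r(1) r'(1) by simp
      ultimately show False using open_not_AE[OF open_ball] by blast
    qed
    thus ?thesis by blast
  qed
  have cover: "U \<subseteq> {x. good x} \<union> {x. bad x}"
  proof
    fix x assume "x \<in> U"
    then obtain r c' where "r > 0" "AE y in lborel. y \<in> ball x r \<longrightarrow> Z y = c'" using lc by blast
    thus "x \<in> {x. good x} \<union> {x. bad x}" unfolding good_def bad_def by (cases "c' = c") blast+
  qed
  have "x1 \<in> {x. good x} \<inter> U" using c x1 by (auto simp: good_def)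
  hence "{x. bad x} \<inter> U = {}" using connectedD[OF O(2) og ob disj cover] by blast
  hence allg: "good x" if "x \<in> U" for x using cover that by blast
  then obtain rr where rr: "\<And>x. x \<in> U \<Longrightarrow> rr x > 0 \<and> (AE y in lborel. y \<in> ball x (rr x) \<longrightarrow> Z y = c)"
    unfolding good_def by metis
  \<comment> \<open>Almost everywhere statements can be combined only countably often, hence a
    countable subcover.\<close>
  obtain F where F: "F \<subseteq> (\<lambda>x. ball x (rr x)) ` U" "countable F" "\<Union>F = \<Union>((\<lambda>x. ball x (rr x)) ` U)"
    by (rule Lindelof[of "(\<lambda>x. ball x (rr x)) ` U"]) auto
  have "AE x in lborel. \<forall>S\<in>F. x \<in> S \<longrightarrow> Z x = c"
    using F(1) rr by (subst AE_ball_countable[OF F(2)]) blast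
  hence "AE x in lborel. x \<in> U \<longrightarrow> Z x = c"
  proof eventually_elim
    case (elim x)
    show ?case
    proof
      assume "x \<in> U"
      hence "x \<in> \<Union>F" unfolding F(3) using rr[of x] centre_in_ball[of x "rr x"] by blast
      thus "Z x = c" using elim by blast
    qed
  qed
  thus ?thesis by blast
qed simp

text \<open>The remainder in Picone's identity is a square. Its sign gives the bound, and equality
  makes it vanish.\<close>

lemma (in weak_eigenfunction) Rayleigh:
  assumes pU: "AE x in lborel. x \<in> U \<longrightarrow> \<phi> x > 0" and T: "tapprox U u G" and Wu: "W12 u G"
    and off: "AE x in lborel. x \<notin> U \<longrightarrow> u x = 0"
  shows "l * (LBINT x. f x * (u x)\<^sup>2) \<le> nsq G"
    "nsq G = l * (LBINT x. f x * (u x)\<^sup>2) \<Longrightarrow> AE x in lborel. x \<in> U \<longrightarrow> G x = (u x / \<phi> x) *\<^sub>R H x"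
proof -
  let ?v = "\<lambda>x. indicator P x *\<^sub>R (G x - (u x / \<phi> x) *\<^sub>R H x)"
  have mu [measurable]: "u \<in> mble" using W12D(1)[OF Wu] by (rule sq_meas)
  have I: "(LBINT x. f x * (u x)\<^sup>2 * indicator P x) = (LBINT x. f x * (u x)\<^sup>2)"
  proof (rule integral_cong_AE)
    show "AE x in lborel. f x * (u x)\<^sup>2 * indicator P x = f x * (u x)\<^sup>2"
      using pU off by eventually_elim auto
    show "(\<lambda>x. f x * (u x)\<^sup>2 * indicator P x) \<in> mble"
      by (intro borel_measurable_times borel_measurable_power borel_measurable_indicator mP mf mu)
    show "(\<lambda>x. f x * (u x)\<^sup>2) \<in> mble" by measurable
  qed
  have le: "nsq ?v \<le> nsq G - l * (LBINT x. f x * (u x)\<^sup>2)" using Picone(2)[OF T Wu] unfolding I .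
  thus "l * (LBINT x. f x * (u x)\<^sup>2) \<le> nsq G" using nsq_nonneg[of ?v] by linarith
  assume "nsq G = l * (LBINT x. f x * (u x)\<^sup>2)"
  hence "nsq ?v = 0" using le nsq_nonneg[of ?v] by linarith
  from nsq_eq_0_AE[OF Picone(1)[OF T Wu] this] pU
  show "AE x in lborel. x \<in> U \<longrightarrow> G x = (u x / \<phi> x) *\<^sub>R H x" by eventually_elim auto
qed

text \<open>Equality in the Rayleigh bound makes the cosine of the polar angle of
  \<open>(u, \<phi>)\<close> a constant \<open>c\<close> in \<open>U\<close>. Since
  \<open>\<phi>\<close> is positive there, \<open>\<bar>c\<bar> < 1\<close>, and the ratio of
  \<open>u\<close> to \<open>\<phi>\<close> is the cotangent
  \<open>c / sqrt (1 - c\<^sup>2)\<close>.\<close>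

lemma (in weak_eigenfunction) simple_eigenvalue:
  assumes conn: "connected U" and pU: "AE x in lborel. x \<in> U \<longrightarrow> \<phi> x > 0"
    and offp: "AE x in lborel. x \<notin> U \<longrightarrow> \<phi> x = 0"
    and T: "tapprox U u G" and Wu: "W12 u G" and off: "AE x in lborel. x \<notin> U \<longrightarrow> u x = 0"
    and crit: "nsq G = l * (LBINT x. f x * (u x)\<^sup>2)"
  shows "\<exists>k. AE x in lborel. u x = k * \<phi> x"
proof -
  let ?Z = "\<lambda>x. u x / sqrt ((u x)\<^sup>2 + (\<phi> x)\<^sup>2)"
  have prp: "AE x in lborel. x \<in> U \<longrightarrow> (\<phi> x > 0 \<and> G x = (u x / \<phi> x) *\<^sub>R H x) \<or> (u x = 0 \<and> \<phi> x = 0 \<and> G x = 0 \<and> H x = 0)"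
    using Rayleigh(2)[OF pU T Wu off crit] pU by eventually_elim auto
  obtain c where c: "AE x in lborel. x \<in> U \<longrightarrow> ?Z x = c"
    using connected_constant[OF U conn angle_gradient[OF Wu _ prp]] by blast
  have "AE x in lborel. u x = (c / sqrt (1 - c\<^sup>2)) * \<phi> x"
    using c pU offp off
  proof eventually_elim
    case (elim x)
    show ?case
    proof (cases "x \<in> U")
      case True
      define r where "r = sqrt ((u x)\<^sup>2 + (\<phi> x)\<^sup>2)"
      have p: "\<phi> x > 0" and cx: "u x / r = c" using elim True by (auto simp: r_def)
      have r0: "r > 0" using p by (simp add: r_def add_nonneg_pos)
      have r2: "r\<^sup>2 = (u x)\<^sup>2 + (\<phi> x)\<^sup>2" by (simp add: r_def)
      have u: "u x = c * r" using cx r0 by auto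
      have ph: "(\<phi> x)\<^sup>2 = (1 - c\<^sup>2) * r\<^sup>2" using r2 unfolding u by (simp add: power_mult_distrib algebra_simps)
      have "(\<phi> x)\<^sup>2 > 0" using p by simp
      hence c1: "1 - c\<^sup>2 > 0" unfolding ph using r0 by (simp add: zero_less_mult_iff)
      have "\<phi> x = sqrt ((\<phi> x)\<^sup>2)" using p by simp
      also have "\<dots> = sqrt (1 - c\<^sup>2) * r" unfolding ph using r0 by (simp add: real_sqrt_mult)
      finally show ?thesis using c1 u by simp
    qed (use elim in auto)
  qed
  thus ?thesis by blast
qed

text \<open>Otherwise the indicator of \<open>S\<close> would be a Sobolev function with vanishing gradient.\<close>
lemma (in weak_eigenfunction) not_whole_space:
  assumes UN: "U = UNIV" and S: "open S" "bounded S" "S \<noteq> {}"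
    and pS: "AE x in lborel. x \<in> S \<longrightarrow> \<phi> x > 0" and off: "AE x in lborel. x \<notin> S \<longrightarrow> \<phi> x = 0 \<and> H x = 0"
  shows False
proof -
  obtain R where R: "S \<subseteq> ball 0 R" using S(2) by (auto dest: bounded_subset_ballD[of S 0])
  obtain \<eta> where \<eta>: "test_fun UNIV \<eta>" "\<And>x. x \<in> cball 0 R \<Longrightarrow> \<eta> x = 1"
    using cutoffs[of 1] by (metis zero_less_one)
  have t: "test_fun U \<eta>" using \<eta>(1) UN by simp
  \<comment> \<open>With \<open>u = \<phi>\<close> the cosine is \<open>1 / sqrt 2\<close> where
    \<open>\<phi>\<close> is positive and 0 elsewhere, thus a multiple of the indicator of
    \<open>S\<close>.\<close>
  let ?Z = "\<lambda>x. \<phi> x / sqrt ((\<phi> x)\<^sup>2 + (\<phi> x)\<^sup>2)"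
  have "AE x in lborel. x \<in> U \<longrightarrow> (\<phi> x > 0 \<and> H x = (\<phi> x / \<phi> x) *\<^sub>R H x) \<or> (\<phi> x = 0 \<and> \<phi> x = 0 \<and> H x = 0 \<and> H x = 0)"
    using pS off by eventually_elim auto
  note A = angle_gradient[OF W t this]
  have "AE x in lborel. ?Z x *\<^sub>R grad \<eta> x = 0"
    using off
  proof eventually_elim
    case (elim x)
    show ?case
    proof (cases "x \<in> S")
      case True
      hence "x \<in> ball 0 R" using R by blast
      hence "grad \<eta> x = 0" using grad_const_on[of "ball 0 R" x \<eta> 1] \<eta>(2) by auto
      thus ?thesis by simp
    qed (use elim in simp)
  qed
  hence "AE x in lborel. (norm (?Z x *\<^sub>R grad \<eta> x))\<^sup>2 = 0" by eventually_elim simp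
  hence "nsq (\<lambda>x. ?Z x *\<^sub>R grad \<eta> x) = 0" unfolding nsq_def by (rule integral_eq_zero_AE)
  from zero_grad_zero[OF A this] pS have "AE x in lborel. x \<notin> S"
  proof eventually_elim
    case (elim x)
    show ?case
    proof
      assume x: "x \<in> S"
      hence "\<eta> x = 1" "\<phi> x > 0" using R \<eta>(2) elim by auto
      hence "?Z x = 0" using elim by simp
      thus False using \<open>\<phi> x > 0\<close> by (simp add: sum_power2_eq_zero_iff)
    qed
  qed
  thus False using open_not_AE[OF S(1,3)] by blast
qed

section \<open>Bounded domains with smooth boundary\<close>

lemma segment_mvt:
  assumes "Ck 1 \<rho>"
  shows "\<exists>t\<in>{0<..<1}. \<rho> (p + q) - \<rho> p = grad \<rho> (p + t *\<^sub>R q) \<bullet> q"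
proof -
  have d: "\<rho> differentiable (at x)" for x using assms by (simp add: Ck.simps)
  have D: "((\<lambda>t. \<rho> (p + t *\<^sub>R q)) has_derivative (\<lambda>h. grad \<rho> (p + t *\<^sub>R q) \<bullet> (h *\<^sub>R q))) (at t)" for t
  proof -
    have "((\<lambda>s. p + s *\<^sub>R q) has_derivative (\<lambda>h. h *\<^sub>R q)) (at t)" by (auto intro!: derivative_eq_intros)
    from has_derivative_compose[OF this has_derivative_grad[OF d]] show ?thesis .
  qed
  have "\<exists>t\<in>{0<..<1}. \<rho> (p + 1 *\<^sub>R q) - \<rho> (p + 0 *\<^sub>R q) = grad \<rho> (p + t *\<^sub>R q) \<bullet> ((1 - 0) *\<^sub>R q)"
    by (rule mvt[of 0 1 "\<lambda>t. \<rho> (p + t *\<^sub>R q)"])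
       (auto intro!: continuous_at_imp_continuous_on has_derivative_continuous[OF D] D)
  thus ?thesis by simp
qed

locale smooth_region =
  fixes Om :: "R3 set" and \<rho> :: "R3 \<Rightarrow> real"
  assumes b: "bounded Om" and sm: "smooth \<rho>" and Om: "Om = {x. \<rho> x < 0}" and g: "\<And>x. \<rho> x = 0 \<Longrightarrow> grad \<rho> x \<noteq> 0"
begin

lemma c1: "Ck 1 \<rho>" and cr: "continuous_on UNIV \<rho>" and cg: "continuous_on UNIV (grad \<rho>)"
  using smooth_Ck[OF sm] Ck_continuous Ck1_grad_cont by blast+

lemma oOm: "open Om"
  unfolding Om using cr by (intro open_Collect_less continuous_on_const)

lemma cOm: "compact (closure Om)" using b by simp

lemma closure_le: "x \<in> closure Om \<Longrightarrow> \<rho> x \<le> 0"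
proof -
  have "closure Om \<subseteq> {x. \<rho> x \<le> 0}"
    by (rule closure_minimal) (auto simp: Om intro: closed_Collect_le cr continuous_on_const)
  thus "x \<in> closure Om \<Longrightarrow> \<rho> x \<le> 0" by blast
qed

lemma bd_zero: "x \<in> closure Om \<Longrightarrow> x \<notin> Om \<Longrightarrow> \<rho> x = 0"
  using closure_le[of x] by (simp add: Om)

lemma near_boundary:
  assumes "\<rho> x0 = 0"
  obtains d where "d > 0" "\<And>x. dist x x0 < d \<Longrightarrow> norm (grad \<rho> x - grad \<rho> x0) < norm (grad \<rho> x0) / 4"
proof -
  have "isCont (grad \<rho>) x0" using cg by (simp add: continuous_on_eq_continuous_at)
  hence "\<exists>d>0. \<forall>x. dist x x0 < d \<longrightarrow> dist (grad \<rho> x) (grad \<rho> x0) < norm (grad \<rho> x0) / 4"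
    using g[OF assms] unfolding continuous_at_eps_delta by (elim allE[of _ "norm (grad \<rho> x0) / 4"]) simp
  thus thesis using that by (auto simp: dist_norm)
qed

text \<open>At a boundary point the gradient \<open>e\<close> of \<open>\<rho>\<close> points
  outwards. Kernels centred at \<open>- t n *\<^sub>R e\<close>, with a radius that is small against
  this shift, move nearby points of the closure strictly inside, because \<open>\<rho>\<close>
  decreases along the move.\<close>

lemma local_approx:
  assumes x0: "x0 \<in> closure Om"
  shows "\<exists>r>0. \<forall>v G. W12 v G \<longrightarrow> (AE x in lborel. x \<notin> Om \<longrightarrow> v x = 0) \<longrightarrow> (AE x in lborel. x \<notin> cball x0 r \<longrightarrow> v x = 0) \<longrightarrow> tapprox Om v G"
proof (cases "x0 \<in> Om")
  case True
  then obtain r where r: "r > 0" "cball x0 r \<subseteq> Om" using oOm open_contains_cball by metis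
  thus ?thesis using tapprox_compact[OF _ compact_cball r(2) oOm] by blast
next
  case False
  define e where "e = grad \<rho> x0"
  have z: "\<rho> x0 = 0" using bd_zero x0 False by blast
  have e0: "norm e > 0" using g[OF z] by (simp add: e_def)
  obtain d where d: "d > 0" "\<And>x. dist x x0 < d \<Longrightarrow> norm (grad \<rho> x - e) < norm e / 4"
    using near_boundary[OF z] unfolding e_def by blast
  let ?K = "closure Om \<inter> cball x0 (d / 4)"
  \<comment> \<open>This size keeps all segments used below within distance \<open>d\<close> of
    \<open>x0\<close>: shift plus kernel radius is at most 5/4 of \<open>d / 4\<close>.\<close>
  define t where "t n = d / (4 * norm e) * inverse (real (Suc n))" for n
  have t0: "t n > 0" for n using d e0 by (simp add: t_def)
  have tl: "t \<longlonglongrightarrow> 0" unfolding t_def using tendsto_mult_left[OF LIMSEQ_inverse_real_of_nat, of "d / (4 * norm e)"] by simp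
  have tb: "t n * norm e \<le> d / 4" for n
  proof -
    have "t n * norm e = d / 4 * inverse (real (Suc n))" using e0 by (simp add: t_def)
    also have "\<dots> \<le> d / 4 * 1" using d by (intro mult_left_mono) (auto simp: inverse_le_1_iff)
    finally show ?thesis by simp
  qed
  have inside: "p + q \<in> Om" if p: "p \<in> ?K" and q: "q \<in> cball (- t n *\<^sub>R e) (t n * norm e / 4)" for n p q
  proof -
    define T where "T = t n * norm e"
    have T: "T > 0" "T \<le> d / 4" using t0 e0 tb[of n] by (auto simp: T_def)
    have qa: "norm (q - (- t n *\<^sub>R e)) \<le> T / 4" using q by (simp add: dist_norm norm_minus_commute T_def)
    have na: "norm (- t n *\<^sub>R e) = T" using t0[of n] by (simp add: T_def)
    have qn: "norm q \<le> T + T / 4" using norm_triangle_ineq[of "q - (- t n *\<^sub>R e)" "- t n *\<^sub>R e"] qa na by simp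
    obtain s where s: "s \<in> {0<..<1}" "\<rho> (p + q) - \<rho> p = grad \<rho> (p + s *\<^sub>R q) \<bullet> q" using segment_mvt[OF c1] by blast
    have sq: "norm (s *\<^sub>R q) \<le> norm q" using s(1) by (simp add: mult_left_le_one_le)
    have "norm (p - x0) \<le> d / 4" using p by (simp add: dist_norm norm_minus_commute)
    hence "dist (p + s *\<^sub>R q) x0 < d"
      using norm_triangle_ineq[of "p - x0" "s *\<^sub>R q"] sq qn T d(1) by (simp add: dist_norm add_diff_eq diff_add_eq)
    note gd = d(2)[OF this]
    have 1: "grad \<rho> (p + s *\<^sub>R q) \<bullet> q = e \<bullet> (- t n *\<^sub>R e) + e \<bullet> (q - (- t n *\<^sub>R e)) + (grad \<rho> (p + s *\<^sub>R q) - e) \<bullet> q"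
      unfolding inner_diff_left inner_diff_right by linarith
    have 2: "e \<bullet> (- t n *\<^sub>R e) = - (T * norm e)" by (simp add: T_def power2_norm_eq_inner[symmetric] power2_eq_square)
    have 3: "e \<bullet> (q - (- t n *\<^sub>R e)) \<le> norm e * (T / 4)"
      by (rule order_trans[OF norm_cauchy_schwarz]) (intro mult_left_mono qa, simp)
    have 4: "(grad \<rho> (p + s *\<^sub>R q) - e) \<bullet> q \<le> norm e / 4 * (T + T / 4)"
      by (rule order_trans[OF norm_cauchy_schwarz]) (intro mult_mono less_imp_le[OF gd] qn; simp add: e0 less_imp_le)
    have 5: "norm e * T > 0" using e0 T by simp
    \<comment> \<open>Relative to \<open>norm e * T\<close> the main term is -1, while the kernel
      radius contributes at most 1/4 and the variation of the gradient at most 5/16.\<close>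
    have "grad \<rho> (p + s *\<^sub>R q) \<bullet> q < 0"
    proof -
      have "norm e / 4 * (T + T / 4) = (5/16) * (norm e * T)" "norm e * (T / 4) = (1/4) * (norm e * T)" "T * norm e = norm e * T"
        by (simp_all add: algebra_simps)
      moreover have "x < 0" if "x = a + b + c" "a = - N" "b \<le> (1/4) * N" "c \<le> (5/16) * N" "N > 0" for x a b c N :: real
        using that by argo
      ultimately show ?thesis using 1 2 3 4 5 by metis
    qed
    moreover have "\<rho> p \<le> 0" using p closure_le by blast
    ultimately show ?thesis using s(2) unfolding Om by simp
  qed
  show ?thesis
  proof (intro exI[of _ "d/4"] conjI allI impI)
    fix v G assume W: "W12 v G" and o: "AE x in lborel. x \<notin> Om \<longrightarrow> v x = 0" and c: "AE x in lborel. x \<notin> cball x0 (d/4) \<longrightarrow> v x = 0"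
    have K: "compact ?K" using cOm by (intro compact_Int_closed) auto
    have off: "AE x in lborel. x \<notin> ?K \<longrightarrow> v x = 0"
      using o c by eventually_elim (use closure_subset in blast)
    have a: "(\<lambda>n. - t n *\<^sub>R e) \<longlonglongrightarrow> 0" using tendsto_scaleR[OF tendsto_minus[OF tl] tendsto_const[of e]] by simp
    have h: "(\<lambda>n. t n * norm e / 4) \<longlonglongrightarrow> 0" using tendsto_mult_right[OF tl, of "norm e / 4"] by simp
    show "tapprox Om v G"
      by (rule mollify_tapprox[OF W K off _ h a inside]) (use t0 e0 in auto)
  qed (use d in simp)
qed

text \<open>Induction over a finite cover of the closure by balls on which local approximation
  works; a cutoff splits off one ball at a time, in place of a partition of unity.\<close>

theorem zero_off_imp_tapprox:
  assumes W: "W12 v G" and off: "AE x in lborel. x \<notin> Om \<longrightarrow> v x = 0"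
  shows "tapprox Om v G"
proof -
  define R where "R y r \<longleftrightarrow> r > 0 \<and> (\<forall>v G. W12 v G \<longrightarrow> (AE x in lborel. x \<notin> Om \<longrightarrow> v x = 0)
    \<longrightarrow> (AE x in lborel. x \<notin> cball y r \<longrightarrow> v x = 0) \<longrightarrow> tapprox Om v G)" for y r
  have "\<forall>y. \<exists>r. y \<in> closure Om \<longrightarrow> R y r" unfolding R_def using local_approx by blast
  from choice[OF this] obtain r where R: "y \<in> closure Om \<Longrightarrow> R y (r y)" for y by blast
  have r: "\<And>y. y \<in> closure Om \<Longrightarrow> r y > 0"
    "\<And>y v G. y \<in> closure Om \<Longrightarrow> W12 v G \<Longrightarrow> AE x in lborel. x \<notin> Om \<longrightarrow> v x = 0 \<Longrightarrow> AE x in lborel. x \<notin> cball y (r y) \<longrightarrow> v x = 0 \<Longrightarrow> tapprox Om v G"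
    using R unfolding R_def by blast+
  have claim: "tapprox Om v G"
    if "finite F" "F \<subseteq> closure Om" "W12 v G" "AE x in lborel. x \<notin> Om \<longrightarrow> v x = 0"
      "AE x in lborel. x \<notin> (\<Union>y\<in>F. ball y (r y / 2)) \<longrightarrow> v x = 0" for F v G
    using that
  proof (induction F arbitrary: v G rule: finite_induct)
    case empty
    show ?case by (rule tapprox_compact[OF empty(2) compact_empty empty_subsetI oOm]) (use empty(4) in simp)
  next
    case (insert y F)
    have y: "y \<in> closure Om" "r y > 0" using insert.prems(1) r(1) by auto
    have s4: "r y / 4 > 0" using y by simp
    obtain C where "\<forall>a R. \<exists>\<eta>. test_fun UNIV \<eta> \<and> (\<forall>x. 0 \<le> \<eta> x \<and> \<eta> x \<le> 1) \<and> (\<forall>x\<in>cball a R. \<eta> x = 1)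
     \<and> (\<forall>x. x \<notin> cball a (R + 2 * (r y / 4)) \<longrightarrow> \<eta> x = 0) \<and> (\<forall>x. norm (grad \<eta> x) \<le> C)"
      using cutoffs[OF s4] by blast
    then obtain \<eta> where \<eta>: "test_fun UNIV \<eta>" "\<forall>x. 0 \<le> \<eta> x \<and> \<eta> x \<le> 1" "\<forall>x\<in>cball y (r y / 2). \<eta> x = 1"
      "\<forall>x. x \<notin> cball y (r y / 2 + 2 * (r y / 4)) \<longrightarrow> \<eta> x = 0" "\<forall>x. norm (grad \<eta> x) \<le> C" by blast
    have z: "\<eta> x = 0" if "x \<notin> cball y (r y)" for x using \<eta>(4) that by simp
    have W1: "W12 (\<lambda>x. \<eta> x * v x) (\<lambda>x. \<eta> x *\<^sub>R G x + v x *\<^sub>R grad \<eta> x)"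
    proof (rule W12_mult[OF insert.prems(2) test_fun_smooth[OF \<eta>(1)], of "max 1 C"])
      show "\<bar>\<eta> x\<bar> \<le> max 1 C" for x using \<eta>(2)[rule_format, of x] by auto
      show "norm (grad \<eta> x) \<le> max 1 C" for x using \<eta>(5)[rule_format, of x] by auto
    qed
    note W2 = W12_diff[OF insert.prems(2) W1]
    have T1: "tapprox Om (\<lambda>x. \<eta> x * v x) (\<lambda>x. \<eta> x *\<^sub>R G x + v x *\<^sub>R grad \<eta> x)"
    proof (rule r(2)[OF y(1) W1])
      show "AE x in lborel. x \<notin> Om \<longrightarrow> \<eta> x * v x = 0" using insert.prems(3) by eventually_elim auto
      show "AE x in lborel. x \<notin> cball y (r y) \<longrightarrow> \<eta> x * v x = 0" using z by (intro AE_I2) simp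
    qed
    \<comment> \<open>The rest vanishes on \<open>ball y (r y / 2)\<close>, where the cutoff is 1,
      so the balls of the smaller family suffice for it.\<close>
    have T2: "tapprox Om (\<lambda>x. v x - \<eta> x * v x) (\<lambda>x. G x - (\<eta> x *\<^sub>R G x + v x *\<^sub>R grad \<eta> x))"
    proof (rule insert.IH[OF _ W2])
      show "F \<subseteq> closure Om" using insert.prems(1) by simp
      show "AE x in lborel. x \<notin> Om \<longrightarrow> v x - \<eta> x * v x = 0" using insert.prems(3) by eventually_elim auto
      show "AE x in lborel. x \<notin> (\<Union>y\<in>F. ball y (r y / 2)) \<longrightarrow> v x - \<eta> x * v x = 0"
        using insert.prems(4)
      proof eventually_elim
        case (elim x)
        show ?case
        proof (cases "x \<in> ball y (r y / 2)")
          case True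
          hence "\<eta> x = 1" using \<eta>(3) by simp
          thus ?thesis by simp
        qed (use elim in auto)
      qed
    qed
    from tapprox_add[OF T1 T2 W12D(1,2)[OF W1] W12D(1,2)[OF W2]] show ?case by simp
  qed
  have "closure Om \<subseteq> (\<Union>y\<in>closure Om. ball y (r y / 2))" using r(1) by force
  then obtain F where F: "F \<subseteq> closure Om" "finite F" "closure Om \<subseteq> (\<Union>y\<in>F. ball y (r y / 2))"
    using compactE_image[OF cOm, of "closure Om" "\<lambda>y. ball y (r y / 2)"] by auto
  show ?thesis
  proof (rule claim[OF F(2,1) W off])
    show "AE x in lborel. x \<notin> (\<Union>y\<in>F. ball y (r y / 2)) \<longrightarrow> v x = 0"
      using off by eventually_elim (use F(3) closure_subset in blast)
  qed
qed

text \<open>Near a boundary point the zero set of \<open>\<rho>\<close> has infinitely many disjoint translates inside a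
  bounded set, because \<open>\<rho>\<close> is strictly increasing in the direction of its gradient.\<close>
lemma local_null:
  assumes x0: "\<rho> x0 = 0"
  shows "\<exists>r>0. {x. \<rho> x = 0} \<inter> cball x0 r \<in> null_sets lborel"
proof -
  define e where "e = grad \<rho> x0"
  have e0: "norm e > 0" using g[OF x0] by (simp add: e_def)
  obtain d where d: "d > 0" "\<And>x. dist x x0 < d \<Longrightarrow> norm (grad \<rho> x - e) < norm e / 4"
    using near_boundary[OF x0] unfolding e_def by blast
  let ?N = "{x. \<rho> x = 0} \<inter> cball x0 (d / 4)"
  define t where "t n = d / (4 * norm e) * inverse (real (Suc n))" for n
  have t0: "t n > 0" for n using d e0 by (simp add: t_def)
  have tb: "t n * norm e \<le> d / 4" for n
  proof -
    have "t n * norm e = d / 4 * inverse (real (Suc n))" using e0 by (simp add: t_def)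
    also have "\<dots> \<le> d / 4 * 1" using d by (intro mult_left_mono) (auto simp: inverse_le_1_iff)
    finally show ?thesis by simp
  qed
  have tinj: "t m < t n" if "n < m" for n m
    using that d e0 unfolding t_def by (intro mult_strict_left_mono) (auto simp: inverse_less_iff_less)
  have cN: "closed ?N" using cr by (intro closed_Int closed_Collect_eq continuous_on_const) auto
  define T where "T n = {x. x - t n *\<^sub>R e \<in> ?N}" for n
  have cT: "closed (T n)" for n
  proof -
    have "T n = (\<lambda>x. x - t n *\<^sub>R e) -` ?N" by (auto simp: T_def)
    thus ?thesis using continuous_closed_vimage[OF cN, of "\<lambda>x. x - t n *\<^sub>R e"] by (auto intro: continuous_intros)
  qed
  have Tb: "T n \<subseteq> cball x0 d" for n
  proof
    fix x assume "x \<in> T n"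
    hence "norm (x - t n *\<^sub>R e - x0) \<le> d / 4" by (simp add: T_def dist_norm norm_minus_commute)
    moreover have "norm (t n *\<^sub>R e) \<le> d / 4" using tb[of n] t0[of n] by simp
    ultimately have "norm (x - x0) \<le> d" using norm_triangle_ineq[of "x - t n *\<^sub>R e - x0" "t n *\<^sub>R e"] d(1) by simp
    thus "x \<in> cball x0 d" by (simp add: dist_norm norm_minus_commute)
  qed
  have disj: "T n \<inter> T m = {}" if nm: "n < m" for n m
  proof -
    have False if x: "x \<in> T n" "x \<in> T m" for x
    proof -
      let ?p = "x - t n *\<^sub>R e" and ?q = "(t n - t m) *\<^sub>R e"
      have p: "\<rho> ?p = 0" "norm (?p - x0) \<le> d / 4" and pq: "\<rho> (?p + ?q) = 0"
        using x by (auto simp: T_def dist_norm norm_minus_commute algebra_simps)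
      obtain s where s: "s \<in> {0<..<1}" "\<rho> (?p + ?q) - \<rho> ?p = grad \<rho> (?p + s *\<^sub>R ?q) \<bullet> ?q" using segment_mvt[OF c1] by blast
      have tt: "0 < t n - t m" "t n - t m \<le> t n" using tinj[OF nm] t0[of m] by auto
      have "norm (s *\<^sub>R ?q) \<le> t n * norm e"
      proof -
        have "norm (s *\<^sub>R ?q) = s * ((t n - t m) * norm e)" using s(1) tt by simp
        also have "\<dots> \<le> 1 * (t n * norm e)" using s(1) tt by (intro mult_mono) auto
        finally show ?thesis by simp
      qed
      hence "dist (?p + s *\<^sub>R ?q) x0 < d"
        using norm_triangle_ineq[of "?p - x0" "s *\<^sub>R ?q"] p(2) tb[of n] d(1) by (simp add: dist_norm add_diff_eq diff_add_eq)
      note gd = d(2)[OF this]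
      have "grad \<rho> (?p + s *\<^sub>R ?q) \<bullet> e = e \<bullet> e + (grad \<rho> (?p + s *\<^sub>R ?q) - e) \<bullet> e" by (simp add: inner_diff_left)
      moreover have "\<bar>(grad \<rho> (?p + s *\<^sub>R ?q) - e) \<bullet> e\<bar> \<le> norm e / 4 * norm e"
        by (rule order_trans[OF Cauchy_Schwarz_ineq2]) (intro mult_right_mono less_imp_le[OF gd], simp)
      moreover have "e \<bullet> e = norm e * norm e" by (simp add: power2_norm_eq_inner[symmetric] power2_eq_square)
      moreover have "norm e * norm e > 0" using e0 by simp
      ultimately have "grad \<rho> (?p + s *\<^sub>R ?q) \<bullet> e > 0" by (simp add: abs_le_iff)
      hence "grad \<rho> (?p + s *\<^sub>R ?q) \<bullet> ?q > 0" using tt(1) unfolding inner_scaleR_right by (rule mult_pos_pos[rotated])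
      thus False unfolding s(2)[symmetric] p(1) pq by simp
    qed
    thus ?thesis by blast
  qed
  have df: "disjoint_family T" unfolding disjoint_family_on_def
    using disj by (metis Int_commute linorder_neqE_nat)
  have fb: "emeasure lborel (cball x0 d) < \<infinity>" by (intro emeasure_bounded_finite) auto
  have fin: "emeasure lborel A < \<infinity>" if "A \<subseteq> cball x0 d" "A \<in> sets lborel" for A
    using emeasure_mono[OF that(1), of lborel] fb by (auto simp: le_less_trans)
  have mT: "T n \<in> sets borel" for n using cT by simp
  have mN: "?N \<in> sets borel" using cN by simp
  have Ns: "?N \<subseteq> cball x0 d" using d(1) by auto
  have finN: "emeasure lborel ?N < \<infinity>" by (rule fin[OF Ns]) (use mN in simp)
  have eqm: "measure lborel (T n) = measure lborel ?N" for n
  proof -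
    have "nsq (\<lambda>x. indicator ?N (x + (- t n *\<^sub>R e)) *\<^sub>R (1::real)) = nsq (\<lambda>x. indicator ?N x *\<^sub>R (1::real))"
      by (rule sq_shift(2)[OF sq_indicator_const(1)[OF mN finN]])
    moreover have "indicator ?N (x + (- t n *\<^sub>R e)) = (indicator (T n) x :: real)" for x by (simp add: T_def indicator_def)
    ultimately have "nsq (\<lambda>x. indicator (T n) x *\<^sub>R (1::real)) = nsq (\<lambda>x. indicator ?N x *\<^sub>R (1::real))" by (simp only:)
    thus ?thesis
      using sq_indicator_const(2)[OF mN finN, of "1::real"] sq_indicator_const(2)[OF mT fin[OF Tb], of n "1::real"] mT by simp
  qed
  have "(\<lambda>n. measure lborel (T n)) sums measure lborel (\<Union>n. T n)"
  proof (rule measure_UNION[OF _ df])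
    have "(\<Union>n. T n) \<subseteq> cball x0 d" using Tb by blast
    hence "emeasure lborel (\<Union>n. T n) < \<infinity>" by (rule fin) (use mT in auto)
    thus "emeasure lborel (\<Union>n. T n) \<noteq> \<infinity>" by simp
  qed (use mT in auto)
  hence "summable (\<lambda>n::nat. measure lborel ?N)" unfolding eqm by (rule sums_summable)
  hence "measure lborel ?N = 0" using summable_LIMSEQ_zero LIMSEQ_const_iff by blast
  hence "emeasure lborel ?N = 0" using finN by (simp add: emeasure_eq_ennreal_measure)
  hence "?N \<in> null_sets lborel" using mN by (intro null_setsI) auto
  thus ?thesis using d(1) by (intro exI[of _ "d/4"]) auto
qed

text \<open>The boundary is compact and \<open>\<rho>\<close> vanishes on it, so finitely many of
  the null pieces cover it.\<close>

lemma AE_boundary: "AE x in lborel. x \<in> closure Om \<longrightarrow> x \<in> Om"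
proof -
  let ?B = "closure Om - Om"
  have cB: "compact ?B" using cOm oOm by (rule compact_diff)
  obtain r where r: "\<And>x. x \<in> ?B \<Longrightarrow> r x > 0 \<and> {y. \<rho> y = 0} \<inter> cball x (r x) \<in> null_sets lborel"
    using local_null bd_zero by (metis DiffD1 DiffD2)
  have "?B \<subseteq> (\<Union>x\<in>?B. ball x (r x))" using r by force
  then obtain F where F: "F \<subseteq> ?B" "finite F" "?B \<subseteq> (\<Union>x\<in>F. ball x (r x))"
    using compactE_image[OF cB, of ?B "\<lambda>x. ball x (r x)"] by auto
  have "AE x in lborel. \<forall>y\<in>F. x \<notin> {z. \<rho> z = 0} \<inter> cball y (r y)"
    using F r by (subst AE_ball_countable[OF countable_finite[OF F(2)]]) (blast intro: AE_not_in)
  thus ?thesis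
  proof eventually_elim
    case (elim x)
    show ?case
    proof (intro impI, rule ccontr)
      assume x: "x \<in> closure Om" "x \<notin> Om"
      then obtain y where "y \<in> F" "x \<in> ball y (r y)" using F(3) by blast
      moreover have "\<rho> x = 0" using x bd_zero by blast
      ultimately show False using elim by auto
    qed
  qed
qed

end

section \<open>Powers of Sobolev functions\<close>

text \<open>The first or the second term bounds the left side according to whether
  \<open>\<bar>s\<bar>\<close> is below or above \<open>R\<close>. A large \<open>R\<close> makes
  the coefficient of the sixth power small, which later allows it to be absorbed.\<close>

lemma powr_interpolation:
  fixes R q s :: real
  assumes R: "R > 0" and q: "2 < q" "q < 6"
  shows "\<bar>s\<bar> powr q \<le> R powr (q - 2) * s\<^sup>2 + R powr (q - 6) * s ^ 6"
proof -
  define t where "t = \<bar>s\<bar>"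
  have t: "t \<ge> 0" "s\<^sup>2 = t\<^sup>2" "s ^ 6 = t ^ 6" by (auto simp: t_def)
  have "t powr q \<le> R powr (q - 2) * t\<^sup>2 + R powr (q - 6) * t ^ 6"
  proof (cases "t = 0")
    case False
    hence t0: "t > 0" using t(1) by simp
    have n: "0 \<le> R powr (q - 2) * t\<^sup>2" "0 \<le> R powr (q - 6) * t ^ 6" using t0 by auto
    show ?thesis
    proof (cases "t \<le> R")
      case True
      have "t powr q = t powr (q - 2) * t powr 2" by (simp flip: powr_add)
      also have "\<dots> = t powr (q - 2) * t\<^sup>2" using t0 by (simp add: powr_numeral)
      also have "\<dots> \<le> R powr (q - 2) * t\<^sup>2" using True t0 q by (intro mult_right_mono powr_mono2) auto
      finally show ?thesis using n by linarith
    next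
      case False
      have "t powr q = t powr (q - 6) * t powr 6" by (simp flip: powr_add)
      also have "\<dots> = t powr (q - 6) * t ^ 6" using t0 by (simp add: powr_numeral)
      also have "\<dots> \<le> R powr (q - 6) * t ^ 6" using False R q by (intro mult_right_mono powr_mono2') auto
      finally show ?thesis using n by linarith
    qed
  qed simp
  thus ?thesis by (simp only: t t_def[symmetric])
qed

lemma W12_powr:
  assumes W: "W12 u G" and q: "2 < q" "q < 6"
  shows "integrable lborel (\<lambda>x. \<bar>u x\<bar> powr q)"
    "R > 0 \<Longrightarrow> (LBINT x. \<bar>u x\<bar> powr q) \<le> R powr (q - 2) * nsq u + R powr (q - 6) * (4096 * nsq G ^ 3)"
proof -
  have [measurable]: "u \<in> mble" and i2: "integrable lborel (\<lambda>x. (u x)\<^sup>2)"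
    using W12D(1)[OF W] by (auto simp: sq_def)
  have i: "integrable lborel (\<lambda>x. R powr (q - 2) * (u x)\<^sup>2 + R powr (q - 6) * u x ^ 6)" for R
    using i2 Sobolev(1)[OF W] by simp
  show 1: "integrable lborel (\<lambda>x. \<bar>u x\<bar> powr q)"
    by (rule Bochner_Integration.integrable_bound[OF i[of 1]])
       (use powr_interpolation[OF zero_less_one q] in \<open>auto intro!: AE_I2 order_trans[OF _ abs_ge_self]\<close>)
  assume R: "R > 0"
  have "(LBINT x. \<bar>u x\<bar> powr q) \<le> (LBINT x. R powr (q - 2) * (u x)\<^sup>2 + R powr (q - 6) * u x ^ 6)"
    by (rule integral_mono[OF 1 i powr_interpolation[OF R q]])
  also have "\<dots> = R powr (q - 2) * nsq u + R powr (q - 6) * (LBINT x. u x ^ 6)"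
    using i2 Sobolev(1)[OF W] by (simp add: nsq_def)
  also have "\<dots> \<le> R powr (q - 2) * nsq u + R powr (q - 6) * (4096 * nsq G ^ 3)"
    by (intro add_left_mono mult_left_mono Sobolev(2)[OF W]) simp
  finally show "(LBINT x. \<bar>u x\<bar> powr q) \<le> R powr (q - 2) * nsq u + R powr (q - 6) * (4096 * nsq G ^ 3)" .
qed

text \<open>Mean value theorem for \<open>t powr q\<close> between the two moduli, with the
  derivative bounded by its value at \<open>\<bar>x\<bar> + \<bar>y\<bar>\<close>.\<close>

lemma powr_diff_bound:
  fixes x y q :: real
  assumes q: "1 < q"
  shows "\<bar>\<bar>x + y\<bar> powr q - \<bar>x\<bar> powr q\<bar> \<le> q * 2 powr (q - 1) * (\<bar>x\<bar> powr (q - 1) * \<bar>y\<bar> + \<bar>y\<bar> powr q)"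
proof -
  have mv: "a powr q - b powr q \<le> q * a powr (q - 1) * (a - b)" if ab: "0 \<le> b" "b < a" for a b :: real
  proof -
    have c: "continuous_on {b..a} (\<lambda>t. t powr q)"
      using q ab by (intro continuous_on_powr' continuous_intros) auto
    have "(\<lambda>t. t powr q) differentiable (at t)" if "b < t" for t
      using has_real_derivative_powr[of t q] that ab unfolding real_differentiable_def by fastforce
    then obtain l z where z: "b < z" "z < a" "DERIV (\<lambda>t. t powr q) z :> l" "a powr q - b powr q = (a - b) * l"
      using MVT[OF ab(2) c] by blast
    have "l = q * z powr (q - 1)"
      using DERIV_unique[OF z(3)] has_real_derivative_powr[of z q] z ab by simp
    also have "\<dots> \<le> q * a powr (q - 1)" using z ab q by (intro mult_left_mono powr_mono2) auto
    finally show ?thesis using ab by (simp only: z(4) mult.commute[of "a - b"]) (intro mult_right_mono, auto)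
  qed
  define s where "s = \<bar>x\<bar> + \<bar>y\<bar>"
  have m: "\<bar>a powr q - b powr q\<bar> \<le> q * s powr (q - 1) * \<bar>y\<bar>"
    if "0 \<le> a" "0 \<le> b" "a \<le> s" "b \<le> s" "\<bar>a - b\<bar> \<le> \<bar>y\<bar>" for a b
  proof -
    have *: "\<bar>a powr q - b powr q\<bar> \<le> q * s powr (q - 1) * \<bar>y\<bar>"
      if "0 \<le> b" "b \<le> a" "a \<le> s" "a - b \<le> \<bar>y\<bar>" for a b
    proof (cases "a = b")
      case False
      have "b powr q \<le> a powr q" using that q by (intro powr_mono2) auto
      hence "\<bar>a powr q - b powr q\<bar> \<le> q * a powr (q - 1) * (a - b)" using mv[of b a] that False by simp
      also have "\<dots> \<le> q * s powr (q - 1) * \<bar>y\<bar>"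
        using that q by (intro mult_mono mult_left_mono powr_mono2) auto
      finally show ?thesis .
    qed (use q in simp)
    show ?thesis
    proof (cases "b \<le> a")
      case True thus ?thesis using *[of b a] that by simp
    next
      case False thus ?thesis using *[of a b] that by (simp add: abs_minus_commute)
    qed
  qed
  have s1: "s powr (q - 1) \<le> 2 powr (q - 1) * (\<bar>x\<bar> powr (q - 1) + \<bar>y\<bar> powr (q - 1))"
  proof -
    have "s powr (q - 1) \<le> (2 * max \<bar>x\<bar> \<bar>y\<bar>) powr (q - 1)" using q by (intro powr_mono2) (auto simp: s_def)
    also have "\<dots> = 2 powr (q - 1) * max \<bar>x\<bar> \<bar>y\<bar> powr (q - 1)" by (rule powr_mult)
    also have "\<dots> \<le> 2 powr (q - 1) * (\<bar>x\<bar> powr (q - 1) + \<bar>y\<bar> powr (q - 1))"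
      by (intro mult_left_mono) (auto simp: max_def)
    finally show ?thesis .
  qed
  have yq: "\<bar>y\<bar> powr (q - 1) * \<bar>y\<bar> = \<bar>y\<bar> powr q"
    using powr_add[of "\<bar>y\<bar>" "q - 1" 1] by (cases "y = 0") auto
  have "\<bar>\<bar>x + y\<bar> powr q - \<bar>x\<bar> powr q\<bar> \<le> q * s powr (q - 1) * \<bar>y\<bar>" by (rule m) (auto simp: s_def)
  also have "\<dots> \<le> q * (2 powr (q - 1) * (\<bar>x\<bar> powr (q - 1) + \<bar>y\<bar> powr (q - 1))) * \<bar>y\<bar>"
    using q by (intro mult_right_mono mult_left_mono s1) auto
  also have "\<dots> = q * 2 powr (q - 1) * (\<bar>x\<bar> powr (q - 1) * \<bar>y\<bar> + \<bar>y\<bar> powr q)"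
    unfolding yq[symmetric] by (simp only: mult.assoc distrib_right)
  finally show ?thesis .
qed

text \<open>The exponent \<open>q - 1\<close> is split into \<open>q / 2\<close> and
  \<open>(q - 2) / 2\<close>. The weight \<open>\<bar>u\<bar> powr (q - 2)\<close> lies in L^(3/2)
  because 3/2 times \<open>q - 2\<close> is between 3 and 6, so the convergence theorem for critical
  weights applies to it.\<close>

lemma cross_term:
  assumes Wu: "W12 u G" and Wv: "W12 v H" and q: "4 < q" "q < 6"
  shows "integrable lborel (\<lambda>x. \<bar>u x\<bar> powr (q - 1) * \<bar>v x\<bar>)"
    "(LBINT x. \<bar>u x\<bar> powr (q - 1) * \<bar>v x\<bar>)
       \<le> sqrt (LBINT x. \<bar>u x\<bar> powr q) * sqrt (LBINT x. \<bar>\<bar>u x\<bar> powr (q - 2)\<bar> * (v x)\<^sup>2)"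
    "integrable lborel (\<lambda>x. \<bar>\<bar>u x\<bar> powr (q - 2)\<bar> powr (3/2))" "(\<lambda>x. \<bar>u x\<bar> powr (q - 2)) \<in> mble"
proof -
  have [measurable]: "u \<in> mble" "v \<in> mble"
    using W12D(1)[OF Wu] W12D(1)[OF Wv] by (auto simp: sq_def)
  show m: "(\<lambda>x. \<bar>u x\<bar> powr (q - 2)) \<in> mble" by measurable
  have "\<bar>\<bar>t\<bar> powr (q - 2)\<bar> powr (3/2) = \<bar>t\<bar> powr ((q - 2) * (3/2))" for t :: real by (simp add: powr_powr)
  thus g: "integrable lborel (\<lambda>x. \<bar>\<bar>u x\<bar> powr (q - 2)\<bar> powr (3/2))"
    using W12_powr(1)[OF Wu, of "(q - 2) * (3/2)"] q by simp
  have e1: "(norm (\<bar>t\<bar> powr (q/2)))\<^sup>2 = \<bar>t\<bar> powr q" for t :: real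
    by (simp add: power2_eq_square flip: powr_add)
  have e2: "(norm (\<bar>t\<bar> powr ((q - 2)/2) * s))\<^sup>2 = \<bar>\<bar>t\<bar> powr (q - 2)\<bar> * s\<^sup>2" for t s :: real
    unfolding norm_mult power_mult_distrib by (simp add: power2_eq_square diff_divide_distrib flip: powr_add)
  have e3: "norm (\<bar>t\<bar> powr (q/2)) * norm (\<bar>t\<bar> powr ((q - 2)/2) * s) = \<bar>t\<bar> powr (q - 1) * \<bar>s\<bar>" for t s :: real
    by (simp add: abs_mult mult.assoc[symmetric] diff_divide_distrib flip: powr_add)
  have s1: "sq (\<lambda>x. \<bar>u x\<bar> powr (q/2))" unfolding sq_def e1 using W12_powr(1)[OF Wu, of q] q by simp
  have s2: "sq (\<lambda>x. \<bar>u x\<bar> powr ((q - 2)/2) * v x)" unfolding sq_def e2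
    using weighted_int(1)[OF m g _ Sobolev(1)[OF Wv]] by simp
  show "integrable lborel (\<lambda>x. \<bar>u x\<bar> powr (q - 1) * \<bar>v x\<bar>)"
    using sq_norm_mult_int[OF s1 s2] unfolding e3 .
  show "(LBINT x. \<bar>u x\<bar> powr (q - 1) * \<bar>v x\<bar>)
       \<le> sqrt (LBINT x. \<bar>u x\<bar> powr q) * sqrt (LBINT x. \<bar>\<bar>u x\<bar> powr (q - 2)\<bar> * (v x)\<^sup>2)"
    using L2_CS_norm[OF s1 s2] unfolding e3 nsq_def e1 e2 .
qed

text \<open>A bounded sequence that vanishes locally is weakly null: truncate \<open>z\<close> to a
  large ball.\<close>

lemma local_null_weak:
  fixes w :: "nat \<Rightarrow> R3 \<Rightarrow> real"
  assumes w: "\<And>n. sq (w n)" "\<And>n. nsq (w n) \<le> C" and z: "sq z"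
    and lim: "\<And>k. (\<lambda>n. nsq_on (real k) (\<lambda>x. w n x)) \<longlonglongrightarrow> 0"
  shows "(\<lambda>n. LBINT x. w n x * z x) \<longlonglongrightarrow> 0"
proof (rule LIMSEQ_I)
  fix e :: real assume e: "e > 0"
  have [measurable]: "z \<in> mble" using z by (simp add: sq_def)
  define zk where "zk k x = indicator (ball 0 (real k)) x *\<^sub>R z x" for k x
  have szk: "sq (zk k)" for k unfolding zk_def by (rule sq_indicator(1)[OF _ z]) simp
  have "(\<lambda>k. nsq (\<lambda>x. zk k x - z x)) \<longlonglongrightarrow> 0"
  proof (rule sq_dominated(3)[where w="\<lambda>x. \<bar>z x\<bar>"])
    show "AE x in lborel. (\<lambda>k. zk k x) \<longlonglongrightarrow> z x"
    proof (rule AE_I2)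
      fix x :: R3
      have "eventually (\<lambda>k. zk k x = z x) sequentially"
      proof (rule eventually_sequentiallyI[of "nat \<lceil>norm x\<rceil> + 1"])
        fix k assume "nat \<lceil>norm x\<rceil> + 1 \<le> k"
        hence "norm x < real k" by linarith
        thus "zk k x = z x" by (simp add: zk_def)
      qed
      thus "(\<lambda>k. zk k x) \<longlonglongrightarrow> z x" by (rule tendsto_eventually)
    qed
    show "sq (\<lambda>x. \<bar>z x\<bar>)" using z by (simp add: sq_def)
    show "zk k \<in> mble" for k by (rule sq_meas[OF szk])
    show "AE x in lborel. norm (zk k x) \<le> \<bar>z x\<bar>" for k
      by (rule AE_I2) (simp add: zk_def indicator_def)
  qed simp
  from tendsto_mult[OF tendsto_const[of "sqrt C"] tendsto_real_sqrt[OF this]]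
  have "(\<lambda>k. sqrt C * sqrt (nsq (\<lambda>x. zk k x - z x))) \<longlonglongrightarrow> 0" by simp
  from LIMSEQ_D[OF this, of "e/2"] e obtain k where k: "\<bar>sqrt C * sqrt (nsq (\<lambda>x. zk k x - z x))\<bar> < e/2" by auto
  from tendsto_mult[OF tendsto_real_sqrt[OF lim[of k]] tendsto_const[of "sqrt (nsq z)"]]
  have "(\<lambda>n. sqrt (nsq_on (real k) (\<lambda>x. w n x)) * sqrt (nsq z)) \<longlonglongrightarrow> 0" by simp
  from LIMSEQ_D[OF this, of "e/2"] e obtain N where
    N: "\<And>n. n \<ge> N \<Longrightarrow> \<bar>sqrt (nsq_on (real k) (\<lambda>x. w n x)) * sqrt (nsq z)\<bar> < e/2" by auto
  have "\<bar>LBINT x. w n x * z x\<bar> < e" if n: "n \<ge> N" for n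
  proof -
    let ?i = "\<lambda>x. indicator (ball 0 (real k)) x *\<^sub>R w n x"
    have si: "sq ?i" by (rule sq_indicator(1)[OF _ w(1)]) simp
    have sd: "sq (\<lambda>x. zk k x - z x)" by (rule sq_diff(1)[OF szk z])
    have "(LBINT x. w n x * z x) = (LBINT x. ?i x \<bullet> z x - w n x \<bullet> (zk k x - z x))"
      by (simp add: zk_def algebra_simps)
    also have "\<dots> = (LBINT x. ?i x \<bullet> z x) - (LBINT x. w n x \<bullet> (zk k x - z x))"
      by (rule Bochner_Integration.integral_diff[OF sq_inner_int[OF si z] sq_inner_int[OF w(1) sd]])
    finally have "\<bar>LBINT x. w n x * z x\<bar> \<le> \<bar>LBINT x. ?i x \<bullet> z x\<bar> + \<bar>LBINT x. w n x \<bullet> (zk k x - z x)\<bar>"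
      by linarith
    moreover have "\<bar>LBINT x. ?i x \<bullet> z x\<bar> \<le> sqrt (nsq ?i) * sqrt (nsq z)" by (rule L2_CS[OF si z])
    moreover have "\<bar>LBINT x. w n x \<bullet> (zk k x - z x)\<bar> \<le> sqrt (nsq (w n)) * sqrt (nsq (\<lambda>x. zk k x - z x))"
      by (rule L2_CS[OF w(1) sd])
    moreover have "sqrt (nsq (w n)) * sqrt (nsq (\<lambda>x. zk k x - z x)) \<le> sqrt C * sqrt (nsq (\<lambda>x. zk k x - z x))"
      by (intro mult_right_mono real_sqrt_le_mono w(2)) simp
    ultimately show ?thesis using N[OF n] k by linarith
  qed
  thus "\<exists>N. \<forall>n\<ge>N. norm ((LBINT x. w n x * z x) - 0) < e" by auto
qed

lemma H1_iff: "u \<in> H1 \<longleftrightarrow> (\<exists>G. W12 u G)"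
  by (auto simp: H1_def L2_grad_def W12_def sq_def)

lemma W12_wgrad:
  assumes "W12 u G" shows "W12 u (wgrad u)"
proof -
  have "L2_grad u G" using assms by (simp add: L2_grad_def W12_def sq_def)
  hence "L2_grad u (wgrad u)" unfolding wgrad_def by (rule someI[where P="L2_grad u"])
  thus ?thesis using assms by (simp add: L2_grad_def W12_def sq_def)
qed

lemma nsq_cong_AE:
  assumes "AE x in lborel. u x = v x" "u \<in> mble" "v \<in> mble"
  shows "nsq u = nsq v"
  unfolding nsq_def using assms by (intro integral_cong_AE) auto

lemma nsq_wgrad:
  assumes "W12 u G" shows "nsq (wgrad u) = nsq G"
  using W12_unique[OF W12_wgrad[OF assms] assms] W12D(2)[OF assms] W12D(2)[OF W12_wgrad[OF assms]]
  by (intro nsq_cong_AE) (auto simp: sq_def)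

section \<open>The energy and its weakly convergent sequences\<close>

locale steep_well =
  fixes V f Q :: "R3 \<Rightarrow> real" and a p c M :: real
  assumes p: "4 < p" "p < 6" and a: "a > 0"
    and V: "\<And>x. V x \<ge> 0" "continuous_on UNIV V" and c: "c > 0" "emeasure lborel {x. V x < c} < \<infinity>"
    and f: "f \<in> mble" "integrable lborel (\<lambda>x. \<bar>f x\<bar> powr (3/2))"
    and Q: "Q \<in> mble" "AE x in lborel. \<bar>Q x\<bar> \<le> M" "M \<ge> 0"
begin

definition "A u = nsq (wgrad u)"
text \<open>The potential energy is taken without the factor \<open>\<mu>\<close>, so that bounds
  uniform in \<open>\<mu>\<close> can be stated; the square root makes it an L^2 norm.\<close>

definition "P u = nsq (\<lambda>x. sqrt (V x) * u x)"
definition "F u = (LBINT x. f x * (u x)\<^sup>2)"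
definition "B u = (LBINT x. Q x * \<bar>u x\<bar> powr p)"
definition "X u \<longleftrightarrow> W12 u (wgrad u) \<and> sq (\<lambda>x. sqrt (V x) * u x)"
definition "E \<mu> lam u = A u + \<mu> * P u - lam * F u"
definition "Kf = (LBINT x. \<bar>f x\<bar> powr (3/2)) + 4096"
text \<open>The constant in the estimate for differences of powers, times the bound of
  \<open>Q\<close>.\<close>

definition "KB = M * (p * 2 powr (p - 1))"

lemma mV [measurable]: "V \<in> mble" and mf [measurable]: "f \<in> mble"
  and mQ [measurable]: "Q \<in> mble"
  by (rule cont_meas[OF V(2)] f(1) Q(1))+

lemma AP_nonneg [simp]: "A u \<ge> 0" "P u \<ge> 0"
  by (simp_all add: A_def P_def)

lemma Kf_pos: "Kf > 0" and KB_nonneg: "KB \<ge> 0"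
  using p Q(3) by (auto simp: Kf_def KB_def intro!: add_nonneg_pos integral_nonneg)

lemma XD: "X u \<Longrightarrow> W12 u (wgrad u)" "X u \<Longrightarrow> sq (\<lambda>x. sqrt (V x) * u x)" "X u \<Longrightarrow> sq u" "X u \<Longrightarrow> sq (wgrad u)"
  "X u \<Longrightarrow> u \<in> mble"
  using W12D(1,2) by (auto simp: X_def sq_def)

lemma XI: "W12 u G \<Longrightarrow> sq (\<lambda>x. sqrt (V x) * u x) \<Longrightarrow> X u"
  using W12_wgrad by (simp add: X_def)

lemma sqrt_V: "(norm (sqrt (V x) * t))\<^sup>2 = V x * t\<^sup>2"
  using V(1)[of x] by (simp add: power_mult_distrib)

lemma P_eq: "P u = (LBINT x. V x * (u x)\<^sup>2)"
  by (simp only: P_def nsq_def sqrt_V)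

lemma X_Xsp: "u \<in> Xsp V \<longleftrightarrow> X u"
proof
  assume "u \<in> Xsp V"
  then obtain G where G: "W12 u G" and i: "integrable lborel (\<lambda>x. V x * (u x)\<^sup>2)" by (auto simp: Xsp_def H1_iff)
  have [measurable]: "u \<in> mble" using W12D(1)[OF G] by (simp add: sq_def)
  show "X u" by (rule XI[OF G]) (simp only: sq_def sqrt_V, simp add: i)
next
  assume "X u"
  thus "u \<in> Xsp V" unfolding Xsp_def H1_iff X_def sq_def sqrt_V by blast
qed

lemma X_add: "X u \<Longrightarrow> X v \<Longrightarrow> X (\<lambda>x. u x + v x)"
  by (rule XI[OF W12_add[OF XD(1) XD(1)]], assumption+)
     (use sq_add(1)[OF XD(2) XD(2)] in \<open>simp add: distrib_left\<close>)

lemma X_scale: "X u \<Longrightarrow> X (\<lambda>x. t * u x)"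
  by (rule XI[OF W12_scale[OF XD(1)]], assumption)
     (use sq_cmult(1)[OF XD(2), of u t] in \<open>simp add: mult.left_commute\<close>)

lemma X_diff: "X u \<Longrightarrow> X v \<Longrightarrow> X (\<lambda>x. u x - v x)"
  using X_add[of u "\<lambda>x. (- 1) * v x"] X_scale[of v "- 1"] by simp

lemma A_W12: "W12 u G \<Longrightarrow> A u = nsq G"
  unfolding A_def by (rule nsq_wgrad)

lemma A_add: "X u \<Longrightarrow> X v \<Longrightarrow> A (\<lambda>x. u x + v x) = A u + 2 * (LBINT x. wgrad u x \<bullet> wgrad v x) + A v"
  unfolding A_W12[OF W12_add[OF XD(1) XD(1)]] nsq_add_expand[OF XD(4) XD(4)] by (simp add: A_def)

lemma A_diff: "X u \<Longrightarrow> X v \<Longrightarrow> A (\<lambda>x. u x - v x) = A u - 2 * (LBINT x. wgrad u x \<bullet> wgrad v x) + A v"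
  unfolding A_W12[OF W12_diff[OF XD(1) XD(1)]] nsq_diff_expand[OF XD(4) XD(4)] by (simp add: A_def)

lemma A_diff_le: "X u \<Longrightarrow> X v \<Longrightarrow> A (\<lambda>x. u x - v x) \<le> 2 * A u + 2 * A v"
  unfolding A_W12[OF W12_diff[OF XD(1) XD(1)]] using sq_diff(2)[OF XD(4) XD(4)] by (simp add: A_def)

lemma P_add: "X u \<Longrightarrow> X v \<Longrightarrow> P (\<lambda>x. u x + v x) =
    P u + 2 * (LBINT x. (sqrt (V x) * v x) * (sqrt (V x) * u x)) + P v"
  unfolding P_def distrib_left nsq_add_expand[OF XD(2) XD(2)] by (simp add: mult.commute)

lemma P_diff_le: "X u \<Longrightarrow> X v \<Longrightarrow> P (\<lambda>x. u x - v x) \<le> 2 * P u + 2 * P v"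
  unfolding P_def right_diff_distrib by (rule sq_diff(2)[OF XD(2) XD(2)])

lemma F_int: "X u \<Longrightarrow> integrable lborel (\<lambda>x. f x * (u x)\<^sup>2)"
  by (rule weighted_int(2)[OF f sq_meas[OF XD(3)] Sobolev(1)[OF XD(1)]])

lemma F_add: assumes "X u" "X v"
  shows "F (\<lambda>x. u x + v x) = F u + 2 * (LBINT x. f x * u x * v x) + F v"
proof -
  note i = F_int[OF assms(1)] weight_bilinear(1)[OF f XD(1)[OF assms(1)] XD(1)[OF assms(2)]] F_int[OF assms(2)]
  have "F (\<lambda>x. u x + v x) = (LBINT x. f x * (u x)\<^sup>2 + 2 * (f x * u x * v x) + f x * (v x)\<^sup>2)"
    unfolding F_def by (simp add: power2_sum algebra_simps)
  also have "\<dots> = F u + 2 * (LBINT x. f x * u x * v x) + F v"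
    unfolding F_def using i by simp
  finally show ?thesis .
qed

lemma scale:
  assumes "X u"
  shows "A (\<lambda>x. t * u x) = t\<^sup>2 * A u" "P (\<lambda>x. t * u x) = t\<^sup>2 * P u" "F (\<lambda>x. t * u x) = t\<^sup>2 * F u"
    "B (\<lambda>x. t * u x) = \<bar>t\<bar> powr p * B u" "E \<mu> lam (\<lambda>x. t * u x) = t\<^sup>2 * E \<mu> lam u"
proof -
  show 1: "A (\<lambda>x. t * u x) = t\<^sup>2 * A u"
    unfolding A_W12[OF W12_scale[OF XD(1)[OF assms]]] sq_scale(2) A_def ..
  show 2: "P (\<lambda>x. t * u x) = t\<^sup>2 * P u"
    unfolding P_def mult.left_commute[of "sqrt _"] sq_cmult(2) ..
  show 3: "F (\<lambda>x. t * u x) = t\<^sup>2 * F u"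
    unfolding F_def power_mult_distrib mult.left_commute[of "f _"] by simp
  show "B (\<lambda>x. t * u x) = \<bar>t\<bar> powr p * B u"
    unfolding B_def abs_mult powr_mult mult.left_commute[of "Q _"] by simp
  show "E \<mu> lam (\<lambda>x. t * u x) = t\<^sup>2 * E \<mu> lam u"
    unfolding E_def 1 2 3 by (simp add: algebra_simps)
qed

lemma B_int: assumes "X u" shows "integrable lborel (\<lambda>x. Q x * \<bar>u x\<bar> powr p)"
proof -
  have [measurable]: "u \<in> mble" by (rule XD(5)[OF assms])
  have i: "integrable lborel (\<lambda>x. M * \<bar>u x\<bar> powr p)"
    using W12_powr(1)[OF XD(1)[OF assms], of p] p by simp
  show ?thesis
    by (rule Bochner_Integration.integrable_bound[OF i])
       (use Q(2,3) in \<open>auto elim!: eventually_mono simp: abs_mult intro: mult_right_mono\<close>)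
qed

lemma B_diff:
  assumes u: "X u" and v: "X v"
  shows "\<bar>B (\<lambda>x. u x + v x) - B u\<bar> \<le> KB * ((LBINT x. \<bar>u x\<bar> powr (p - 1) * \<bar>v x\<bar>) + (LBINT x. \<bar>v x\<bar> powr p))"
proof -
  note i = B_int[OF X_add[OF u v]] B_int[OF u]
  note j = cross_term(1)[OF XD(1)[OF u] XD(1)[OF v] p] W12_powr(1)[OF XD(1)[OF v], of p]
  have "\<bar>B (\<lambda>x. u x + v x) - B u\<bar> = \<bar>\<integral>x. Q x * \<bar>u x + v x\<bar> powr p - Q x * \<bar>u x\<bar> powr p \<partial>lborel\<bar>"
    unfolding B_def using i by simp
  also have "\<dots> \<le> (LBINT x. \<bar>Q x * \<bar>u x + v x\<bar> powr p - Q x * \<bar>u x\<bar> powr p\<bar>)" by (rule integral_abs_bound)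
  also have "\<dots> \<le> (LBINT x. KB * (\<bar>u x\<bar> powr (p - 1) * \<bar>v x\<bar> + \<bar>v x\<bar> powr p))"
  proof (rule integral_mono_AE)
    show "AE x in lborel. \<bar>Q x * \<bar>u x + v x\<bar> powr p - Q x * \<bar>u x\<bar> powr p\<bar> \<le> KB * (\<bar>u x\<bar> powr (p - 1) * \<bar>v x\<bar> + \<bar>v x\<bar> powr p)"
      using Q(2)
    proof eventually_elim
      case (elim x)
      have "\<bar>Q x * \<bar>u x + v x\<bar> powr p - Q x * \<bar>u x\<bar> powr p\<bar> = \<bar>Q x\<bar> * \<bar>\<bar>u x + v x\<bar> powr p - \<bar>u x\<bar> powr p\<bar>"
        by (simp flip: abs_mult right_diff_distrib)
      also have "\<dots> \<le> M * (p * 2 powr (p - 1) * (\<bar>u x\<bar> powr (p - 1) * \<bar>v x\<bar> + \<bar>v x\<bar> powr p))"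
        using elim p by (intro mult_mono powr_diff_bound Q(3)) auto
      finally show ?case by (simp only: KB_def mult.assoc)
    qed
  qed (use i j p in simp_all)
  also have "\<dots> = KB * ((LBINT x. \<bar>u x\<bar> powr (p - 1) * \<bar>v x\<bar>) + (LBINT x. \<bar>v x\<bar> powr p))"
    using j p by simp
  finally show ?thesis .
qed

lemma F_abs_le: "X u \<Longrightarrow> \<bar>F u\<bar> \<le> (LBINT x. \<bar>f x\<bar> * (u x)\<^sup>2)"
  unfolding F_def using integral_abs_bound[of lborel "\<lambda>x. f x * (u x)\<^sup>2"] by (simp add: abs_mult)

lemma F_bound: "X u \<Longrightarrow> \<bar>F u\<bar> \<le> Kf * A u"
  using F_abs_le[of u] weighted_bound[OF f XD(1)[of u]] by (simp add: Kf_def A_def)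

text \<open>Mass in a sublevel set of \<open>V\<close>. As this set has finite measure, its
  indicator is a weight in L^(3/2); the absolute value matches the form of the weighted
  estimates.\<close>

definition "S u = (LBINT x. \<bar>indicator {x. V x < c} x\<bar> * (u x)\<^sup>2)" for u :: "R3 \<Rightarrow> real"

lemma well_weight: "(indicator {x. V x < c} :: R3 \<Rightarrow> real) \<in> mble"
  "integrable lborel (\<lambda>x. \<bar>indicator {x. V x < c} x :: real\<bar> powr (3/2))"
proof -
  have s [measurable]: "{x. V x < c} \<in> sets lborel" by measurable
  thus "(indicator {x. V x < c} :: R3 \<Rightarrow> real) \<in> mble" by measurable
  have "(\<lambda>x. \<bar>indicator {x. V x < c} x :: real\<bar> powr (3/2)) = indicator {x. V x < c}"
    by (auto simp: indicator_def)
  moreover have "integrable lborel (indicator {x. V x < c} :: R3 \<Rightarrow> real)" using s c(2) by simp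
  ultimately show "integrable lborel (\<lambda>x. \<bar>indicator {x. V x < c} x :: real\<bar> powr (3/2))" by simp
qed

text \<open>Outside the sublevel set \<open>V \<ge> c\<close>, so the mass there is controlled by
  the potential energy, for which a large \<open>\<mu>\<close> later pays.\<close>

lemma nsq_split: assumes "X u" shows "nsq u \<le> S u + P u / c"
proof -
  have iS: "integrable lborel (\<lambda>x. \<bar>indicator {x. V x < c} x\<bar> * (u x)\<^sup>2)"
    by (rule weighted_int(1)[OF well_weight sq_meas[OF XD(3)[OF assms]] Sobolev(1)[OF XD(1)[OF assms]]])
  have iP: "integrable lborel (\<lambda>x. V x * (u x)\<^sup>2)" using sq_int[OF XD(2)[OF assms]] unfolding sqrt_V .
  have "nsq u \<le> (LBINT x. \<bar>indicator {x. V x < c} x\<bar> * (u x)\<^sup>2 + V x * (u x)\<^sup>2 / c)"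
    unfolding nsq_def
  proof (rule integral_mono[OF sq_int[OF XD(3)[OF assms]]])
    show "(norm (u x))\<^sup>2 \<le> \<bar>indicator {x. V x < c} x\<bar> * (u x)\<^sup>2 + V x * (u x)\<^sup>2 / c" for x
    proof (cases "V x < c")
      case True thus ?thesis using V(1)[of x] c(1) by simp
    next
      case False
      hence "c * (u x)\<^sup>2 \<le> V x * (u x)\<^sup>2" by (intro mult_right_mono) auto
      thus ?thesis using False c(1) by (simp add: pos_le_divide_eq mult.commute)
    qed
  qed (use iS iP in simp)
  thus ?thesis using iS iP by (simp add: S_def P_eq)
qed

definition "KV = (LBINT x. \<bar>indicator {x. V x < c} x :: real\<bar> powr (3/2)) + 4096"

lemma nsq_bound: "X u \<Longrightarrow> nsq u \<le> KV * A u + P u / c"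
  using nsq_split[of u] weighted_bound[OF well_weight XD(1)[of u]] by (simp add: S_def KV_def A_def)

text \<open>A substitute for weak convergence: energies bounded by \<open>C\<close> and L^2
  convergence on every ball. It leaves open whether mass escapes to infinity.\<close>

definition "wconv C w u \<longleftrightarrow> (\<forall>n. X (w n) \<and> A (w n) \<le> C \<and> P (w n) \<le> C) \<and> X u \<and>
  (\<forall>R. (\<lambda>n. nsq_on R (\<lambda>x. (w n x - u x))) \<longlonglongrightarrow> 0)" for w :: "nat \<Rightarrow> R3 \<Rightarrow> real"

lemma wconvD: assumes "wconv C w u" shows "X (w n)" "A (w n) \<le> C" "P (w n) \<le> C" "X u"
  "(\<lambda>n. nsq_on R (\<lambda>x. (w n x - u x))) \<longlonglongrightarrow> 0" "X (\<lambda>x. w n x - u x)"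
  "A (\<lambda>x. w n x - u x) \<le> 2 * C + 2 * A u" "P (\<lambda>x. w n x - u x) \<le> 2 * C + 2 * P u"
proof -
  show *: "X (w n)" "A (w n) \<le> C" "P (w n) \<le> C" "X u"
    "(\<lambda>n. nsq_on R (\<lambda>x. (w n x - u x))) \<longlonglongrightarrow> 0"
    using assms by (auto simp: wconv_def)
  show "X (\<lambda>x. w n x - u x)" by (rule X_diff[OF *(1,4)])
  show "A (\<lambda>x. w n x - u x) \<le> 2 * C + 2 * A u" "P (\<lambda>x. w n x - u x) \<le> 2 * C + 2 * P u"
    using A_diff_le[OF *(1,4)] P_diff_le[OF *(1,4)] *(2,3) by argo+
qed

text \<open>The L^2 bound for Rellich's theorem comes from \<open>nsq_bound\<close>; the limit gets
  its weak gradient from the minimisation argument and its potential energy from Fatou.\<close>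

lemma compactness:
  assumes w: "\<And>n. X (w n)" "\<And>n. A (w n) \<le> C" "\<And>n. P (w n) \<le> C"
  shows "\<exists>r u. strict_mono (r :: nat \<Rightarrow> nat) \<and> wconv C (\<lambda>n. w (r n)) u"
proof -
  define C' where "C' = max C (KV * C + C / c)"
  have KV: "KV \<ge> 0" unfolding KV_def by (intro add_nonneg_nonneg integral_nonneg) auto
  have "KV * A (w n) + P (w n) / c \<le> KV * C + C / c" for n
    using w c(1) KV by (intro add_mono mult_left_mono divide_right_mono) auto
  hence b: "nsq (w n) \<le> C'" "nsq (wgrad (w n)) \<le> C'" for n
    using nsq_bound[OF w(1)[of n]] w(2)[of n] by (auto simp: C'_def A_def intro: order_trans le_max_iff_disj[THEN iffD2])
  obtain r v where r: "strict_mono (r :: nat \<Rightarrow> nat)" "AE x in lborel. (\<lambda>i. w (r i) x) \<longlonglongrightarrow> v x" "sq v"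
    "\<And>R. (\<lambda>i. nsq_on R (\<lambda>x. (w (r i) x - v x))) \<longlonglongrightarrow> 0"
    using Rellich[of w "\<lambda>n. wgrad (w n)" C', OF XD(1)[OF w(1)] b] by blast
  obtain G where G: "W12 v G" using weak_gradient_limit[OF XD(1)[OF w(1)] b(2) r(3,4)] by blast
  have "sq (\<lambda>x. sqrt (V x) * v x)"
  proof (rule sq_fatou(1)[where u="\<lambda>n x. sqrt (V x) * w (r n) x" and C=C])
    show "sq (\<lambda>x. sqrt (V x) * w (r n) x)" for n by (rule XD(2)[OF w(1)])
    show "AE x in lborel. (\<lambda>n. sqrt (V x) * w (r n) x) \<longlonglongrightarrow> sqrt (V x) * v x"
      using r(2) by eventually_elim (rule tendsto_mult_left)
    show "(\<lambda>x. sqrt (V x) * v x) \<in> mble" using sq_meas[OF r(3)] by measurable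
    show "\<forall>\<^sub>F n in sequentially. nsq (\<lambda>x. sqrt (V x) * w (r n) x) \<le> C" using w(3) by (simp add: P_def)
  qed
  hence "X v" by (rule XI[OF G])
  thus ?thesis using r w by (intro exI[of _ r] exI[of _ v]) (simp add: wconv_def)
qed

context
  fixes C w u assumes wc: "wconv C w u"
begin

text \<open>Asymptotic splitting of a Hilbert norm: the mixed term converges to \<open>A u\<close>
  by weak convergence of the gradients.\<close>

lemma wconv_A: "(\<lambda>n. A (w n) - A (\<lambda>x. w n x - u x)) \<longlonglongrightarrow> A u"
proof -
  have "(\<lambda>n. LBINT x. wgrad (w n) x \<bullet> wgrad u x) \<longlonglongrightarrow> (LBINT x. wgrad u x \<bullet> wgrad u x)"
    using wconvD(2)[OF wc] unfolding A_def
    by (intro weak_convergence_gradient[OF XD(1)[OF wconvD(1)[OF wc]] _ XD(1)[OF wconvD(4)[OF wc]] wconvD(5)[OF wc] XD(1)[OF wconvD(4)[OF wc]]])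
  hence "(\<lambda>n. LBINT x. wgrad (w n) x \<bullet> wgrad u x) \<longlonglongrightarrow> A u"
    by (simp add: A_def nsq_def power2_norm_eq_inner)
  hence "(\<lambda>n. 2 * (LBINT x. wgrad (w n) x \<bullet> wgrad u x) - A u) \<longlonglongrightarrow> 2 * A u - A u"
    by (intro tendsto_intros)
  thus ?thesis unfolding A_diff[OF wconvD(1)[OF wc] wconvD(4)[OF wc]] by (simp add: algebra_simps)
qed

text \<open>The mixed term tends to 0 because \<open>V\<close>, though possibly unbounded, is
  bounded on each ball.\<close>

lemma wconv_P: "(\<lambda>n. P (w n) - P (\<lambda>x. w n x - u x)) \<longlonglongrightarrow> P u"
proof -
  note Xv = wconvD(6)[OF wc] and Xu = wconvD(4)[OF wc]
  have "(\<lambda>n. LBINT x. (sqrt (V x) * (w n x - u x)) * (sqrt (V x) * u x)) \<longlonglongrightarrow> 0"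
  proof (rule local_null_weak[where C="2 * C + 2 * P u"])
    show "sq (\<lambda>x. sqrt (V x) * (w n x - u x))" for n by (rule XD(2)[OF Xv])
    show "nsq (\<lambda>x. sqrt (V x) * (w n x - u x)) \<le> 2 * C + 2 * P u" for n
      using wconvD(8)[OF wc, of n] by (simp only: P_def)
    show "sq (\<lambda>x. sqrt (V x) * u x)" by (rule XD(2)[OF Xu])
    fix k :: nat
    have "compact (V ` cball 0 (real k))" using V(2) by (intro compact_continuous_image) (auto intro: continuous_on_subset)
    hence "bounded (V ` cball 0 (real k))" by (rule compact_imp_bounded)
    then obtain L where L: "\<And>x. x \<in> cball 0 (real k) \<Longrightarrow> \<bar>V x\<bar> \<le> L" unfolding bounded_iff real_norm_def by blast
    have e: "indicator (ball 0 (real k)) x *\<^sub>R (sqrt (V x) * t) = (sqrt (V x) * indicator (ball 0 (real k)) x) *\<^sub>R (indicator (ball 0 (real k)) x *\<^sub>R t)"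
      for x and t :: real by (cases "x \<in> ball 0 (real k)") auto
    have bd: "AE x in lborel. \<bar>sqrt (V x) * indicator (ball 0 (real k)) x\<bar> \<le> sqrt \<bar>L\<bar>"
    proof (rule AE_I2)
      fix x
      show "\<bar>sqrt (V x) * indicator (ball 0 (real k)) x\<bar> \<le> sqrt \<bar>L\<bar>"
        using L[of x] V(1)[of x] by (cases "x \<in> ball 0 (real k)") auto
    qed
    have m: "(\<lambda>x. sqrt (V x) * indicator (ball 0 (real k)) x) \<in> mble"
      by (intro borel_measurable_times borel_measurable_indicator) auto
    show "(\<lambda>n. nsq_on (real k) (\<lambda>x. (sqrt (V x) * (w n x - u x)))) \<longlonglongrightarrow> 0"
    proof (rule null_comparison_nonneg[OF _ nsq_nonneg])
      show "(\<lambda>n. (sqrt \<bar>L\<bar>)\<^sup>2 * nsq_on (real k) (\<lambda>x. (w n x - u x))) \<longlonglongrightarrow> 0"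
        using tendsto_mult_left[OF wconvD(5)[OF wc]] by simp
      show "nsq_on (real k) (\<lambda>x. (sqrt (V x) * (w n x - u x)))
        \<le> (sqrt \<bar>L\<bar>)\<^sup>2 * nsq_on (real k) (\<lambda>x. (w n x - u x))" for n
        unfolding e by (intro sq_mult_bounded(2)[OF m bd] sq_indicator(1) XD(3)[OF Xv]) simp
    qed
  qed
  from tendsto_add[OF tendsto_const[of "P u"] tendsto_mult_left[OF this, of 2]]
  have "(\<lambda>n. P u + 2 * (LBINT x. (sqrt (V x) * (w n x - u x)) * (sqrt (V x) * u x))) \<longlonglongrightarrow> P u" by simp
  moreover have "P (w n) = P u + 2 * (LBINT x. (sqrt (V x) * (w n x - u x)) * (sqrt (V x) * u x)) + P (\<lambda>x. w n x - u x)" for n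
    using P_add[OF Xu Xv[of n]] by simp
  ultimately show ?thesis by simp
qed

lemma wconv_le: "A u \<le> C" "P u \<le> C"
proof -
  have d: "x - y \<le> C" if "x \<le> C" "0 \<le> y" for x y using that by simp
  show "A u \<le> C" by (rule LIMSEQ_le_const2[OF wconv_A]) (use d[OF wconvD(2)[OF wc] AP_nonneg(1)] in blast)
  show "P u \<le> C" by (rule LIMSEQ_le_const2[OF wconv_P]) (use d[OF wconvD(3)[OF wc] AP_nonneg(2)] in blast)
qed

lemma wconv_bound: "A (\<lambda>x. w n x - u x) \<le> 4 * C"
  using wconvD(7)[OF wc, of n] wconv_le by argo

lemma wconv_weighted:
  assumes "g \<in> mble" "integrable lborel (\<lambda>x. \<bar>g x\<bar> powr (3/2))"
  shows "(\<lambda>n. LBINT x. \<bar>g x\<bar> * (w n x - u x)\<^sup>2) \<longlonglongrightarrow> 0"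
proof (rule weighted_convergence[OF assms, where v="\<lambda>n x. w n x - u x" and K="4096 * (4 * C) ^ 3"])
  note Wv = XD(1)[OF wconvD(6)[OF wc]]
  show "sq (\<lambda>x. w n x - u x)" "integrable lborel (\<lambda>x. (w n x - u x) ^ 6)" for n
    by (rule XD(3)[OF wconvD(6)[OF wc]] Sobolev(1)[OF Wv])+
  show "(LBINT x. (w n x - u x) ^ 6) \<le> 4096 * (4 * C) ^ 3" for n
    by (rule order_trans[OF Sobolev(2)[OF Wv]]) (intro mult_left_mono power_mono wconv_bound[unfolded A_def] nsq_nonneg, simp)
  show "(\<lambda>n. nsq_on R (\<lambda>x. (w n x - u x))) \<longlonglongrightarrow> 0" for R by (rule wconvD(5)[OF wc])
qed

lemma wconv_S: "(\<lambda>n. S (\<lambda>x. w n x - u x)) \<longlonglongrightarrow> 0"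
  unfolding S_def by (rule wconv_weighted[OF well_weight])

text \<open>In contrast to the term with \<open>Q\<close>, nothing is lost at infinity, since the
  weight \<open>f\<close> is in L^(3/2).\<close>

lemma wconv_F: "(\<lambda>n. F (w n)) \<longlonglongrightarrow> F u"
proof -
  note Xv = wconvD(6)[OF wc] and Xu = wconvD(4)[OF wc]
  define d where "d n = (LBINT x. \<bar>f x\<bar> * (w n x - u x)\<^sup>2)" for n
  let ?k = "sqrt (nsq (\<lambda>x. sqrt \<bar>f x\<bar> * u x))"
  have d: "d \<longlonglongrightarrow> 0" unfolding d_def by (rule wconv_weighted[OF f])
  have "(\<lambda>n. F (w n) - F u) \<longlonglongrightarrow> 0"
  proof (rule null_comparison)
    have "(\<lambda>n. 2 * (?k * sqrt (d n)) + d n) \<longlonglongrightarrow> 2 * (?k * sqrt 0) + 0" by (intro tendsto_intros d)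
    thus "(\<lambda>n. 2 * (?k * sqrt (d n)) + d n) \<longlonglongrightarrow> 0" by simp
    fix n
    let ?b = "\<integral>x. f x * u x * (w n x - u x) \<partial>lborel"
    have 1: "F (w n) = F u + 2 * ?b + F (\<lambda>x. w n x - u x)" using F_add[OF Xu Xv[of n]] by simp
    have 2: "\<bar>?b\<bar> \<le> ?k * sqrt (d n)"
      using weight_bilinear(2)[OF f XD(1)[OF Xu] XD(1)[OF Xv[of n]]] unfolding sqrt_weight(2)[OF f XD(1)[OF Xv[of n]]] d_def .
    have "\<bar>F (\<lambda>x. w n x - u x)\<bar> \<le> d n" unfolding d_def by (rule F_abs_le[OF Xv])
    moreover have "\<bar>s + 2 * b + e - s\<bar> \<le> 2 * k + d" if "\<bar>b\<bar> \<le> k" "\<bar>e\<bar> \<le> d" for s b e k d :: real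
      using that by arith
    ultimately show "\<bar>F (w n) - F u\<bar> \<le> 2 * (?k * sqrt (d n)) + d n" unfolding 1 using 2 by blast
  qed
  from tendsto_add[OF this tendsto_const[of "F u"]] show ?thesis by simp
qed

text \<open>\<open>Q\<close> is only bounded, so the mass of the remainder at infinity is kept as an
  explicit error. The cross term has a weight in L^(3/2) and tends to 0.\<close>

lemma wconv_B: "\<exists>e. e \<longlonglongrightarrow> 0 \<and> (\<forall>n. \<bar>B (w n) - B u\<bar> \<le> e n + KB * (LBINT x. \<bar>w n x - u x\<bar> powr p))"
proof -
  note Xv = wconvD(6)[OF wc] and Xu = wconvD(4)[OF wc]
  define e where "e n = KB * (LBINT x. \<bar>u x\<bar> powr (p - 1) * \<bar>w n x - u x\<bar>)" for n
  define d where "d n = (LBINT x. \<bar>\<bar>u x\<bar> powr (p - 2)\<bar> * (w n x - u x)\<^sup>2)" for n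
  let ?k = "sqrt (LBINT x. \<bar>u x\<bar> powr p)"
  note ct = cross_term[OF XD(1)[OF Xu] XD(1)[OF Xv] p]
  have d: "d \<longlonglongrightarrow> 0" unfolding d_def by (rule wconv_weighted[OF ct(4,3)])
  have "e \<longlonglongrightarrow> 0"
  proof (rule null_comparison_nonneg)
    have "(\<lambda>n. KB * (?k * sqrt (d n))) \<longlonglongrightarrow> KB * (?k * sqrt 0)" by (intro tendsto_intros d)
    thus "(\<lambda>n. KB * (?k * sqrt (d n))) \<longlonglongrightarrow> 0" by simp
    show "0 \<le> e n" for n unfolding e_def by (intro mult_nonneg_nonneg KB_nonneg integral_nonneg) auto
    show "e n \<le> KB * (?k * sqrt (d n))" for n
      unfolding e_def d_def by (intro mult_left_mono KB_nonneg ct(2))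
  qed
  moreover have "\<bar>B (w n) - B u\<bar> \<le> e n + KB * (LBINT x. \<bar>w n x - u x\<bar> powr p)" for n
    using B_diff[OF Xu Xv[of n]] by (simp add: e_def distrib_left)
  ultimately show ?thesis by blast
qed

end

end

section \<open>The Nehari manifold\<close>

text \<open>\<open>T\<close> is a zero of \<open>k\<close>, the derivative of the fibering map
  divided by \<open>t\<close>. After elimination of \<open>E\<close>, the value at 1 minus the value
  at \<open>T\<close> is \<open>S * (T\<^sup>2 - 1)\<^sup>2 / 4\<close> plus \<open>- B / 2\<close>
  times the gap in a Young inequality.\<close>

lemma fiber_minimum:
  fixes S E B p :: real
  assumes S: "S > 0" and E: "E < 0" and B: "B < 0" and p: "2 < p"
  shows "\<exists>T>0. S * T\<^sup>2 + E = B * T powr (p - 2) \<and>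
    S * T ^ 4 / 4 + E * T\<^sup>2 / 2 - B * T powr p / p \<le> S / 4 + E / 2 - B / p"
proof -
  define k where "k t = S * t\<^sup>2 + E - B * t powr (p - 2)" for t
  \<comment> \<open>Here the quadratic part of \<open>k\<close> vanishes, and \<open>B < 0\<close>
    makes \<open>k T1\<close> nonnegative.\<close>
  define T1 where "T1 = sqrt (- E / S)"
  have "- E / S > 0" using S E by (intro divide_pos_pos) auto
  hence T1: "T1 > 0" "T1\<^sup>2 = - E / S" unfolding T1_def by (simp_all only: real_sqrt_gt_0_iff real_sqrt_pow2 less_imp_le)
  have k0: "k 0 < 0" using E p by (simp add: k_def)
  have k1: "0 \<le> k T1" using S B by (simp add: k_def T1(2) mult_nonpos_nonneg)
  have "continuous_on {0..T1} k" unfolding k_def using p by (intro continuous_intros continuous_on_powr') auto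
  then obtain T where T: "0 \<le> T" "T \<le> T1" "k T = 0" using IVT'[of k 0 0 T1] k0 k1 T1(1) by auto
  have T0: "T > 0" using T k0 by (cases "T = 0") auto
  have kT: "S * T\<^sup>2 + E = B * T powr (p - 2)" using T(3) by (simp add: k_def)
  define q where "q = p / (p - 2)"
  \<comment> \<open>Young's inequality with the exponents \<open>p / 2\<close> and
    \<open>p / (p - 2)\<close>, the first factor being 1.\<close>
  have "1 * T powr (p - 2) \<le> 1 powr (p/2) / (p/2) + (T powr (p - 2)) powr q / q"
    using p by (intro Youngs_inequality) (auto simp: q_def field_simps)
  moreover have "(T powr (p - 2)) powr q = T powr p" using p by (simp add: powr_powr q_def)
  ultimately have y: "T powr (p - 2) \<le> 2 / p + T powr p - 2 * (T powr p / p)"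
    using p by (simp add: q_def diff_divide_distrib right_diff_distrib mult.commute)
  have t2: "T powr p = T powr (p - 2) * T\<^sup>2"
    using powr_add[of T "p - 2" 2] T0 by (simp add: powr_numeral)
  have "- B * (T powr (p - 2)) \<le> - B * (2 / p + T powr p - 2 * (T powr p / p))" using B by (intro mult_left_mono y) auto
  hence b: "- B * T powr (p - 2) \<le> 2 * (- B / p) - B * T powr p + 2 * (B * T powr p / p)" by (simp add: algebra_simps)
  have e: "E = B * T powr (p - 2) - S * T\<^sup>2" using kT by simp
  have e2: "E * T\<^sup>2 = B * T powr p - S * T ^ 4" unfolding e t2 by (simp add: algebra_simps power2_eq_square power4_eq_xxxx)
  have "0 \<le> S * (T\<^sup>2 - 1)\<^sup>2" using S by simp
  also have "S * (T\<^sup>2 - 1)\<^sup>2 = S * T ^ 4 - 2 * (S * T\<^sup>2) + S" by (simp add: power2_eq_square power4_eq_xxxx algebra_simps)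
  finally have s: "0 \<le> S * T ^ 4 - 2 * (S * T\<^sup>2) + S" .
  have "S * T ^ 4 / 4 + E * T\<^sup>2 / 2 - B * T powr p / p \<le> S / 4 + E / 2 - B / p"
  proof -
    have "s4 / 4 + et / 2 - bp \<le> s / 4 + e / 2 - bb"
      if "- bt \<le> 2 * (- bb) - bT + 2 * bp" "e = bt - s2" "et = bT - s4" "0 \<le> s4 - 2 * s2 + s" for s4 et bp s e bb bt bT s2 :: real
      using that by argo
    from this[OF _ e e2 s] show ?thesis using b by (simp only: minus_mult_left minus_divide_left)
  qed
  thus ?thesis using T0 kT by blast
qed

lemma test_fun_off: assumes "test_fun U \<psi>" "x \<notin> U" shows "\<psi> x = 0" "grad \<psi> x = 0"
proof -
  have *: "\<psi> x = 0" if "test_fun U \<psi>" for \<psi>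
    using that assms(2) closure_subset[of "{x. \<psi> x \<noteq> 0}"] by (auto simp: test_fun_def)
  show "\<psi> x = 0" by (rule *[OF assms(1)])
  show "grad \<psi> x = 0" using *[OF test_fun_pd[OF assms(1)]] by (simp add: grad_def vec_eq_iff)
qed

lemma tapprox_off:
  assumes T: "tapprox U u G" and s: "sq u" "sq G"
  shows "AE x in lborel. x \<notin> U \<longrightarrow> u x = 0 \<and> G x = 0"
proof -
  obtain \<psi> where t: "\<And>n. test_fun U (\<psi> n)" and
    l: "AE x in lborel. (\<lambda>n. \<psi> n x) \<longlonglongrightarrow> u x" "AE x in lborel. (\<lambda>n. grad (\<psi> n) x) \<longlonglongrightarrow> G x"
    using tapprox_seq_AE[OF T s] by blast
  show ?thesis using l
  proof eventually_elim
    case (elim x)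
    show ?case
    proof
      assume "x \<notin> U"
      from elim[unfolded test_fun_off[OF t this]] show "u x = 0 \<and> G x = 0" by (simp add: LIMSEQ_const_iff)
    qed
  qed
qed

context steep_well
begin

lemma E_add: assumes "X u" "X v"
  shows "E \<mu> lam (\<lambda>x. u x + v x) = E \<mu> lam u + 2 * ((LBINT x. wgrad u x \<bullet> wgrad v x)
    + \<mu> * (LBINT x. (sqrt (V x) * v x) * (sqrt (V x) * u x)) - lam * (LBINT x. f x * u x * v x)) + E \<mu> lam v"
  unfolding E_def A_add[OF assms] P_add[OF assms] F_add[OF assms] by (simp add: algebra_simps)

lemma A_zero_iff: assumes "X u" shows "A u = 0 \<longleftrightarrow> (AE x in lborel. u x = 0)"
proof
  show "AE x in lborel. u x = 0" if "A u = 0" using zero_grad_zero[OF XD(1)[OF assms]] that by (simp add: A_def)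
  assume "AE x in lborel. u x = 0"
  hence "AE x in lborel. 0 = u x" by eventually_elim simp
  from W12_cong_AE[OF W12_zero this _ XD(5)[OF assms], of "\<lambda>x. 0"] have "W12 u (\<lambda>x. 0)" by simp
  thus "A u = 0" by (simp add: A_W12)
qed

lemma J_eq: assumes "X u"
  shows "Jfun a p V f Q \<mu> lam u = a * (A u)\<^sup>2 / 4 + E \<mu> lam u / 2 - B u / p"
proof -
  note i = sq_int[OF XD(4)[OF assms]] sq_int[OF XD(2)[OF assms], unfolded sqrt_V]
  have "(LBINT x. (norm (wgrad u x))\<^sup>2 + \<mu> * V x * (u x)\<^sup>2) = A u + \<mu> * P u"
    using i unfolding P_eq A_def nsq_def mult.assoc by simp
  thus ?thesis unfolding Jfun_def E_def by (simp add: A_def nsq_def B_def F_def algebra_simps diff_divide_distrib add_divide_distrib)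
qed

section \<open>The fibering map and the positive part of the Nehari manifold\<close>

lemma fib_eq: assumes "X u" "t > 0"
  shows "fib a p V f Q \<mu> lam u t = a * (A u)\<^sup>2 * t ^ 4 / 4 + E \<mu> lam u * t\<^sup>2 / 2 - B u * t powr p / p"
  unfolding fib_def J_eq[OF X_scale[OF assms(1)]] scale[OF assms(1)] using assms(2)
  by (simp add: power_mult_distrib mult_ac flip: power_mult)

lemma deriv_fib: assumes "X u" "t > 0"
  shows "deriv (fib a p V f Q \<mu> lam u) t = a * (A u)\<^sup>2 * t ^ 3 + E \<mu> lam u * t - B u * t powr (p - 1)"
proof -
  have "deriv (fib a p V f Q \<mu> lam u) t = deriv (\<lambda>t. a * (A u)\<^sup>2 * t ^ 4 / 4 + E \<mu> lam u * t\<^sup>2 / 2 - B u * t powr p / p) t"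
    using eventually_nhds_in_open[of "{0<..}" t] assms(2)
    by (intro deriv_cong_ev) (auto elim!: eventually_mono simp: fib_eq[OF assms(1)])
  also have "\<dots> = a * (A u)\<^sup>2 * t ^ 3 + E \<mu> lam u * t - B u * t powr (p - 1)"
    using assms(2) p by (intro DERIV_imp_deriv) (auto intro!: derivative_eq_intros simp: power2_eq_square)
  finally show ?thesis .
qed

lemma deriv2_fib: assumes "X u"
  shows "deriv (deriv (fib a p V f Q \<mu> lam u)) 1 = 3 * (a * (A u)\<^sup>2) + E \<mu> lam u - (p - 1) * B u"
proof -
  have "deriv (deriv (fib a p V f Q \<mu> lam u)) 1 = deriv (\<lambda>t. a * (A u)\<^sup>2 * t ^ 3 + E \<mu> lam u * t - B u * t powr (p - 1)) 1"
    using eventually_nhds_in_open[of "{0<..}" "1::real"]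
    by (intro deriv_cong_ev) (auto elim!: eventually_mono simp: deriv_fib[OF assms])
  also have "\<dots> = 3 * (a * (A u)\<^sup>2) + E \<mu> lam u - (p - 1) * B u"
    using p by (intro DERIV_imp_deriv) (auto intro!: derivative_eq_intros)
  finally show ?thesis .
qed

definition "N \<mu> lam = Nehari_plus a p V f Q \<mu> lam"
definition "J \<mu> lam = Jfun a p V f Q \<mu> lam"

lemma N_iff: "u \<in> N \<mu> lam \<longleftrightarrow> X u \<and> A u > 0 \<and> a * (A u)\<^sup>2 + E \<mu> lam u = B u \<and> 3 * (a * (A u)\<^sup>2) + E \<mu> lam u - (p - 1) * B u > 0"
proof (cases "X u")
  case True
  have "A u > 0 \<longleftrightarrow> \<not> (AE x in lborel. u x = 0)" using A_zero_iff[OF True] AP_nonneg(1)[of u] by linarith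
  thus ?thesis using True unfolding N_def Nehari_plus_def Nehari_def mem_Collect_eq X_Xsp deriv2_fib[OF True] deriv_fib[OF True zero_less_one]
    by auto
qed (auto simp: N_def Nehari_plus_def Nehari_def X_Xsp)

text \<open>At the rescaled function the second derivative condition is automatic: with S the
  quartic term and S + E = B it reads 2 S - (p - 2) B > 0, and B is negative.\<close>

lemma fiber:
  assumes u: "X u" "A u > 0" "E \<mu> lam u < 0" "B u < 0"
  shows "\<exists>t. (\<lambda>x. t * u x) \<in> N \<mu> lam \<and> J \<mu> lam (\<lambda>x. t * u x) \<le> J \<mu> lam u"
proof -
  have S: "a * (A u)\<^sup>2 > 0" using a u(2) by simp
  obtain T where T: "T > 0" "a * (A u)\<^sup>2 * T\<^sup>2 + E \<mu> lam u = B u * T powr (p - 2)"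
    "a * (A u)\<^sup>2 * T ^ 4 / 4 + E \<mu> lam u * T\<^sup>2 / 2 - B u * T powr p / p \<le> a * (A u)\<^sup>2 / 4 + E \<mu> lam u / 2 - B u / p"
    using fiber_minimum[OF S u(3,4), of p] p by auto
  have t2: "T powr p = T powr (p - 2) * T\<^sup>2"
    using powr_add[of T "p - 2" 2] T(1) by (simp add: powr_numeral)
  have n: "a * (T\<^sup>2 * A u)\<^sup>2 + T\<^sup>2 * E \<mu> lam u = T powr p * B u"
    using arg_cong[OF T(2), of "\<lambda>x. T\<^sup>2 * x"] unfolding t2 by (simp add: algebra_simps power_mult_distrib)
  have "3 * s + e - (p - 1) * b > 0" if "s + e = b" "s > 0" "b < 0" for s e b :: real
  proof -
    have "(p - 2) * b < 0" using p that by (simp add: mult_pos_neg)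
    moreover have "3 * s + e - (p - 1) * b = 2 * s - (p - 2) * b" using that(1) by (simp add: algebra_simps)
    ultimately show ?thesis using that(2) by linarith
  qed
  from this[OF n] have "3 * (a * (T\<^sup>2 * A u)\<^sup>2) + T\<^sup>2 * E \<mu> lam u - (p - 1) * (T powr p * B u) > 0"
    using T(1) a u by (simp add: mult_pos_neg)
  hence "(\<lambda>x. T * u x) \<in> N \<mu> lam"
    unfolding N_iff scale[OF u(1)] using n T(1) u(2) X_scale[OF u(1)] by simp
  moreover have "J \<mu> lam (\<lambda>x. T * u x) \<le> J \<mu> lam u"
    using T(3) fib_eq[OF u(1) T(1)] by (simp add: J_def fib_def J_eq[OF u(1)])
  ultimately show ?thesis by blast
qed

text \<open>None of the bounds involves \<open>\<mu>\<close>, because \<open>\<mu> \<ge> 1\<close>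
  enters only through \<open>P u \<le> \<mu> * P u\<close>.\<close>

lemma N_estimates:
  assumes u: "u \<in> N \<mu> lam" and mu: "\<mu> \<ge> 1" and lam: "lam > 0"
  shows "E \<mu> lam u < 0" "J \<mu> lam u < 0" "A u \<le> lam * Kf * (p - 2) / (a * (p - 4))"
    "A u + P u \<le> lam * Kf * A u" "J \<mu> lam u \<ge> - (lam * Kf * A u)"
proof -
  note N = u[unfolded N_iff]
  define S where "S = a * (A u)\<^sup>2"
  have S: "S > 0" using a N by (simp add: S_def)
  have B: "B u = S + E \<mu> lam u" using N by (simp add: S_def)
  \<comment> \<open>The second derivative condition after elimination of \<open>B u\<close>. As
    \<open>p > 4\<close> it forces \<open>E \<mu> lam u < 0\<close>; together with a lower bound of
    \<open>E\<close> that is linear in \<open>A u\<close> it bounds \<open>A u\<close>.\<close>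
  have b: "(p - 4) * S + (p - 2) * E \<mu> lam u < 0" using N unfolding B S_def[symmetric] by (simp add: algebra_simps)
  moreover have s4: "(p - 4) * S > 0" using S p by simp
  ultimately have "(p - 2) * E \<mu> lam u < 0" by linarith
  thus E0: "E \<mu> lam u < 0" using p by (simp add: mult_less_0_iff)
  have lF: "lam * F u \<le> lam * Kf * A u" using F_bound[of u] N lam by (simp add: mult.assoc abs_le_iff)
  have muP: "P u \<le> \<mu> * P u" using mu mult_right_mono[OF mu AP_nonneg(2)[of u]] by simp
  have E1: "E \<mu> lam u \<ge> A u + P u - lam * Kf * A u" using lF muP by (simp add: E_def)
  thus "A u + P u \<le> lam * Kf * A u" using E0 by linarith
  have J: "J \<mu> lam u = S / 4 + E \<mu> lam u / 2 - (S + E \<mu> lam u) / p"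
    using N unfolding J_def by (simp add: J_eq S_def)
  hence J1: "4 * p * J \<mu> lam u = (p - 4) * S + 2 * ((p - 2) * E \<mu> lam u)" using p by (simp add: field_simps)
  hence "4 * p * J \<mu> lam u < 0" using b s4 by linarith
  thus "J \<mu> lam u < 0" using p by (simp add: mult_less_0_iff)
  have E2: "- E \<mu> lam u \<le> lam * Kf * A u" using E1 AP_nonneg[of u] by linarith
  have "(p - 4) * a * (A u * A u) \<le> (p - 2) * (lam * Kf * A u)"
  proof -
    have "(p - 2) * - E \<mu> lam u \<le> (p - 2) * (lam * Kf * A u)" using p by (intro mult_left_mono E2) auto
    thus ?thesis using b by (simp add: S_def power2_eq_square mult_ac)
  qed
  hence "(p - 4) * a * A u \<le> (p - 2) * (lam * Kf)" using N by (simp add: mult.assoc[symmetric])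
  thus "A u \<le> lam * Kf * (p - 2) / (a * (p - 4))" using a p by (simp add: pos_le_divide_eq mult_ac)
  have "4 * p * J \<mu> lam u \<ge> - (4 * p * (lam * Kf * A u))"
  proof -
    have "(2 * (p - 2)) * - E \<mu> lam u \<le> (4 * p) * (lam * Kf * A u)"
      using p E0 E2 by (intro mult_mono) auto
    thus ?thesis using J1 s4 by (simp add: algebra_simps)
  qed
  thus "J \<mu> lam u \<ge> - (lam * Kf * A u)" using p
    by (metis mult_le_cancel_left_pos mult_minus_right mult_pos_pos zero_less_numeral order_less_trans)
qed

text \<open>The possible loss of mass at infinity in the term of order p is absorbed by the potential, once
  the well is steep enough.\<close>
lemma minimiser:
  assumes lam: "lam > 0" and mu0: "\<mu>0 > 0"
    and regime: "\<And>\<mu> u. \<mu> > \<mu>0 \<Longrightarrow> X u \<Longrightarrow> A u > 0 \<Longrightarrow> E \<mu> lam u \<le> 0 \<Longrightarrow> B u < 0"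
    and ne: "\<And>\<mu>. \<mu> > \<mu>0 \<Longrightarrow> N \<mu> lam \<noteq> {}"
  shows "\<exists>\<mu>s>0. \<forall>\<mu>>\<mu>s. \<exists>u0\<in>N \<mu> lam. \<forall>u\<in>N \<mu> lam. J \<mu> lam u0 \<le> J \<mu> lam u"
proof -
  \<comment> \<open>\<open>C1\<close> bounds the Dirichlet integral on \<open>N \<mu> lam\<close>,
    and \<open>C\<close> also the potential energy, both uniformly in \<open>\<mu>\<close>.\<close>
  define C1 where "C1 = lam * Kf * (p - 2) / (a * (p - 4))"
  define C where "C = C1 + lam * Kf * C1"
  have lK: "lam * Kf > 0" using lam Kf_pos by simp
  have C10: "C1 > 0" using lK p a by (simp add: C1_def)
  have C0: "C \<ge> 0" using mult_pos_pos[OF lK C10] C10 by (simp add: C_def)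
  define D where "D = KB / p"
  have D0: "D \<ge> 0" using KB_nonneg p by (simp add: D_def)
  \<comment> \<open>Coefficient of the sixth power term once the cube of a Dirichlet integral of
    size at most \<open>4 * C\<close> is replaced by \<open>16 * C\<^sup>2\<close> times its first
    power.\<close>
  define Y where "Y = D * 4096 * (16 * C\<^sup>2)"
  have Y0: "Y \<ge> 0" using D0 by (simp add: Y_def)
  \<comment> \<open>Chosen so that \<open>R powr (p - 6) * Y \<le> 1/2\<close>, which half of the
    Dirichlet integral absorbs; \<open>p < 6\<close> makes this possible.\<close>
  define R where "R = (1 + 2 * Y) powr (1 / (6 - p))"
  have R0: "R > 0" using Y0 by (simp add: R_def)
  have "1 / (6 - p) * (p - 6) = - 1" using p by (simp add: field_simps)
  hence "R powr (p - 6) = (1 + 2 * Y) powr (- 1)" unfolding R_def powr_powr by (simp only:)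
  also have "\<dots> = inverse (1 + 2 * Y)" using Y0 by (simp add: powr_minus)
  finally have Rp: "R powr (p - 6) = inverse (1 + 2 * Y)" .
  have YR: "R powr (p - 6) * Y \<le> 1/2" unfolding Rp using Y0 by (simp add: field_simps)
  define K2 where "K2 = D * R powr (p - 2)"
  have K20: "K2 \<ge> 0" using D0 by (simp add: K2_def)
  \<comment> \<open>The last summand ensures \<open>K2 / c \<le> \<mu> / 2\<close>, so half of the
    potential energy absorbs the L^2 mass outside the sublevel set.\<close>
  define \<mu>s where "\<mu>s = \<mu>0 + 1 + 2 * (K2 / c)"
  have "0 \<le> 2 * (K2 / c)" using K20 c(1) by simp
  hence mus: "\<mu>s > \<mu>0" "\<mu>s \<ge> 1" "\<mu>s \<ge> 2 * (K2 / c)" using mu0 unfolding \<mu>s_def by linarith+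
  have "\<exists>u0\<in>N \<mu> lam. \<forall>u\<in>N \<mu> lam. J \<mu> lam u0 \<le> J \<mu> lam u" if mu: "\<mu> > \<mu>s" for \<mu>
  proof -
    have mu1: "\<mu> \<ge> 1" "\<mu> > \<mu>0" "K2 / c \<le> \<mu> / 2" using mus mu by linarith+
    note est = N_estimates[OF _ mu1(1) lam]
    have NA: "A u \<le> C1" if "u \<in> N \<mu> lam" for u using est(3)[OF that] by (simp add: C1_def)
    have lKA: "lam * Kf * A u \<le> lam * Kf * C1" if "u \<in> N \<mu> lam" for u
      using NA[OF that] lK by (intro mult_left_mono) auto
    have NC: "A u \<le> C" "P u \<le> C" if "u \<in> N \<mu> lam" for u
    proof -
      have "0 \<le> lam * Kf * C1" using lK C10 by simp
      thus "A u \<le> C" "P u \<le> C" using NA[OF that] lKA[OF that] est(4)[OF that] AP_nonneg[of u] C10 unfolding C_def by linarith+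
    qed
    define m where "m = Inf (J \<mu> lam ` N \<mu> lam)"
    have bdd: "bdd_below (J \<mu> lam ` N \<mu> lam)"
      by (rule bdd_belowI2[where m="- (lam * Kf * C1)"]) (use est(5) lKA in force)
    have lower: "m \<le> J \<mu> lam u" if "u \<in> N \<mu> lam" for u
      unfolding m_def using bdd that by (intro cInf_lower) auto
    have "\<exists>u\<in>N \<mu> lam. J \<mu> lam u < m + inverse (real (Suc n))" for n
      using cInf_lessD[of "J \<mu> lam ` N \<mu> lam" "m + inverse (real (Suc n))"] ne[OF mu1(2)] by (auto simp: m_def)
    then obtain w where w: "\<And>n. w n \<in> N \<mu> lam" "\<And>n. J \<mu> lam (w n) < m + inverse (real (Suc n))" by metis
    obtain r u where r: "strict_mono (r :: nat \<Rightarrow> nat)" and wc: "wconv C (\<lambda>n. w (r n)) u"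
      using compactness[of w C] w(1) NC N_iff by blast
    note Xv = wconvD(6)[OF wc] and Xu = wconvD(4)[OF wc]
    let ?v = "\<lambda>n x. w (r n) x - u x"
    have m0: "m < 0" using lower[OF w(1)[of 0]] est(2)[OF w(1)[of 0]] by linarith
    have Jm: "(\<lambda>n. J \<mu> lam (w (r n))) \<longlonglongrightarrow> m"
    proof (rule tendsto_sandwich[of "\<lambda>n. m" _ _ "\<lambda>n. m + inverse (real (Suc n))"])
      show "(\<lambda>n. m + inverse (real (Suc n))) \<longlonglongrightarrow> m" using LIMSEQ_inverse_real_of_nat_add .
      have "inverse (real (Suc (r n))) \<le> inverse (real (Suc n))" for n
        using seq_suble[OF r, of n] by (intro le_imp_inverse_le) auto
      thus "\<forall>\<^sub>F n in sequentially. J \<mu> lam (w (r n)) \<le> m + inverse (real (Suc n))"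
        using w(2) by (intro always_eventually allI) (meson add_left_mono less_imp_le order_trans)
    qed (use lower w(1) in auto)
    define s t where "s n = A (w (r n)) - A (?v n)" and "t n = P (w (r n)) - P (?v n)" for n
    have st: "s \<longlonglongrightarrow> A u" "t \<longlonglongrightarrow> P u" unfolding s_def t_def by (rule wconv_A[OF wc] wconv_P[OF wc])+
    obtain e where e: "e \<longlonglongrightarrow> 0" "\<And>n. \<bar>B (w (r n)) - B u\<bar> \<le> e n + KB * (LBINT x. \<bar>?v n x\<bar> powr p)"
      using wconv_B[OF wc] by blast
    \<comment> \<open>A lower bound for the energies along the sequence, with limit
      \<open>J \<mu> lam u\<close>. The difference \<open>s n\<close> may be negative, so its square
      is comparable with that of \<open>A (w (r n))\<close> only after truncation at 0.\<close>
    define b where "b n = a * (max (s n) 0)\<^sup>2 / 4 + (s n + \<mu> * t n - lam * F (w (r n))) / 2 - B u / p - e n / p - K2 * S (?v n)" for n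
    have "b \<longlonglongrightarrow> a * (max (A u) 0)\<^sup>2 / 4 + (A u + \<mu> * P u - lam * F u) / 2 - B u / p - 0 / p - K2 * 0"
      unfolding b_def using p by (intro tendsto_intros st e wconv_F[OF wc] wconv_S[OF wc]) auto
    hence bl: "b \<longlonglongrightarrow> J \<mu> lam u" by (simp add: J_def J_eq[OF Xu] E_def)
    have bJ: "b n \<le> J \<mu> lam (w (r n))" for n
    proof -
      define I where "I = (LBINT x. \<bar>?v n x\<bar> powr p)"
      have A3: "A (?v n) ^ 3 \<le> 16 * C\<^sup>2 * A (?v n)"
      proof -
        have "A (?v n) * A (?v n) \<le> (4 * C) * (4 * C)" using wconv_bound[OF wc, of n] C0 by (intro mult_mono) auto
        hence "A (?v n) * A (?v n) * A (?v n) \<le> (4 * C) * (4 * C) * A (?v n)" by (intro mult_right_mono) auto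
        thus ?thesis by (simp add: power3_eq_cube power2_eq_square)
      qed
      have "I \<le> R powr (p - 2) * nsq (?v n) + R powr (p - 6) * (4096 * A (?v n) ^ 3)"
        unfolding I_def A_def using p by (intro W12_powr(2)[OF XD(1)[OF Xv] _ _ R0]) auto
      also have "\<dots> \<le> R powr (p - 2) * (S (?v n) + P (?v n) / c) + R powr (p - 6) * (4096 * (16 * C\<^sup>2 * A (?v n)))"
        by (intro add_mono mult_left_mono nsq_split[OF Xv] A3) auto
      finally have "D * I \<le> D * (R powr (p - 2) * (S (?v n) + P (?v n) / c) + R powr (p - 6) * (4096 * (16 * C\<^sup>2 * A (?v n))))"
        using D0 by (intro mult_left_mono)
      also have "\<dots> = K2 * S (?v n) + (K2 / c) * P (?v n) + (R powr (p - 6) * Y) * A (?v n)"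
        by (simp add: K2_def Y_def algebra_simps)
      also have "\<dots> \<le> K2 * S (?v n) + (\<mu> / 2) * P (?v n) + (1/2) * A (?v n)"
        by (intro add_mono mult_right_mono mu1(3) YR order_refl AP_nonneg)
      finally have DI: "D * I \<le> K2 * S (?v n) + (\<mu> / 2) * P (?v n) + (1/2) * A (?v n)" .
      have "B (w (r n)) / p \<le> (B u + e n + KB * I) / p"
        using e(2)[of n] p by (intro divide_right_mono) (auto simp: I_def abs_le_iff)
      hence Bn: "B (w (r n)) / p \<le> B u / p + e n / p + D * I" by (simp add: D_def add_divide_distrib)
      have "(max (s n) 0)\<^sup>2 \<le> (A (w (r n)))\<^sup>2" by (intro power_mono) (auto simp: s_def)
      hence An: "a * (max (s n) 0)\<^sup>2 / 4 \<le> a * (A (w (r n)))\<^sup>2 / 4" using a by simp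
      have Jw: "J \<mu> lam (w (r n)) = a * (A (w (r n)))\<^sup>2 / 4
          + ((s n + A (?v n)) + (\<mu> * t n + \<mu> * P (?v n)) - lam * F (w (r n))) / 2 - B (w (r n)) / p"
        by (simp add: J_def J_eq[OF wconvD(1)[OF wc]] E_def s_def t_def right_diff_distrib)
      have key: "a1 + (s + mt - l) / 2 - bu - en - ks \<le> a2 + ((s + av) + (mt + mp) - l) / 2 - bw"
        if "a1 \<le> a2" "bw \<le> bu + en + di" "di \<le> ks + mp / 2 + av / 2" for a1 a2 bw bu en di ks mp av s mt l :: real
        using that by argo
      show ?thesis unfolding b_def Jw by (rule key[OF An Bn]) (use DI in simp)
    qed
    have Jum: "J \<mu> lam u \<le> m" by (rule LIMSEQ_le[OF bl Jm]) (use bJ in blast)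
    \<comment> \<open>Dropping the energy of the remainder only lowers the quadratic form, so the
      limit inherits \<open>E \<le> 0\<close> from the sequence.\<close>
    have "(\<lambda>n. s n + \<mu> * t n - lam * F (w (r n))) \<longlonglongrightarrow> E \<mu> lam u"
      unfolding E_def by (intro tendsto_intros st wconv_F[OF wc])
    moreover have "s n + \<mu> * t n - lam * F (w (r n)) \<le> 0" for n
    proof -
      have "s n \<le> A (w (r n))" "\<mu> * t n \<le> \<mu> * P (w (r n))" using mu1(1) by (auto simp: s_def t_def intro!: mult_left_mono)
      thus ?thesis using est(1)[OF w(1)[of "r n"]] by (simp add: E_def)
    qed
    ultimately have E0: "E \<mu> lam u \<le> 0" by (intro LIMSEQ_le_const2) auto
    have Ju: "J \<mu> lam u = a * (A u)\<^sup>2 / 4 + E \<mu> lam u / 2 - B u / p" by (simp add: J_def J_eq[OF Xu])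
    have A0: "A u > 0"
    proof (rule ccontr)
      assume "\<not> A u > 0"
      hence z: "A u = 0" using AP_nonneg(1)[of u] by linarith
      hence "AE x in lborel. Q x * \<bar>u x\<bar> powr p = 0" using A_zero_iff[OF Xu] by (auto elim: eventually_mono)
      hence "B u = 0" unfolding B_def by (rule integral_eq_zero_AE)
      moreover have "F u = 0" using F_bound[OF Xu] z by simp
      ultimately have "J \<mu> lam u \<ge> 0" using mu1(1) unfolding Ju z by (simp add: E_def z)
      thus False using Jum m0 by linarith
    qed
    have B0: "B u < 0" by (rule regime[OF mu1(2) Xu A0 E0])
    \<comment> \<open>Otherwise \<open>J \<mu> lam u\<close> would be a sum of nonnegative terms,
      although it is at most \<open>m < 0\<close>.\<close>
    have "E \<mu> lam u \<noteq> 0"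
    proof
      assume "E \<mu> lam u = 0"
      moreover have "B u / p < 0" using B0 p by (simp add: divide_neg_pos)
      moreover have "a * (A u)\<^sup>2 / 4 \<ge> 0" using a by simp
      ultimately show False using Ju Jum m0 by linarith
    qed
    hence "E \<mu> lam u < 0" using E0 by simp
    from fiber[OF Xu A0 this B0] show ?thesis using Jum lower by (meson order_trans)
  qed
  thus ?thesis using mus(1) mu0 by (intro exI[of _ \<mu>s]) auto
qed

end

section \<open>Values near the principal eigenvalue\<close>

lemma H10_tapprox:
  assumes "\<phi> \<in> H10 U"
  shows "W12 \<phi> (wgrad \<phi>)" "tapprox U \<phi> (wgrad \<phi>)"
proof -
  obtain \<psi> where t: "\<And>n. test_fun U (\<psi> n)" and H: "\<phi> \<in> H1"
    and l: "(\<lambda>n. (LBINT x. (\<psi> n x - \<phi> x)\<^sup>2) + (LBINT x. (norm (grad (\<psi> n) x - wgrad \<phi> x))\<^sup>2)) \<longlonglongrightarrow> 0"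
    using assms by (auto simp: H10_def)
  show "W12 \<phi> (wgrad \<phi>)" using H W12_wgrad by (auto simp: H1_iff)
  have l': "(\<lambda>n. nsq (\<lambda>x. \<psi> n x - \<phi> x) + nsq (\<lambda>x. grad (\<psi> n) x - wgrad \<phi> x)) \<longlonglongrightarrow> 0"
    using l by (simp add: nsq_def)
  show "tapprox U \<phi> (wgrad \<phi>)"
    by (rule tapproxI_seq[of U \<psi>, OF t]; rule null_comparison_nonneg[OF l'], simp_all)
qed

locale bounded_well = steep_well +
  fixes U :: "R3 set" and l1 :: real and \<phi> :: "R3 \<Rightarrow> real"
  assumes U: "U = interior {x. V x = 0}" "smooth_bounded_domain U" "closure U = {x. V x = 0}"
    and eig: "principal_eigenpair U f l1 \<phi>" and neg: "(LINT x:U|lborel. Q x * (\<phi> x) powr p) < 0"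
begin

lemma mU [measurable]: "U \<in> sets lborel" "U \<in> sets borel"
  unfolding U(1) by simp_all

lemma U_open: "open U" and U_conn: "connected U" and U_ne: "U \<noteq> {}" and U_bdd: "bounded U"
  using U(2) by (auto simp: smooth_bounded_domain_def)

lemma region: "\<exists>\<rho>. smooth_region U \<rho>"
  using U(2) unfolding smooth_bounded_domain_def smooth_region_def by blast

lemma l1: "l1 > 0" using eig by (simp add: principal_eigenpair_def)

text \<open>Zero potential energy confines \<open>u\<close> to the zero set of \<open>V\<close>,
  which is the closure of \<open>U\<close>. The boundary is a null set, and its smoothness puts
  \<open>u\<close> into H^1_0.\<close>

lemma P_zero:
  assumes "X u" "P u = 0"
  shows "AE x in lborel. x \<notin> U \<longrightarrow> u x = 0" "tapprox U u (wgrad u)"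
proof -
  obtain \<rho> where "smooth_region U \<rho>" using region by blast
  then interpret smooth_region U \<rho> .
  have "AE x in lborel. sqrt (V x) * u x = 0"
    by (rule nsq_eq_0_AE[OF XD(2)[OF assms(1)]]) (use assms(2) in \<open>simp add: P_def\<close>)
  thus off: "AE x in lborel. x \<notin> U \<longrightarrow> u x = 0"
    using AE_boundary by eventually_elim (auto simp: U(3))
  show "tapprox U u (wgrad u)" by (rule zero_off_imp_tapprox[OF XD(1)[OF assms(1)] off])
qed

lemma W\<phi>: "W12 \<phi> (wgrad \<phi>)" and T\<phi>: "tapprox U \<phi> (wgrad \<phi>)"
  using eig H10_tapprox by (auto simp: principal_eigenpair_def)

lemma off\<phi>: "AE x in lborel. x \<notin> U \<longrightarrow> \<phi> x = 0 \<and> wgrad \<phi> x = 0"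
  by (rule tapprox_off[OF T\<phi> W12D(1,2)[OF W\<phi>]])

lemma pos\<phi>: "AE x in lborel. x \<in> U \<longrightarrow> \<phi> x > 0"
  using eig by (simp add: principal_eigenpair_def)

lemma nonneg\<phi>: "AE x in lborel. \<phi> x \<ge> 0"
  using off\<phi> pos\<phi> by eventually_elim force

sublocale eigen: weak_eigenfunction f U \<phi> "wgrad \<phi>" l1
  using f U_open W\<phi> nonneg\<phi> eig by unfold_locales (auto simp: principal_eigenpair_def)

lemma V\<phi>: "AE x in lborel. sqrt (V x) * \<phi> x = 0"
  using off\<phi>
proof eventually_elim
  case (elim x)
  have "x \<in> U \<Longrightarrow> V x = 0" using closure_subset[of U] U(3) by blast
  thus ?case using elim by (cases "x \<in> U") auto
qed

lemma m\<phi> [measurable]: "\<phi> \<in> mble"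
  using W12D(1)[OF W\<phi>] by (simp add: sq_def)

lemma X\<phi>: "X \<phi>"
  by (rule XI[OF W\<phi> sq_bound(1)[OF sq_zero(1)]]) (use V\<phi> in auto)

lemma P\<phi>: "P \<phi> = 0"
  using nsq_cong_AE[OF V\<phi>] sq_meas[OF XD(2)[OF X\<phi>]] by (simp add: P_def)

lemma F\<phi>: "F \<phi> = 1"
proof -
  have "(LINT x:U|lborel. f x * (\<phi> x)\<^sup>2) = F \<phi>"
    unfolding F_def set_lebesgue_integral_def 
  proof (rule integral_cong_AE)
    show "AE x in lborel. indicator U x *\<^sub>R (f x * (\<phi> x)\<^sup>2) = f x * (\<phi> x)\<^sup>2"
      using off\<phi> by eventually_elim (auto simp: indicator_def)
  qed measurable
  thus ?thesis using eig by (simp add: principal_eigenpair_def)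
qed

lemma A\<phi>: "A \<phi> = l1"
proof -
  have "A \<phi> = (LBINT x. wgrad \<phi> x \<bullet> wgrad \<phi> x)" by (simp only: A_def nsq_def power2_norm_eq_inner)
  also have "\<dots> = l1 * F \<phi>"
    unfolding eigen.eq_extend[OF T\<phi> W\<phi>] by (simp only: F_def power2_eq_square mult.assoc)
  finally show ?thesis by (simp add: F\<phi>)
qed

lemma B\<phi>: "B \<phi> < 0"
proof -
  have "(LINT x:U|lborel. Q x * (\<phi> x) powr p) = B \<phi>"
    unfolding B_def set_lebesgue_integral_def
  proof (rule integral_cong_AE)
    show "AE x in lborel. indicator U x *\<^sub>R (Q x * \<phi> x powr p) = Q x * \<bar>\<phi> x\<bar> powr p"
      using off\<phi> nonneg\<phi> by eventually_elim (auto simp: indicator_def)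
  qed measurable
  thus ?thesis using neg by simp
qed

text \<open>The Rayleigh bound and the hypotheses close the chain
  \<open>l1 * F u \<le> A u \<le> 1 \<le> l1 * F u\<close>. By simplicity \<open>u\<close> is then a
  nonzero multiple of \<open>\<phi>\<close>, and scaling does not change the sign of
  \<open>B\<close>.\<close>

lemma principal_direction:
  assumes u: "X u" "P u = 0" "A u \<le> 1" "1 \<le> l1 * F u"
  shows "A u = 1" "B u < 0"
proof -
  note z = P_zero[OF u(1,2)]
  note Wu = XD(1)[OF u(1)]
  have "l1 * F u \<le> A u" using eigen.Rayleigh(1)[OF pos\<phi> z(2) Wu z(1)] by (simp add: F_def A_def)
  hence eq: "A u = 1" "A u = l1 * F u" using u by linarith+
  thus "A u = 1" by simp
  have "AE x in lborel. x \<notin> U \<longrightarrow> \<phi> x = 0" using off\<phi> by eventually_elim blast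
  then obtain k where k: "AE x in lborel. u x = k * \<phi> x"
    using eigen.simple_eigenvalue[OF U_conn pos\<phi> _ z(2) Wu z(1)] eq(2) unfolding A_def F_def by blast
  have "F u = F (\<lambda>x. k * \<phi> x)" "B u = B (\<lambda>x. k * \<phi> x)"
    unfolding F_def B_def using k XD(5)[OF u(1)] by (intro integral_cong_AE; auto elim: eventually_mono)+
  hence FB: "F u = k\<^sup>2" "B u = \<bar>k\<bar> powr p * B \<phi>" using F\<phi> by (simp_all add: scale[OF X\<phi>])
  have "k \<noteq> 0" using FB(1) eq by auto
  thus "B u < 0" using FB(2) B\<phi> by (simp add: mult_pos_neg)
qed

text \<open>The argument is by contradiction, so \<open>\<delta>\<close> and \<open>\<mu>0\<close>
  are not explicit; \<open>\<mu>0\<close> serves all \<open>lam\<close> in the interval at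
  once.\<close>

lemma regime:
  "\<exists>\<delta>>0. \<exists>\<mu>0>0. \<forall>lam \<mu> u. l1 \<le> lam \<longrightarrow> lam < l1 + \<delta> \<longrightarrow> \<mu> > \<mu>0 \<longrightarrow> X u \<longrightarrow> A u > 0 \<longrightarrow> E \<mu> lam u \<le> 0 \<longrightarrow> B u < 0"
proof (rule ccontr)
  assume neg: "\<not> ?thesis"
  have "\<exists>lam \<mu> u. l1 \<le> lam \<and> lam < l1 + inverse (real (Suc n)) \<and> \<mu> > real (Suc n) \<and> X u \<and> A u > 0 \<and> E \<mu> lam u \<le> 0 \<and> 0 \<le> B u" for n
  proof -
    have "0 < inverse (real (Suc n))" "0 < real (Suc n)" by simp_all
    thus ?thesis using neg unfolding not_less[symmetric] by blast
  qed
  then obtain L m u0 where h: "\<And>n. l1 \<le> L n" "\<And>n. L n < l1 + inverse (real (Suc n))" "\<And>n. m n > real (Suc n)"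
    and u0: "\<And>n. X (u0 n)" "\<And>n. A (u0 n) > 0" "\<And>n. E (m n) (L n) (u0 n) \<le> 0" "\<And>n. 0 \<le> B (u0 n)" by metis
  \<comment> \<open>All conditions are invariant under scaling, so the Dirichlet integral may be
    normalised to 1.\<close>
  define w where "w n = (\<lambda>x. 1 / sqrt (A (u0 n)) * u0 n x)" for n
  have wX: "X (w n)" for n unfolding w_def by (rule X_scale[OF u0(1)])
  have w: "X (w n)" "A (w n) = 1" "E (m n) (L n) (w n) \<le> 0" "0 \<le> B (w n)" for n
    using u0(2)[of n] u0(3)[of n] u0(4)[of n] wX[of n] unfolding w_def scale[OF u0(1)]
    by (auto simp: power_divide divide_le_0_iff)
  define K where "K = (l1 + 1) * Kf"
  have K0: "K \<ge> 0" using l1 Kf_pos by (simp add: K_def)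
  have LF: "L n * F (w n) \<le> K" "1 + m n * P (w n) \<le> L n * F (w n)" for n
  proof -
    have "inverse (real (Suc n)) \<le> 1" by (simp add: inverse_le_1_iff)
    hence "L n \<le> l1 + 1" using h(2)[of n] by linarith
    have "L n * F (w n) \<le> L n * Kf"
      using h(1)[of n] l1 F_bound[OF w(1)[of n]] unfolding w(2) by (intro mult_left_mono) auto
    also have "\<dots> \<le> (l1 + 1) * Kf" using \<open>L n \<le> l1 + 1\<close> Kf_pos by (intro mult_right_mono) auto
    finally show "L n * F (w n) \<le> K" by (simp add: K_def)
    show "1 + m n * P (w n) \<le> L n * F (w n)" using w(2,3)[of n] by (simp add: E_def)
  qed
  \<comment> \<open>The term with \<open>f\<close> bounds \<open>m n * P (w n)\<close>, and
    \<open>m n\<close> exceeds \<open>n + 1\<close>, so no potential energy remains in the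
    limit.\<close>
  have Pw: "P (w n) \<le> K * inverse (real (Suc n))" for n
  proof -
    have "real (Suc n) * P (w n) \<le> m n * P (w n)" using h(3)[of n] by (intro mult_right_mono) auto
    hence "real (Suc n) * P (w n) \<le> K" using LF[of n] by linarith
    thus ?thesis by (simp add: field_simps)
  qed
  have Pl: "(\<lambda>n. P (w n)) \<longlonglongrightarrow> 0"
    by (rule null_comparison_nonneg[OF _ AP_nonneg(2) Pw]) (use tendsto_mult_left[OF LIMSEQ_inverse_real_of_nat, of K] in simp)
  have "K * inverse (real (Suc n)) \<le> K * 1" for n using K0 by (intro mult_left_mono) (auto simp: inverse_le_1_iff)
  hence Pc: "P (w n) \<le> max 1 K" for n using Pw[of n] by (simp add: le_max_iff_disj) (meson order_trans)
  have Ac: "A (w n) \<le> max 1 K" for n by (simp add: w(2))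
  obtain r u where r: "strict_mono (r :: nat \<Rightarrow> nat)" and wc: "wconv (max 1 K) (\<lambda>n. w (r n)) u"
    using compactness[of w, OF w(1) Ac Pc] by blast
  note Xv = wconvD(6)[OF wc] and Xu = wconvD(4)[OF wc]
  let ?v = "\<lambda>n x. w (r n) x - u x"
  note sub = LIMSEQ_subseq_LIMSEQ[OF _ r, unfolded o_def]
  have "P u \<le> 0" by (rule LIMSEQ_le[OF wconv_P[OF wc] sub[OF Pl]]) (auto intro: exI[of _ 0])
  hence Pu: "P u = 0" using AP_nonneg(2)[of u] by linarith
  have Au: "A u \<le> 1" by (rule LIMSEQ_le_const2[OF wconv_A[OF wc]]) (auto simp: w(2) intro: exI[of _ 0])
  have "(\<lambda>n. l1 + inverse (real (Suc n))) \<longlonglongrightarrow> l1" by (rule LIMSEQ_inverse_real_of_nat_add)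
  hence Ll: "L \<longlonglongrightarrow> l1"
    by (rule tendsto_sandwich[OF _ _ tendsto_const[of l1], rotated 2]) (use h(1,2) less_imp_le in \<open>auto intro!: always_eventually\<close>)
  have Fu: "1 \<le> l1 * F u"
  proof (rule LIMSEQ_le_const)
    show "(\<lambda>n. L (r n) * F (w (r n))) \<longlonglongrightarrow> l1 * F u" by (intro tendsto_mult sub[OF Ll] wconv_F[OF wc])
    have "1 \<le> L n * F (w n)" for n
    proof -
      have "m n > 0" using h(3)[of n] by simp
      hence "m n * P (w n) \<ge> 0" by simp
      thus ?thesis using LF(2)[of n] by linarith
    qed
    thus "\<exists>N. \<forall>n\<ge>N. 1 \<le> L (r n) * F (w (r n))" by blast
  qed
  note pd = principal_direction[OF Xu Pu Au Fu]
  \<comment> \<open>The limit already has the full Dirichlet integral 1, so none is left for the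
    remainder; convergence is strong and \<open>B\<close> passes to the limit.\<close>
  have Av: "(\<lambda>n. A (?v n)) \<longlonglongrightarrow> 0"
    using tendsto_diff[OF tendsto_const[of 1] wconv_A[OF wc]] by (simp add: w(2) pd(1))
  have Pv: "(\<lambda>n. P (?v n)) \<longlonglongrightarrow> 0"
    using tendsto_diff[OF sub[OF Pl] wconv_P[OF wc]] by (simp add: Pu)
  have Iv: "(\<lambda>n. LBINT x. \<bar>?v n x\<bar> powr p) \<longlonglongrightarrow> 0"
  proof (rule null_comparison_nonneg)
    have "(\<lambda>n. (S (?v n) + P (?v n) / c) + 4096 * A (?v n) ^ 3) \<longlonglongrightarrow> (0 + 0 / c) + 4096 * 0 ^ 3"
      using c(1) by (intro tendsto_intros wconv_S[OF wc] Pv Av) auto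
    thus "(\<lambda>n. (S (?v n) + P (?v n) / c) + 4096 * A (?v n) ^ 3) \<longlonglongrightarrow> 0" by simp
    show "0 \<le> (LBINT x. \<bar>?v n x\<bar> powr p)" for n by (rule Bochner_Integration.integral_nonneg) simp
    show "(LBINT x. \<bar>?v n x\<bar> powr p) \<le> (S (?v n) + P (?v n) / c) + 4096 * A (?v n) ^ 3" for n
    proof -
      have "(LBINT x. \<bar>?v n x\<bar> powr p) \<le> 1 powr (p - 2) * nsq (?v n) + 1 powr (p - 6) * (4096 * A (?v n) ^ 3)"
        unfolding A_def using p by (intro W12_powr(2)[OF XD(1)[OF Xv]]) auto
      hence "(LBINT x. \<bar>?v n x\<bar> powr p) \<le> nsq (?v n) + 4096 * A (?v n) ^ 3" by (simp only: powr_one_eq_one mult_1_left)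
      thus ?thesis using nsq_split[OF Xv[of n]] by linarith
    qed
  qed
  obtain e where e: "e \<longlonglongrightarrow> 0" "\<And>n. \<bar>B (w (r n)) - B u\<bar> \<le> e n + KB * (LBINT x. \<bar>?v n x\<bar> powr p)"
    using wconv_B[OF wc] by blast
  have "(\<lambda>n. e n + KB * (LBINT x. \<bar>?v n x\<bar> powr p)) \<longlonglongrightarrow> 0 + KB * 0"
    by (intro tendsto_intros e(1) Iv)
  hence "(\<lambda>n. e n + KB * (LBINT x. \<bar>?v n x\<bar> powr p)) \<longlonglongrightarrow> 0" by (simp only: mult_zero_right add_0)
  hence "(\<lambda>n. B (w (r n)) - B u) \<longlonglongrightarrow> 0" by (rule null_comparison[OF _ e(2)])
  from tendsto_add[OF this tendsto_const[of "B u"]] have "(\<lambda>n. B (w (r n))) \<longlonglongrightarrow> B u" by simp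
  hence "0 \<le> B u" by (rule LIMSEQ_le_const) (use w(4) in blast)
  thus False using pd(2) by simp
qed

lemma test_X: assumes t: "test_fun W \<psi>" shows "X \<psi>"
proof (rule XI[OF W12_test[OF t]])
  obtain R where R: "\<forall>x. x \<notin> ball 0 R \<longrightarrow> \<psi> x = 0" by (rule test_fun_ball[OF t]) blast
  have "continuous_on UNIV (\<lambda>x. sqrt (V x) * \<psi> x)"
    using V(2) C1c_D(4)[OF test_fun_C1c[OF t]] by (intro continuous_intros)
  moreover have "sqrt (V x) * \<psi> x = 0" if "x \<notin> cball 0 R" for x using R that by (auto simp: not_le)
  ultimately show "sq (\<lambda>x. sqrt (V x) * \<psi> x)"
    using cont_supp_bounded[of "\<lambda>x. sqrt (V x) * \<psi> x" R] bounded_supp_int(2) cont_meas by blast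
qed

text \<open>At the eigenvalue itself a negative direction exists because otherwise the eigenfunction,
  extended by zero, would solve the equation on the whole space.\<close>
lemma negative_direction:
  assumes lam: "l1 \<le> lam"
  shows "\<exists>v. X v \<and> E \<mu> lam v < 0"
proof (rule ccontr)
  assume "\<not> ?thesis"
  hence nn: "0 \<le> E \<mu> lam v" if "X v" for v using that not_less by blast
  have E\<phi>: "E \<mu> lam \<phi> = l1 - lam" by (simp add: E_def A\<phi> P\<phi> F\<phi>)
  hence ll: "lam = l1" using nn[OF X\<phi>] lam by simp
  have E0: "E \<mu> l1 \<phi> = 0" using E\<phi> ll by simp
  have "(LBINT x. wgrad \<phi> x \<bullet> grad \<psi> x) = l1 * (LBINT x. f x * \<phi> x * \<psi> x)" if t: "test_fun UNIV \<psi>" for \<psi>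
  proof -
    note Xp = test_X[OF t]
    define D where "D = (LBINT x. wgrad \<phi> x \<bullet> wgrad \<psi> x)
      + \<mu> * (LBINT x. (sqrt (V x) * \<psi> x) * (sqrt (V x) * \<phi> x)) - lam * (LBINT x. f x * \<phi> x * \<psi> x)"
    \<comment> \<open>\<open>E\<close> vanishes at its minimum \<open>\<phi>\<close>, so along a
      line through \<open>\<phi>\<close> it is a nonnegative quadratic polynomial without constant
      term, whose linear coefficient must be zero.\<close>
    have q: "0 \<le> s * (2 * D) + s\<^sup>2 * E \<mu> lam \<psi>" for s
    proof -
      have ws: "(LBINT x. wgrad \<phi> x \<bullet> wgrad (\<lambda>x. s * \<psi> x) x) = s * (LBINT x. wgrad \<phi> x \<bullet> wgrad \<psi> x)"
      proof -
        have "AE x in lborel. wgrad (\<lambda>x. s * \<psi> x) x = s *\<^sub>R wgrad \<psi> x"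
          by (rule W12_unique[OF XD(1)[OF X_scale[OF Xp]] W12_scale[OF XD(1)[OF Xp]]])
        hence "(LBINT x. wgrad \<phi> x \<bullet> wgrad (\<lambda>x. s * \<psi> x) x) = (LBINT x. s * (wgrad \<phi> x \<bullet> wgrad \<psi> x))"
          using sq_inner_int[OF XD(4)[OF X\<phi>] XD(4)[OF X_scale[OF Xp, of s]]] sq_inner_int[OF XD(4)[OF X\<phi>] XD(4)[OF Xp]]
          by (intro integral_cong_AE) (auto elim: eventually_mono)
        thus ?thesis by simp
      qed
      have "0 \<le> E \<mu> lam (\<lambda>x. \<phi> x + s * \<psi> x)" by (rule nn[OF X_add[OF X\<phi> X_scale[OF Xp]]])
      also have "\<dots> = s * (2 * D) + s\<^sup>2 * E \<mu> lam \<psi>"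
        unfolding E_add[OF X\<phi> X_scale[OF Xp]] ws scale(5)[OF Xp] ll E0 D_def mult.left_commute[of _ s] mult.assoc
        by (simp add: algebra_simps)
      finally show ?thesis .
    qed
    have "D = 0"
    proof (rule ccontr)
      assume "D \<noteq> 0"
      \<comment> \<open>Adding 1 makes the denominator positive even if
        \<open>E \<mu> lam \<psi>\<close> is 0; at \<open>s = - D / e\<close> the polynomial is then
        at most \<open>- (D * D / e)\<close>.\<close>
      define e where "e = E \<mu> lam \<psi> + 1"
      have e: "e > 0" using nn[OF Xp] by (simp add: e_def)
      have "0 \<le> (- D / e) * (2 * D) + (- D / e)\<^sup>2 * E \<mu> lam \<psi>" by (rule q)
      also have "\<dots> \<le> (- D / e) * (2 * D) + (- D / e)\<^sup>2 * e" by (intro add_left_mono mult_left_mono) (auto simp: e_def)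
      also have "\<dots> = - (D * D / e)" using e by (simp add: power2_eq_square field_simps)
      finally have "D * D / e \<le> 0" by simp
      moreover have "D * D / e > 0" using \<open>D \<noteq> 0\<close> e by (intro divide_pos_pos) (auto simp: zero_less_mult_iff)
      ultimately show False by simp
    qed
    \<comment> \<open>The mixed potential term vanishes whatever \<open>\<mu>\<close> is, since
      \<open>V\<close> is zero where \<open>\<phi>\<close> is not.\<close>
    moreover have "(LBINT x. (sqrt (V x) * \<psi> x) * (sqrt (V x) * \<phi> x)) = 0"
      by (rule integral_eq_zero_AE) (use V\<phi> in \<open>auto elim: eventually_mono\<close>)
    moreover have "(LBINT x. wgrad \<phi> x \<bullet> wgrad \<psi> x) = (LBINT x. wgrad \<phi> x \<bullet> grad \<psi> x)"
      using W12_unique[OF XD(1)[OF Xp] W12_test[OF t]] sq_inner_int[OF XD(4)[OF X\<phi>] XD(4)[OF Xp]] sq_inner_int[OF XD(4)[OF X\<phi>] test_sq(3)[OF t]]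
      by (intro integral_cong_AE) (auto elim: eventually_mono)
    ultimately show ?thesis by (simp add: D_def ll)
  qed
  \<comment> \<open>The equation now holds against test functions that cross the boundary of
    \<open>U\<close>.\<close>
  then interpret whole: weak_eigenfunction f UNIV \<phi> "wgrad \<phi>" l1
    using f W\<phi> nonneg\<phi> by unfold_locales auto
  show False by (rule whole.not_whole_space[OF refl U_open U_bdd U_ne pos\<phi> off\<phi>])
qed

text \<open>A negative direction has \<open>B < 0\<close> by \<open>regime\<close>, so
  \<open>fiber\<close> moves it into \<open>N \<mu> lam\<close>; nonemptiness is what the existence
  argument still needs.\<close>

theorem minimiser_near_eigenvalue:
  "\<exists>\<delta>>0. \<forall>lam. l1 \<le> lam \<and> lam < l1 + \<delta> \<longrightarrow>
     (\<exists>\<mu>s>0. \<forall>\<mu>>\<mu>s. \<exists>u0\<in>N \<mu> lam. \<forall>u\<in>N \<mu> lam. J \<mu> lam u0 \<le> J \<mu> lam u)"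
proof -
  obtain \<delta> \<mu>0 where d: "\<delta> > 0" "\<mu>0 > 0" and
    reg: "\<And>lam \<mu> u. l1 \<le> lam \<Longrightarrow> lam < l1 + \<delta> \<Longrightarrow> \<mu> > \<mu>0 \<Longrightarrow> X u \<Longrightarrow> A u > 0 \<Longrightarrow> E \<mu> lam u \<le> 0 \<Longrightarrow> B u < 0"
    using regime by blast
  have "\<exists>\<mu>s>0. \<forall>\<mu>>\<mu>s. \<exists>u0\<in>N \<mu> lam. \<forall>u\<in>N \<mu> lam. J \<mu> lam u0 \<le> J \<mu> lam u" if lam: "l1 \<le> lam" "lam < l1 + \<delta>" for lam
  proof (rule minimiser[OF _ d(2) reg[OF lam]])
    show "lam > 0" using l1 lam by simp
    show "N \<mu> lam \<noteq> {}" if mu: "\<mu> > \<mu>0" for \<mu>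
    proof -
      obtain v where v: "X v" "E \<mu> lam v < 0" using negative_direction[OF lam(1)] by blast
      have "A v > 0"
      proof (rule ccontr)
        assume "\<not> A v > 0"
        hence "A v = 0" using AP_nonneg(1)[of v] by linarith
        hence "F v = 0" using F_bound[OF v(1)] by simp
        hence "E \<mu> lam v \<ge> 0" using mu d(2) by (simp add: E_def)
        thus False using v(2) by simp
      qed
      thus ?thesis using fiber[OF v(1) _ v(2)] reg[OF lam mu v(1)] v(2) by fastforce
    qed
  qed
  thus ?thesis using d(1) by blast
qed

end

theorem theorem4p3:
  fixes V f Q :: "real^3 \<Rightarrow> real" and a p :: real and \<Omega> :: "(real^3) set"
    and lam1 :: real and \<phi>1 :: "real^3 \<Rightarrow> real"
  assumes p: "4 < p" "p < 6" and a: "a > 0"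
    and V1: "\<forall>x. V x \<ge> 0" "continuous_on UNIV V"
    and V2: "\<exists>c>0. {x. V x < c} \<noteq> {} \<and> emeasure lborel {x. V x < c} < \<infinity>"
    and V3: "\<Omega> = interior {x. V x = 0}" "smooth_bounded_domain \<Omega>"
            "closure \<Omega> = {x. V x = 0}"
    and D1: "f \<in> borel_measurable lborel" "integrable lborel (\<lambda>x. \<bar>f x\<bar> powr (3/2))"
            "emeasure lborel {x \<in> \<Omega>. f x > 0} > 0"
    and D2: "Q \<in> borel_measurable lborel" "\<exists>M. AE x in lborel. \<bar>Q x\<bar> \<le> M"
            "emeasure lborel {x \<in> \<Omega>. Q x > 0} > 0"
    and eig: "principal_eigenpair \<Omega> f lam1 \<phi>1"
    and neg: "(LINT x:\<Omega>|lborel. Q x * (\<phi>1 x) powr p) < 0"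
  shows "\<exists>\<delta>0>0. \<forall>lam. lam1 \<le> lam \<and> lam < lam1 + \<delta>0 \<longrightarrow>
           (\<exists>\<mu>s>0. \<forall>\<mu>>\<mu>s. \<exists>u0 \<in> Nehari_plus a p V f Q \<mu> lam.
              \<forall>u \<in> Nehari_plus a p V f Q \<mu> lam. Jfun a p V f Q \<mu> lam u0 \<le> Jfun a p V f Q \<mu> lam u)"
proof -
  obtain c where c: "c > 0" "emeasure lborel {x. V x < c} < \<infinity>" using V2 by blast
  obtain M where "AE x in lborel. \<bar>Q x\<bar> \<le> M" using D2(2) by blast
  \<comment> \<open>The locale asks for a nonnegative bound of \<open>Q\<close>.\<close>
  then have M: "AE x in lborel. \<bar>Q x\<bar> \<le> max M 0" by eventually_elim simp
  interpret bounded_well V f Q a p c "max M 0" \<Omega> lam1 \<phi>1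
    using p a V1 c V3 D1 D2(1) M eig neg by unfold_locales auto
  show ?thesis using minimiser_near_eigenvalue unfolding N_def J_def .
qed

end
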